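(* Let $\mathcal{L}$ be the ($\mathbb{R}$-linear) linearization operator at the one-frequency solitary wave $\phi(x)e^{-\mathrm{i}\omega t}$ described in the context. For $\ell\in\mathbb{N}_0$ and $m\in\mathbb{N}$ with $m\le\ell$, let $\mathscr{X}_{\ell,0}$, $\mathscr{X}_{\ell,m}$, $\mathscr{Y}_\ell$ be the subspaces of $L^2(\mathbb{R}^3,\mathbb{C}^4)$ consisting of all elements of $L^2(\mathbb{R}^3,\mathbb{C}^4)$ of the respective forms $$\mathscr{X}_{\ell,0}:\ \begin{bmatrix}(A_0+B_0\sigma_r\varSigma)h_{\ell,0}e_1\\ \mathrm{i}\sigma_r(P_0+Q_0\sigma_r\varSigma)h_{\ell,0}e_1\end{bmatrix},\qquad \mathscr{X}_{\ell,m}:\ \sum_{\pm}\begin{bmatrix}(A_{\pm m}+B_{\pm m}\sigma_r\varSigma)h_{\ell,\pm m}e_1\\ \mathrm{i}\sigma_r(P_{\pm m}+Q_{\pm m}\sigma_r\varSigma)h_{\ell,\pm m}e_1\end{bmatrix},\qquad \mathscr{Y}_\ell:\ \begin{bmatrix}R_\ell h_{\ell,-\ell}e_2\\ \mathrm{i}\sigma_rS_\ell h_{\ell,-\ell}e_2\end{bmatrix},$$ where $A_0,B_0,P_0,Q_0,A_{\pm m},B_{\pm m},P_{\pm m},Q_{\pm m},R_\ell,S_\ell$ are complex-valued functions of $r=|x|$. Then: (1) $\mathscr{X}_{\ell,0}$, $\mathscr{X}_{\ell,m}$ and $\mathscr{Y}_\ell$ (for all $\ell\in\mathbb{N}_0$,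 $m\in\mathbb{N}$, $m\le\ell$) are invariant subspaces of $\mathcal{L}$, that is, $\mathcal{L}$ maps the elements of each of these subspaces which are in $\mathrm{dom}(\mathcal{L})$ into the same subspace. (2) For each $\ell\in\mathbb{N}_0$, $\sigma\big(-\mathrm{i}\mathcal{L}|_{\mathscr{Y}_\ell}\big)\subset\mathrm{i}\mathbb{R}$.
   Context: Soler model. $\psi(t,x)\in\mathbb{C}^4$, $x\in\mathbb{R}^3$, satisfies $\mathrm{i}\partial_t\psi=D_0\psi+g(\psi^*\beta\psi)\beta\psi$, where $D_0=-\mathrm{i}\boldsymbol\alpha\cdot\nabla$, $g(\tau)=m_0-f(\tau)$, $m_0>0$ is the mass, $f:\mathbb{R}\to\mathbb{R}$ is a $C^1$ function with $f(0)=0$, and $\alpha^j=\begin{bmatrix}0&\sigma_j\\ \sigma_j&0\end{bmatrix}$, $\beta=\begin{bmatrix}I_2&0\\0&-I_2\end{bmatrix}$, with $\sigma_1,\sigma_2,\sigma_3$ the Pauli matrices; $^*$ is the hermitian conjugate; $e_1,e_2$ is the standard basis of $\mathbb{C}^2$. Notation. $r=|x|$, $\sigma_r=r^{-1}\sum_jx_j\sigma_j$, $\varSigma=\sum_j\sigma_j\partial_j$. In $B\sigma_r\varSigma h\,e_1$ the operator $\varSigma$ acts on $h\,e_1$, where the spherical harmonic $h$ is a function on $\mathbb{R}^3\setminus\{0\}$ independent of $r$. Spherical harmonics. For $0\le m\le\ell$, $h_{\ell,m}(\theta,\phi)=\sqrt{\frac{2\ell+1}{4\pi}\frac{(\ell-m)!}{(\ell+m)!}}\,e^{\mathrm{i}m\phi}P_{\ell,m}(\cos\theta)$,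 with $P_{\ell,m}(w)=(1-w^2)^{m/2}\frac{d^m}{dw^m}P_\ell(w)$, $P_\ell(w)=\frac{1}{2^\ell\ell!}\frac{d^\ell}{dw^\ell}(w^2-1)^\ell$, and $h_{\ell,-m}=\overline{h_{\ell,m}}$; here $x=(r\cos\phi\sin\theta,r\sin\phi\sin\theta,r\cos\theta)$. Solitary wave. $\omega\in\mathbb{R}$ and $\phi(x)=\begin{bmatrix}v(r)e_1\\ \mathrm{i}\sigma_ru(r)e_1\end{bmatrix}\in H^1(\mathbb{R}^3,\mathbb{C}^4)$, with $v,u$ real-valued, bounded, and satisfying $\omega v=\partial_ru+\frac2ru+g(v^2-u^2)v$, $\omega u=-\partial_rv-g(v^2-u^2)u$ for $r>0$, so that $\phi(x)e^{-\mathrm{i}\omega t}$ solves the Soler equation. Linearization. Writing a perturbed solution as $(\phi+\rho)e^{-\mathrm{i}\omega t}$, the linearized equation is $\mathrm{i}\partial_t\rho=\mathcal{L}\rho$ with $$\mathcal{L}\rho=D_0\rho+g\beta\rho+2g'\beta\phi\,\mathrm{Re}(\phi^*\beta\rho)-\omega\rho,\qquad \mathrm{dom}(\mathcal{L})=H^1(\mathbb{R}^3,\mathbb{C}^4),$$ where $g$ and $g'$ are evaluated at $\phi^*\beta\phi=v^2-u^2$. The operator $\mathcal{L}$ is $\mathbb{R}$-linear, not $\mathbb{C}$-linear in general, because of the term $\mathrm{Re}(\phi^*\beta\rho)$. *)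

theory Defs
  imports "HOL-Analysis.Analysis"
begin

definition pauli :: "3 \<Rightarrow> complex^2^2" where
  "pauli j =
     (if j = 1 then vector [vector [0, 1], vector [1, 0]]
      else if j = 2 then vector [vector [0, -\<i>], vector [\<i>, 0]]
      else vector [vector [1, 0], vector [0, -1]])"

definition spinor :: "complex^2 \<Rightarrow> complex^2 \<Rightarrow> complex^4" where
  "spinor a b = vector [a$1, a$2, b$1, b$2]"

definition block_mat ::
    "complex^2^2 \<Rightarrow> complex^2^2 \<Rightarrow> complex^2^2 \<Rightarrow> complex^2^2 \<Rightarrow> complex^4^4" where
  "block_mat A B C D = vector [spinor (A$1) (B$1), spinor (A$2) (B$2),
                               spinor (C$1) (D$1), spinor (C$2) (D$2)]"

definition alpha_mat :: "3 \<Rightarrow> complex^4^4" where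
  "alpha_mat j = block_mat 0 (pauli j) (pauli j) 0"

definition beta_mat :: "complex^4^4" where
  "beta_mat = block_mat (mat 1) 0 0 (- mat 1)"

definition herm :: "complex^'n \<Rightarrow> complex^'n \<Rightarrow> complex" where
  "herm a b = (\<Sum>i\<in>UNIV. cnj (a$i) * b$i)"

definition e1 :: "complex^2" where "e1 = axis 1 1"
definition e2 :: "complex^2" where "e2 = axis 2 1"

text \<open>At the origin this is 0, by division by zero; nothing below depends on that value.\<close>
definition sigma_r :: "real^3 \<Rightarrow> complex^2^2" where
  "sigma_r x = (\<Sum>j\<in>UNIV. (x$j / norm x) *\<^sub>R pauli j)"

text \<open>
  Elements of \<open>L2\<close> and \<open>H1\<close> are represented by Borel functions; every statement about
  them below is invariant under changes on null sets.
\<close>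

definition L2 :: "(real^3 \<Rightarrow> complex^4) set" where
  "L2 = {\<rho>. \<rho> \<in> borel_measurable lborel \<and> integrable lborel (\<lambda>x. (norm (\<rho> x))\<^sup>2)}"

definition L2_norm :: "(real^3 \<Rightarrow> complex^4) \<Rightarrow> real" where
  "L2_norm \<rho> = sqrt (\<integral>x. (norm (\<rho> x))\<^sup>2 \<partial>lborel)"

definition partial_deriv ::
    "3 \<Rightarrow> (real^3 \<Rightarrow> 'b::real_normed_vector) \<Rightarrow> real^3 \<Rightarrow> 'b" where
  "partial_deriv j f x = frechet_derivative f (at x) (axis j 1)"

primrec Ck :: "nat \<Rightarrow> (real^3 \<Rightarrow> real) \<Rightarrow> bool" where
  "Ck 0 f \<longleftrightarrow> continuous_on UNIV f"
| "Ck (Suc k) f \<longleftrightarrow> (\<forall>x. f differentiable (at x)) \<and> (\<forall>j. Ck k (partial_deriv j f))"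

definition test_function :: "(real^3 \<Rightarrow> real) \<Rightarrow> bool" where
  "test_function \<eta> \<longleftrightarrow> (\<forall>k. Ck k \<eta>) \<and> compact (closure {x. \<eta> x \<noteq> 0})"

definition is_weak_partial ::
    "3 \<Rightarrow> (real^3 \<Rightarrow> complex^4) \<Rightarrow> (real^3 \<Rightarrow> complex^4) \<Rightarrow> bool" where
  "is_weak_partial j \<rho> \<rho>' \<longleftrightarrow>
     (\<forall>\<eta>. test_function \<eta> \<longrightarrow>
        (\<integral>x. partial_deriv j \<eta> x *\<^sub>R \<rho> x \<partial>lborel) = - (\<integral>x. \<eta> x *\<^sub>R \<rho>' x \<partial>lborel))"

definition H1 :: "(real^3 \<Rightarrow> complex^4) set" where
  "H1 = {\<rho> \<in> L2. \<forall>j. \<exists>\<rho>' \<in> L2. is_weak_partial j \<rho> \<rho>'}"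

text \<open>Meaningful for \<open>\<rho> \<in> H1\<close>; then determined up to a null set.\<close>
definition weak_partial :: "3 \<Rightarrow> (real^3 \<Rightarrow> complex^4) \<Rightarrow> real^3 \<Rightarrow> complex^4" where
  "weak_partial j \<rho> = (SOME \<rho>'. \<rho>' \<in> L2 \<and> is_weak_partial j \<rho> \<rho>')"

definition dirac_op :: "(real^3 \<Rightarrow> complex^4) \<Rightarrow> real^3 \<Rightarrow> complex^4" where
  "dirac_op \<rho> x = (- \<i>) *s (\<Sum>j\<in>UNIV. alpha_mat j *v weak_partial j \<rho> x)"

definition wave_profile :: "(real \<Rightarrow> real) \<Rightarrow> (real \<Rightarrow> real) \<Rightarrow> real^3 \<Rightarrow> complex^4" where
  "wave_profile v u x =
     spinor (of_real (v (norm x)) *s e1)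
            (\<i> *s (sigma_r x *v (of_real (u (norm x)) *s e1)))"

text \<open>
  \<open>\<phi>\<^sup>*\<beta>\<phi>\<close> is real; \<open>Re\<close> only converts its type.
\<close>
definition soler_linearization ::
    "(real \<Rightarrow> real) \<Rightarrow> real \<Rightarrow> (real^3 \<Rightarrow> complex^4) \<Rightarrow>
     (real^3 \<Rightarrow> complex^4) \<Rightarrow> real^3 \<Rightarrow> complex^4" where
  "soler_linearization g \<omega> \<phi> \<rho> x =
     (let \<tau> = Re (herm (\<phi> x) (beta_mat *v \<phi> x)) in
      dirac_op \<rho> x + g \<tau> *\<^sub>R (beta_mat *v \<rho> x)
      + (2 * deriv g \<tau> * Re (herm (\<phi> x) (beta_mat *v \<rho> x))) *\<^sub>R (beta_mat *v \<phi> x)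
      - \<omega> *\<^sub>R \<rho> x)"

definition solitary_wave ::
    "(real \<Rightarrow> real) \<Rightarrow> real \<Rightarrow> (real \<Rightarrow> real) \<Rightarrow> (real \<Rightarrow> real) \<Rightarrow> bool" where
  "solitary_wave g \<omega> v u \<longleftrightarrow>
     wave_profile v u \<in> H1 \<and>
     bounded (v ` {0<..}) \<and> bounded (u ` {0<..}) \<and>
     (\<forall>r>0. v differentiable (at r) \<and> u differentiable (at r) \<and>
        \<omega> * v r = deriv u r + 2 / r * u r + g ((v r)\<^sup>2 - (u r)\<^sup>2) * v r \<and>
        \<omega> * u r = - deriv v r - g ((v r)\<^sup>2 - (u r)\<^sup>2) * u r)"

definition legendre_P :: "nat \<Rightarrow> real \<Rightarrow> real" where
  "legendre_P l w = 1 / (2^l * fact l) * (deriv ^^ l) (\<lambda>t. (t\<^sup>2 - 1)^l) w"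

text \<open>
  For \<open>\<bar>w\<bar> \<le> 1\<close>, \<open>sqrt (1 - w\<^sup>2) ^ m\<close> is \<open>(1 - w\<^sup>2)\<close> to the power \<open>m / 2\<close>; with \<open>powr\<close> the
  case \<open>m = 0\<close>, \<open>w = \<plusminus>1\<close> would come out as 0.
\<close>
definition assoc_legendre_P :: "nat \<Rightarrow> nat \<Rightarrow> real \<Rightarrow> real" where
  "assoc_legendre_P l m w = sqrt (1 - w\<^sup>2) ^ m * (deriv ^^ m) (legendre_P l) w"

definition sph_harm_angles :: "nat \<Rightarrow> nat \<Rightarrow> real \<Rightarrow> real \<Rightarrow> complex" where
  "sph_harm_angles l m \<theta> \<phi> =
     of_real (sqrt ((2 * real l + 1) / (4 * pi) * (fact (l - m) / fact (l + m))))
     * exp (\<i> * of_nat m * of_real \<phi>) * of_real (assoc_legendre_P l m (cos \<theta>))"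

text \<open>
  As a function on the complement of the origin, independent of the radius, via
  \<open>\<theta> = arccos (x\<^sub>3 / r)\<close> and \<open>\<phi> = Arg (x\<^sub>1 + \<i> x\<^sub>2)\<close>. The jump of \<open>Arg\<close> and its value on the
  \<open>x\<^sub>3\<close>-axis are harmless, because of the factors \<open>exp (\<i> m \<phi>)\<close> and \<open>(sin \<theta>)\<^sup>m\<close>.
\<close>
definition sph_harm :: "nat \<Rightarrow> int \<Rightarrow> real^3 \<Rightarrow> complex" where
  "sph_harm l m x =
     (let h = sph_harm_angles l (nat \<bar>m\<bar>) (arccos (x$3 / norm x)) (Arg (Complex (x$1) (x$2)))
      in if 0 \<le> m then h else cnj h)"

definition Sigma_op :: "(real^3 \<Rightarrow> complex^2) \<Rightarrow> real^3 \<Rightarrow> complex^2" where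
  "Sigma_op F x = (\<Sum>j\<in>UNIV. pauli j *v partial_deriv j F x)"

text \<open>\<open>\<Sigma>\<close> acts on \<open>h e\<^sub>1\<close> only, not on the radial factor.\<close>
definition AB_form ::
    "nat \<Rightarrow> int \<Rightarrow> (real \<Rightarrow> complex) \<Rightarrow> (real \<Rightarrow> complex) \<Rightarrow> real^3 \<Rightarrow> complex^2" where
  "AB_form l m A B x =
     A (norm x) *s (sph_harm l m x *s e1)
     + B (norm x) *s (sigma_r x *v Sigma_op (\<lambda>y. sph_harm l m y *s e1) x)"

definition X_form ::
    "nat \<Rightarrow> int \<Rightarrow> (real \<Rightarrow> complex) \<Rightarrow> (real \<Rightarrow> complex) \<Rightarrow>
     (real \<Rightarrow> complex) \<Rightarrow> (real \<Rightarrow> complex) \<Rightarrow> real^3 \<Rightarrow> complex^4" where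
  "X_form l m A B P Q x =
     spinor (AB_form l m A B x) (\<i> *s (sigma_r x *v AB_form l m P Q x))"

definition Y_form ::
    "nat \<Rightarrow> (real \<Rightarrow> complex) \<Rightarrow> (real \<Rightarrow> complex) \<Rightarrow> real^3 \<Rightarrow> complex^4" where
  "Y_form l R S x =
     spinor (R (norm x) *s (sph_harm l (- int l) x *s e2))
            (\<i> *s (sigma_r x *v (S (norm x) *s (sph_harm l (- int l) x *s e2))))"

definition X0_space :: "nat \<Rightarrow> (real^3 \<Rightarrow> complex^4) set" where
  "X0_space l = {\<rho> \<in> L2. \<exists>A B P Q. AE x in lborel. \<rho> x = X_form l 0 A B P Q x}"

definition X_space :: "nat \<Rightarrow> nat \<Rightarrow> (real^3 \<Rightarrow> complex^4) set" where
  "X_space l m = {\<rho> \<in> L2. \<exists>A B P Q A' B' P' Q'. AE x in lborel.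
     \<rho> x = X_form l (int m) A B P Q x + X_form l (- int m) A' B' P' Q' x}"

definition Y_space :: "nat \<Rightarrow> (real^3 \<Rightarrow> complex^4) set" where
  "Y_space l = {\<rho> \<in> L2. \<exists>R S. AE x in lborel. \<rho> x = Y_form l R S x}"

text \<open>
  Spectrum of an operator \<open>T\<close> with domain \<open>D\<close> in the closed complex subspace \<open>X\<close> of \<open>L2\<close>:
  \<open>z\<close> is in the resolvent set iff \<open>T - z : D \<rightarrow> X\<close> is a bijection (modulo null sets) with
  bounded inverse.
\<close>
definition resolvent_set ::
    "(real^3 \<Rightarrow> complex^4) set \<Rightarrow> (real^3 \<Rightarrow> complex^4) set \<Rightarrow>
     ((real^3 \<Rightarrow> complex^4) \<Rightarrow> real^3 \<Rightarrow> complex^4) \<Rightarrow> complex set" where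
  "resolvent_set X D T =
     {z. let S = (\<lambda>\<rho> x. T \<rho> x - z *s \<rho> x) in
         (\<forall>\<rho>\<in>D. S \<rho> \<in> X) \<and>
         (\<forall>\<rho>\<in>D. \<forall>\<rho>'\<in>D. (AE x in lborel. S \<rho> x = S \<rho>' x) \<longrightarrow> (AE x in lborel. \<rho> x = \<rho>' x)) \<and>
         (\<forall>\<eta>\<in>X. \<exists>\<rho>\<in>D. AE x in lborel. S \<rho> x = \<eta> x) \<and>
         (\<exists>C. \<forall>\<rho>\<in>D. L2_norm \<rho> \<le> C * L2_norm (S \<rho>))}"

definition spectrum_on ::
    "(real^3 \<Rightarrow> complex^4) set \<Rightarrow> (real^3 \<Rightarrow> complex^4) set \<Rightarrow>
     ((real^3 \<Rightarrow> complex^4) \<Rightarrow> real^3 \<Rightarrow> complex^4) \<Rightarrow> complex set" where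
  "spectrum_on X D T = - resolvent_set X D T"

text \<open>
  The linearization is only \<open>\<real>\<close>-linear, but on \<open>Y_space l\<close> the term that is not
  \<open>\<complex>\<close>-linear vanishes, so that the restriction to that space is \<open>\<complex>\<close>-linear and
  \<open>spectrum_on\<close> is its usual spectrum.
\<close>
lemma herm_wave_profile_Y_form:
  "herm (wave_profile v u x) (beta_mat *v Y_form l R S x) = 0"
proof -
  have nth: "spinor a b $ 1 = a$1" "spinor a b $ 2 = a$2"
            "spinor a b $ 3 = b$1" "spinor a b $ 4 = b$2" for a b
    by (simp_all add: spinor_def vector_def)
  have vector4: "(vector [a,b,c,d] :: complex^4^4) $ 1 = a" "(vector [a,b,c,d] :: complex^4^4) $ 2 = b"
    "(vector [a,b,c,d] :: complex^4^4) $ 3 = c" "(vector [a,b,c,d] :: complex^4^4) $ 4 = d" for a b c d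
    by (simp_all add: vector_def)
  have beta: "beta_mat *v spinor a b = spinor a (- b)" for a b
    by (simp add: vec_eq_iff forall_4 beta_mat_def block_mat_def matrix_vector_mult_def
        sum_4 sum_2 vector4 nth mat_def)
  have herm: "herm (spinor a b) (spinor c d) = herm a c + herm b d" for a b c d
    by (simp add: herm_def sum_4 sum_2 nth)
  have sigma: "sigma_r x =
      vector [vector [of_real (x$3/norm x), of_real (x$1/norm x) - \<i> * of_real (x$2/norm x)],
              vector [of_real (x$1/norm x) + \<i> * of_real (x$2/norm x), - of_real (x$3/norm x)]]"
    unfolding sigma_r_def pauli_def sum_3
    by (simp add: vec_eq_iff forall_2) (simp add: complex_eq_iff)
  show ?thesis
    unfolding wave_profile_def Y_form_def beta herm
    by (simp add: herm_def sum_2 e1_def e2_def axis_def sigma matrix_vector_mult_def)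
qed

end

theory Submission
  imports Defs "HOL-Computational_Algebra.Polynomial"
begin

text \<open>
  The argument takes place in the real Hilbert space underlying \<open>L2\<close>, in which \<open>- \<i> D\<^sub>0\<close> is
  skew-symmetric on \<open>H1\<close>. Since \<open>r \<sigma>\<^sub>r \<Sigma>\<close> acts on the spinors \<open>h e\<^sub>1\<close>, \<open>\<sigma>\<^sub>r \<Sigma> h e\<^sub>1\<close> by constants, by the
  Legendre equation, each of the spaces consists of the fields \<open>\<Sum> a\<^sub>p(r) g\<^sub>p(x / r)\<close>, where the finitely many
  \<open>g\<^sub>p\<close> are orthonormal on the sphere and their span is invariant under \<open>\<alpha> \<cdot> x / r\<close> and \<open>r \<alpha> \<cdot> \<nabla>\<close>. The
  orthogonal projection \<open>Q\<close> onto such a space, given by spherical averages, maps test fields vanishing near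
  the origin to fields of the same kind whose Dirac derivative is again in the space; testing with \<open>Q \<psi>\<close>
  shows that \<open>Q\<close> commutes with \<open>D\<^sub>0\<close>, without differentiating the radial coefficients of an \<open>H1\<close> field.
  The potential terms preserve the space because the real part of a combination of \<open>h\<close> and its conjugate is
  such a combination.

  On \<open>Y_space l\<close> the term that is not \<open>\<complex>\<close>-linear vanishes, so that \<open>- \<i> \<L> - z\<close> is a skew-symmetric operator
  minus \<open>Re z\<close>. This gives the resolvent estimate, and closed range. A field orthogonal to the range is a
  weak solution of the adjoint equation away from the origin; it is one across the origin too, because
  points have zero capacity, hence in \<open>H1\<close> by elliptic regularity, hence zero.
\<close>

subsection \<open>The real Hilbert space of square-integrable spinor fields\<close>

text \<open>The obstacle is regularity. A member of one of the spaces comes with arbitrary radial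
  coefficients, so the radial form of the Dirac system cannot be written down for it, and fields
  that are homogeneous of degree 0 are singular at the origin. Therefore every classical derivative
  falls on C1 test fields that vanish near the origin; for these, averages over spheres may be
  differentiated under the integral.

  Weak derivatives are tested with smooth functions, whereas averaging yields C1 fields.
  Mollification joins the two: it gives integration by parts in \<open>H1\<close>, and, because the
  Dirac matrices anticommute, it bounds every weak derivative by the Dirac derivative.

  The scalars are real because the linearization is only real-linear; each generating spinor enters
  together with its multiple by \<open>\<i>\<close>. The generators may be dependent or even vanish:
  for \<open>m = l\<close> the second spinor carries the derivative of a constant polynomial. An
  orthonormal system must therefore be extracted from them, and expansions in it hold only almost
  everywhere.\<close>

definition ip :: "(real^3 \<Rightarrow> complex^4) \<Rightarrow> (real^3 \<Rightarrow> complex^4) \<Rightarrow> real" where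
  "ip f g = (\<integral>x. f x \<bullet> g x \<partial>lborel)"

lemma L2_measurable [measurable_dest]: "f \<in> L2 \<Longrightarrow> f \<in> borel_measurable borel"
  by (simp add: L2_def)

lemma L2_integrable: "f \<in> L2 \<Longrightarrow> integrable lborel (\<lambda>x. (norm (f x))\<^sup>2)"
  by (simp add: L2_def)

lemma L2_bound:
  assumes g: "g \<in> borel_measurable borel" and f: "f \<in> L2"
    and b: "AE x in lborel. norm (g x) \<le> c * norm (f x)"
  shows "g \<in> L2"
proof -
  have "integrable lborel (\<lambda>x. (norm (g x))\<^sup>2)"
  proof (rule Bochner_Integration.integrable_bound)
    show "integrable lborel (\<lambda>x. c\<^sup>2 * (norm (f x))\<^sup>2)" using L2_integrable[OF f] by simp
    show "AE x in lborel. norm ((norm (g x))\<^sup>2) \<le> norm (c\<^sup>2 * (norm (f x))\<^sup>2)"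
      using b
    proof eventually_elim
      case (elim x)
      then have "(norm (g x))\<^sup>2 \<le> (c * norm (f x))\<^sup>2" by (intro power_mono) auto
      then show ?case by (simp add: power_mult_distrib)
    qed
  qed (use g in measurable)
  then show ?thesis using g by (simp add: L2_def)
qed

lemma L2_integrable_mult:
  assumes f: "f \<in> L2" and g: "g \<in> L2"
  shows "integrable lborel (\<lambda>x. norm (f x) * norm (g x))"
proof (rule Bochner_Integration.integrable_bound)
  show "integrable lborel (\<lambda>x. (norm (f x))\<^sup>2 + (norm (g x))\<^sup>2)"
    using L2_integrable[OF f] L2_integrable[OF g] by simp
  show "AE x in lborel. norm (norm (f x) * norm (g x)) \<le> norm ((norm (f x))\<^sup>2 + (norm (g x))\<^sup>2)"
  proof (rule AE_I2)
    fix x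
    have "0 \<le> (norm (f x) - norm (g x))\<^sup>2" "0 \<le> norm (f x) * norm (g x)" by simp_all
    then have "norm (f x) * norm (g x) \<le> (norm (f x))\<^sup>2 + (norm (g x))\<^sup>2"
      unfolding power2_diff by linarith
    then show "norm (norm (f x) * norm (g x)) \<le> norm ((norm (f x))\<^sup>2 + (norm (g x))\<^sup>2)" by simp
  qed
qed (use f g in measurable)

lemma L2_integrable_inner:
  assumes f: "f \<in> L2" and g: "g \<in> L2"
  shows "integrable lborel (\<lambda>x. f x \<bullet> g x)"
  by (rule Bochner_Integration.integrable_bound[OF L2_integrable_mult[OF f g]])
    (use f g in \<open>auto intro!: AE_I2 simp: Cauchy_Schwarz_ineq2\<close>)

lemma L2_zero [simp]: "(\<lambda>x. 0) \<in> L2"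
  by (simp add: L2_def)

lemma L2_linear_image:
  assumes f: "f \<in> L2" and T: "bounded_linear T"
  shows "(\<lambda>x. T (f x)) \<in> L2"
proof -
  obtain K where K: "\<And>x. norm (T x) \<le> norm x * K" using T bounded_linear.bounded by blast
  have "T \<in> borel_measurable borel"
    by (intro borel_measurable_continuous_onI linear_continuous_on T)
  then have m: "(\<lambda>x. T (f x)) \<in> borel_measurable borel" using f by measurable
  show ?thesis by (rule L2_bound[OF m f, of K]) (use K in \<open>auto simp: mult.commute\<close>)
qed

lemma L2_scaleR: "f \<in> L2 \<Longrightarrow> (\<lambda>x. c *\<^sub>R f x) \<in> L2"
  by (rule L2_linear_image) (auto intro: bounded_linear_scaleR_right)

lemma L2_minus: "f \<in> L2 \<Longrightarrow> (\<lambda>x. - f x) \<in> L2"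
  using L2_scaleR[of f "-1"] by simp

lemma L2_add:
  assumes f: "f \<in> L2" and g: "g \<in> L2"
  shows "(\<lambda>x. f x + g x) \<in> L2"
proof -
  have "integrable lborel (\<lambda>x. (norm (f x + g x))\<^sup>2)"
  proof (rule Bochner_Integration.integrable_bound)
    show "integrable lborel (\<lambda>x. (norm (f x))\<^sup>2 + (norm (g x))\<^sup>2 + 2 * (norm (f x) * norm (g x)))"
      using L2_integrable[OF f] L2_integrable[OF g] L2_integrable_mult[OF f g] by simp
    show "AE x in lborel. norm ((norm (f x + g x))\<^sup>2)
       \<le> norm ((norm (f x))\<^sup>2 + (norm (g x))\<^sup>2 + 2 * (norm (f x) * norm (g x)))"
    proof (rule AE_I2)
      fix x
      have "(norm (f x + g x))\<^sup>2 \<le> (norm (f x) + norm (g x))\<^sup>2"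
        by (intro power_mono norm_triangle_ineq) auto
      then show "norm ((norm (f x + g x))\<^sup>2)
       \<le> norm ((norm (f x))\<^sup>2 + (norm (g x))\<^sup>2 + 2 * (norm (f x) * norm (g x)))"
        by (simp add: power2_sum)
    qed
  qed (use f g in measurable)
  moreover have "(\<lambda>x. f x + g x) \<in> borel_measurable borel" using f g by measurable
  ultimately show ?thesis by (simp add: L2_def)
qed

lemma L2_diff: "f \<in> L2 \<Longrightarrow> g \<in> L2 \<Longrightarrow> (\<lambda>x. f x - g x) \<in> L2"
  using L2_add[of f "\<lambda>x. - g x"] L2_minus[of g] by simp

lemma L2_sum: "(\<And>i. i \<in> I \<Longrightarrow> f i \<in> L2) \<Longrightarrow> (\<lambda>x. \<Sum>i\<in>I. f i x) \<in> L2"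
  by (induction I rule: infinite_finite_induct) (auto intro: L2_add)

lemma L2_bounded_support:
  assumes m: "f \<in> borel_measurable borel" and b: "\<And>x. norm (f x) \<le> C" and s: "\<And>x. norm x > R \<Longrightarrow> f x = 0"
  shows "f \<in> L2"
proof -
  have "integrable lborel (\<lambda>x. (norm (f x))\<^sup>2)"
  proof (rule Bochner_Integration.integrable_bound)
    show "integrable lborel (\<lambda>x::real^3. C\<^sup>2 * indicator (cball 0 R) x :: real)"
      by (intro integrable_mult_right integrable_real_indicator)
         (use emeasure_bounded_finite[OF bounded_cball[of "0::real^3" R]] in simp_all)
    show "AE x in lborel. norm ((norm (f x))\<^sup>2) \<le> norm (C\<^sup>2 * indicator (cball 0 R) x :: real)"
    proof (rule AE_I2)
      fix x
      have "(norm (f x))\<^sup>2 \<le> C\<^sup>2" using b by (intro power_mono) auto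
      then show "norm ((norm (f x))\<^sup>2) \<le> norm (C\<^sup>2 * indicator (cball 0 R) x :: real)"
        using s[of x] by (cases "norm x > R") (auto simp: indicator_def dist_norm)
    qed
  qed (use m in measurable)
  then show ?thesis using m by (simp add: L2_def)
qed

lemma ip_commute: "ip f g = ip g f"
  by (simp add: ip_def inner_commute)

lemma ip_cong_AE:
  assumes "f \<in> borel_measurable borel" "f' \<in> borel_measurable borel" "g \<in> borel_measurable borel"
    "AE x in lborel. f x = f' x"
  shows "ip f g = ip f' g"
  unfolding ip_def by (rule integral_cong_AE) (use assms in auto)

lemma ip_add_left: "f \<in> L2 \<Longrightarrow> g \<in> L2 \<Longrightarrow> h \<in> L2 \<Longrightarrow> ip (\<lambda>x. f x + g x) h = ip f h + ip g h"
  unfolding ip_def by (simp add: inner_add_left L2_integrable_inner)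

lemma ip_diff_left: "f \<in> L2 \<Longrightarrow> g \<in> L2 \<Longrightarrow> h \<in> L2 \<Longrightarrow> ip (\<lambda>x. f x - g x) h = ip f h - ip g h"
  unfolding ip_def by (simp add: inner_diff_left L2_integrable_inner)

lemma ip_scaleR_left: "ip (\<lambda>x. c *\<^sub>R f x) g = c * ip f g"
  unfolding ip_def by simp

lemma ip_minus_left: "ip (\<lambda>x. - f x) g = - ip f g"
  unfolding ip_def by simp

lemma ip_sum_left: "(\<And>i. i \<in> I \<Longrightarrow> f i \<in> L2) \<Longrightarrow> g \<in> L2 \<Longrightarrow> ip (\<lambda>x. \<Sum>i\<in>I. f i x) g = (\<Sum>i\<in>I. ip (f i) g)"
  unfolding ip_def by (simp add: inner_sum_left L2_integrable_inner)

lemma ip_add_right: "f \<in> L2 \<Longrightarrow> g \<in> L2 \<Longrightarrow> h \<in> L2 \<Longrightarrow> ip h (\<lambda>x. f x + g x) = ip h f + ip h g"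
  using ip_add_left[of f g h] by (simp add: ip_commute)

lemma ip_diff_right: "f \<in> L2 \<Longrightarrow> g \<in> L2 \<Longrightarrow> h \<in> L2 \<Longrightarrow> ip h (\<lambda>x. f x - g x) = ip h f - ip h g"
  using ip_diff_left[of f g h] by (simp add: ip_commute)

lemma ip_scaleR_right: "ip g (\<lambda>x. c *\<^sub>R f x) = c * ip g f"
  using ip_scaleR_left[of c f g] by (simp add: ip_commute)

lemma ip_minus_right: "ip g (\<lambda>x. - f x) = - ip g f"
  using ip_minus_left[of f g] by (simp add: ip_commute)

lemma ip_sum_right: "(\<And>i. i \<in> I \<Longrightarrow> f i \<in> L2) \<Longrightarrow> g \<in> L2 \<Longrightarrow> ip g (\<lambda>x. \<Sum>i\<in>I. f i x) = (\<Sum>i\<in>I. ip g (f i))"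
  using ip_sum_left[of I f g] by (simp add: ip_commute)

lemma ip_self_nonneg: "0 \<le> ip f f"
  unfolding ip_def by simp

lemma L2_norm_eq: "L2_norm f = sqrt (ip f f)"
  by (simp add: L2_norm_def ip_def power2_norm_eq_inner)

lemma L2_norm_power2: "(L2_norm f)\<^sup>2 = ip f f"
  by (simp add: L2_norm_eq ip_self_nonneg)

lemma L2_norm_nonneg [simp]: "0 \<le> L2_norm f"
  by (simp add: L2_norm_eq ip_self_nonneg)

lemma L2_norm_cong_AE:
  assumes "f \<in> borel_measurable borel" "g \<in> borel_measurable borel" "AE x in lborel. f x = g x"
  shows "L2_norm f = L2_norm g"
proof -
  have "(\<integral>x. (norm (f x))\<^sup>2 \<partial>lborel) = (\<integral>x. (norm (g x))\<^sup>2 \<partial>lborel)"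
    by (rule integral_cong_AE) (use assms in auto)
  then show ?thesis by (simp add: L2_norm_def)
qed

lemma L2_norm_mono_AE:
  assumes f: "f \<in> L2" and g: "g \<in> L2" and le: "AE x in lborel. norm (f x) \<le> norm (g x)"
  shows "L2_norm f \<le> L2_norm g"
  unfolding L2_norm_def using le
  by (intro real_sqrt_le_mono integral_mono_AE L2_integrable f g) (auto elim!: eventually_mono intro!: power_mono)

lemma L2_norm_zero_AE:
  assumes f: "f \<in> L2" and z: "L2_norm f = 0"
  shows "AE x in lborel. f x = 0"
proof -
  have "(\<integral>x. (norm (f x))\<^sup>2 \<partial>lborel) = 0" using z by (simp add: L2_norm_def)
  then have "AE x in lborel. (norm (f x))\<^sup>2 = 0"
    using integral_nonneg_eq_0_iff_AE[OF L2_integrable[OF f]] by simp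
  then show ?thesis by simp
qed

lemma ip_Cauchy_Schwarz:
  assumes f: "f \<in> L2" and g: "g \<in> L2"
  shows "\<bar>ip f g\<bar> \<le> L2_norm f * L2_norm g"
proof -
  have q: "0 \<le> ip f f + 2 * t * ip f g + t\<^sup>2 * ip g g" for t
  proof -
    have "0 \<le> ip (\<lambda>x. f x + t *\<^sub>R g x) (\<lambda>x. f x + t *\<^sub>R g x)" by (rule ip_self_nonneg)
    also have "\<dots> = ip f f + 2 * t * ip f g + t\<^sup>2 * ip g g"
      by (simp add: ip_add_left ip_add_right L2_add L2_scaleR f g ip_scaleR_left ip_scaleR_right
          ip_commute[of g f] power2_eq_square algebra_simps)
    finally show ?thesis .
  qed
  have "(ip f g)\<^sup>2 \<le> ip f f * ip g g"
  proof (cases "ip g g = 0")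
    case True
    have "ip f g = 0"
    proof (rule ccontr)
      assume "ip f g \<noteq> 0"
      \<comment> \<open>With \<open>ip g g = 0\<close> the quadratic is affine in \<open>t\<close>;
        this value of \<open>t\<close> makes it equal to -1.\<close>
      then show False using q[of "- (ip f f + 1) / (2 * ip f g)"] True by (simp add: field_simps)
    qed
    then show ?thesis using True by simp
  next
    case False
    then have "ip g g > 0" using ip_self_nonneg[of g] by simp
    then show ?thesis using q[of "- ip f g / ip g g"] by (simp add: field_simps power2_eq_square)
  qed
  then have "\<bar>ip f g\<bar> \<le> sqrt (ip f f * ip g g)"
    using real_le_rsqrt by (metis abs_le_square_iff real_sqrt_abs real_sqrt_le_mono)
  then show ?thesis by (simp add: L2_norm_eq real_sqrt_mult)
qed

lemma L2_norm_triangle: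
  assumes f: "f \<in> L2" and g: "g \<in> L2"
  shows "L2_norm (\<lambda>x. f x + g x) \<le> L2_norm f + L2_norm g"
proof (rule power2_le_imp_le)
  show "(L2_norm (\<lambda>x. f x + g x))\<^sup>2 \<le> (L2_norm f + L2_norm g)\<^sup>2"
    using ip_Cauchy_Schwarz[OF f g]
    by (simp add: power2_sum L2_norm_power2 ip_add_left ip_add_right f g L2_add ip_commute[of g f])
qed simp

lemma L2_norm_scaleR: "L2_norm (\<lambda>x. c *\<^sub>R f x) = \<bar>c\<bar> * L2_norm f"
proof -
  have "ip (\<lambda>x. c *\<^sub>R f x) (\<lambda>x. c *\<^sub>R f x) = c\<^sup>2 * ip f f"
    by (simp only: ip_scaleR_left ip_scaleR_right power2_eq_square mult.assoc)
  then show ?thesis by (simp add: L2_norm_eq real_sqrt_mult)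
qed

lemma L2_norm_minus_commute: "L2_norm (\<lambda>x. f x - g x) = L2_norm (\<lambda>x. g x - f x)"
  by (simp add: L2_norm_def norm_minus_commute)

lemma L2_norm_diff_triangle:
  assumes "f \<in> L2" "g \<in> L2" "h \<in> L2"
  shows "L2_norm (\<lambda>x. f x - h x) \<le> L2_norm (\<lambda>x. f x - g x) + L2_norm (\<lambda>x. g x - h x)"
  using L2_norm_triangle[OF L2_diff[of f g] L2_diff[of g h]] assms by simp

lemma tendsto_ip:
  assumes f: "\<And>n. f n \<in> L2" "F \<in> L2" "(\<lambda>n. L2_norm (\<lambda>x. f n x - F x)) \<longlonglongrightarrow> 0"
    and g: "\<And>n. g n \<in> L2" "G \<in> L2" "(\<lambda>n. L2_norm (\<lambda>x. g n x - G x)) \<longlonglongrightarrow> 0"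
  shows "(\<lambda>n. ip (f n) (g n)) \<longlonglongrightarrow> ip F G"
proof -
  have e: "ip (f n) (g n) - ip F G = ip (\<lambda>x. f n x - F x) (\<lambda>x. g n x - G x)
      + ip (\<lambda>x. f n x - F x) G + ip F (\<lambda>x. g n x - G x)" for n
    using f g by (simp add: ip_diff_left ip_diff_right L2_diff)
  have "(\<lambda>n. ip (f n) (g n) - ip F G) \<longlonglongrightarrow> 0"
  proof (rule Lim_null_comparison)
    let ?a = "\<lambda>n. L2_norm (\<lambda>x. f n x - F x)" and ?b = "\<lambda>n. L2_norm (\<lambda>x. g n x - G x)"
    show "\<forall>\<^sub>F n in sequentially. norm (ip (f n) (g n) - ip F G)
        \<le> ?a n * ?b n + ?a n * L2_norm G + L2_norm F * ?b n"
    proof (rule always_eventually, rule allI)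
      fix n
      have "\<bar>ip (\<lambda>x. f n x - F x) (\<lambda>x. g n x - G x)\<bar> \<le> ?a n * ?b n"
        "\<bar>ip (\<lambda>x. f n x - F x) G\<bar> \<le> ?a n * L2_norm G"
        "\<bar>ip F (\<lambda>x. g n x - G x)\<bar> \<le> L2_norm F * ?b n"
        using f g by (auto intro!: ip_Cauchy_Schwarz L2_diff)
      then show "norm (ip (f n) (g n) - ip F G) \<le> ?a n * ?b n + ?a n * L2_norm G + L2_norm F * ?b n"
        unfolding e real_norm_def by linarith
    qed
    show "(\<lambda>n. ?a n * ?b n + ?a n * L2_norm G + L2_norm F * ?b n) \<longlonglongrightarrow> 0"
      using tendsto_add[OF tendsto_add[OF tendsto_mult[OF f(3) g(3)] tendsto_mult_right[OF f(3), of "L2_norm G"]]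
        tendsto_mult_left[OF g(3), of "L2_norm F"]] by simp
  qed
  then show ?thesis by (simp add: LIM_zero_iff)
qed

lemma tendsto_ip_left:
  assumes f: "\<And>n. f n \<in> L2" "F \<in> L2" "(\<lambda>n. L2_norm (\<lambda>x. f n x - F x)) \<longlonglongrightarrow> 0" and g: "g \<in> L2"
  shows "(\<lambda>n. ip (f n) g) \<longlonglongrightarrow> ip F g"
  by (rule tendsto_ip[OF f]) (use g in \<open>simp_all add: L2_norm_def\<close>)

lemma L2_norm_nn: "f \<in> L2 \<Longrightarrow> (\<integral>\<^sup>+x. ennreal ((norm (f x))\<^sup>2) \<partial>lborel) = ennreal ((L2_norm f)\<^sup>2)"
  using nn_integral_eq_integral[OF L2_integrable, of f]
  by (simp add: L2_norm_def)

lemma L2_if_nn: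
  assumes m: "f \<in> borel_measurable borel" and le: "(\<integral>\<^sup>+x. ennreal ((norm (f x))\<^sup>2) \<partial>lborel) \<le> ennreal (C\<^sup>2)"
    and C: "C \<ge> 0"
  shows "f \<in> L2" "L2_norm f \<le> C"
proof -
  have i: "integrable lborel (\<lambda>x. (norm (f x))\<^sup>2)"
    by (rule integrableI_nonneg) (use m le in \<open>auto intro: le_less_trans\<close>)
  then show f: "f \<in> L2" using m by (simp add: L2_def)
  have "ennreal ((L2_norm f)\<^sup>2) \<le> ennreal (C\<^sup>2)" using le L2_norm_nn[OF f] by simp
  then show "L2_norm f \<le> C" using C by (simp add: ennreal_le_iff power2_le_iff_abs_le)
qed

text \<open>Riesz-Fischer. A fast subsequence converges almost everywhere, because a weighted sum of
  its squared increments has finite integral; Fatou's lemma along that subsequence then bounds the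
  distance of every late member to the limit.\<close>

lemma L2_complete:
  assumes f: "\<And>n. f n \<in> L2"
    and cau: "\<And>e. e > 0 \<Longrightarrow> \<exists>N. \<forall>m\<ge>N. \<forall>n\<ge>N. L2_norm (\<lambda>x. f m x - f n x) < e"
  shows "\<exists>F\<in>L2. (\<lambda>n. L2_norm (\<lambda>x. f n x - F x)) \<longlonglongrightarrow> 0"
proof -
  have "\<exists>N. \<forall>m\<ge>N. \<forall>n\<ge>N. L2_norm (\<lambda>x. f m x - f n x) < (1/2)^k" for k
    using cau[of "(1/2)^k"] by simp
  then obtain M where M: "\<And>k m n. m \<ge> M k \<Longrightarrow> n \<ge> M k \<Longrightarrow> L2_norm (\<lambda>x. f m x - f n x) < (1/2)^k"
    by metis
  \<comment> \<open>Summing the thresholds makes the indices nondecreasing and keeps them above each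
    \<open>M i\<close> with \<open>i \<le> k\<close>.\<close>
  define s where "s k = (\<Sum>i\<le>k. M i)" for k
  have smono: "M i \<le> s k" if "i \<le> k" for i k
    unfolding s_def using that by (intro member_le_sum) auto
  then have sM: "M k \<le> s k" "M k \<le> s (Suc k)" for k by simp_all
  define d where "d k x = f (s (Suc k)) x - f (s k) x" for k x
  have d: "d k \<in> L2" for k unfolding d_def by (intro L2_diff f)
  have dm [measurable]: "d k \<in> borel_measurable borel" "f k \<in> borel_measurable borel" for k
    using L2_measurable d f by blast+
  have dn: "L2_norm (d k) \<le> (1/2)^k" for k
    using M[OF sM(2) sM(1), of k] unfolding d_def by simp
  \<comment> \<open>The squared increments are at most \<open>(1/4)^k\<close>, so the weight
    \<open>2^k\<close> still leaves a summable series; where the weighted sum is finite, the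
    increments decay like \<open>sqrt (1/2) ^ k\<close>.\<close>
  have "(\<integral>\<^sup>+x. (\<Sum>k. ennreal (2^k * (norm (d k x))\<^sup>2)) \<partial>lborel) = (\<Sum>k. \<integral>\<^sup>+x. ennreal (2^k * (norm (d k x))\<^sup>2) \<partial>lborel)"
    by (rule nn_integral_suminf) measurable
  also have "\<dots> = (\<Sum>k. ennreal (2^k * (L2_norm (d k))\<^sup>2))"
  proof (rule suminf_cong)
    fix k
    have "(\<integral>\<^sup>+x. ennreal (2^k * (norm (d k x))\<^sup>2) \<partial>lborel) = (\<integral>\<^sup>+x. ennreal (2^k) * ennreal ((norm (d k x))\<^sup>2) \<partial>lborel)"
      by (simp add: ennreal_mult)
    also have "\<dots> = ennreal (2^k) * ennreal ((L2_norm (d k))\<^sup>2)"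
      using L2_norm_nn[OF d, of k] L2_measurable[OF d, of k] by (simp add: nn_integral_cmult)
    finally show "(\<integral>\<^sup>+x. ennreal (2^k * (norm (d k x))\<^sup>2) \<partial>lborel) = ennreal (2^k * (L2_norm (d k))\<^sup>2)"
      by (simp add: ennreal_mult)
  qed
  also have "\<dots> \<le> (\<Sum>k. ennreal ((1/2)^k))"
  proof (rule suminf_le)
    fix k
    have "(L2_norm (d k))\<^sup>2 \<le> ((1/2)^k)\<^sup>2" using dn by (intro power_mono) auto
    then have "2^k * (L2_norm (d k))\<^sup>2 \<le> 2^k * ((1/2)^k)\<^sup>2" by simp
    also have "\<dots> = (1/2)^k" by (simp add: power2_eq_square field_simps)
    finally show "ennreal (2^k * (L2_norm (d k))\<^sup>2) \<le> ennreal ((1/2)^k)" by (rule ennreal_leI)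
  qed auto
  also have "\<dots> = ennreal (\<Sum>k. (1/2)^k)"
    by (rule suminf_ennreal2) (auto intro: summable_geometric)
  finally have "(\<integral>\<^sup>+x. (\<Sum>k. ennreal (2^k * (norm (d k x))\<^sup>2)) \<partial>lborel) \<noteq> \<infinity>"
    by (auto simp: top_unique)
  then have "AE x in lborel. (\<Sum>k. ennreal (2^k * (norm (d k x))\<^sup>2)) \<noteq> \<infinity>"
    by (intro nn_integral_PInf_AE) measurable
  then have conv: "AE x in lborel. convergent (\<lambda>k. f (s k) x)"
  proof eventually_elim
    case (elim x)
    define S where "S = (\<Sum>k. ennreal (2^k * (norm (d k x))\<^sup>2))"
    define C where "C = enn2real S"
    have "S < top" using elim unfolding S_def by (simp add: less_top)
    then have C: "S = ennreal C" "C \<ge> 0" by (simp_all add: C_def)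
    have b: "norm (d k x) \<le> sqrt C * (sqrt (1/2))^k" for k
    proof -
      have "ennreal (2^k * (norm (d k x))\<^sup>2) \<le> ennreal C"
        using sum_le_suminf[of "\<lambda>k. ennreal (2^k * (norm (d k x))\<^sup>2)" "{k}"] unfolding S_def[symmetric] C(1) by simp
      then have "2^k * (norm (d k x))\<^sup>2 \<le> C" using C by (simp add: ennreal_le_iff)
      then have "(norm (d k x))\<^sup>2 \<le> C * (1/2)^k" by (simp add: field_simps)
      then have "norm (d k x) \<le> sqrt (C * (1/2)^k)" by (rule real_le_rsqrt)
      then show ?thesis by (simp add: real_sqrt_mult real_sqrt_power)
    qed
    have "summable (\<lambda>k. d k x)"
    proof (rule summable_comparison_test')
      show "summable (\<lambda>k. sqrt C * (sqrt (1/2))^k)"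
        by (intro summable_mult summable_geometric) (simp add: real_sqrt_divide)
    qed (use b in auto)
    then have "convergent (\<lambda>k. f (s 0) x + (\<Sum>i<k. d i x))"
      by (intro convergent_add convergent_const) (simp add: summable_iff_convergent)
    moreover have "f (s 0) x + (\<Sum>i<k. d i x) = f (s k) x" for k
      using sum_lessThan_telescope[of "\<lambda>k. f (s k) x" k] by (simp add: d_def)
    ultimately show ?case by simp
  qed
  define F where "F x = lim (\<lambda>k. f (s k) x)" for x
  have Fm [measurable]: "F \<in> borel_measurable borel"
    unfolding F_def by (intro borel_measurable_lim_metric) measurable
  have lim: "AE x in lborel. (\<lambda>k. f (s k) x) \<longlonglongrightarrow> F x"
    using conv unfolding F_def by eventually_elim (simp add: convergent_LIMSEQ_iff)
  have est: "(\<lambda>x. f n x - F x) \<in> L2 \<and> L2_norm (\<lambda>x. f n x - F x) \<le> (1/2)^j" if n: "n \<ge> M j" for n j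
  proof -
    have "(\<integral>\<^sup>+x. ennreal ((norm (f n x - F x))\<^sup>2) \<partial>lborel)
        = (\<integral>\<^sup>+x. liminf (\<lambda>k. ennreal ((norm (f n x - f (s k) x))\<^sup>2)) \<partial>lborel)"
    proof (rule nn_integral_cong_AE)
      show "AE x in lborel. ennreal ((norm (f n x - F x))\<^sup>2) = liminf (\<lambda>k. ennreal ((norm (f n x - f (s k) x))\<^sup>2))"
        using lim
      proof eventually_elim
        case (elim x)
        then have "(\<lambda>k. ennreal ((norm (f n x - f (s k) x))\<^sup>2)) \<longlonglongrightarrow> ennreal ((norm (f n x - F x))\<^sup>2)"
          by (intro tendsto_ennrealI tendsto_intros)
        then show ?case by (rule lim_imp_Liminf[OF sequentially_bot, symmetric])
      qed
    qed
    also have "\<dots> \<le> liminf (\<lambda>k. \<integral>\<^sup>+x. ennreal ((norm (f n x - f (s k) x))\<^sup>2) \<partial>lborel)"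
      by (rule nn_integral_liminf) measurable
    also have "\<dots> \<le> ennreal (((1/2)^j)\<^sup>2)"
    proof (rule Liminf_le)
      show "\<forall>\<^sub>F k in sequentially. (\<integral>\<^sup>+x. ennreal ((norm (f n x - f (s k) x))\<^sup>2) \<partial>lborel) \<le> ennreal (((1/2)^j)\<^sup>2)"
      proof (rule eventually_sequentiallyI)
        fix k assume "k \<ge> j"
        then have "L2_norm (\<lambda>x. f n x - f (s k) x) \<le> (1/2)^j"
          using M[OF n smono[of j k]] by simp
        then have "(L2_norm (\<lambda>x. f n x - f (s k) x))\<^sup>2 \<le> ((1/2)^j)\<^sup>2" by (intro power_mono) auto
        then show "(\<integral>\<^sup>+x. ennreal ((norm (f n x - f (s k) x))\<^sup>2) \<partial>lborel) \<le> ennreal (((1/2)^j)\<^sup>2)"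
          using L2_norm_nn[OF L2_diff[OF f f], of n "s k"] by (simp add: ennreal_leI)
      qed
    qed simp
    finally have le: "(\<integral>\<^sup>+x. ennreal ((norm (f n x - F x))\<^sup>2) \<partial>lborel) \<le> ennreal (((1/2)^j)\<^sup>2)" .
    have "(\<lambda>x. f n x - F x) \<in> borel_measurable borel" by measurable
    from L2_if_nn[OF this le] show ?thesis by simp
  qed
  have "F \<in> L2"
    using L2_diff[OF f[of "M 0"] conjunct1[OF est[of 0 "M 0"]]] by simp
  moreover have "(\<lambda>n. L2_norm (\<lambda>x. f n x - F x)) \<longlonglongrightarrow> 0"
  proof (rule LIMSEQ_I)
    fix e :: real assume "e > 0"
    then obtain j where "(1/2)^j < e" using real_arch_pow_inv[of e "1/2"] by auto
    then show "\<exists>n0. \<forall>n\<ge>n0. norm (L2_norm (\<lambda>x. f n x - F x) - 0) < e"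
      using est by (intro exI[of _ "M j"]) (fastforce intro: le_less_trans)
  qed
  ultimately show ?thesis by blast
qed

text \<open>Projection onto the closure of a subspace that need not be closed: the projection
  \<open>w\<close> comes with a sequence in \<open>T\<close> that approximates it. This serves
  twice, for the density of test fields and for the range of the resolvent equation.\<close>

lemma L2_projection:
  assumes T: "T \<subseteq> L2" and T0: "(\<lambda>x. 0) \<in> T"
    and Tadd: "\<And>f g. f \<in> T \<Longrightarrow> g \<in> T \<Longrightarrow> (\<lambda>x. f x + g x) \<in> T"
    and Tscale: "\<And>c f. f \<in> T \<Longrightarrow> (\<lambda>x. c *\<^sub>R f x) \<in> T"
    and eta: "\<eta> \<in> L2"
  shows "\<exists>t w. (\<forall>n. t n \<in> T) \<and> w \<in> L2 \<and> (\<lambda>n. L2_norm (\<lambda>x. t n x - w x)) \<longlonglongrightarrow> 0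
           \<and> (\<forall>f\<in>T. ip (\<lambda>x. \<eta> x - w x) f = 0)"
proof -
  define q where "q f = ip (\<lambda>x. \<eta> x - f x) (\<lambda>x. \<eta> x - f x)" for f
  define d where "d = Inf (q ` T)"
  have TL: "f \<in> L2" if "f \<in> T" for f using that T by blast
  have bdd: "bdd_below (q ` T)" unfolding q_def by (intro bdd_belowI2[of _ 0] ip_self_nonneg)
  have dle: "d \<le> q f" if "f \<in> T" for f unfolding d_def by (rule cINF_lower[OF bdd that])
  have "\<exists>f\<in>T. q f < d + inverse (Suc n)" for n
  proof -
    have "Inf (q ` T) < d + inverse (Suc n)" by (simp add: d_def)
    then show ?thesis using cInf_lessD[of "q ` T"] T0 by blast
  qed
  then obtain t where t: "\<And>n. t n \<in> T" "\<And>n. q (t n) < d + inverse (Suc n)" by metis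
  note tL = TL[OF t(1)]
  \<comment> \<open>The parallelogram law: the midpoint of two almost minimising elements lies in
    \<open>T\<close>, so its distance to \<eta> is at least the infimum, and the two elements must
    be close.\<close>
  have par: "ip (\<lambda>x. t m x - t n x) (\<lambda>x. t m x - t n x) \<le> 2 * inverse (Suc m) + 2 * inverse (Suc n)" for m n
  proof -
    have h: "(\<lambda>x. (1/2) *\<^sub>R (t m x + t n x)) \<in> T" using Tadd[OF t(1) t(1)] Tscale by blast
    have "4 * q (\<lambda>x. (1/2) *\<^sub>R (t m x + t n x)) + ip (\<lambda>x. t m x - t n x) (\<lambda>x. t m x - t n x) = 2 * q (t m) + 2 * q (t n)"
      unfolding q_def
      by (simp add: ip_diff_left ip_diff_right ip_add_left ip_add_right ip_scaleR_left ip_scaleR_right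
          L2_diff L2_add L2_scaleR eta tL ip_commute algebra_simps)
    then show ?thesis using dle[OF h] t(2)[of m] t(2)[of n] by linarith
  qed
  have "\<exists>w\<in>L2. (\<lambda>n. L2_norm (\<lambda>x. t n x - w x)) \<longlonglongrightarrow> 0"
  proof (rule L2_complete[OF tL])
    fix e :: real assume e: "e > 0"
    obtain N where N: "inverse (Suc N) < e\<^sup>2 / 4" using reals_Archimedean[of "e\<^sup>2/4"] e by auto
    show "\<exists>N. \<forall>m\<ge>N. \<forall>n\<ge>N. L2_norm (\<lambda>x. t m x - t n x) < e"
    proof (intro exI allI impI)
      fix m n assume "m \<ge> N" "n \<ge> N"
      then have "inverse (real (Suc m)) \<le> inverse (Suc N)" "inverse (real (Suc n)) \<le> inverse (Suc N)"
        by (auto intro!: le_imp_inverse_le)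
      then have "(L2_norm (\<lambda>x. t m x - t n x))\<^sup>2 < e\<^sup>2" using par[of m n] N unfolding L2_norm_power2 by linarith
      then show "L2_norm (\<lambda>x. t m x - t n x) < e" using e by (simp add: power_less_imp_less_base)
    qed
  qed
  then obtain w where w: "w \<in> L2" "(\<lambda>n. L2_norm (\<lambda>x. t n x - w x)) \<longlonglongrightarrow> 0" by blast
  have "ip (\<lambda>x. \<eta> x - w x) f = 0" if f: "f \<in> T" for f
  proof -
    have w': "(\<lambda>n. L2_norm (\<lambda>x. (\<eta> x - t n x) - (\<eta> x - w x))) \<longlonglongrightarrow> 0"
      using w(2) by (simp add: L2_norm_minus_commute)
    have qw: "(\<lambda>n. q (t n)) \<longlonglongrightarrow> q w"
      unfolding q_def by (rule tendsto_ip) (use w' eta tL w(1) in \<open>auto intro: L2_diff\<close>)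
    have "(\<lambda>n. d + inverse (real (Suc n))) \<longlonglongrightarrow> d + 0"
      by (intro tendsto_intros LIMSEQ_inverse_real_of_nat)
    then have qd: "q w \<le> d"
      using LIMSEQ_le[OF qw, of "\<lambda>n. d + inverse (real (Suc n))" d] t(2) by (auto intro: less_imp_le)
    have var: "d \<le> q w - 2 * c * ip (\<lambda>x. \<eta> x - w x) f + c\<^sup>2 * ip f f" for c
    proof -
      have "(\<lambda>n. q (\<lambda>x. t n x + c *\<^sub>R f x)) \<longlonglongrightarrow> q (\<lambda>x. w x + c *\<^sub>R f x)"
        unfolding q_def using w(2)
        by (intro tendsto_ip L2_diff L2_add L2_scaleR eta tL w TL f) (auto simp: L2_norm_minus_commute)
      then have "d \<le> q (\<lambda>x. w x + c *\<^sub>R f x)"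
        by (rule LIMSEQ_le_const) (auto intro!: dle Tadd Tscale t f)
      also have "\<dots> = q w - 2 * c * ip (\<lambda>x. \<eta> x - w x) f + c\<^sup>2 * ip f f"
        unfolding q_def
        by (simp add: ip_diff_left ip_diff_right ip_add_left ip_add_right ip_scaleR_left ip_scaleR_right
          L2_diff L2_add L2_scaleR eta w(1) TL[OF f] ip_commute algebra_simps power2_eq_square)
      finally show ?thesis .
    qed
    have v: "2 * c * ip (\<lambda>x. \<eta> x - w x) f \<le> c\<^sup>2 * ip f f" for c using var[of c] qd by linarith
    show ?thesis
    proof (rule ccontr)
      assume a: "ip (\<lambda>x. \<eta> x - w x) f \<noteq> 0"
      define p where "p = ip (\<lambda>x. \<eta> x - w x) f"
      \<comment> \<open>The minimiser of the quadratic would be \<open>p / ip f f\<close>; adding 1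
        avoids a zero denominator and still gives a contradiction.\<close>
      define c where "c = p / (ip f f + 1)"
      have ff: "ip f f + 1 > 0" using ip_self_nonneg[of f] by linarith
      have p: "p = c * (ip f f + 1)" using ff by (simp add: c_def)
      have "c \<noteq> 0" using a ff by (auto simp: c_def p_def)
      then have "0 < c\<^sup>2 * (ip f f + 2)" using ff by (intro mult_pos_pos) auto
      moreover have "2 * c * (c * (ip f f + 1)) \<le> c\<^sup>2 * ip f f" using v[of c] p unfolding p_def by simp
      ultimately show False by (simp add: algebra_simps power2_eq_square)
    qed
  qed
  then show ?thesis using t(1) w by blast
qed

subsection \<open>Continuously differentiable fields with compact support\<close>

text \<open>The partial derivatives are carried as data, so that sums, products and compositions
  come with explicit formulas for them.\<close>

definition C1 :: "(real^3 \<Rightarrow> 'b::euclidean_space) \<Rightarrow> (3 \<Rightarrow> real^3 \<Rightarrow> 'b) \<Rightarrow> bool" where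
  "C1 F DF \<longleftrightarrow> (\<forall>x. (F has_derivative (\<lambda>h. \<Sum>k\<in>UNIV. h$k *\<^sub>R DF k x)) (at x)) \<and>
     (\<forall>k. continuous_on UNIV (DF k))"

definition C1c :: "(real^3 \<Rightarrow> 'b::euclidean_space) \<Rightarrow> (3 \<Rightarrow> real^3 \<Rightarrow> 'b) \<Rightarrow> bool" where
  "C1c F DF \<longleftrightarrow> C1 F DF \<and> (\<exists>R. \<forall>x. norm x > R \<longrightarrow> F x = 0)"

text \<open>Vanishing on a whole ball around the origin allows multiplication by angular fields that
  are singular there.\<close>

definition off0 :: "(real^3 \<Rightarrow> 'b::zero) \<Rightarrow> bool" where
  "off0 F \<longleftrightarrow> (\<exists>d>0. \<forall>x. norm x < d \<longrightarrow> F x = 0)"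

lemma C1_has_derivative: "C1 F DF \<Longrightarrow> (F has_derivative (\<lambda>h. \<Sum>k\<in>UNIV. h$k *\<^sub>R DF k x)) (at x)"
  by (simp add: C1_def)

lemma C1_continuous: "C1 F DF \<Longrightarrow> continuous_on UNIV F" "C1 F DF \<Longrightarrow> continuous_on UNIV (DF k)"
  by (auto simp: C1_def intro: differentiable_imp_continuous_on differentiableI
      intro!: continuous_at_imp_continuous_on has_derivative_continuous)

lemma C1_measurable: "C1 F DF \<Longrightarrow> F \<in> borel_measurable borel" "C1 F DF \<Longrightarrow> DF k \<in> borel_measurable borel"
  by (auto intro!: borel_measurable_continuous_onI dest: C1_continuous)

lemma sum_axis:
  fixes f :: "3 \<Rightarrow> 'b::real_vector"
  shows "(\<Sum>k\<in>UNIV. (axis j (1::real) :: real^3) $ k *\<^sub>R f k) = f j"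
proof -
  have "(\<Sum>k\<in>UNIV. (axis j (1::real) :: real^3) $ k *\<^sub>R f k) = (\<Sum>k\<in>UNIV. if k = j then f k else 0)"
    by (rule sum.cong) (auto simp: axis_def)
  then show ?thesis by simp
qed

lemma partial_deriv_eq:
  assumes "(F has_derivative (\<lambda>h. \<Sum>k\<in>UNIV. h$k *\<^sub>R D k)) (at x)"
  shows "partial_deriv j F x = D j"
  unfolding partial_deriv_def frechet_derivative_at[OF assms, symmetric] by (rule sum_axis)

lemma C1_deriv_zero:
  assumes C: "C1 F DF" and S: "open S" "x \<in> S" "\<And>y. y \<in> S \<Longrightarrow> F y = 0"
  shows "DF k x = 0"
proof -
  have "(F has_derivative (\<lambda>h. 0)) (at x)"
    by (rule has_derivative_transform_within_open[OF has_derivative_const S(1,2)]) (use S in auto)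
  from has_derivative_unique[OF C1_has_derivative[OF C] this]
  have "(\<Sum>j\<in>UNIV. (axis k (1::real) :: real^3) $ j *\<^sub>R DF j x) = 0" by meson
  then show ?thesis by (simp only: sum_axis)
qed

lemma C1c_support:
  assumes "C1c F DF"
  obtains R where "R > 0" "\<And>x. norm x > R \<Longrightarrow> F x = 0" "\<And>x k. norm x > R \<Longrightarrow> DF k x = 0"
proof -
  obtain R where R: "\<And>x. norm x > R \<Longrightarrow> F x = 0" and C: "C1 F DF" using assms by (auto simp: C1c_def)
  have "DF k x = 0" if "norm x > R" for x k
    by (rule C1_deriv_zero[OF C, of "{x. norm x > R}"])
       (use that R in \<open>auto intro!: open_Collect_less continuous_intros\<close>)
  then show ?thesis using R by (intro that[of "max R 1"]) auto
qed

lemma off0_deriv: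
  assumes C: "C1 F DF" and o: "off0 F" shows "off0 (DF k)"
proof -
  obtain d where d: "d > 0" "\<And>x. norm x < d \<Longrightarrow> F x = 0" using o by (auto simp: off0_def)
  have "DF k x = 0" if "norm x < d" for x
    by (rule C1_deriv_zero[OF C, of "{x. norm x < d}"])
       (use that d in \<open>auto intro!: open_Collect_less continuous_intros\<close>)
  then show ?thesis using d by (auto simp: off0_def)
qed

lemma compact_support_bounded:
  assumes c: "continuous_on UNIV (F :: real^3 \<Rightarrow> 'b::euclidean_space)" and s: "\<And>x. norm x > R \<Longrightarrow> F x = 0"
  obtains B where "B \<ge> 0" "\<And>x. norm (F x) \<le> B"
proof -
  have "compact (F ` cball 0 R)"
    by (intro compact_continuous_image continuous_on_subset[OF c] compact_cball) auto
  then obtain B where "\<And>x. x \<in> cball 0 R \<Longrightarrow> norm (F x) \<le> B"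
    using compact_imp_bounded bounded_iff by (metis imageI)
  then have "norm (F x) \<le> max B 0" for x
    using s[of x] by (cases "norm x > R") (auto simp: dist_norm intro: max.coboundedI1)
  then show ?thesis by (intro that[of "max B 0"]) auto
qed

lemma compact_support_integrable:
  assumes c: "continuous_on UNIV (F :: real^3 \<Rightarrow> 'b::euclidean_space)" and s: "\<And>x. norm x > R \<Longrightarrow> F x = 0"
  shows "integrable lborel F"
proof -
  have "integrable lborel (\<lambda>x. indicator (cball 0 R) x *\<^sub>R F x)"
    by (rule borel_integrable_compact[OF compact_cball continuous_on_subset[OF c]]) auto
  also have "(\<lambda>x. indicator (cball 0 R) x *\<^sub>R F x) = F"
    using s by (auto simp: indicator_def fun_eq_iff dist_norm not_le)
  finally show ?thesis .
qed

lemma compact_support_L2: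
  assumes c: "continuous_on UNIV F" and s: "\<And>x. norm x > R \<Longrightarrow> F x = 0"
  shows "F \<in> L2"
proof -
  obtain B where "\<And>x. norm (F x) \<le> B" using compact_support_bounded[OF c s] by blast
  then show ?thesis by (intro L2_bounded_support[OF borel_measurable_continuous_onI[OF c] _ s])
qed

lemma C1c_C1: "C1c F DF \<Longrightarrow> C1 F DF"
  by (simp add: C1c_def)

lemma C1c_L2:
  assumes "C1c F DF" shows "F \<in> L2" "DF k \<in> L2"
  using C1c_support[OF assms] C1_continuous[OF C1c_C1[OF assms]] compact_support_L2 by metis+

lemma C1c_integrable:
  assumes "C1c F DF" shows "integrable lborel F" "integrable lborel (DF k)"
  using C1c_support[OF assms] C1_continuous[OF C1c_C1[OF assms]] compact_support_integrable by metis+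

lemma lborel_integral_translate:
  fixes f :: "'a::euclidean_space \<Rightarrow> 'b::euclidean_space"
  assumes [measurable]: "f \<in> borel_measurable borel"
  shows "(\<integral>x. f (a + x) \<partial>lborel) = (\<integral>x. f x \<partial>lborel)"
proof -
  have "(\<integral>x. f x \<partial>lborel) = (\<integral>x. f x \<partial>distr lborel borel ((+) a))" by (simp add: lborel_distr_plus)
  also have "\<dots> = (\<integral>x. f (a + x) \<partial>lborel)" by (rule integral_distr) auto
  finally show ?thesis by simp
qed

lemma nn_integral_translate:
  assumes [measurable]: "f \<in> borel_measurable borel"
  shows "(\<integral>\<^sup>+x. f ((a::'a::euclidean_space) + x) \<partial>lborel) = (\<integral>\<^sup>+x. f x \<partial>lborel)"
proof -
  have "(\<integral>\<^sup>+x. f x \<partial>lborel) = (\<integral>\<^sup>+x. f x \<partial>distr lborel borel ((+) a))" by (simp add: lborel_distr_plus)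
  also have "\<dots> = (\<integral>\<^sup>+x. f (a + x) \<partial>lborel)" by (rule nn_integral_distr) auto
  finally show ?thesis by simp
qed

lemma has_vector_derivative_tendsto:
  assumes "(f has_vector_derivative D) (at (a::real))"
  shows "((\<lambda>t. (f (a + t) - f a) /\<^sub>R t) \<longlongrightarrow> D) (at 0)"
proof -
  have l: "((\<lambda>h. norm (f (a + h) - f a - h *\<^sub>R D) / norm h) \<longlongrightarrow> 0) (at 0)"
    using assms by (simp add: has_vector_derivative_def has_derivative_at)
  have "((\<lambda>h. norm ((f (a + h) - f a) /\<^sub>R h - D)) \<longlongrightarrow> 0) (at 0)"
  proof (rule Lim_transform_eventually[OF l])
    show "\<forall>\<^sub>F h in at 0. norm (f (a + h) - f a - h *\<^sub>R D) / norm h = norm ((f (a + h) - f a) /\<^sub>R h - D)"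
      unfolding eventually_at
    proof (intro exI[of _ 1] conjI ballI impI)
      fix h :: real assume h: "h \<noteq> 0 \<and> dist h 0 < 1"
      have "(f (a + h) - f a) /\<^sub>R h - D = (f (a + h) - f a - h *\<^sub>R D) /\<^sub>R h"
        using h by (simp add: scaleR_diff_right)
      then show "norm (f (a + h) - f a - h *\<^sub>R D) / norm h = norm ((f (a + h) - f a) /\<^sub>R h - D)"
        by (simp add: divide_inverse)
    qed simp
  qed
  then show ?thesis by (simp add: tendsto_norm_zero_iff Lim_null[symmetric])
qed

text \<open>Translation invariance kills the integral of every difference quotient.\<close>

lemma C1c_integral_deriv:
  assumes C: "C1c F DF"
  shows "(\<integral>x. DF k x \<partial>lborel) = 0"
proof -
  obtain R where R: "R > 0" "\<And>x. norm x > R \<Longrightarrow> F x = 0" "\<And>x k. norm x > R \<Longrightarrow> DF k x = 0"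
    using C1c_support[OF C] by blast
  note C' = C1c_C1[OF C]
  have "\<exists>B. \<forall>x. norm (DF k x) \<le> B" for k
    using compact_support_bounded[OF C1_continuous(2)[OF C'] R(3)] by metis
  then obtain B where B: "\<And>x. norm (DF k x) \<le> B" by metis
  define h where "h n = inverse (real (Suc n))" for n
  have h: "h n > 0" "h n \<le> 1" for n unfolding h_def by (auto simp: field_simps)
  have hl: "h \<longlonglongrightarrow> 0" unfolding h_def[abs_def] by (rule LIMSEQ_inverse_real_of_nat)
  define e :: "real^3" where "e = axis k 1"
  have ne: "norm e = 1" by (simp add: e_def)
  have dl: "((\<lambda>t. F (x + t *\<^sub>R e)) has_vector_derivative DF k (x + t *\<^sub>R e)) (at t within S)" for x t S
  proof -
    have "((\<lambda>t. F (x + t *\<^sub>R e)) has_derivative (\<lambda>s. \<Sum>k\<in>UNIV. (s *\<^sub>R e)$k *\<^sub>R DF k (x + t *\<^sub>R e))) (at t)"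
      by (rule has_derivative_compose[of "\<lambda>t. x + t *\<^sub>R e" "\<lambda>s. s *\<^sub>R e" t UNIV F])
         (auto intro!: derivative_eq_intros C1_has_derivative C')
    also have "(\<lambda>s. \<Sum>k\<in>UNIV. (s *\<^sub>R e)$k *\<^sub>R DF k (x + t *\<^sub>R e)) = (\<lambda>s. s *\<^sub>R DF k (x + t *\<^sub>R e))"
    proof (rule ext)
      fix s
      have "(\<Sum>k\<in>UNIV. (s *\<^sub>R e)$k *\<^sub>R DF k (x + t *\<^sub>R e)) = s *\<^sub>R (\<Sum>k\<in>UNIV. e$k *\<^sub>R DF k (x + t *\<^sub>R e))"
        unfolding scaleR_sum_right by (rule sum.cong) simp_all
      then show "(\<Sum>k\<in>UNIV. (s *\<^sub>R e)$k *\<^sub>R DF k (x + t *\<^sub>R e)) = s *\<^sub>R DF k (x + t *\<^sub>R e)"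
        by (simp only: e_def sum_axis)
    qed
    finally show ?thesis by (simp add: has_vector_derivative_def has_derivative_at_withinI)
  qed
  \<comment> \<open>The increments \<open>h n\<close> are at most 1, so all difference quotients
    live in one ball of radius \<open>R + 1\<close>, and the mean value inequality bounds them by
    \<open>B\<close> there.\<close>
  have lim: "(\<lambda>n. \<integral>x. (1 / h n) *\<^sub>R (F (h n *\<^sub>R e + x) - F x) \<partial>lborel) \<longlonglongrightarrow> (\<integral>x. DF k x \<partial>lborel)"
  proof (rule integral_dominated_convergence[where w="\<lambda>x. B * indicator (cball 0 (R + 1)) x"])
    show "DF k \<in> borel_measurable lborel" using C1_measurable[OF C'] by simp
    have [measurable]: "F \<in> borel_measurable borel" using C1_measurable[OF C'] by simp
    show "(\<lambda>x. (1 / h n) *\<^sub>R (F (h n *\<^sub>R e + x) - F x)) \<in> borel_measurable lborel" for n by measurable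
    show "integrable lborel (\<lambda>x. B * indicator (cball (0::real^3) (R + 1)) x)"
      using emeasure_bounded_finite[OF bounded_cball[of "0::real^3" "R + 1"]] by simp
    show "AE x in lborel. (\<lambda>n. (1 / h n) *\<^sub>R (F (h n *\<^sub>R e + x) - F x)) \<longlonglongrightarrow> DF k x"
    proof (rule AE_I2)
      fix x
      have "((\<lambda>t. F (x + t *\<^sub>R e)) has_vector_derivative DF k x) (at 0)" using dl[of x 0 UNIV] by simp
      then have "((\<lambda>t. (F (x + t *\<^sub>R e) - F x) /\<^sub>R t) \<longlongrightarrow> DF k x) (at 0)"
        using has_vector_derivative_tendsto by fastforce
      moreover have "filterlim h (at 0) sequentially"
        unfolding filterlim_at using hl h by (auto intro!: always_eventually simp: less_imp_neq[symmetric])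
      ultimately have "(\<lambda>n. (F (x + h n *\<^sub>R e) - F x) /\<^sub>R h n) \<longlonglongrightarrow> DF k x"
        by (rule filterlim_compose)
      then show "(\<lambda>n. (1 / h n) *\<^sub>R (F (h n *\<^sub>R e + x) - F x)) \<longlonglongrightarrow> DF k x"
        by (simp add: divide_inverse add.commute)
    qed
    show "AE x in lborel. norm ((1 / h n) *\<^sub>R (F (h n *\<^sub>R e + x) - F x)) \<le> B * indicator (cball 0 (R + 1)) x" for n
    proof (rule AE_I2)
      fix x
      show "norm ((1 / h n) *\<^sub>R (F (h n *\<^sub>R e + x) - F x)) \<le> B * indicator (cball 0 (R + 1)) x"
      proof (cases "norm x \<le> R + 1")
        case True
        have "norm (F (x + h n *\<^sub>R e) - F (x + 0 *\<^sub>R e)) \<le> B * norm (h n - 0)"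
          by (rule differentiable_bound[of UNIV "\<lambda>t. F (x + t *\<^sub>R e)" "\<lambda>t s. s *\<^sub>R DF k (x + t *\<^sub>R e)"])
             (use dl B in \<open>auto simp: has_vector_derivative_def mult.commute[of B] intro!: onorm_le mult_left_mono\<close>)
        then have "norm (F (h n *\<^sub>R e + x) - F x) / h n \<le> B"
          using h[of n] by (simp add: field_simps)
        moreover have "norm ((1 / h n) *\<^sub>R (F (h n *\<^sub>R e + x) - F x)) = norm (F (h n *\<^sub>R e + x) - F x) / h n"
          using h[of n] by (simp add: divide_inverse mult.commute del: scaleR_diff_right)
        ultimately show ?thesis using True by (simp only:) (simp add: dist_norm)
      next
        case False
        have "norm x \<le> norm (h n *\<^sub>R e + x) + norm (h n *\<^sub>R e)"
          using norm_triangle_ineq4[of "h n *\<^sub>R e + x" "h n *\<^sub>R e"] by simp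
        then have "norm (h n *\<^sub>R e + x) > R" using False h[of n] ne by simp
        then show ?thesis using False R by (simp add: dist_norm)
      qed
    qed
  qed
  have "(\<integral>x. (1 / h n) *\<^sub>R (F (h n *\<^sub>R e + x) - F x) \<partial>lborel) = 0" for n
  proof -
    have m: "F \<in> borel_measurable borel" using C1_measurable[OF C'] by simp
    have i: "integrable lborel (\<lambda>x. F (h n *\<^sub>R e + x))"
    proof (rule compact_support_integrable)
      show "continuous_on UNIV (\<lambda>x. F (h n *\<^sub>R e + x))"
        by (rule continuous_on_compose2[OF C1_continuous(1)[OF C']]) (auto intro!: continuous_intros)
      fix x :: "real^3" assume x: "norm x > R + 1"
      have "norm x \<le> norm (h n *\<^sub>R e + x) + norm (h n *\<^sub>R e)"
        using norm_triangle_ineq4[of "h n *\<^sub>R e + x" "h n *\<^sub>R e"] by simp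
      then show "F (h n *\<^sub>R e + x) = 0" using x h[of n] ne R by simp
    qed
    show ?thesis
      using i C1c_integrable(1)[OF C] lborel_integral_translate[OF m, of "h n *\<^sub>R e"] by simp
  qed
  then have "(\<lambda>n. 0) \<longlonglongrightarrow> (\<integral>x. DF k x \<partial>lborel)" using lim by (simp only:)
  then show ?thesis by (simp add: LIMSEQ_const_iff)
qed


section \<open>Calculus of C1 functions, bump functions and the fundamental lemma\<close>

lemma C1_const: "C1 (\<lambda>x. c) (\<lambda>k x. 0)"
  by (simp add: C1_def)

lemma C1_add: "C1 F DF \<Longrightarrow> C1 G DG \<Longrightarrow> C1 (\<lambda>x. F x + G x) (\<lambda>k x. DF k x + DG k x)"
  unfolding C1_def by (auto intro!: continuous_intros has_derivative_eq_rhs[OF has_derivative_add]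
      simp: scaleR_add_right sum.distrib)

lemma C1_linear_image:
  assumes T: "bounded_linear T" and C: "C1 F DF"
  shows "C1 (\<lambda>x. T (F x)) (\<lambda>k x. T (DF k x))"
  unfolding C1_def
proof (intro conjI allI)
  interpret T: bounded_linear T by (rule T)
  fix x
  show "((\<lambda>x. T (F x)) has_derivative (\<lambda>h. \<Sum>k\<in>UNIV. h $ k *\<^sub>R T (DF k x))) (at x)"
    by (rule has_derivative_eq_rhs[OF bounded_linear.has_derivative[OF T C1_has_derivative[OF C]]])
       (simp add: T.sum T.scaleR)
  show "continuous_on UNIV (\<lambda>x. T (DF k x))" for k
    by (rule bounded_linear.continuous_on[OF T C1_continuous(2)[OF C]])
qed

lemma C1_scaleR:
  fixes F :: "real^3 \<Rightarrow> real"
  assumes F: "C1 F DF" and G: "C1 G DG"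
  shows "C1 (\<lambda>x. F x *\<^sub>R G x) (\<lambda>k x. F x *\<^sub>R DG k x + DF k x *\<^sub>R G x)"
  unfolding C1_def
proof (intro conjI allI)
  fix x
  show "((\<lambda>x. F x *\<^sub>R G x) has_derivative (\<lambda>h. \<Sum>k\<in>UNIV. h $ k *\<^sub>R (F x *\<^sub>R DG k x + DF k x *\<^sub>R G x))) (at x)"
    by (rule has_derivative_eq_rhs[OF has_derivative_scaleR[OF C1_has_derivative[OF F] C1_has_derivative[OF G]]])
       (simp add: fun_eq_iff scaleR_add_right sum.distrib scaleR_sum_right scaleR_sum_left mult.commute)
  show "continuous_on UNIV (\<lambda>x. F x *\<^sub>R DG k x + DF k x *\<^sub>R G x)" for k
    by (intro continuous_intros C1_continuous[OF F] C1_continuous[OF G])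
qed

lemma C1_mult:
  fixes F G :: "real^3 \<Rightarrow> real"
  shows "C1 F DF \<Longrightarrow> C1 G DG \<Longrightarrow> C1 (\<lambda>x. F x * G x) (\<lambda>k x. F x * DG k x + DF k x * G x)"
  using C1_scaleR[of F DF G DG] by simp

lemma C1_compose:
  fixes F :: "real^3 \<Rightarrow> real" and p :: "real \<Rightarrow> 'b::euclidean_space"
  assumes F: "C1 F DF" and p: "\<And>t. (p has_vector_derivative p' t) (at t)" "continuous_on UNIV p'"
  shows "C1 (\<lambda>x. p (F x)) (\<lambda>k x. DF k x *\<^sub>R p' (F x))"
  unfolding C1_def
proof (intro conjI allI)
  fix x
  have "((\<lambda>x. p (F x)) has_derivative (\<lambda>h. (\<Sum>k\<in>UNIV. h $ k *\<^sub>R DF k x) *\<^sub>R p' (F x))) (at x)"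
    by (rule has_derivative_compose[OF C1_has_derivative[OF F] p(1)[unfolded has_vector_derivative_def]])
  then show "((\<lambda>x. p (F x)) has_derivative (\<lambda>h. \<Sum>k\<in>UNIV. h $ k *\<^sub>R DF k x *\<^sub>R p' (F x))) (at x)"
    by (simp add: scaleR_sum_left)
  show "continuous_on UNIV (\<lambda>x. DF k x *\<^sub>R p' (F x))" for k
    by (intro continuous_intros C1_continuous[OF F] continuous_on_compose2[OF p(2) C1_continuous(1)[OF F]]) auto
qed

lemma vec_eq_sum_axis: "(h :: real^3) $ i = (\<Sum>k\<in>UNIV. h $ k *\<^sub>R (if k = i then 1 else 0))"
proof -
  have "(\<Sum>k\<in>UNIV. h $ k *\<^sub>R (if k = i then 1 else 0)) = (\<Sum>k\<in>UNIV. if k = i then h $ k else 0)"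
    by (rule sum.cong) auto
  then show ?thesis by simp
qed

lemma C1_component: "C1 (\<lambda>x. x $ i) (\<lambda>k x. if k = i then 1 else 0)"
  unfolding C1_def
proof (intro conjI allI)
  fix x :: "real^3"
  show "((\<lambda>x. x $ i) has_derivative (\<lambda>h. \<Sum>k\<in>UNIV. h $ k *\<^sub>R (if k = i then 1 else 0))) (at x)"
    unfolding vec_eq_sum_axis[symmetric]
    by (rule bounded_linear.has_derivative[OF bounded_linear_vec_nth has_derivative_ident])
qed auto

lemma C1_norm2: "C1 (\<lambda>x. (norm x)\<^sup>2) (\<lambda>k x. 2 * x $ k)"
  unfolding C1_def
proof (intro conjI allI)
  fix x :: "real^3"
  have "((\<lambda>x. x \<bullet> x) has_derivative (\<lambda>h. x \<bullet> h + h \<bullet> x)) (at x)"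
    by (rule has_derivative_inner[OF has_derivative_ident has_derivative_ident])
  then show "((\<lambda>x. (norm x)\<^sup>2) has_derivative (\<lambda>h. \<Sum>k\<in>UNIV. h $ k *\<^sub>R (2 * x $ k))) (at x)"
    unfolding power2_norm_eq_inner
    by (rule has_derivative_eq_rhs) (auto simp: fun_eq_iff inner_vec_def sum.distrib[symmetric] intro!: sum.cong)
qed (auto intro!: continuous_intros)

text \<open>The squared positive part is C1 and nonzero exactly on a half line; products of such
  factors give bumps with a prescribed nonzero set.\<close>

definition ppow :: "real \<Rightarrow> real" where "ppow t = (max 0 t)\<^sup>2"

lemma ppow_pos: "ppow t > 0 \<longleftrightarrow> t > 0" and ppow_nonneg: "ppow t \<ge> 0"
  by (auto simp: ppow_def max_def)

lemma ppow_deriv: "(ppow has_vector_derivative 2 * max 0 t) (at t)"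
proof -
  consider "t > 0" | "t < 0" | "t = 0" by linarith
  then have "(ppow has_real_derivative 2 * max 0 t) (at t)"
  proof cases
    case 1
    have "((\<lambda>t. t\<^sup>2) has_real_derivative 2 * t) (at t)" by (auto intro!: derivative_eq_intros)
    then have "(ppow has_real_derivative 2 * t) (at t)"
      by (rule has_field_derivative_transform_within_open[of _ _ _ "{0<..}"]) (use 1 in \<open>auto simp: ppow_def\<close>)
    then show ?thesis using 1 by simp
  next
    case 2
    have "((\<lambda>t. 0) has_real_derivative 0) (at t)" by simp
    then have "(ppow has_real_derivative 0) (at t)"
      by (rule has_field_derivative_transform_within_open[of _ _ _ "{..<0}"]) (use 2 in \<open>auto simp: ppow_def\<close>)
    then show ?thesis using 2 by simp
  next
    case 3
    have "((\<lambda>h. ppow h / h) \<longlongrightarrow> 0) (at 0)"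
    proof (rule Lim_null_comparison)
      show "\<forall>\<^sub>F h in at 0. norm (ppow h / h) \<le> \<bar>h\<bar>"
        by (rule always_eventually) (auto simp: ppow_def max_def power2_eq_square)
      show "((\<lambda>h. \<bar>h\<bar>) \<longlongrightarrow> 0) (at (0::real))" by (intro tendsto_eq_intros) auto
    qed
    then show ?thesis using 3 by (simp add: DERIV_def) (simp add: ppow_def)
  qed
  then show ?thesis by (simp add: has_real_derivative_iff_has_vector_derivative)
qed

lemma C1_ppow: "C1 F DF \<Longrightarrow> C1 (\<lambda>x. ppow (F x)) (\<lambda>k x. DF k x *\<^sub>R (2 * max 0 (F x)))"
  by (rule C1_compose[OF _ ppow_deriv]) (auto intro!: continuous_intros)

text \<open>The functions \<open>n b\<^sup>2 / (1 + n b\<^sup>2)\<close> increase to the indicator of \<open>{b \<noteq> 0}\<close>.\<close>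

definition sat :: "nat \<Rightarrow> real \<Rightarrow> real" where "sat n t = real n * t\<^sup>2 / (1 + real n * t\<^sup>2)"

lemma sat_pos: "1 + real n * t\<^sup>2 > 0"
  by (simp add: add_pos_nonneg)

lemma sat_bound: "0 \<le> sat n t" "sat n t \<le> 1" "sat n 0 = 0"
  using sat_pos[of n t] by (auto simp: sat_def divide_simps)

lemma sat_lim: "(\<lambda>n. sat n t) \<longlonglongrightarrow> (if t = 0 then 0 else 1)"
proof (cases "t = 0")
  case False
  have "(\<lambda>n. 1 - sat n t) \<longlonglongrightarrow> 0"
  proof (rule Lim_null_comparison)
    show "\<forall>\<^sub>F n in sequentially. norm (1 - sat n t) \<le> (1 / t\<^sup>2) * inverse (real n)"
    proof (rule eventually_sequentiallyI[of 1])
      fix n :: nat assume n: "n \<ge> 1"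
      have "1 - sat n t = 1 / (1 + real n * t\<^sup>2)" using sat_pos[of n t] by (simp add: sat_def field_simps)
      also have "\<dots> \<le> 1 / (real n * t\<^sup>2)"
        using n False by (intro divide_left_mono mult_pos_pos sat_pos) auto
      finally show "norm (1 - sat n t) \<le> (1 / t\<^sup>2) * inverse (real n)"
        using sat_bound(1,2)[of n t] by (simp add: field_simps)
    qed
    show "(\<lambda>n. (1 / t\<^sup>2) * inverse (real n)) \<longlonglongrightarrow> 0"
      by (rule tendsto_mult_right_zero[OF lim_inverse_n])
  qed
  from tendsto_diff[OF tendsto_const[of 1] this] show ?thesis using False by simp
qed (simp add: sat_bound)

lemma C1_sat:
  assumes "C1 F DF" obtains D where "C1 (\<lambda>x. sat n (F x)) D"
proof -
  have "(sat n has_vector_derivative (2 * real n * t / (1 + real n * t\<^sup>2)\<^sup>2)) (at t)" for t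
    unfolding sat_def[abs_def] has_real_derivative_iff_has_vector_derivative[symmetric]
    using sat_pos[of n t]
    by (auto intro!: derivative_eq_intros simp: field_simps power2_eq_square)
  moreover have "continuous_on UNIV (\<lambda>t. 2 * real n * t / (1 + real n * t\<^sup>2)\<^sup>2)"
    using sat_pos by (auto intro!: continuous_intros simp: less_imp_neq[symmetric])
  ultimately show ?thesis by (intro that) (rule C1_compose[OF assms])
qed


lemma C1c_mult:
  fixes F :: "real^3 \<Rightarrow> real"
  assumes F: "C1 F DF" and G: "C1c G DG"
  shows "C1c (\<lambda>x. F x *\<^sub>R G x) (\<lambda>k x. F x *\<^sub>R DG k x + DF k x *\<^sub>R G x)"
  using C1_scaleR[OF F C1c_C1[OF G]] G by (auto simp: C1c_def)

text \<open>Open boxes generate the Borel sets, so it suffices to have a C1 function that is nonzero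
  exactly on a given box.\<close>

lemma C1_box_bump:
  fixes a b :: "real^3"
  obtains B :: "real^3 \<Rightarrow> real" and DB where "C1 B DB" "{x. B x \<noteq> 0} = box a b"
proof -
  define B where "B i x = ppow ((x::real^3) $ i - a $ i) * ppow (b $ i - x $ i)" for i x
  have "\<exists>D. C1 (B i) D" for i
  proof -
    have "C1 (\<lambda>x::real^3. x $ i - a $ i) (\<lambda>k x. if k = i then 1 else 0)"
      using C1_add[OF C1_component C1_const[of "- a $ i"]] by simp
    moreover have "C1 (\<lambda>x::real^3. b $ i - x $ i) (\<lambda>k x. - (if k = i then 1 else 0))"
      using C1_add[OF C1_const[of "b $ i"] C1_linear_image[OF bounded_linear_minus[OF bounded_linear_ident] C1_component]]
      by simp
    ultimately show ?thesis unfolding B_def using C1_mult[OF C1_ppow C1_ppow] by blast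
  qed
  then obtain D where D: "\<And>i. C1 (B i) (D i)" by metis
  note C1_mult[OF D[of 1] C1_mult[OF D[of 2] D[of 3]]]
  moreover have "{x. B 1 x * (B 2 x * B 3 x) \<noteq> 0} = box a b"
  proof -
    have "B i x \<noteq> 0 \<longleftrightarrow> a $ i < x $ i \<and> x $ i < b $ i" for i x
      using ppow_pos ppow_nonneg by (smt (verit) B_def mult_eq_0_iff)
    then show ?thesis by (intro set_eqI) (auto simp: mem_box_cart forall_3)
  qed
  ultimately show ?thesis by (rule that)
qed

text \<open>Nonzero exactly on an open spherical shell. The shells increase to the complement of the
  origin, and each stays away from the origin and from infinity.\<close>

definition annulus_bump :: "nat \<Rightarrow> real^3 \<Rightarrow> real" where
  "annulus_bump m x = ppow ((norm x)\<^sup>2 - 1 / Suc m) * ppow (Suc m - (norm x)\<^sup>2)"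

lemma annulus_bump_C1: obtains D where "C1 (annulus_bump m) D"
proof -
  have "C1 (\<lambda>x::real^3. (norm x)\<^sup>2 - 1 / Suc m) (\<lambda>k x. 2 * x $ k)"
    using C1_add[OF C1_norm2 C1_const[of "- (1 / Suc m)"]] by simp
  moreover have "C1 (\<lambda>x::real^3. Suc m - (norm x)\<^sup>2) (\<lambda>k x. - (2 * x $ k))"
    using C1_add[OF C1_const[of "real (Suc m)"] C1_linear_image[OF bounded_linear_minus[OF bounded_linear_ident] C1_norm2]]
    by simp
  ultimately show ?thesis using that C1_mult[OF C1_ppow C1_ppow] unfolding annulus_bump_def[abs_def] by blast
qed

lemma annulus_bump_nonzero: "annulus_bump m x \<noteq> 0 \<longleftrightarrow> 1 / Suc m < (norm x)\<^sup>2 \<and> (norm x)\<^sup>2 < Suc m"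
  unfolding annulus_bump_def using ppow_pos ppow_nonneg by (smt (verit) mult_eq_0_iff)

lemma annulus_bump_support: "norm x > Suc m \<Longrightarrow> annulus_bump m x = 0"
proof -
  assume n: "norm x > Suc m"
  then have "norm x * 1 \<le> norm x * norm x" by (intro mult_left_mono) auto
  then show ?thesis using annulus_bump_nonzero[of m x] n by (auto simp: power2_eq_square)
qed

lemma annulus_bump_off0: "off0 (annulus_bump m)"
proof -
  have "annulus_bump m x = 0" if "norm x < sqrt (1 / Suc m)" for x
  proof -
    have "(norm x)\<^sup>2 \<le> (sqrt (1 / Suc m))\<^sup>2" using that by (intro power_mono) auto
    then show ?thesis using annulus_bump_nonzero[of m x] by auto
  qed
  then show ?thesis unfolding off0_def by (intro exI[of _ "sqrt (1 / Suc m)"]) auto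
qed

lemma annulus_exhaust: "x \<noteq> 0 \<Longrightarrow> \<exists>m. annulus_bump m x \<noteq> 0"
proof -
  assume "x \<noteq> 0"
  then have p: "(norm x)\<^sup>2 > 0" by simp
  obtain m1 where m1: "inverse (Suc m1) < (norm x)\<^sup>2" using reals_Archimedean[OF p] by auto
  obtain m2 where m2: "(norm x)\<^sup>2 < real m2" using reals_Archimedean2 by blast
  have "1 / Suc (max m1 m2) \<le> inverse (Suc m1)" by (simp add: field_simps)
  then show ?thesis using m1 m2 annulus_bump_nonzero[of "max m1 m2" x] by (intro exI[of _ "max m1 m2"]) auto
qed

text \<open>The test function saturated from a box bump times a shell bump converges boundedly to
  the indicator of the box within the shell. Hence \<open>G\<close> has integral 0 over all such
  sets, and then over every Borel subset of the shell.\<close>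

lemma fundamental_lemma_real:
  fixes G :: "real^3 \<Rightarrow> real"
  assumes G: "integrable lborel (\<lambda>x. indicator {x. annulus_bump m x \<noteq> 0} x * G x)" "G \<in> borel_measurable borel"
    and z: "\<And>\<theta> D. C1c \<theta> D \<Longrightarrow> off0 \<theta> \<Longrightarrow> (\<integral>x. \<theta> x * G x \<partial>lborel) = 0"
  shows "AE x in lborel. annulus_bump m x \<noteq> 0 \<longrightarrow> G x = 0"
proof -
  define H where "H x = indicator {x. annulus_bump m x \<noteq> 0} x * G x" for x
  have H: "integrable lborel H" using G by (simp add: H_def[abs_def])
  have [measurable]: "G \<in> borel_measurable borel" by (rule G)
  obtain DA where DA: "C1 (annulus_bump m) DA" by (rule annulus_bump_C1)
  have [measurable]: "annulus_bump m \<in> borel_measurable borel" using C1_measurable[OF DA] by simp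
  have bump: "(\<integral>x. indicator {x. B x \<noteq> 0} x * H x \<partial>lborel) = 0" if B: "C1 B DB" for B :: "real^3 \<Rightarrow> real" and DB
  proof -
    have [measurable]: "B \<in> borel_measurable borel" using C1_measurable[OF B] by simp
    have sm[measurable]: "sat n \<in> borel_measurable borel" for n unfolding sat_def[abs_def] by measurable
    have "(\<lambda>n. \<integral>x. sat n (B x) * sat n (annulus_bump m x) * G x \<partial>lborel)
        \<longlonglongrightarrow> (\<integral>x. indicator {x. B x \<noteq> 0} x * H x \<partial>lborel)"
    proof (rule integral_dominated_convergence[where w="\<lambda>x. norm (H x)"])
      show "integrable lborel (\<lambda>x. norm (H x))" using H by simp
      show "AE x in lborel. (\<lambda>n. sat n (B x) * sat n (annulus_bump m x) * G x) \<longlonglongrightarrow> indicator {x. B x \<noteq> 0} x * H x"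
      proof (rule AE_I2)
        fix x
        have "(\<lambda>n. sat n (B x) * sat n (annulus_bump m x) * G x)
           \<longlonglongrightarrow> (if B x = 0 then 0 else 1) * (if annulus_bump m x = 0 then 0 else 1) * G x"
          by (intro tendsto_intros sat_lim)
        then show "(\<lambda>n. sat n (B x) * sat n (annulus_bump m x) * G x) \<longlonglongrightarrow> indicator {x. B x \<noteq> 0} x * H x"
          by (cases "B x = 0"; cases "annulus_bump m x = 0") (auto simp: H_def)
      qed
      show "AE x in lborel. norm (sat n (B x) * sat n (annulus_bump m x) * G x) \<le> norm (H x)" for n
      proof (rule AE_I2)
        fix x
        have "\<bar>sat n (B x)\<bar> * \<bar>sat n (annulus_bump m x)\<bar> * \<bar>G x\<bar> \<le> 1 * 1 * \<bar>G x\<bar>"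
          using sat_bound by (intro mult_right_mono mult_mono) auto
        then show "norm (sat n (B x) * sat n (annulus_bump m x) * G x) \<le> norm (H x)"
          using sat_bound(3)[of n] by (cases "annulus_bump m x = 0") (auto simp: H_def abs_mult)
      qed
    next
      show "(\<lambda>x. sat n (B x) * sat n (annulus_bump m x) * G x) \<in> borel_measurable lborel" for n by measurable
    qed (simp add: H_def[abs_def])
    moreover have "(\<integral>x. sat n (B x) * sat n (annulus_bump m x) * G x \<partial>lborel) = 0" for n
    proof -
      obtain D1 where D1: "C1 (\<lambda>x. sat n (B x)) D1" by (rule C1_sat[OF B])
      obtain D2 where D2: "C1 (\<lambda>x. sat n (annulus_bump m x)) D2" by (rule C1_sat[OF DA])
      have "C1c (\<lambda>x. sat n (annulus_bump m x)) D2"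
        unfolding C1c_def using D2 annulus_bump_support[of m] sat_bound(3) by (auto intro!: exI[of _ "real (Suc m)"])
      moreover have "off0 (\<lambda>x. sat n (B x) *\<^sub>R sat n (annulus_bump m x))"
        using annulus_bump_off0[of m] sat_bound(3)[of n] by (auto simp: off0_def)
      ultimately show ?thesis using z[OF C1c_mult[OF D1]] by simp
    qed
    ultimately show ?thesis by (simp add: LIMSEQ_const_iff)
  qed
  \<comment> \<open>Boxes are stable under intersection, so complements and countable disjoint
    unions of them reach every Borel set.\<close>
  have all: "(\<integral>x. indicator E x * H x \<partial>lborel) = 0" if "E \<in> sets borel" for E
  proof -
    have E: "E \<in> sigma_sets UNIV (range (\<lambda>(a, b). box a b :: (real^3) set))"
      using that by (simp add: borel_eq_box)
    show ?thesis
    proof (induction rule: sigma_sets_induct_disjoint[OF _ _ E])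
      case 1
      show ?case by (auto simp: Int_stable_def box_Int_box)
    next
      case 2 show ?case by auto
    next
      case (3 A)
      then obtain a b where A: "A = box a b" by auto
      obtain B :: "real^3 \<Rightarrow> real" and DB where B: "C1 B DB" "{x. B x \<noteq> 0} = box a b" by (rule C1_box_bump[of a b])
      show ?case using bump[OF B(1)] unfolding B(2) A .
    next
      case 4 show ?case by simp
    next
      case (5 A)
      have Am: "A \<in> sets borel" using 5 by (simp add: borel_eq_box)
      \<comment> \<open>Complements need the integral over the whole space; the constant 1, taken as
        the bump, provides it.\<close>
      have "(\<integral>x. indicator {x::real^3. (1::real) \<noteq> 0} x * H x \<partial>lborel) = 0" by (rule bump[OF C1_const])
      then have u: "(\<integral>x. H x \<partial>lborel) = 0" by simp
      have "(\<integral>x. indicator (UNIV - A) x * H x \<partial>lborel) = (\<integral>x. H x - indicator A x * H x \<partial>lborel)"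
        by (rule Bochner_Integration.integral_cong) (auto simp: indicator_def)
      also have "\<dots> = 0"
        using H integrable_mult_indicator[OF _ H, of A] Am u 5 by simp
      finally show ?case .
    next
      case (6 A)
      have Am: "A i \<in> sets borel" for i using 6 by (auto simp: borel_eq_box)
      have "(\<integral>x\<in>(\<Union>i. A i). H x \<partial>lborel) = (\<Sum>i. \<integral>x\<in>A i. H x \<partial>lborel)"
      proof (rule lebesgue_integral_countable_add)
        show "A i \<inter> A j = {}" if "i \<noteq> j" for i j using 6 that by (auto simp: disjoint_family_on_def)
        show "set_integrable lborel (\<Union>i. A i) H"
          unfolding set_integrable_def using Am by (intro integrable_mult_indicator H) auto
      qed (use Am in auto)
      then show ?case using 6 by (simp add: set_lebesgue_integral_def)
    qed
  qed
  \<comment> \<open>Integrating over the set where \<open>s * H\<close> is positive shows that this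
    set is null, for either sign.\<close>
  have half: "AE x in lborel. s * H x \<le> 0" if s: "s = 1 \<or> s = -1" for s :: real
  proof -
    have Em: "{x. s * H x > 0} \<in> sets borel" using H by measurable
    let ?P = "\<lambda>x. indicator {x. s * H x > 0} x * (s * H x)"
    have i: "integrable lborel ?P"
      using integrable_mult_indicator[OF _ integrable_mult_right[OF H, of s], of "{x. s * H x > 0}"] Em by simp
    have "(\<integral>x. ?P x \<partial>lborel) = s * (\<integral>x. indicator {x. s * H x > 0} x * H x \<partial>lborel)"
      by (subst integral_mult_right_zero[symmetric]) (simp add: mult.left_commute)
    then have "(\<integral>x. ?P x \<partial>lborel) = 0" using all[OF Em] by simp
    moreover have "AE x in lborel. 0 \<le> ?P x" by (auto simp: indicator_def)
    ultimately have "AE x in lborel. ?P x = 0" using integral_nonneg_eq_0_iff_AE[OF i] by simp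
    then show ?thesis by eventually_elim (auto simp: indicator_def split: if_splits)
  qed
  show ?thesis using half[OF disjI1[OF refl]] half[OF disjI2[OF refl]]
    by eventually_elim (auto simp: H_def indicator_def split: if_splits)
qed

text \<open>Test fields vanishing near the origin still suffice, since the shells cover everything
  except a single point, which is a null set.\<close>

lemma fundamental_lemma:
  assumes F: "F \<in> L2"
    and z: "\<And>\<psi> D. C1c \<psi> D \<Longrightarrow> off0 \<psi> \<Longrightarrow> ip F \<psi> = 0"
  shows "AE x in lborel. F x = 0"
proof -
  have "AE x in lborel. \<forall>c\<in>Basis. \<forall>m. annulus_bump m x \<noteq> 0 \<longrightarrow> F x \<bullet> c = 0"
  proof (rule AE_finite_allI[OF finite_Basis], rule AE_all_countable[THEN iffD2], rule allI)
    fix c :: "complex^4" and m assume c: "c \<in> Basis"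
    obtain DA where DA: "C1 (annulus_bump m) DA" by (rule annulus_bump_C1)
    have [measurable]: "annulus_bump m \<in> borel_measurable borel" using C1_measurable[OF DA] by simp
    have "(\<lambda>x. indicator {x. annulus_bump m x \<noteq> 0} x *\<^sub>R c) \<in> L2"
      by (rule L2_bounded_support[where C="norm c" and R="Suc m"])
         (use annulus_bump_support[of m] in \<open>auto simp: indicator_def\<close>)
    from L2_integrable_inner[OF F this]
    have i: "integrable lborel (\<lambda>x. indicator {x. annulus_bump m x \<noteq> 0} x * (F x \<bullet> c))" by simp
    show "AE x in lborel. annulus_bump m x \<noteq> 0 \<longrightarrow> F x \<bullet> c = 0"
    proof (rule fundamental_lemma_real[OF i])
      show "(\<lambda>x. F x \<bullet> c) \<in> borel_measurable borel" using F by measurable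
      fix \<theta> :: "real^3 \<Rightarrow> real" and D assume t: "C1c \<theta> D" "off0 \<theta>"
      have "C1 (\<lambda>x. \<theta> x *\<^sub>R c) (\<lambda>k x. D k x *\<^sub>R c)"
        by (rule C1_linear_image[OF bounded_linear_scaleR_left C1c_C1[OF t(1)]])
      then have "C1c (\<lambda>x. \<theta> x *\<^sub>R c) (\<lambda>k x. D k x *\<^sub>R c)" using t(1) by (auto simp: C1c_def)
      from z[OF this] t(2) have "ip F (\<lambda>x. \<theta> x *\<^sub>R c) = 0" by (auto simp: off0_def)
      then show "(\<integral>x. \<theta> x * (F x \<bullet> c) \<partial>lborel) = 0" by (simp add: ip_def)
    qed
  qed
  moreover have "AE x in lborel. x \<noteq> (0::real^3)" by (rule AE_lborel_singleton)
  ultimately show ?thesis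
    by eventually_elim (metis annulus_exhaust euclidean_all_zero_iff)
qed

text \<open>The part of \<eta> orthogonal to all test fields is null by the fundamental lemma, so
  \<eta> coincides with its projection onto their closure.\<close>

lemma C1c_dense:
  assumes f: "\<eta> \<in> L2"
  shows "\<exists>t. (\<forall>n. \<exists>D. C1c (t n) D \<and> off0 (t n)) \<and> (\<lambda>n. L2_norm (\<lambda>x. t n x - \<eta> x)) \<longlonglongrightarrow> 0"
proof -
  define T :: "(real^3 \<Rightarrow> complex^4) set" where "T = {t. \<exists>D. C1c t D \<and> off0 t}"
  have "\<exists>t w. (\<forall>n. t n \<in> T) \<and> w \<in> L2 \<and> (\<lambda>n. L2_norm (\<lambda>x. t n x - w x)) \<longlonglongrightarrow> 0
           \<and> (\<forall>f\<in>T. ip (\<lambda>x. \<eta> x - w x) f = 0)"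
  proof (rule L2_projection[OF _ _ _ _ f])
    show "T \<subseteq> L2" by (auto simp: T_def C1c_L2)
    have "C1c (\<lambda>x::real^3. 0::complex^4) (\<lambda>k x. 0)" by (simp add: C1c_def C1_const)
    then show "(\<lambda>x. 0) \<in> T" by (auto simp: T_def off0_def intro!: exI[of _ 1])
    show "(\<lambda>x. f x + g x) \<in> T" if fg: "f \<in> T" "g \<in> T" for f g
    proof -
      obtain Df Dg where D: "C1c f Df" "C1c g Dg" "off0 f" "off0 g" using fg unfolding T_def by blast
      obtain R1 R2 where "\<And>x. norm x > R1 \<Longrightarrow> f x = 0" "\<And>x. norm x > R2 \<Longrightarrow> g x = 0"
        using D by (auto simp: C1c_def)
      then have "C1c (\<lambda>x. f x + g x) (\<lambda>k x. Df k x + Dg k x)"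
        using C1_add[OF C1c_C1[OF D(1)] C1c_C1[OF D(2)]] by (auto simp: C1c_def intro!: exI[of _ "max R1 R2"])
      moreover obtain d1 d2 where "d1 > 0" "\<And>x. norm x < d1 \<Longrightarrow> f x = 0" "d2 > 0" "\<And>x. norm x < d2 \<Longrightarrow> g x = 0"
        using D by (auto simp: off0_def)
      then have "off0 (\<lambda>x. f x + g x)" by (auto simp: off0_def intro!: exI[of _ "min d1 d2"])
      ultimately show ?thesis by (auto simp: T_def)
    qed
    show "(\<lambda>x. c *\<^sub>R f x) \<in> T" if fT: "f \<in> T" for f c
    proof -
      obtain Df where D: "C1c f Df" "off0 f" using fT unfolding T_def by blast
      then have "C1c (\<lambda>x. c *\<^sub>R f x) (\<lambda>k x. c *\<^sub>R Df k x)"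
        using C1_linear_image[OF bounded_linear_scaleR_right C1c_C1[OF D(1)]] by (auto simp: C1c_def)
      then show ?thesis using D by (auto simp: T_def off0_def)
    qed
  qed
  then obtain t w where t: "\<And>n. t n \<in> T" "w \<in> L2" "(\<lambda>n. L2_norm (\<lambda>x. t n x - w x)) \<longlonglongrightarrow> 0"
    "\<And>f. f \<in> T \<Longrightarrow> ip (\<lambda>x. \<eta> x - w x) f = 0" by blast
  have ae: "AE x in lborel. \<eta> x - w x = 0"
    by (rule fundamental_lemma[OF L2_diff[OF f t(2)]]) (use t(4) in \<open>auto simp: T_def\<close>)
  have "L2_norm (\<lambda>x. t n x - \<eta> x) = L2_norm (\<lambda>x. t n x - w x)" for n
  proof (rule L2_norm_cong_AE)
    have "t n \<in> L2" using t(1)[of n] by (auto simp: T_def C1c_L2)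
    then show "(\<lambda>x. t n x - \<eta> x) \<in> borel_measurable borel" "(\<lambda>x. t n x - w x) \<in> borel_measurable borel"
      using f t(2) by (auto intro!: L2_measurable L2_diff)
  qed (use ae in eventually_elim, simp)
  then show ?thesis using t(1,3) by (intro exI[of _ t]) (auto simp: T_def)
qed

subsection \<open>Mollification\<close>

text \<open>In the variable \<open>s = 1 / t\<close> one has \<open>ds/dt = - s * s\<close>, so
  differentiating \<open>p(s) * exp (- s)\<close> replaces \<open>p\<close> by
  \<open>s * s * (p - p')\<close>.\<close>

fun flatp :: "nat \<Rightarrow> real poly" where
  "flatp 0 = 1"
| "flatp (Suc n) = [:0, 0, 1:] * (flatp n - pderiv (flatp n))"

text \<open>The \<open>n\<close>-th derivative of \<open>t \<mapsto> exp (-1/t)\<close>, extended by 0 to \<open>t \<le> 0\<close>.\<close>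

definition flat :: "nat \<Rightarrow> real \<Rightarrow> real" where
  "flat n t = (if t > 0 then poly (flatp n) (1 / t) * exp (- (1 / t)) else 0)"

text \<open>The free power \<open>s ^ k\<close> carries the induction over the coefficients; the
  case \<open>k = 1\<close> is the one used, for a difference quotient at 0.\<close>

lemma poly_exp_decay: "((\<lambda>s. s ^ k * poly p s * exp (- s)) \<longlongrightarrow> (0::real)) at_top"
proof (induction p arbitrary: k)
  case 0
  then show ?case by simp
next
  case (pCons a p)
  have "((\<lambda>s. a * (s ^ k / exp s) + s ^ Suc k * poly p s * exp (- s)) \<longlongrightarrow> a * 0 + 0) at_top"
    by (intro tendsto_intros tendsto_power_div_exp_0 pCons.IH)
  then show ?case by (simp add: algebra_simps exp_minus divide_inverse)
qed

lemma flat_deriv: "(flat n has_real_derivative flat (Suc n) t) (at t)"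
proof -
  consider "t > 0" | "t < 0" | "t = 0" by linarith
  then show ?thesis
  proof cases
    case 1
    have d: "((\<lambda>t. 1 / t) has_real_derivative - ((1 / t)\<^sup>2)) (at t)"
      using 1 by (auto intro!: derivative_eq_intros simp: power2_eq_square)
    have "((\<lambda>t. poly (flatp n) (1 / t) * exp (- (1 / t))) has_real_derivative
        poly (flatp n) (1 / t) * (exp (- (1 / t)) * (1 / t)\<^sup>2)
        + poly (pderiv (flatp n)) (1 / t) * - ((1 / t)\<^sup>2) * exp (- (1 / t))) (at t)"
      by (rule DERIV_mult'[OF DERIV_chain2[OF poly_DERIV d]])
         (rule DERIV_cong[OF DERIV_chain2[OF DERIV_exp DERIV_minus[OF d]]], simp)
    also have "poly (flatp n) (1 / t) * (exp (- (1 / t)) * (1 / t)\<^sup>2)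
        + poly (pderiv (flatp n)) (1 / t) * - ((1 / t)\<^sup>2) * exp (- (1 / t)) = flat (Suc n) t"
      using 1 by (simp add: flat_def algebra_simps power2_eq_square del: divide_inverse)
    finally have "((\<lambda>t. poly (flatp n) (1 / t) * exp (- (1 / t))) has_real_derivative flat (Suc n) t) (at t)" .
    then show ?thesis
      by (rule has_field_derivative_transform_within_open[of _ _ _ "{0<..}"]) (use 1 in \<open>auto simp: flat_def\<close>)
  next
    case 2
    have "((\<lambda>t. 0) has_real_derivative flat (Suc n) t) (at t)" using 2 by (simp add: flat_def)
    then show ?thesis
      by (rule has_field_derivative_transform_within_open[of _ _ _ "{..<0}"]) (use 2 in \<open>auto simp: flat_def\<close>)
  next
    case 3
    \<comment> \<open>With \<open>s = 1 / h\<close> the quotient is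
      \<open>s * poly (flatp n) s * exp (- s)\<close>, and \<open>s\<close> tends to
      infinity.\<close>
    have "((\<lambda>h. flat n h / h) \<longlongrightarrow> 0) (at_right 0)"
    proof (rule Lim_transform_eventually)
      show "((\<lambda>h. inverse h ^ 1 * poly (flatp n) (inverse h) * exp (- inverse h)) \<longlongrightarrow> 0) (at_right (0::real))"
        by (rule filterlim_compose[OF poly_exp_decay filterlim_inverse_at_top_right])
      show "\<forall>\<^sub>F h in at_right 0. inverse h ^ 1 * poly (flatp n) (inverse h) * exp (- inverse h) = flat n h / h"
        unfolding eventually_at_right_field by (intro exI[of _ 1]) (auto simp: flat_def divide_inverse mult_ac)
    qed
    moreover have "((\<lambda>h. flat n h / h) \<longlongrightarrow> 0) (at_left 0)"
    proof (rule Lim_transform_eventually[OF tendsto_const])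
      show "\<forall>\<^sub>F h in at_left 0. 0 = flat n h / h"
        unfolding eventually_at_left_field by (intro exI[of _ "-1"]) (auto simp: flat_def)
    qed
    ultimately have "((\<lambda>h. flat n h / h) \<longlongrightarrow> 0) (at 0)" by (rule filterlim_split_at_real[rotated])
    then show ?thesis using 3 by (simp add: DERIV_def) (simp add: flat_def)
  qed
qed

lemma flat_cont: "continuous_on S (flat n)"
  by (rule continuous_at_imp_continuous_on) (blast intro: DERIV_isCont flat_deriv)

lemma CkSucI:
  assumes "\<And>x. (F has_derivative (\<lambda>h. \<Sum>k\<in>UNIV. h$k *\<^sub>R D k x)) (at x)" "\<And>j. Ck k (D j)"
  shows "Ck (Suc k) F"
proof -
  have "partial_deriv j F = D j" for j by (rule ext) (rule partial_deriv_eq[OF assms(1)])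
  then show ?thesis using assms by (auto simp: differentiable_def)
qed

lemma differentiable_sum_form:
  assumes "(F :: real^3 \<Rightarrow> real) differentiable (at x)"
  shows "(F has_derivative (\<lambda>h. \<Sum>k\<in>UNIV. h$k *\<^sub>R partial_deriv k F x)) (at x)"
proof -
  have d: "(F has_derivative frechet_derivative F (at x)) (at x)"
    using assms frechet_derivative_works by blast
  interpret l: linear "frechet_derivative F (at x)" using d by (rule has_derivative_linear)
  have "frechet_derivative F (at x) h = (\<Sum>k\<in>UNIV. h$k *\<^sub>R partial_deriv k F x)" for h
  proof -
    have "h = (\<Sum>k\<in>UNIV. h$k *\<^sub>R axis k 1)"
      unfolding scalar_mult_eq_scaleR[symmetric] by (rule basis_expansion[symmetric])
    from arg_cong[OF this, of "frechet_derivative F (at x)"] show ?thesis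
      by (simp only: l.sum l.scale partial_deriv_def)
  qed
  then have "frechet_derivative F (at x) = (\<lambda>h. \<Sum>k\<in>UNIV. h$k *\<^sub>R partial_deriv k F x)" by (rule ext)
  then show ?thesis using d by simp
qed

lemma Ck_C1: "Ck (Suc k) F \<Longrightarrow> Ck 0 F \<and> (\<forall>j. Ck 0 (partial_deriv j F)) "
proof -
  have c: "Ck k F \<Longrightarrow> Ck 0 F" for k and F :: "real^3 \<Rightarrow> real"
    by (cases k) (auto intro!: differentiable_imp_continuous_on simp: differentiable_on_def intro: differentiable_at_withinI)
  assume "Ck (Suc k) F"
  then show ?thesis using c[of "Suc k" F] c[of k] by auto
qed

lemma Ck_mono: "Ck (Suc k) F \<Longrightarrow> Ck k F"
proof (induction k arbitrary: F)
  case 0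
  then show ?case using Ck_C1[of 0 F] by blast
qed simp

lemma Ck_const: "Ck k (\<lambda>x. c)"
proof (induction k arbitrary: c)
  case (Suc k)
  show ?case by (rule CkSucI[where D="\<lambda>j x. 0"]) (use Suc in simp_all)
qed simp

lemma Ck_add: "Ck k F \<Longrightarrow> Ck k G \<Longrightarrow> Ck k (\<lambda>x. F x + G x)"
proof (induction k arbitrary: F G)
  case (Suc k)
  show ?case
  proof (rule CkSucI[where D="\<lambda>j x. partial_deriv j F x + partial_deriv j G x"])
    show "((\<lambda>x. F x + G x) has_derivative (\<lambda>h. \<Sum>k\<in>UNIV. h $ k *\<^sub>R (partial_deriv k F x + partial_deriv k G x))) (at x)" for x
      using Suc.prems differentiable_sum_form[of F x] differentiable_sum_form[of G x]
      by (auto intro!: has_derivative_eq_rhs[OF has_derivative_add] simp: distrib_left sum.distrib)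
  qed (use Suc in auto)
qed (auto intro: continuous_intros)

lemma Ck_mult: "Ck k F \<Longrightarrow> Ck k G \<Longrightarrow> Ck k (\<lambda>x. F x * G x)"
proof (induction k arbitrary: F G)
  case (Suc k)
  show ?case
  proof (rule CkSucI[where D="\<lambda>j x. F x * partial_deriv j G x + partial_deriv j F x * G x"])
    show "((\<lambda>x. F x * G x) has_derivative
        (\<lambda>h. \<Sum>k\<in>UNIV. h $ k *\<^sub>R (F x * partial_deriv k G x + partial_deriv k F x * G x))) (at x)" for x
      using Suc.prems differentiable_sum_form[of F x] differentiable_sum_form[of G x]
      by (auto intro!: has_derivative_eq_rhs[OF has_derivative_mult]
          simp: distrib_left sum.distrib sum_distrib_left sum_distrib_right mult_ac fun_eq_iff)
  qed (use Suc Ck_mono[OF Suc.prems(1)] Ck_mono[OF Suc.prems(2)] in \<open>auto intro!: Ck_add\<close>)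
qed (auto intro: continuous_intros)

lemma Ck_component_diff: "Ck k (\<lambda>y. c * (x $ j - y $ j))"
proof (cases k)
  case (Suc k')
  show ?thesis unfolding Suc
  proof (rule CkSucI[where D="\<lambda>i y. - c * (if i = j then 1 else 0)"])
    fix y :: "real^3"
    have "((\<lambda>y. c * (x $ j - y $ j)) has_derivative (\<lambda>h. c * (0 - h $ j))) (at y)"
      by (intro has_derivative_mult_right has_derivative_diff has_derivative_const
          bounded_linear.has_derivative[OF bounded_linear_vec_nth] has_derivative_ident)
    then show "((\<lambda>y. c * (x $ j - y $ j)) has_derivative (\<lambda>h. \<Sum>k\<in>UNIV. h $ k *\<^sub>R (- c * (if k = j then 1 else 0)))) (at y)"
      by (rule has_derivative_eq_rhs) (auto simp: fun_eq_iff vec_eq_sum_axis[of _ j] sum_distrib_left sum_negf[symmetric] intro!: sum.cong)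
  qed (rule Ck_const)
qed (auto intro!: continuous_intros)

lemma flat_ball_deriv:
  "((\<lambda>y. flat n (c - (norm (x - y))\<^sup>2)) has_derivative
     (\<lambda>h. \<Sum>k\<in>UNIV. h $ k *\<^sub>R (2 * (x $ k - y $ k) * flat (Suc n) (c - (norm (x - y))\<^sup>2)))) (at (y :: real^3))"
proof -
  have "((\<lambda>y. c - (x - y) \<bullet> (x - y)) has_derivative (\<lambda>h. 0 - ((x - y) \<bullet> (0 - h) + (0 - h) \<bullet> (x - y)))) (at y)"
    by (intro has_derivative_diff has_derivative_const has_derivative_inner has_derivative_ident)
  then have "((\<lambda>y. c - (norm (x - y))\<^sup>2) has_derivative (\<lambda>h. 2 * ((x - y) \<bullet> h))) (at y)"
    unfolding power2_norm_eq_inner by (rule has_derivative_eq_rhs) (simp add: fun_eq_iff inner_commute)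
  from has_derivative_compose[OF this flat_deriv[unfolded has_field_derivative_def]] show ?thesis
    by (rule has_derivative_eq_rhs)
       (auto simp: fun_eq_iff inner_vec_def sum_distrib_left intro!: sum.cong)
qed

text \<open>The induction runs over \<open>k\<close> for all \<open>n\<close> together, because a
  derivative turns \<open>flat n\<close> into \<open>flat (Suc n)\<close> times a linear
  factor.\<close>

lemma Ck_flat_ball: "Ck k (\<lambda>y. flat n (c - (norm (x - y))\<^sup>2))"
proof (induction k arbitrary: n)
  case 0
  show ?case by (auto intro!: continuous_on_compose2[OF flat_cont[of UNIV]] continuous_intros)
next
  case (Suc k)
  show ?case
    by (rule CkSucI[OF flat_ball_deriv]) (intro Ck_mult Suc Ck_component_diff)
qed

text \<open>Smooth and not merely C1, since the reflected translates of the mollifier have to be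
  test functions in the sense of the weak derivative.\<close>

definition bump :: "nat \<Rightarrow> real^3 \<Rightarrow> real" where
  "bump n y = flat 0 ((1 / Suc n)\<^sup>2 - (norm y)\<^sup>2)"

definition mass :: "nat \<Rightarrow> real" where "mass n = (\<integral>y. bump n y \<partial>lborel)"

definition mol :: "nat \<Rightarrow> real^3 \<Rightarrow> real" where "mol n y = bump n y / mass n"

definition dmol :: "nat \<Rightarrow> 3 \<Rightarrow> real^3 \<Rightarrow> real" where
  "dmol n k y = (- 2 * y $ k) * flat 1 ((1 / Suc n)\<^sup>2 - (norm y)\<^sup>2) / mass n"

lemma bump_nonneg: "bump n y \<ge> 0" and bump_zero: "norm y \<ge> 1 / Suc n \<Longrightarrow> bump n y = 0"
proof -
  show "bump n y \<ge> 0" by (auto simp: bump_def flat_def)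
  assume "norm y \<ge> 1 / Suc n"
  then have "(1 / Suc n)\<^sup>2 \<le> (norm y)\<^sup>2" by (intro power_mono) auto
  then have "\<not> 0 < (1 / Suc n)\<^sup>2 - (norm y)\<^sup>2" by linarith
  then show "bump n y = 0" by (simp only: bump_def flat_def if_False)
qed

lemma bump_cont: "continuous_on UNIV (bump n)"
  unfolding bump_def[abs_def] by (intro continuous_on_compose2[OF flat_cont[of UNIV]] continuous_intros) auto

lemma bump_integrable: "integrable lborel (bump n)"
  by (rule compact_support_integrable[OF bump_cont, of "1 / Suc n"]) (use bump_zero in auto)

lemma mass_pos: "mass n > 0"
proof -
  have "mass n \<noteq> 0"
  proof
    assume "mass n = 0"
    then have "AE y in lborel. bump n y = 0"
      using integral_nonneg_eq_0_iff_AE[OF bump_integrable] bump_nonneg unfolding mass_def by auto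
    then have "AE y in lborel. y \<notin> ball (0::real^3) (1 / Suc n)"
    proof eventually_elim
      case (elim y)
      show ?case
      proof
        assume "y \<in> ball 0 (1 / Suc n)"
        then have "(norm y)\<^sup>2 < (1 / Suc n)\<^sup>2" by (intro power_strict_mono) (auto simp: dist_norm)
        then show False using elim by (simp add: bump_def flat_def)
      qed
    qed
    then have "ball (0::real^3) (1 / Suc n) \<in> null_sets lborel"
      by (subst (asm) AE_iff_null_sets[symmetric]) auto
    then have "measure lborel (ball (0::real^3) (1 / Suc n)) = 0" by (auto simp: measure_def)
    then show False using content_ball_pos[of "1 / Suc n" "0::real^3"] by simp
  qed
  moreover have "mass n \<ge> 0" unfolding mass_def by (intro Bochner_Integration.integral_nonneg bump_nonneg)
  ultimately show ?thesis by simp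
qed

lemma mol_C1c: "C1c (mol n) (dmol n)"
proof -
  have "((\<lambda>y. inverse (mass n) * bump n y) has_derivative
      (\<lambda>h. inverse (mass n) * (\<Sum>k\<in>UNIV. h $ k *\<^sub>R (2 * (0 $ k - y $ k) * flat (Suc 0) ((1 / Suc n)\<^sup>2 - (norm (0 - y))\<^sup>2))))) (at y)" for y
    unfolding bump_def[abs_def] using flat_ball_deriv[of 0 "(1 / Suc n)\<^sup>2" 0 y]
    by (intro has_derivative_mult_right) simp
  moreover have "inverse (mass n) * (\<Sum>k\<in>UNIV. h $ k *\<^sub>R (2 * (0 $ k - y $ k) * flat (Suc 0) ((1 / Suc n)\<^sup>2 - (norm (0 - y))\<^sup>2)))
      = (\<Sum>k\<in>UNIV. h $ k *\<^sub>R dmol n k y)" for h y :: "real^3"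
    unfolding sum_distrib_left by (rule sum.cong) (simp_all add: dmol_def divide_inverse)
  ultimately have "((\<lambda>y. inverse (mass n) * bump n y) has_derivative (\<lambda>h. \<Sum>k\<in>UNIV. h $ k *\<^sub>R dmol n k y)) (at y)" for y
    by (simp only:)
  moreover have "(\<lambda>y. inverse (mass n) * bump n y) = mol n"
    by (simp add: fun_eq_iff mol_def divide_inverse)
  ultimately have "(mol n has_derivative (\<lambda>h. \<Sum>k\<in>UNIV. h $ k *\<^sub>R dmol n k y)) (at y)" for y by simp
  moreover have "continuous_on UNIV (dmol n k)" for k
    unfolding dmol_def[abs_def] using mass_pos[of n]
    by (intro continuous_intros continuous_on_compose2[OF flat_cont[of UNIV]]) auto
  ultimately show ?thesis unfolding C1c_def C1_def
    using bump_zero[of n] by (auto simp: mol_def intro!: exI[of _ "1 / Suc n"])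
qed

lemma mol_simps: "mol n (- y) = mol n y" "dmol n k (- y) = - dmol n k y" "mol n y \<ge> 0"
  "norm y \<ge> 1 / Suc n \<Longrightarrow> mol n y = 0" "(\<integral>y. mol n y \<partial>lborel) = 1"
  using bump_nonneg[of n y] bump_zero[of n y] mass_pos[of n]
  by (auto simp: mol_def dmol_def bump_def mass_def)

lemma mol_test_deriv:
  "((\<lambda>y. mol n (x - y)) has_derivative (\<lambda>h. \<Sum>k\<in>UNIV. h $ k *\<^sub>R - dmol n k (x - y))) (at y)"
proof -
  have "((\<lambda>y. mol n (x - y)) has_derivative (\<lambda>h. \<Sum>k\<in>UNIV. (0 - h) $ k *\<^sub>R dmol n k (x - y))) (at y)"
    by (rule has_derivative_compose[OF _ C1_has_derivative[OF C1c_C1[OF mol_C1c]]])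
       (intro has_derivative_diff has_derivative_const has_derivative_ident)
  then show ?thesis by (rule has_derivative_eq_rhs) (auto simp: fun_eq_iff)
qed

lemma mol_test_function: "test_function (\<lambda>y. mol n (x - y))"
  unfolding test_function_def
proof
  have "Ck k (\<lambda>y. inverse (mass n) * flat 0 ((1 / Suc n)\<^sup>2 - (norm (x - y))\<^sup>2))" for k
    by (intro Ck_mult Ck_const Ck_flat_ball)
  then show "\<forall>k. Ck k (\<lambda>y. mol n (x - y))" by (simp add: mol_def bump_def divide_inverse mult.commute)
  have "{y. mol n (x - y) \<noteq> 0} \<subseteq> cball x (1 / Suc n)"
    using mol_simps(4)[of n] by (auto simp: dist_norm) (metis linear)
  then show "compact (closure {y. mol n (x - y) \<noteq> 0})"
    by (meson bounded_cball bounded_subset compact_closure)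
qed

lemma mol_test_partial: "partial_deriv k (\<lambda>y. mol n (x - y)) y = - dmol n k (x - y)"
  by (rule partial_deriv_eq[OF mol_test_deriv])

lemma test_function_C1c:
  assumes t: "test_function \<eta>"
  shows "C1c \<eta> (\<lambda>k. partial_deriv k \<eta>)"
proof -
  have C: "Ck (Suc 0) \<eta>" using t unfolding test_function_def by blast
  have "bounded (closure {x. \<eta> x \<noteq> 0})" using t compact_imp_bounded unfolding test_function_def by blast
  then obtain R where R: "\<And>x. x \<in> closure {x. \<eta> x \<noteq> 0} \<Longrightarrow> norm x \<le> R" unfolding bounded_iff by blast
  have "\<eta> x = 0" if "norm x > R" for x
    using R[of x] closure_subset[of "{x. \<eta> x \<noteq> 0}"] that by force
  moreover have "C1 \<eta> (\<lambda>k. partial_deriv k \<eta>)"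
    unfolding C1_def using C differentiable_sum_form by auto
  ultimately show ?thesis unfolding C1c_def by blast
qed

section \<open>Convolution of square-integrable fields with compactly supported kernels\<close>

definition cs :: "(real^3 \<Rightarrow> real) \<Rightarrow> bool" where
  "cs \<phi> \<longleftrightarrow> continuous_on UNIV \<phi> \<and> (\<exists>R. \<forall>x. norm x > R \<longrightarrow> \<phi> x = 0)"

definition conv :: "(real^3 \<Rightarrow> real) \<Rightarrow> (real^3 \<Rightarrow> complex^4) \<Rightarrow> real^3 \<Rightarrow> complex^4" where
  "conv \<phi> f x = (\<integral>y. \<phi> y *\<^sub>R f (x - y) \<partial>lborel)"

lemma cs_mol: "cs (mol n)" "cs (dmol n k)"
  using C1_continuous[OF C1c_C1[OF mol_C1c]] C1c_support[OF mol_C1c] unfolding cs_def by metis+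

lemma cs_diff: "cs f \<Longrightarrow> cs g \<Longrightarrow> cs (\<lambda>x. f x - g x)"
proof -
  assume f: "cs f" and g: "cs g"
  obtain R1 R2 where "\<And>x. norm x > R1 \<Longrightarrow> f x = 0" "\<And>x. norm x > R2 \<Longrightarrow> g x = 0"
    using f g unfolding cs_def by blast
  then show ?thesis using f g unfolding cs_def
    by (auto intro!: continuous_intros exI[of _ "max R1 R2"])
qed

lemma cs_measurable: "cs \<phi> \<Longrightarrow> \<phi> \<in> borel_measurable borel"
  by (simp add: cs_def borel_measurable_continuous_onI)

lemma cs_integrable: "cs \<phi> \<Longrightarrow> integrable lborel \<phi>"
  unfolding cs_def using compact_support_integrable by blast

lemma cs_scaleR_L2: "cs \<phi> \<Longrightarrow> (\<lambda>y. \<phi> y *\<^sub>R c) \<in> L2"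
proof -
  assume a: "cs \<phi>"
  then obtain R where "\<And>x. norm x > R \<Longrightarrow> \<phi> x = 0" unfolding cs_def by blast
  moreover have "continuous_on UNIV (\<lambda>y. \<phi> y *\<^sub>R c)" using a unfolding cs_def by (intro continuous_intros) auto
  ultimately show ?thesis by (intro compact_support_L2[of _ R]) auto
qed

lemma lborel_distr_reflect: "distr lborel borel (\<lambda>y. x - y) = (lborel :: (real^3) measure)"
proof -
  have "(lborel :: (real^3) measure) = density (distr lborel borel (\<lambda>y. x - y)) (\<lambda>_. 1)"
    using lborel_affine[of "-1" x] by simp
  then show ?thesis by (simp add: density_1)
qed

lemma lborel_integral_reflect:
  fixes f :: "real^3 \<Rightarrow> 'b::euclidean_space"
  assumes [measurable]: "f \<in> borel_measurable borel"
  shows "(\<integral>y. f (x - y) \<partial>lborel) = (\<integral>y. f y \<partial>lborel)"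
proof -
  have "(\<integral>y. f y \<partial>lborel) = (\<integral>y. f y \<partial>distr lborel borel (\<lambda>y. x - y))" by (simp add: lborel_distr_reflect)
  also have "\<dots> = (\<integral>y. f (x - y) \<partial>lborel)" by (rule integral_distr) auto
  finally show ?thesis by simp
qed

lemma L2_reflect: "f \<in> L2 \<Longrightarrow> (\<lambda>y. f (x - y)) \<in> L2"
proof -
  assume f: "f \<in> L2"
  have [measurable]: "f \<in> borel_measurable borel" using f by measurable
  have "integrable (distr lborel borel (\<lambda>y. x - y)) (\<lambda>y. (norm (f y))\<^sup>2)"
    using L2_integrable[OF f] by (simp add: lborel_distr_reflect)
  then have "integrable lborel (\<lambda>y. (norm (f (x - y)))\<^sup>2)" by (subst (asm) integrable_distr_eq) auto
  then show ?thesis by (simp add: L2_def)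
qed

lemma L2_translate: "f \<in> L2 \<Longrightarrow> (\<lambda>x. f (x - y)) \<in> L2"
  using L2_reflect[OF L2_reflect[of f 0], of y] by simp

lemma ip_translate:
  assumes f: "f \<in> L2" and g: "g \<in> L2"
  shows "ip (\<lambda>x. f (x - y)) (\<lambda>x. g (x - z)) = ip (\<lambda>x. f (x - (y - z))) g"
proof -
  have [measurable]: "f \<in> borel_measurable borel" "g \<in> borel_measurable borel" using f g by measurable
  have "ip (\<lambda>x. f (x - (y - z))) g = (\<integral>x. f ((- z + x) - (y - z)) \<bullet> g (- z + x) \<partial>lborel)"
    unfolding ip_def by (rule lborel_integral_translate[symmetric]) measurable
  then show ?thesis by (simp add: ip_def algebra_simps)
qed

lemma ip_translate_bound:
  assumes f: "f \<in> L2" and g: "g \<in> L2"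
  shows "\<bar>ip (\<lambda>x. f (x - y)) g\<bar> \<le> L2_norm f * L2_norm g"
proof -
  have "ip (\<lambda>x. f (x - y)) (\<lambda>x. f (x - y)) = ip f f"
    using ip_translate[OF f f, of y y] by simp
  then have "L2_norm (\<lambda>x. f (x - y)) = L2_norm f" by (simp add: L2_norm_eq)
  then show ?thesis using ip_Cauchy_Schwarz[OF L2_translate[OF f] g, of y] by simp
qed

lemma conv_integrable:
  assumes \<phi>: "cs \<phi>" and f: "f \<in> L2"
  shows "integrable lborel (\<lambda>y. \<phi> y *\<^sub>R f (x - y))"
proof (rule Bochner_Integration.integrable_bound)
  have [measurable]: "f \<in> borel_measurable borel" "\<phi> \<in> borel_measurable borel"
    using f cs_measurable[OF \<phi>] by auto
  show "(\<lambda>y. \<phi> y *\<^sub>R f (x - y)) \<in> borel_measurable lborel" by measurable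
  show "integrable lborel (\<lambda>y. norm (\<phi> y *\<^sub>R axis (1::4) (1::complex)) * norm (f (x - y)))"
    by (rule L2_integrable_mult[OF cs_scaleR_L2[OF \<phi>] L2_reflect[OF f]])
qed auto

lemma conv_measurable [measurable]:
  assumes \<phi>: "\<phi> \<in> borel_measurable borel" and f: "f \<in> borel_measurable borel"
  shows "conv \<phi> f \<in> borel_measurable borel"
proof -
  note [measurable] = assms
  have "(\<lambda>x. \<integral>y. \<phi> y *\<^sub>R f (x - y) \<partial>lborel) \<in> borel_measurable lborel"
    by (rule lborel.borel_measurable_lebesgue_integral) measurable
  then show ?thesis by (simp add: conv_def[abs_def])
qed

lemma nn_norm_translate:
  assumes f: "f \<in> L2"
  shows "(\<integral>\<^sup>+x. ennreal ((norm (f (x - y)))\<^sup>2) \<partial>lborel) = ennreal ((L2_norm f)\<^sup>2)"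
proof -
  have [measurable]: "f \<in> borel_measurable borel" using f by measurable
  show ?thesis using nn_integral_translate[of "\<lambda>x. ennreal ((norm (f x))\<^sup>2)" "- y"] L2_norm_nn[OF f] by simp
qed

text \<open>The Cauchy-Schwarz inequality with weight \<open>\<bar>\<phi>\<bar>\<close>.\<close>

lemma conv_L2:
  assumes \<phi>: "cs \<phi>" and f: "f \<in> L2"
  shows "conv \<phi> f \<in> L2" "L2_norm (conv \<phi> f) \<le> (\<integral>y. \<bar>\<phi> y\<bar> \<partial>lborel) * L2_norm f"
proof -
  have [measurable]: "f \<in> borel_measurable borel" "\<phi> \<in> borel_measurable borel"
    using f cs_measurable[OF \<phi>] by auto
  define A where "A = (\<integral>y. \<bar>\<phi> y\<bar> \<partial>lborel)"
  have A0: "A \<ge> 0" by (simp add: A_def)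
  have nA: "(\<integral>\<^sup>+y. ennreal \<bar>\<phi> y\<bar> \<partial>lborel) = ennreal A"
    unfolding A_def using cs_integrable[OF \<phi>] by (intro nn_integral_eq_integral) auto
  have pt: "ennreal ((norm (conv \<phi> f x))\<^sup>2) \<le> ennreal A * (\<integral>\<^sup>+y. ennreal (\<bar>\<phi> y\<bar> * (norm (f (x - y)))\<^sup>2) \<partial>lborel)" for x
  proof -
    have "ennreal (norm (conv \<phi> f x)) \<le> (\<integral>\<^sup>+y. ennreal (norm (\<phi> y *\<^sub>R f (x - y))) \<partial>lborel)"
      unfolding conv_def by (rule integral_norm_bound_ennreal[OF conv_integrable[OF \<phi> f]])
    also have "\<dots> = (\<integral>\<^sup>+y. ennreal (sqrt \<bar>\<phi> y\<bar>) * ennreal (sqrt \<bar>\<phi> y\<bar> * norm (f (x - y))) \<partial>lborel)"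
      by (rule nn_integral_cong) (simp add: ennreal_mult[symmetric] mult.assoc[symmetric])
    finally have "(ennreal (norm (conv \<phi> f x)))\<^sup>2
        \<le> (\<integral>\<^sup>+y. ennreal (sqrt \<bar>\<phi> y\<bar>) * ennreal (sqrt \<bar>\<phi> y\<bar> * norm (f (x - y))) \<partial>lborel)\<^sup>2"
      by (rule power_mono) simp
    also have "\<dots> \<le> (\<integral>\<^sup>+y. (ennreal (sqrt \<bar>\<phi> y\<bar>))\<^sup>2 \<partial>lborel) * (\<integral>\<^sup>+y. (ennreal (sqrt \<bar>\<phi> y\<bar> * norm (f (x - y))))\<^sup>2 \<partial>lborel)"
      by (rule Cauchy_Schwarz_nn_integral) auto
    also have "(\<integral>\<^sup>+y. (ennreal (sqrt \<bar>\<phi> y\<bar>))\<^sup>2 \<partial>lborel) = ennreal A"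
      unfolding nA[symmetric] by (rule nn_integral_cong) (simp add: ennreal_power)
    finally show ?thesis by (simp add: ennreal_power power_mult_distrib)
  qed
  have "(\<integral>\<^sup>+x. ennreal ((norm (conv \<phi> f x))\<^sup>2) \<partial>lborel)
      \<le> (\<integral>\<^sup>+x. ennreal A * (\<integral>\<^sup>+y. ennreal (\<bar>\<phi> y\<bar> * (norm (f (x - y)))\<^sup>2) \<partial>lborel) \<partial>lborel)"
    by (rule nn_integral_mono[OF pt])
  also have "\<dots> = ennreal A * (\<integral>\<^sup>+x. \<integral>\<^sup>+y. ennreal (\<bar>\<phi> y\<bar> * (norm (f (x - y)))\<^sup>2) \<partial>lborel \<partial>lborel)"
    by (rule nn_integral_cmult) measurable
  also have "(\<integral>\<^sup>+x. \<integral>\<^sup>+y. ennreal (\<bar>\<phi> y\<bar> * (norm (f (x - y)))\<^sup>2) \<partial>lborel \<partial>lborel)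
      = (\<integral>\<^sup>+y. \<integral>\<^sup>+x. ennreal (\<bar>\<phi> y\<bar> * (norm (f (x - y)))\<^sup>2) \<partial>lborel \<partial>lborel)"
    by (rule lborel_pair.Fubini') measurable
  also have "\<dots> = (\<integral>\<^sup>+y. ennreal \<bar>\<phi> y\<bar> * ennreal ((L2_norm f)\<^sup>2) \<partial>lborel)"
    by (rule nn_integral_cong) (simp add: ennreal_mult nn_integral_cmult nn_norm_translate[OF f])
  also have "\<dots> = ennreal A * ennreal ((L2_norm f)\<^sup>2)"
    by (simp add: nn_integral_multc nA)
  finally have le: "(\<integral>\<^sup>+x. ennreal ((norm (conv \<phi> f x))\<^sup>2) \<partial>lborel) \<le> ennreal ((A * L2_norm f)\<^sup>2)"
    using A0 by (simp add: ennreal_mult[symmetric] power_mult_distrib power2_eq_square mult_ac)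
  have m: "conv \<phi> f \<in> borel_measurable borel" by measurable
  show "conv \<phi> f \<in> L2" "L2_norm (conv \<phi> f) \<le> (\<integral>y. \<bar>\<phi> y\<bar> \<partial>lborel) * L2_norm f"
    using L2_if_nn[OF m le] A0 by (simp_all add: A_def)
qed

text \<open>Fubini's theorem: a convolution is an average of translates. This reduces the adjoint
  and the commutation of convolutions to the translation invariance of \<open>ip\<close>.\<close>

lemma ip_conv:
  assumes \<phi>: "cs \<phi>" and f: "f \<in> L2" and g: "g \<in> L2"
  shows "ip (conv \<phi> f) g = (\<integral>y. \<phi> y * ip (\<lambda>x. f (x - y)) g \<partial>lborel)"
proof -
  have [measurable]: "f \<in> borel_measurable borel" "\<phi> \<in> borel_measurable borel" "g \<in> borel_measurable borel"
    using f g cs_measurable[OF \<phi>] by auto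
  let ?k = "\<lambda>(y, x). \<phi> y * (f (x - y) \<bullet> g x)"
  have int: "integrable (lborel \<Otimes>\<^sub>M lborel) ?k"
  proof (rule lborel_pair.Fubini_integrable)
    show "?k \<in> borel_measurable (lborel \<Otimes>\<^sub>M lborel)" by measurable
    show "AE y in lborel. integrable lborel (\<lambda>x. ?k (y, x))"
      using L2_integrable_inner[OF L2_translate[OF f] g] by auto
    show "integrable lborel (\<lambda>y. \<integral>x. norm (?k (y, x)) \<partial>lborel)"
    proof (rule Bochner_Integration.integrable_bound)
      show "integrable lborel (\<lambda>y. \<phi> y * (L2_norm f * L2_norm g))" using cs_integrable[OF \<phi>] by simp
      show "(\<lambda>y. \<integral>x. norm (?k (y, x)) \<partial>lborel) \<in> borel_measurable lborel" by measurable
      show "AE y in lborel. norm (\<integral>x. norm (?k (y, x)) \<partial>lborel) \<le> norm (\<phi> y * (L2_norm f * L2_norm g))"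
      proof (rule AE_I2)
        fix y
        \<comment> \<open>Moving the sign into the second factor turns the integral of the absolute
          value into an inner product, to which the bound for translates applies.\<close>
        define h where "h x = sgn (f (x - y) \<bullet> g x) *\<^sub>R g x" for x
        have hL: "h \<in> L2"
        proof (rule L2_bound[OF _ g, of _ 1])
          show "h \<in> borel_measurable borel" unfolding h_def[abs_def] by measurable
          show "AE x in lborel. norm (h x) \<le> 1 * norm (g x)"
            by (rule AE_I2) (auto simp: h_def sgn_real_def)
        qed
        have "L2_norm h \<le> L2_norm g"
          by (rule L2_norm_mono_AE[OF hL g], rule AE_I2) (auto simp: h_def sgn_real_def)
        have "(\<integral>x. \<bar>f (x - y) \<bullet> g x\<bar> \<partial>lborel) = ip (\<lambda>x. f (x - y)) h"
          unfolding ip_def h_def by (simp add: abs_sgn mult.commute)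
        also have "\<dots> \<le> L2_norm f * L2_norm h" using ip_translate_bound[OF f hL, of y] by simp
        also have "\<dots> \<le> L2_norm f * L2_norm g" by (intro mult_left_mono \<open>L2_norm h \<le> _\<close>) simp
        finally have "\<bar>\<phi> y\<bar> * (\<integral>x. \<bar>f (x - y) \<bullet> g x\<bar> \<partial>lborel) \<le> \<bar>\<phi> y\<bar> * (L2_norm f * L2_norm g)"
          by (intro mult_left_mono) auto
        then show "norm (\<integral>x. norm (?k (y, x)) \<partial>lborel) \<le> norm (\<phi> y * (L2_norm f * L2_norm g))"
          by (simp add: abs_mult)
      qed
    qed
  qed
  have "ip (conv \<phi> f) g = (\<integral>x. (\<integral>y. \<phi> y * (f (x - y) \<bullet> g x) \<partial>lborel) \<partial>lborel)"
    unfolding ip_def conv_def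
  proof (rule Bochner_Integration.integral_cong)
    fix x
    have "(\<integral>y. \<phi> y *\<^sub>R f (x - y) \<partial>lborel) \<bullet> g x = (\<integral>y. (\<phi> y *\<^sub>R f (x - y)) \<bullet> g x \<partial>lborel)"
      by (rule integral_inner_left[symmetric]) (rule conv_integrable[OF \<phi> f])
    then show "(\<integral>y. \<phi> y *\<^sub>R f (x - y) \<partial>lborel) \<bullet> g x = (\<integral>y. \<phi> y * (f (x - y) \<bullet> g x) \<partial>lborel)" by simp
  qed simp
  also have "\<dots> = (\<integral>y. (\<integral>x. \<phi> y * (f (x - y) \<bullet> g x) \<partial>lborel) \<partial>lborel)"
    by (rule lborel_pair.Fubini_integral) (rule int)
  finally show ?thesis by (simp add: ip_def)
qed

text \<open>The sign \<open>s\<close> treats the even mollifiers (\<open>s = 1\<close>) and their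
  odd derivatives (\<open>s = -1\<close>) at once.\<close>

lemma conv_adjoint:
  assumes \<phi>: "cs \<phi>" and f: "f \<in> L2" and g: "g \<in> L2" and odd: "\<And>y. \<phi> (- y) = s * \<phi> y"
  shows "ip (conv \<phi> f) g = s * ip f (conv \<phi> g)"
proof -
  have [measurable]: "f \<in> borel_measurable borel" "\<phi> \<in> borel_measurable borel" "g \<in> borel_measurable borel"
    using f g cs_measurable[OF \<phi>] by auto
  have "ip f (conv \<phi> g) = (\<integral>y. \<phi> y * ip (\<lambda>x. g (x - y)) f \<partial>lborel)"
    by (subst ip_commute) (rule ip_conv[OF \<phi> g f])
  also have "\<dots> = (\<integral>y. \<phi> (0 - y) * ip (\<lambda>x. g (x - (0 - y))) f \<partial>lborel)"
    by (rule lborel_integral_reflect[symmetric]) (simp add: ip_def, measurable)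
  also have "\<dots> = (\<integral>y. s * (\<phi> y * ip (\<lambda>x. f (x - y)) g) \<partial>lborel)"
  proof (rule Bochner_Integration.integral_cong)
    fix y
    have "ip (\<lambda>x. g (x - (0 - y))) f = ip (\<lambda>x. f (x - y)) g"
      using ip_translate[OF f g, of y 0] ip_translate[OF f g, of 0 "- y"] by (simp add: ip_commute)
    then show "\<phi> (0 - y) * ip (\<lambda>x. g (x - (0 - y))) f = s * (\<phi> y * ip (\<lambda>x. f (x - y)) g)"
      using odd[of y] by simp
  qed simp
  also have "\<dots> = s * ip (conv \<phi> f) g" by (simp add: ip_conv[OF \<phi> f g])
  finally have e: "ip f (conv \<phi> g) = s * ip (conv \<phi> f) g" .
  \<comment> \<open>Reflecting twice shows that \<open>s\<close> squares to 1 unless the kernel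
    vanishes identically; this inverts the factor \<open>s\<close> in \<open>e\<close>.\<close>
  have "s * s * \<phi> y = \<phi> y" for y using odd[of y] odd[of "- y"] by simp
  then have "s * s = 1 \<or> (\<forall>y. \<phi> y = 0)" by (metis mult_cancel_right1)
  then show ?thesis
  proof
    assume "s * s = 1"
    then show ?thesis using e by (metis mult.assoc mult_1)
  next
    assume "\<forall>y. \<phi> y = 0"
    then show ?thesis by (simp add: conv_def[abs_def] ip_def)
  qed
qed

text \<open>Both sides are the double integral of \<open>\<phi> y * \<psi> z\<close> against the
  translate by \<open>y + z\<close>, which is symmetric in the two kernels. The pairing with
  \<open>g\<close> keeps the integrand scalar.\<close>

lemma conv_commute:
  assumes \<phi>: "cs \<phi>" and \<psi>: "cs \<psi>" and f: "f \<in> L2" and g: "g \<in> L2"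
  shows "ip (conv \<phi> (conv \<psi> f)) g = ip (conv \<psi> (conv \<phi> f)) g"
proof -
  have [measurable]: "f \<in> borel_measurable borel" "\<phi> \<in> borel_measurable borel" "\<psi> \<in> borel_measurable borel" "g \<in> borel_measurable borel"
    using f g cs_measurable[OF \<phi>] cs_measurable[OF \<psi>] by auto
  have *: "ip (conv \<phi> (conv \<psi> f)) g = (\<integral>y. (\<integral>z. \<phi> y * \<psi> z * ip (\<lambda>x. f (x - (y + z))) g \<partial>lborel) \<partial>lborel)"
    if \<phi>: "cs \<phi>" and \<psi>: "cs \<psi>" for \<phi> \<psi>
  proof -
    have "ip (\<lambda>x. conv \<psi> f (x - y)) g = (\<integral>z. \<psi> z * ip (\<lambda>x. f (x - (y + z))) g \<partial>lborel)" for y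
    proof -
      have "ip (\<lambda>x. conv \<psi> f (x - y)) g = ip (conv \<psi> f) (\<lambda>x. g (x - (- y)))"
        using ip_translate[OF conv_L2(1)[OF \<psi> f] g, of 0 "- y"] by simp
      also have "\<dots> = (\<integral>z. \<psi> z * ip (\<lambda>x. f (x - z)) (\<lambda>x. g (x - (- y))) \<partial>lborel)"
        by (rule ip_conv[OF \<psi> f L2_translate[OF g]])
      finally show ?thesis using ip_translate[OF f g, of _ "- y"] by (simp add: add.commute)
    qed
    then show ?thesis by (simp add: ip_conv[OF \<phi> conv_L2(1)[OF \<psi> f] g] mult.assoc)
  qed
  have int: "integrable (lborel \<Otimes>\<^sub>M lborel) (\<lambda>(y, z). \<phi> y * \<psi> z * ip (\<lambda>x. f (x - (y + z))) g)"
  proof (rule Bochner_Integration.integrable_bound)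
    have "integrable (lborel \<Otimes>\<^sub>M lborel) (\<lambda>(y, z). \<phi> y * \<psi> z)"
      by (rule lborel_pair.Fubini_integrable) (auto simp: abs_mult cs_integrable[OF \<phi>] cs_integrable[OF \<psi>])
    then show "integrable (lborel \<Otimes>\<^sub>M lborel) (\<lambda>p. (\<lambda>(y, z). \<phi> y * \<psi> z) p * (L2_norm f * L2_norm g))"
      by (rule integrable_mult_left)
    show "(\<lambda>(y, z). \<phi> y * \<psi> z * ip (\<lambda>x. f (x - (y + z))) g) \<in> borel_measurable (lborel \<Otimes>\<^sub>M lborel)"
      unfolding ip_def by measurable
    show "AE p in lborel \<Otimes>\<^sub>M lborel. norm ((\<lambda>(y, z). \<phi> y * \<psi> z * ip (\<lambda>x. f (x - (y + z))) g) p)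
        \<le> norm ((\<lambda>(y, z). \<phi> y * \<psi> z) p * (L2_norm f * L2_norm g))"
      using ip_translate_bound[OF f g] by (intro AE_I2) (auto simp: abs_mult intro!: mult_left_mono)
  qed
  have "(\<integral>y. (\<integral>z. \<phi> y * \<psi> z * ip (\<lambda>x. f (x - (y + z))) g \<partial>lborel) \<partial>lborel)
      = (\<integral>z. (\<integral>y. \<phi> y * \<psi> z * ip (\<lambda>x. f (x - (y + z))) g \<partial>lborel) \<partial>lborel)"
    by (rule lborel_pair.Fubini_integral[symmetric]) (rule int)
  then show ?thesis by (simp add: *[OF \<phi> \<psi>] *[OF \<psi> \<phi>] mult.commute[of "\<phi> _"] add.commute)
qed

lemma conv_linear_image:
  assumes \<phi>: "cs \<phi>" and f: "f \<in> L2" and T: "bounded_linear T"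
  shows "conv \<phi> (\<lambda>x. T (f x)) = (\<lambda>x. T (conv \<phi> f x))"
proof
  fix x
  interpret T: bounded_linear T by (rule T)
  show "conv \<phi> (\<lambda>x. T (f x)) x = T (conv \<phi> f x)" unfolding conv_def
    using integral_bounded_linear[OF T conv_integrable[OF \<phi> f, of x]] by (simp add: T.scaleR)
qed

lemma conv_diff:
  assumes \<phi>: "cs \<phi>" and f: "f \<in> L2" "g \<in> L2"
  shows "conv \<phi> (\<lambda>x. f x - g x) x = conv \<phi> f x - conv \<phi> g x"
  unfolding conv_def using conv_integrable[OF \<phi>] f by (simp add: scaleR_diff_right)

lemma conv_diff_left:
  assumes \<phi>: "cs \<phi>" "cs \<psi>" and f: "f \<in> L2"
  shows "conv (\<lambda>y. \<phi> y - \<psi> y) f x = conv \<phi> f x - conv \<psi> f x"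
  unfolding conv_def using conv_integrable[OF \<phi>(1) f] conv_integrable[OF \<phi>(2) f] by (simp add: scaleR_diff_left)

lemma mol_contraction:
  assumes f: "f \<in> L2" shows "L2_norm (conv (mol n) f) \<le> L2_norm f"
  using conv_L2(2)[OF cs_mol(1) f, of n] mol_simps(3,5)[of n] by simp

lemma C1c_Lipschitz:
  fixes F :: "real^3 \<Rightarrow> 'b::euclidean_space"
  assumes C: "C1c F DF"
  obtains L where "L \<ge> 0" "\<And>x y. norm (F x - F y) \<le> L * norm (x - y)"
proof -
  obtain R where R: "\<And>x k. norm x > R \<Longrightarrow> DF k x = 0" using C1c_support[OF C] by metis
  have "\<exists>B. B \<ge> 0 \<and> (\<forall>x. norm (DF k x) \<le> B)" for k
    using compact_support_bounded[OF C1_continuous(2)[OF C1c_C1[OF C]] R] by metis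
  then obtain B where B: "\<And>k. B k \<ge> 0" "\<And>k x. norm (DF k x) \<le> B k" by metis
  have "norm (F x - F y) \<le> (\<Sum>k\<in>UNIV. B k) * norm (x - y)" for x y
  proof (rule differentiable_bound[of UNIV F "\<lambda>x h. \<Sum>k\<in>UNIV. h$k *\<^sub>R DF k x"])
    show "onorm (\<lambda>h. \<Sum>k\<in>UNIV. h$k *\<^sub>R DF k x) \<le> (\<Sum>k\<in>UNIV. B k)" for x
    proof (rule onorm_le)
      fix h :: "real^3"
      have "norm (\<Sum>k\<in>UNIV. h$k *\<^sub>R DF k x) \<le> (\<Sum>k\<in>UNIV. norm h * B k)"
        using B by (intro sum_norm_le) (auto intro!: mult_mono component_le_norm_cart)
      then show "norm (\<Sum>k\<in>UNIV. h$k *\<^sub>R DF k x) \<le> (\<Sum>k\<in>UNIV. B k) * norm h"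
        unfolding sum_distrib_left[symmetric] by (simp only: mult.commute)
    qed
  qed (use C1_has_derivative[OF C1c_C1[OF C]] in auto)
  then show ?thesis using that sum_nonneg[of UNIV B] B(1) by blast
qed

text \<open>For a C1 field of compact support the convergence is uniform, by the Lipschitz bound,
  and confined to a fixed ball; density and the contraction property carry it over to all of
  \<open>L2\<close>.\<close>

lemma mol_tendsto:
  assumes f: "f \<in> L2"
  shows "(\<lambda>n. L2_norm (\<lambda>x. conv (mol n) f x - f x)) \<longlonglongrightarrow> 0"
proof (rule LIMSEQ_I)
  fix e :: real assume e: "e > 0"
  obtain tt where tt: "\<And>m. \<exists>D. C1c (tt m) D \<and> off0 (tt m)" "(\<lambda>m. L2_norm (\<lambda>x. tt m x - f x)) \<longlonglongrightarrow> 0"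
    using C1c_dense[OF f] by blast
  then obtain m where m: "L2_norm (\<lambda>x. tt m x - f x) < e / 3" using LIMSEQ_D[OF tt(2), of "e / 3"] e by auto
  define t where "t = tt m"
  obtain D where C: "C1c t D" using tt(1) unfolding t_def by blast
  note tL = C1c_L2(1)[OF C]
  obtain R where R: "R > 0" "\<And>x. norm x > R \<Longrightarrow> t x = 0" using C1c_support[OF C] by metis
  obtain L where L: "L \<ge> 0" "\<And>x y. norm (t x - t y) \<le> L * norm (x - y)" using C1c_Lipschitz[OF C] by metis
  \<comment> \<open>The norm of the indicator of a ball containing all supports; a unit spinor makes
    the indicator an element of \<open>L2\<close>.\<close>
  define V where "V = L2_norm (\<lambda>x. indicator (cball 0 (R + 1)) x *\<^sub>R axis (1::4) (1::complex))"
  have VL: "(\<lambda>x. indicator (cball 0 (R + 1)) x *\<^sub>R axis (1::4) (1::complex)) \<in> L2"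
    by (rule L2_bounded_support[where C=1 and R="R + 1"]) (auto simp: indicator_def)
  have key: "L2_norm (\<lambda>x. conv (mol n) t x - t x) \<le> L / Suc n * V" for n
  proof -
    have b: "norm (conv (mol n) t x - t x) \<le> norm ((L / Suc n) *\<^sub>R (indicator (cball 0 (R + 1)) x *\<^sub>R axis (1::4) (1::complex)))" for x
    proof -
      have i: "integrable lborel (mol n)" by (rule cs_integrable[OF cs_mol(1)])
      have "(\<integral>y. mol n y *\<^sub>R t x \<partial>lborel) = t x" using i mol_simps(5)[of n] by simp
      then have "conv (mol n) t x - t x = (\<integral>y. mol n y *\<^sub>R t (x - y) \<partial>lborel) - (\<integral>y. mol n y *\<^sub>R t x \<partial>lborel)"
        by (simp add: conv_def)
      also have "\<dots> = (\<integral>y. mol n y *\<^sub>R t (x - y) - mol n y *\<^sub>R t x \<partial>lborel)"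
        by (rule Bochner_Integration.integral_diff[symmetric]) (use conv_integrable[OF cs_mol(1) tL] i in auto)
      finally have eq: "conv (mol n) t x - t x = (\<integral>y. mol n y *\<^sub>R (t (x - y) - t x) \<partial>lborel)"
        by (simp add: scaleR_diff_right)
      show ?thesis
      proof (cases "norm x > R + 1")
        case True
        have "mol n y *\<^sub>R (t (x - y) - t x) = 0" for y
        proof (cases "norm y \<ge> 1 / Suc n")
          case False
          moreover have "1 / real (Suc n) \<le> 1" by simp
          ultimately have "norm y < 1" by linarith
          then have "norm (x - y) > R" using True norm_triangle_ineq2[of x y] by linarith
          then show ?thesis using True R by simp
        qed (simp add: mol_simps(4))
        then have "conv (mol n) t x - t x = 0" unfolding eq by (simp only: Bochner_Integration.integral_zero)
        then show ?thesis by (simp only: norm_zero norm_ge_zero)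
      next
        case False
        have "norm (conv (mol n) t x - t x) \<le> (\<integral>y. norm (mol n y *\<^sub>R (t (x - y) - t x)) \<partial>lborel)"
          unfolding eq by (rule integral_norm_bound)
        also have "\<dots> \<le> (\<integral>y. mol n y * (L / Suc n) \<partial>lborel)"
        proof (rule integral_mono)
          show "integrable lborel (\<lambda>y. norm (mol n y *\<^sub>R (t (x - y) - t x)))"
            using conv_integrable[OF cs_mol(1) tL] i by (simp add: scaleR_diff_right)
          show "integrable lborel (\<lambda>y. mol n y * (L / Suc n))" using i by simp
          fix y
          have "mol n y * norm (t (x - y) - t x) \<le> mol n y * (L / Suc n)"
          proof (cases "norm y \<ge> 1 / Suc n")
            case False
            have "norm (t (x - y) - t x) \<le> L * norm y" using L(2)[of "x - y" x] by simp
            also have "\<dots> \<le> L * (1 / Suc n)" using False L(1) by (intro mult_left_mono) auto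
            finally show ?thesis using mol_simps(3)[of n y] by (intro mult_left_mono) auto
          qed (simp add: mol_simps(4))
          then show "norm (mol n y *\<^sub>R (t (x - y) - t x)) \<le> mol n y * (L / Suc n)"
            using mol_simps(3)[of n y] by simp
        qed
        also have "\<dots> = L / Suc n" using mol_simps(5)[of n] by simp
        finally show ?thesis using False L(1) by (simp add: dist_norm)
      qed
    qed
    have "L2_norm (\<lambda>x. conv (mol n) t x - t x) \<le> L2_norm (\<lambda>x. (L / Suc n) *\<^sub>R (indicator (cball 0 (R + 1)) x *\<^sub>R axis (1::4) (1::complex)))"
      by (rule L2_norm_mono_AE[OF L2_diff[OF conv_L2(1)[OF cs_mol(1) tL] tL] L2_scaleR[OF VL] AE_I2[OF b]])
    then show ?thesis using L(1) unfolding V_def by (simp only: L2_norm_scaleR) simp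
  qed
  have V0: "V \<ge> 0" unfolding V_def by simp
  obtain N where N: "inverse (real (Suc N)) * (L * V) < e / 3"
  proof -
    have "(\<lambda>n. inverse (real (Suc n)) * (L * V)) \<longlonglongrightarrow> 0 * (L * V)"
      by (intro tendsto_mult_right LIMSEQ_inverse_real_of_nat)
    from LIMSEQ_D[OF this, of "e / 3"] e obtain N where "norm (inverse (real (Suc N)) * (L * V) - 0 * (L * V)) < e / 3" by auto
    then show ?thesis using that[of N] by simp
  qed
  show "\<exists>n0. \<forall>n\<ge>n0. norm (L2_norm (\<lambda>x. conv (mol n) f x - f x) - 0) < e"
  proof (intro exI[of _ N] allI impI)
    fix n assume n: "n \<ge> N"
    note cL = conv_L2(1)[OF cs_mol(1)]
    have 1: "L2_norm (\<lambda>x. conv (mol n) f x - conv (mol n) t x) < e / 3"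
    proof -
      have "(\<lambda>x. conv (mol n) f x - conv (mol n) t x) = conv (mol n) (\<lambda>x. f x - t x)"
        by (rule ext) (rule conv_diff[OF cs_mol(1) f tL, symmetric])
      then have "L2_norm (\<lambda>x. conv (mol n) f x - conv (mol n) t x) \<le> L2_norm (\<lambda>x. f x - t x)"
        using mol_contraction[OF L2_diff[OF f tL]] by simp
      then show ?thesis using m L2_norm_minus_commute[of f t] unfolding t_def by linarith
    qed
    have "inverse (real (Suc n)) * (L * V) \<le> inverse (real (Suc N)) * (L * V)"
      using n L(1) V0 by (intro mult_right_mono le_imp_inverse_le) auto
    then have 2: "L2_norm (\<lambda>x. conv (mol n) t x - t x) < e / 3"
      using key[of n] N unfolding divide_inverse mult.assoc mult.left_commute[of L] by linarith
    have "L2_norm (\<lambda>x. conv (mol n) f x - f x)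
        \<le> L2_norm (\<lambda>x. conv (mol n) f x - conv (mol n) t x) + L2_norm (\<lambda>x. conv (mol n) t x - f x)"
      by (rule L2_norm_diff_triangle[OF cL[OF f] cL[OF tL] f])
    also have "L2_norm (\<lambda>x. conv (mol n) t x - f x) \<le> L2_norm (\<lambda>x. conv (mol n) t x - t x) + L2_norm (\<lambda>x. t x - f x)"
      by (rule L2_norm_diff_triangle[OF cL[OF tL] tL f])
    finally show "norm (L2_norm (\<lambda>x. conv (mol n) f x - f x) - 0) < e"
      using 1 2 m unfolding t_def by simp
  qed
qed

subsection \<open>The Dirac matrices\<close>

lemma spinor_nth [simp]: "spinor a b $ 1 = a$1" "spinor a b $ 2 = a$2" "spinor a b $ 3 = b$1" "spinor a b $ 4 = b$2"
  by (simp_all add: spinor_def vector_def)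

lemma vector4_nth [simp]: "(vector [a,b,c,d] :: complex^4^4) $ 1 = a" "(vector [a,b,c,d] :: complex^4^4) $ 2 = b"
    "(vector [a,b,c,d] :: complex^4^4) $ 3 = c" "(vector [a,b,c,d] :: complex^4^4) $ 4 = d"
  by (simp_all add: vector_def)

lemma spinor_exhaust: obtains a b where "v = spinor a b"
proof
  show "v = spinor (vector [v$1, v$2]) (vector [v$3, v$4])" by (simp add: vec_eq_iff forall_4)
qed

lemma alpha_mult: "alpha_mat k *v spinor a b = spinor (pauli k *v b) (pauli k *v a)"
  by (simp add: vec_eq_iff forall_4 alpha_mat_def block_mat_def matrix_vector_mult_def sum_4 sum_2)

lemma beta_mult: "beta_mat *v spinor a b = spinor a (- b)"
  by (simp add: vec_eq_iff forall_4 beta_mat_def block_mat_def matrix_vector_mult_def sum_4 sum_2 mat_def)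

lemma spinor_inner: "spinor a b \<bullet> spinor c d = a \<bullet> c + b \<bullet> d"
  by (simp add: inner_vec_def sum_4 sum_2)

lemma spinor_add: "spinor a b + spinor c d = spinor (a + c) (b + d)"
  by (simp add: vec_eq_iff forall_4)

lemma spinor_scaleR: "r *\<^sub>R spinor a b = spinor (r *\<^sub>R a) (r *\<^sub>R b)"
  by (simp add: vec_eq_iff forall_4)

lemma spinor_scale: "c *s spinor a b = spinor (c *s a) (c *s b)"
  by (simp add: vec_eq_iff forall_4)

lemma spinor_zero: "spinor 0 0 = 0"
  by (simp add: vec_eq_iff forall_4)

lemma spinor_sum: "(\<Sum>i\<in>I. spinor (f i) (g i)) = spinor (\<Sum>i\<in>I. f i) (\<Sum>i\<in>I. g i)"
  by (induction I rule: infinite_finite_induct) (auto simp: spinor_add spinor_zero)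

lemma pauli_mult:
  "(pauli k *v a) $ 1 = (if k = 1 then a$2 else if k = 2 then - \<i> * a$2 else a$1)"
  "(pauli k *v a) $ 2 = (if k = 1 then a$1 else if k = 2 then \<i> * a$1 else - a$2)"
  by (simp_all add: pauli_def matrix_vector_mult_def sum_2)

lemma pauli_sym: "(pauli k *v a) \<bullet> b = a \<bullet> (pauli k *v b)"
  by (simp add: inner_vec_def sum_2 pauli_mult inner_complex_def)

lemma pauli_anticommute: "pauli k *v (pauli l *v a) + pauli l *v (pauli k *v a) = (if k = l then 2 else 0) *\<^sub>R a"
  using exhaust_3[of k] exhaust_3[of l]
  by (auto simp: vec_eq_iff forall_2 pauli_mult scaleR_2)

lemma alpha_linear: "bounded_linear (\<lambda>v. alpha_mat k *v v)"
  by (rule linear_conv_bounded_linear[THEN iffD1], rule linearI)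
     (rule matrix_vector_right_distrib, simp add: vec_eq_iff matrix_vector_mult_def sum_4 scaleR_add_right)

lemma alpha_sym: "(alpha_mat k *v v) \<bullet> w = v \<bullet> (alpha_mat k *v w)"
  by (rule spinor_exhaust[of v], rule spinor_exhaust[of w]) (simp add: alpha_mult spinor_inner pauli_sym)

lemma alpha_anticommute:
  "alpha_mat k *v (alpha_mat l *v v) + alpha_mat l *v (alpha_mat k *v v) = (if k = l then 2 else 0) *\<^sub>R v"
  by (rule spinor_exhaust[of v]) (simp only: alpha_mult spinor_add pauli_anticommute spinor_scaleR)

lemma alpha_square: "alpha_mat k *v (alpha_mat k *v v) = v"
  using alpha_anticommute[of k k v] by (simp flip: scaleR_2)

lemma alpha_L2: "f \<in> L2 \<Longrightarrow> (\<lambda>x. alpha_mat k *v f x) \<in> L2"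
  using L2_linear_image[OF _ alpha_linear] .

lemma ip_alpha: "ip (\<lambda>x. alpha_mat k *v f x) g = ip f (\<lambda>x. alpha_mat k *v g x)"
  by (simp add: ip_def alpha_sym)

subsection \<open>Weak derivatives and elliptic regularity\<close>

lemma cs_test: assumes "test_function \<eta>" shows "cs \<eta>" "cs (partial_deriv k \<eta>)"
  using C1_continuous[OF C1c_C1[OF test_function_C1c[OF assms]]] C1c_support[OF test_function_C1c[OF assms]]
  unfolding cs_def by metis+

lemma cs_mult_integrable:
  assumes \<phi>: "cs \<phi>" and f: "f \<in> L2"
  shows "integrable lborel (\<lambda>x. \<phi> x *\<^sub>R f x)"
proof (rule Bochner_Integration.integrable_bound)
  have [measurable]: "f \<in> borel_measurable borel" "\<phi> \<in> borel_measurable borel"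
    using f cs_measurable[OF \<phi>] by auto
  show "(\<lambda>y. \<phi> y *\<^sub>R f y) \<in> borel_measurable lborel" by measurable
  show "integrable lborel (\<lambda>y. norm (\<phi> y *\<^sub>R axis (1::4) (1::complex)) * norm (f y))"
    by (rule L2_integrable_mult[OF cs_scaleR_L2[OF \<phi>] f])
qed auto

lemma cs_mult_inner:
  assumes \<phi>: "cs \<phi>" and f: "f \<in> L2"
  shows "(\<integral>x. \<phi> x *\<^sub>R f x \<partial>lborel) \<bullet> c = ip f (\<lambda>x. \<phi> x *\<^sub>R c)"
  using integral_inner_left[of c lborel "\<lambda>x. \<phi> x *\<^sub>R f x"] cs_mult_integrable[OF assms] by (simp add: ip_def)

text \<open>Testing the vector identity with every constant spinor \<open>c\<close> expresses weak
  derivatives through \<open>ip\<close>.\<close>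

lemma is_weak_partial_iff:
  assumes f: "f \<in> L2" and g: "g \<in> L2"
  shows "is_weak_partial k f g \<longleftrightarrow> (\<forall>\<eta> c. test_function \<eta> \<longrightarrow>
     ip f (\<lambda>x. partial_deriv k \<eta> x *\<^sub>R c) = - ip g (\<lambda>x. \<eta> x *\<^sub>R c))"
proof -
  have "(\<integral>x. partial_deriv k \<eta> x *\<^sub>R f x \<partial>lborel) = - (\<integral>x. \<eta> x *\<^sub>R g x \<partial>lborel) \<longleftrightarrow>
     (\<forall>c. ip f (\<lambda>x. partial_deriv k \<eta> x *\<^sub>R c) = - ip g (\<lambda>x. \<eta> x *\<^sub>R c))" if "test_function \<eta>" for \<eta>
    by (subst vector_eq_rdot[symmetric]) (simp add: cs_mult_inner cs_test[OF that] f g)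
  then show ?thesis unfolding is_weak_partial_def by (intro iffI allI impI) (meson, meson)
qed

lemma H1_L2: "f \<in> H1 \<Longrightarrow> f \<in> L2"
  by (simp add: H1_def)

lemma weak_partial_H1:
  assumes "f \<in> H1" shows "weak_partial k f \<in> L2" "is_weak_partial k f (weak_partial k f)"
proof -
  have "\<exists>g. g \<in> L2 \<and> is_weak_partial k f g" using assms by (auto simp: H1_def)
  from someI_ex[OF this] show "weak_partial k f \<in> L2" "is_weak_partial k f (weak_partial k f)"
    by (simp_all add: weak_partial_def)
qed

lemma conv_reflect:
  assumes [measurable]: "\<phi> \<in> borel_measurable borel" "f \<in> borel_measurable borel"
  shows "conv \<phi> f x = (\<integral>y. \<phi> (x - y) *\<^sub>R f y \<partial>lborel)"
proof -
  have "(\<integral>y. \<phi> (x - y) *\<^sub>R f y \<partial>lborel) = (\<integral>y. \<phi> (x - (x - y)) *\<^sub>R f (x - y) \<partial>lborel)"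
    by (rule lborel_integral_reflect[symmetric]) measurable
  then show ?thesis by (simp add: conv_def)
qed

text \<open>The reflected mollifier \<open>y \<mapsto> mol n (x - y)\<close> is itself a test
  function, so the identity holds at every point \<open>x\<close>.\<close>

lemma conv_weak_partial:
  assumes f: "f \<in> L2" and g: "g \<in> L2" and w: "is_weak_partial k f g"
  shows "conv (dmol n k) f x = conv (mol n) g x"
proof -
  have "conv (dmol n k) f x = - (\<integral>y. partial_deriv k (\<lambda>y. mol n (x - y)) y *\<^sub>R f y \<partial>lborel)"
    using f cs_measurable[OF cs_mol(2)] by (simp add: conv_reflect L2_measurable mol_test_partial)
  also have "\<dots> = (\<integral>y. mol n (x - y) *\<^sub>R g y \<partial>lborel)"
    using w mol_test_function[of n x] by (simp add: is_weak_partial_def)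
  finally show ?thesis using g cs_measurable[OF cs_mol(1)] by (simp add: conv_reflect L2_measurable)
qed

text \<open>Mollifications converge back to the field, so all of them together determine it. This is
  the source of the uniqueness of weak derivatives.\<close>

lemma conv_mol_injective:
  assumes f: "f \<in> L2" and g: "g \<in> L2" and e: "\<And>n x. conv (mol n) f x = conv (mol n) g x"
  shows "AE x in lborel. f x = g x"
proof -
  have "conv (mol n) (\<lambda>x. f x - g x) = (\<lambda>x. 0)" for n
    using e by (simp add: fun_eq_iff conv_diff[OF cs_mol(1) f g])
  then have "(\<lambda>n. L2_norm (\<lambda>x. 0 - (f x - g x))) \<longlonglongrightarrow> 0"
    using mol_tendsto[OF L2_diff[OF f g]] by simp
  then have "L2_norm (\<lambda>x. 0 - (f x - g x)) = 0" by (simp only: LIMSEQ_const_iff)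
  from L2_norm_zero_AE[OF L2_diff[OF L2_zero L2_diff[OF f g]] this] show ?thesis by (rule eventually_mono) simp
qed

lemma weak_partial_unique:
  assumes "f \<in> L2" "g \<in> L2" "h \<in> L2" "is_weak_partial k f g" "is_weak_partial k f h"
  shows "AE x in lborel. g x = h x"
  using conv_weak_partial assms by (intro conv_mol_injective) metis+

lemma weak_partial_AE: "f \<in> H1 \<Longrightarrow> g \<in> L2 \<Longrightarrow> is_weak_partial k f g \<Longrightarrow> AE x in lborel. weak_partial k f x = g x"
  by (rule weak_partial_unique[OF H1_L2 weak_partial_H1(1)]) (auto intro: weak_partial_H1)

text \<open>Integration by parts for weak derivatives: mollify both factors and move the odd kernel
  \<open>dmol n k\<close> across, using that convolutions commute; then let the mollifiers
  concentrate.\<close>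

lemma weak_partial_skew:
  assumes L: "f \<in> L2" "f' \<in> L2" "g \<in> L2" "g' \<in> L2"
    and wf: "is_weak_partial k f f'" and wg: "is_weak_partial k g g'"
  shows "ip f' g = - ip f g'"
proof -
  note cL = conv_L2(1)[OF cs_mol(1)] and dL = conv_L2(1)[OF cs_mol(2)]
  have e: "ip (conv (mol n) f') (conv (mol n) g) = - ip (conv (mol n) f) (conv (mol n) g')" for n
  proof -
    have "ip (conv (mol n) f') (conv (mol n) g) = ip (conv (dmol n k) f) (conv (mol n) g)"
      using conv_weak_partial[OF L(1,2) wf] by (simp add: ip_def)
    also have "\<dots> = - ip f (conv (dmol n k) (conv (mol n) g))"
      using conv_adjoint[OF cs_mol(2) L(1) cL[OF L(3)], where s="-1"] mol_simps(2) by simp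
    also have "ip f (conv (dmol n k) (conv (mol n) g)) = ip f (conv (mol n) (conv (dmol n k) g))"
      using conv_commute[OF cs_mol(2) cs_mol(1) L(3) L(1)] by (simp add: ip_commute)
    also have "\<dots> = ip (conv (mol n) f) (conv (dmol n k) g)"
      using conv_adjoint[OF cs_mol(1) L(1) dL[OF L(3)], where s=1] mol_simps(1) by simp
    also have "\<dots> = ip (conv (mol n) f) (conv (mol n) g')"
      using conv_weak_partial[OF L(3,4) wg] by (simp add: ip_def)
    finally show ?thesis .
  qed
  have "(\<lambda>n. ip (conv (mol n) f') (conv (mol n) g)) \<longlonglongrightarrow> ip f' g"
    by (rule tendsto_ip) (intro cL L mol_tendsto)+
  moreover have "(\<lambda>n. - ip (conv (mol n) f) (conv (mol n) g')) \<longlonglongrightarrow> - ip f g'"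
    by (intro tendsto_minus tendsto_ip cL L mol_tendsto)
  ultimately show ?thesis using LIMSEQ_unique unfolding e by blast
qed

lemma C1c_weak_partial:
  assumes C: "C1c G DG"
  shows "is_weak_partial k G (DG k)"
  unfolding is_weak_partial_def
proof (intro allI impI)
  fix \<eta> assume t: "test_function \<eta>"
  note T = test_function_C1c[OF t]
  note i = cs_mult_integrable[OF cs_test(1)[OF t] C1c_L2(2)[OF C, of k]]
    cs_mult_integrable[OF cs_test(2)[OF t] C1c_L2(1)[OF C], of k]
  have "(\<integral>x. \<eta> x *\<^sub>R DG k x + partial_deriv k \<eta> x *\<^sub>R G x \<partial>lborel) = 0"
    by (rule C1c_integral_deriv[OF C1c_mult[OF C1c_C1[OF T] C]])
  then show "(\<integral>x. partial_deriv k \<eta> x *\<^sub>R G x \<partial>lborel) = - (\<integral>x. \<eta> x *\<^sub>R DG k x \<partial>lborel)"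
    using i by (simp add: eq_neg_iff_add_eq_0 add.commute)
qed

lemma C1c_H1: "C1c G DG \<Longrightarrow> G \<in> H1"
  using C1c_weak_partial C1c_L2 unfolding H1_def by blast

lemma C1_reflect:
  assumes C: "C1 G DG" shows "C1 (\<lambda>y. G (x - y)) (\<lambda>k y. - DG k (x - y))"
  unfolding C1_def
proof (intro conjI allI)
  fix y
  have "((\<lambda>y. G (x - y)) has_derivative (\<lambda>h. \<Sum>k\<in>UNIV. (0 - h) $ k *\<^sub>R DG k (x - y))) (at y)"
    by (rule has_derivative_compose[OF _ C1_has_derivative[OF C]])
       (intro has_derivative_diff has_derivative_const has_derivative_ident)
  then show "((\<lambda>y. G (x - y)) has_derivative (\<lambda>h. \<Sum>k\<in>UNIV. h $ k *\<^sub>R - DG k (x - y))) (at y)"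
    by (rule has_derivative_eq_rhs) (auto simp: fun_eq_iff)
  show "continuous_on UNIV (\<lambda>y. - DG k (x - y))" for k
    by (intro continuous_intros continuous_on_compose2[OF C1_continuous(2)[OF C]]) auto
qed

text \<open>The difference of the two sides is the integral of a derivative of
  \<open>y \<mapsto> mol n y *\<^sub>R G (x - y)\<close>, which has compact support.\<close>

lemma conv_deriv_swap:
  assumes C: "C1c G DG"
  shows "conv (mol n) (DG k) x = conv (dmol n k) G x"
proof -
  obtain R where R: "R > 0" "\<And>x. norm x > R \<Longrightarrow> mol n x = 0" using C1c_support[OF mol_C1c] by metis
  have "C1c (\<lambda>y. mol n y *\<^sub>R G (x - y)) (\<lambda>k y. mol n y *\<^sub>R - DG k (x - y) + dmol n k y *\<^sub>R G (x - y))"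
    using C1_scaleR[OF C1c_C1[OF mol_C1c] C1_reflect[OF C1c_C1[OF C]]] R by (auto simp: C1c_def)
  from C1c_integral_deriv[OF this, of k]
  have "(\<integral>y. dmol n k y *\<^sub>R G (x - y) - mol n y *\<^sub>R DG k (x - y) \<partial>lborel) = 0" by (simp add: algebra_simps)
  then show ?thesis
    using conv_integrable[OF cs_mol(1) C1c_L2(2)[OF C, of k], of n x] conv_integrable[OF cs_mol(2) C1c_L2(1)[OF C], of n k x]
    by (simp add: conv_def)
qed

lemma C1_scaleR_const: "C1 F DF \<Longrightarrow> C1 (\<lambda>x. F x *\<^sub>R c) (\<lambda>k x. DF k x *\<^sub>R c)"
  by (rule C1_linear_image[OF bounded_linear_scaleR_left])

lemma test_scaleR_C1c: "test_function \<eta> \<Longrightarrow> C1c (\<lambda>x. \<eta> x *\<^sub>R c) (\<lambda>k x. partial_deriv k \<eta> x *\<^sub>R c)"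
  using test_function_C1c[of \<eta>] C1_scaleR_const by (auto simp: C1c_def)

text \<open>By duality: the mollifier moves onto the test field, where the derivative changes sides,
  and back with the sign of the odd kernel.\<close>

lemma mollified_weak_partial:
  assumes f: "f \<in> L2"
  shows "is_weak_partial k (conv (mol n) f) (conv (dmol n k) f)"
  unfolding is_weak_partial_iff[OF conv_L2(1)[OF cs_mol(1) f] conv_L2(1)[OF cs_mol(2) f]]
proof (intro allI impI)
  fix \<eta> and c :: "complex^4" assume "test_function \<eta>"
  note T = test_scaleR_C1c[OF this, of c]
  have "ip (conv (mol n) f) (\<lambda>x. partial_deriv k \<eta> x *\<^sub>R c) = ip f (conv (mol n) (\<lambda>x. partial_deriv k \<eta> x *\<^sub>R c))"
    using conv_adjoint[OF cs_mol(1) f C1c_L2(2)[OF T], where s=1] mol_simps(1) by simp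
  also have "conv (mol n) (\<lambda>x. partial_deriv k \<eta> x *\<^sub>R c) = conv (dmol n k) (\<lambda>x. \<eta> x *\<^sub>R c)"
    using conv_deriv_swap[OF T] by auto
  also have "ip f (conv (dmol n k) (\<lambda>x. \<eta> x *\<^sub>R c)) = - ip (conv (dmol n k) f) (\<lambda>x. \<eta> x *\<^sub>R c)"
    using conv_adjoint[OF cs_mol(2) f C1c_L2(1)[OF T], where s="-1"] mol_simps(2) by simp
  finally show "ip (conv (mol n) f) (\<lambda>x. partial_deriv k \<eta> x *\<^sub>R c) = - ip (conv (dmol n k) f) (\<lambda>x. \<eta> x *\<^sub>R c)" .
qed

text \<open>Since convolutions commute, the cross terms cancel by the Clifford relations.\<close>

lemma dirac_conv_norm:
  assumes K: "\<And>k. cs (K k)" "\<And>k y. K k (- y) = - K k y" and f: "f \<in> L2"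
  shows "ip (\<lambda>x. \<Sum>k\<in>UNIV. alpha_mat k *v conv (K k) f x) (\<lambda>x. \<Sum>k\<in>UNIV. alpha_mat k *v conv (K k) f x)
    = (\<Sum>k\<in>UNIV. ip (conv (K k) f) (conv (K k) f))"
proof -
  define C where "C k l = ip (\<lambda>x. alpha_mat k *v conv (K k) f x) (\<lambda>x. alpha_mat l *v conv (K l) f x)" for k l
  have L: "(\<lambda>x. alpha_mat k *v conv (K k) f x) \<in> L2" for k
    by (intro alpha_L2 conv_L2 K f)
  have "(\<lambda>x. \<Sum>k\<in>UNIV. alpha_mat k *v conv (K k) f x) \<in> L2" by (intro L2_sum L)
  then have 1: "ip (\<lambda>x. \<Sum>k\<in>UNIV. alpha_mat k *v conv (K k) f x) (\<lambda>x. \<Sum>k\<in>UNIV. alpha_mat k *v conv (K k) f x)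
      = (\<Sum>k\<in>UNIV. \<Sum>l\<in>UNIV. C k l)"
    by (simp add: ip_sum_left ip_sum_right L C_def)
  have C: "C k l = - ip (\<lambda>x. alpha_mat l *v (alpha_mat k *v f x)) (conv (K k) (conv (K l) f))" for k l
  proof -
    have "C k l = ip (conv (K k) (\<lambda>x. alpha_mat l *v (alpha_mat k *v f x))) (conv (K l) f)"
      unfolding C_def ip_alpha[symmetric, where k=l]
      using conv_linear_image[OF K(1) f alpha_linear] conv_linear_image[OF K(1) alpha_L2[OF f] alpha_linear] by simp
    also have "\<dots> = - ip (\<lambda>x. alpha_mat l *v (alpha_mat k *v f x)) (conv (K k) (conv (K l) f))"
      using conv_adjoint[OF K(1) alpha_L2[OF alpha_L2[OF f]] conv_L2(1)[OF K(1) f], where s="-1"] K(2) by simp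
    finally show ?thesis .
  qed
  have zero: "C k l + C l k = 0" if "k \<noteq> l" for k l
  proof -
    have "ip (\<lambda>x. alpha_mat l *v (alpha_mat k *v f x)) (conv (K k) (conv (K l) f))
        = ip (\<lambda>x. alpha_mat l *v (alpha_mat k *v f x)) (conv (K l) (conv (K k) f))"
      using conv_commute[OF K(1) K(1) f alpha_L2[OF alpha_L2[OF f]]] by (simp add: ip_commute)
    then have "C k l + C l k = - ip (\<lambda>x. alpha_mat l *v (alpha_mat k *v f x) + alpha_mat k *v (alpha_mat l *v f x)) (conv (K l) (conv (K k) f))"
      unfolding C by (subst ip_add_left) (auto intro!: alpha_L2 conv_L2 K f)
    then show ?thesis using that by (simp add: alpha_anticommute ip_def)
  qed
  have diag: "C k k = ip (conv (K k) f) (conv (K k) f)" for k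
    by (simp add: C_def ip_alpha alpha_square)
  have "C 1 2 + C 2 1 = 0" "C 1 3 + C 3 1 = 0" "C 2 3 + C 3 2 = 0" by (auto intro!: zero)
  then show ?thesis unfolding 1 by (simp add: sum_3 diag)
qed

section \<open>The weak Dirac operator and its regularity\<close>

definition weak_dirac :: "(real^3 \<Rightarrow> complex^4) \<Rightarrow> (real^3 \<Rightarrow> complex^4) \<Rightarrow> bool" where
  "weak_dirac f g \<longleftrightarrow> (\<forall>\<eta> c. test_function \<eta> \<longrightarrow>
     (\<Sum>k\<in>UNIV. ip (\<lambda>x. alpha_mat k *v f x) (\<lambda>x. partial_deriv k \<eta> x *\<^sub>R c)) = ip g (\<lambda>x. \<eta> x *\<^sub>R c))"

text \<open>This is \<open>- \<i>\<close> times the Dirac operator. In \<open>weak_dirac\<close> the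
  minus sign is cancelled by integration by parts, which is why the derivative of the test function
  appears there with a plus sign.\<close>

definition skew_dirac :: "(real^3 \<Rightarrow> complex^4) \<Rightarrow> real^3 \<Rightarrow> complex^4" where
  "skew_dirac f x = - (\<Sum>k\<in>UNIV. alpha_mat k *v weak_partial k f x)"

lemma skew_dirac_L2: "f \<in> H1 \<Longrightarrow> skew_dirac f \<in> L2"
  unfolding skew_dirac_def[abs_def] by (intro L2_minus L2_sum alpha_L2 weak_partial_H1)

text \<open>After mollification a weak solution satisfies the Dirac equation at every point, with
  the kernel derivatives in place of weak derivatives.\<close>

lemma conv_weak_dirac:
  assumes f: "f \<in> L2" and g: "g \<in> L2" and w: "weak_dirac f g"
  shows "conv (mol n) g x = - (\<Sum>k\<in>UNIV. alpha_mat k *v conv (dmol n k) f x)"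
proof (rule vector_eq_rdot[THEN iffD1], rule allI)
  fix c :: "complex^4"
  have mi: "cs (\<lambda>y. mol n (x - y))" "cs (\<lambda>y. dmol n k (x - y))" for k
  proof -
    show "cs (\<lambda>y. mol n (x - y))" by (rule cs_test(1)[OF mol_test_function])
    have "cs (\<lambda>y. 0 - partial_deriv k (\<lambda>y. mol n (x - y)) y)"
      by (rule cs_diff[OF _ cs_test(2)[OF mol_test_function]]) (simp add: cs_def)
    then show "cs (\<lambda>y. dmol n k (x - y))" by (simp add: mol_test_partial)
  qed
  have c1: "conv (mol n) h x \<bullet> c = ip h (\<lambda>y. mol n (x - y) *\<^sub>R c)" if "h \<in> L2" for h
    using cs_mult_inner[OF mi(1) that] cs_measurable[OF cs_mol(1)] that by (simp add: conv_reflect L2_measurable)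
  have c2: "conv (dmol n k) h x \<bullet> c = ip h (\<lambda>y. dmol n k (x - y) *\<^sub>R c)" if "h \<in> L2" for h k
    using cs_mult_inner[OF mi(2) that] cs_measurable[OF cs_mol(2)] that by (simp add: conv_reflect L2_measurable)
  have "conv (mol n) g x \<bullet> c = ip g (\<lambda>y. mol n (x - y) *\<^sub>R c)" by (rule c1[OF g])
  also have "\<dots> = (\<Sum>k\<in>UNIV. ip (\<lambda>x. alpha_mat k *v f x) (\<lambda>y. partial_deriv k (\<lambda>y. mol n (x - y)) y *\<^sub>R c))"
    using w mol_test_function[of n x] by (simp add: weak_dirac_def)
  also have "\<dots> = (\<Sum>k\<in>UNIV. - (conv (dmol n k) (\<lambda>x. alpha_mat k *v f x) x \<bullet> c))"
    by (simp add: mol_test_partial c2[OF alpha_L2[OF f]] ip_minus_right)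
  also have "\<dots> = (- (\<Sum>k\<in>UNIV. alpha_mat k *v conv (dmol n k) f x)) \<bullet> c"
    by (simp add: conv_linear_image[OF cs_mol(2) f alpha_linear] inner_sum_left sum_negf)
  finally show "conv (mol n) g x \<bullet> c = (- (\<Sum>k\<in>UNIV. alpha_mat k *v conv (dmol n k) f x)) \<bullet> c" .
qed

lemma weak_dirac_unique:
  assumes "f \<in> L2" "g \<in> L2" "h \<in> L2" "weak_dirac f g" "weak_dirac f h"
  shows "AE x in lborel. g x = h x"
  using conv_weak_dirac[OF assms(1,2,4)] conv_weak_dirac[OF assms(1,3,5)]
  by (intro conv_mol_injective assms) simp

lemma skew_dirac_weak: "f \<in> H1 \<Longrightarrow> weak_dirac f (skew_dirac f)"
  unfolding weak_dirac_def
proof (intro allI impI)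
  fix \<eta> and c :: "complex^4" assume f: "f \<in> H1" and t: "test_function \<eta>"
  note T = test_scaleR_C1c[OF t]
  have "ip (\<lambda>x. alpha_mat k *v f x) (\<lambda>x. partial_deriv k \<eta> x *\<^sub>R c) = - ip (\<lambda>x. alpha_mat k *v weak_partial k f x) (\<lambda>x. \<eta> x *\<^sub>R c)" for k
  proof -
    have e: "alpha_mat k *v (r *\<^sub>R c) = r *\<^sub>R (alpha_mat k *v c)" for r
      using bounded_linear.linear[OF alpha_linear] by (rule linear_cmul)
    show ?thesis
      using weak_partial_H1[OF f, of k] t is_weak_partial_iff[OF H1_L2[OF f]]
      by (simp add: ip_alpha e)
  qed
  then show "(\<Sum>k\<in>UNIV. ip (\<lambda>x. alpha_mat k *v f x) (\<lambda>x. partial_deriv k \<eta> x *\<^sub>R c)) = ip (skew_dirac f) (\<lambda>x. \<eta> x *\<^sub>R c)"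
    unfolding skew_dirac_def
    by (simp add: ip_minus_left ip_sum_left alpha_L2 weak_partial_H1[OF f] C1c_L2(1)[OF T] sum_negf)
qed

text \<open>Elliptic regularity. The Dirac derivatives of the mollifications converge to
  \<open>g\<close>; \<open>dirac_conv_norm\<close> bounds each single mollified derivative by them,
  so these are Cauchy too, and their limit is a weak derivative.\<close>

lemma weak_dirac_H1:
  assumes f: "f \<in> L2" and g: "g \<in> L2" and w: "weak_dirac f g"
  shows "f \<in> H1" "AE x in lborel. skew_dirac f x = g x"
proof -
  have "\<exists>h\<in>L2. is_weak_partial k f h" for k
  proof -
    let ?d = "\<lambda>n. conv (dmol n k) f"
    have dL: "?d n \<in> L2" for n by (rule conv_L2(1)[OF cs_mol(2) f])
    have est: "L2_norm (\<lambda>x. ?d m x - ?d n x) \<le> L2_norm (\<lambda>x. conv (mol m) g x - conv (mol n) g x)" for m n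
    proof -
      \<comment> \<open>A difference of two mollifier derivatives is again an odd kernel, so the
        norm identity applies to the Cauchy differences directly.\<close>
      let ?K = "\<lambda>k y. dmol m k y - dmol n k y"
      have K: "cs (?K k)" "?K k (- y) = - ?K k y" for k y by (auto intro: cs_diff cs_mol simp: mol_simps(2))
      have cK: "conv (?K k) f x = conv (dmol m k) f x - conv (dmol n k) f x" for k x
        by (rule conv_diff_left[OF cs_mol(2) cs_mol(2) f])
      have "(\<lambda>x. conv (mol m) g x - conv (mol n) g x) = (\<lambda>x. - (\<Sum>k\<in>UNIV. alpha_mat k *v conv (?K k) f x))"
        unfolding cK conv_weak_dirac[OF f g w]
        by (simp add: fun_eq_iff matrix_vector_mult_diff_distrib sum_subtractf)
      then have "ip (\<lambda>x. conv (mol m) g x - conv (mol n) g x) (\<lambda>x. conv (mol m) g x - conv (mol n) g x)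
          = (\<Sum>k\<in>UNIV. ip (conv (?K k) f) (conv (?K k) f))"
        by (simp only: ip_minus_left ip_minus_right dirac_conv_norm[OF K f] minus_minus)
      also have "\<dots> \<ge> ip (conv (?K k) f) (conv (?K k) f)"
        by (rule member_le_sum) (auto intro: ip_self_nonneg)
      also have "ip (conv (?K k) f) (conv (?K k) f) = ip (\<lambda>x. ?d m x - ?d n x) (\<lambda>x. ?d m x - ?d n x)"
        by (simp add: cK[abs_def])
      finally show ?thesis by (simp add: L2_norm_eq)
    qed
    have "\<exists>h\<in>L2. (\<lambda>n. L2_norm (\<lambda>x. ?d n x - h x)) \<longlonglongrightarrow> 0"
    proof (rule L2_complete[OF dL])
      fix e :: real assume "e > 0"
      then obtain N where N: "\<And>n. n \<ge> N \<Longrightarrow> L2_norm (\<lambda>x. conv (mol n) g x - g x) < e / 2"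
        using LIMSEQ_D[OF mol_tendsto[OF g], of "e / 2"] by auto
      show "\<exists>N. \<forall>m\<ge>N. \<forall>n\<ge>N. L2_norm (\<lambda>x. ?d m x - ?d n x) < e"
      proof (intro exI allI impI)
        fix m n assume mn: "m \<ge> N" "n \<ge> N"
        have "L2_norm (\<lambda>x. conv (mol m) g x - conv (mol n) g x)
            \<le> L2_norm (\<lambda>x. conv (mol m) g x - g x) + L2_norm (\<lambda>x. g x - conv (mol n) g x)"
          by (intro L2_norm_diff_triangle conv_L2 cs_mol g)
        also have "\<dots> < e" using N[OF mn(1)] N[OF mn(2)] L2_norm_minus_commute[of g "conv (mol n) g"] by linarith
        finally show "L2_norm (\<lambda>x. ?d m x - ?d n x) < e" using est[of m n] by linarith
      qed
    qed
    then obtain h where h: "h \<in> L2" "(\<lambda>n. L2_norm (\<lambda>x. ?d n x - h x)) \<longlonglongrightarrow> 0" by blast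
    have "is_weak_partial k f h"
      unfolding is_weak_partial_iff[OF f h(1)]
    proof (intro allI impI)
      fix \<eta> and c :: "complex^4" assume t: "test_function \<eta>"
      note T = test_scaleR_C1c[OF t, of c]
      have "(\<lambda>n. ip (conv (mol n) f) (\<lambda>x. partial_deriv k \<eta> x *\<^sub>R c)) \<longlonglongrightarrow> ip f (\<lambda>x. partial_deriv k \<eta> x *\<^sub>R c)"
        by (intro tendsto_ip_left conv_L2 cs_mol f mol_tendsto C1c_L2(2)[OF T])
      moreover have "(\<lambda>n. - ip (?d n) (\<lambda>x. \<eta> x *\<^sub>R c)) \<longlonglongrightarrow> - ip h (\<lambda>x. \<eta> x *\<^sub>R c)"
        by (intro tendsto_minus tendsto_ip_left dL h C1c_L2(1)[OF T])
      moreover have "ip (conv (mol n) f) (\<lambda>x. partial_deriv k \<eta> x *\<^sub>R c) = - ip (?d n) (\<lambda>x. \<eta> x *\<^sub>R c)" for n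
        using mollified_weak_partial[OF f] t is_weak_partial_iff[OF conv_L2(1)[OF cs_mol(1) f] dL] by blast
      ultimately show "ip f (\<lambda>x. partial_deriv k \<eta> x *\<^sub>R c) = - ip h (\<lambda>x. \<eta> x *\<^sub>R c)"
        using LIMSEQ_unique by simp
    qed
    then show ?thesis using h by blast
  qed
  then show H: "f \<in> H1" using f by (auto simp: H1_def)
  show "AE x in lborel. skew_dirac f x = g x"
    by (rule weak_dirac_unique[OF f skew_dirac_L2[OF H] g skew_dirac_weak[OF H] w])
qed

lemma skew_dirac_skew:
  assumes f: "f \<in> H1" and g: "g \<in> H1"
  shows "ip (skew_dirac f) g = - ip f (skew_dirac g)"
proof -
  have "ip (\<lambda>x. alpha_mat k *v weak_partial k f x) g = - ip f (\<lambda>x. alpha_mat k *v weak_partial k g x)" for k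
  proof -
    have "is_weak_partial k (\<lambda>x. alpha_mat k *v g x) (\<lambda>x. alpha_mat k *v weak_partial k g x)"
      unfolding is_weak_partial_iff[OF alpha_L2[OF H1_L2[OF g]] alpha_L2[OF weak_partial_H1(1)[OF g]]]
    proof (intro allI impI)
      fix \<eta> and c :: "complex^4" assume t: "test_function \<eta>"
      have e: "alpha_mat k *v (r *\<^sub>R c) = r *\<^sub>R (alpha_mat k *v c)" for r
        using bounded_linear.linear[OF alpha_linear] by (rule linear_cmul)
      show "ip (\<lambda>x. alpha_mat k *v g x) (\<lambda>x. partial_deriv k \<eta> x *\<^sub>R c) = - ip (\<lambda>x. alpha_mat k *v weak_partial k g x) (\<lambda>x. \<eta> x *\<^sub>R c)"
        using weak_partial_H1[OF g, of k] t is_weak_partial_iff[OF H1_L2[OF g]] by (simp add: ip_alpha e)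
    qed
    from weak_partial_skew[OF H1_L2[OF f] weak_partial_H1(1)[OF f] alpha_L2[OF H1_L2[OF g]] alpha_L2[OF weak_partial_H1(1)[OF g]] weak_partial_H1(2)[OF f] this]
    show ?thesis by (simp add: ip_alpha)
  qed
  then show ?thesis unfolding skew_dirac_def
    by (simp add: ip_minus_left ip_minus_right ip_sum_left ip_sum_right alpha_L2 weak_partial_H1 f g H1_L2 sum_negf)
qed

lemma skew_dirac_self: "f \<in> H1 \<Longrightarrow> ip (skew_dirac f) f = 0"
  using skew_dirac_skew[of f f] by (simp add: ip_commute)

lemma skew_dirac_C1c:
  assumes C: "C1c G DG"
  shows "AE x in lborel. skew_dirac G x = - (\<Sum>k\<in>UNIV. alpha_mat k *v DG k x)"
proof -
  have "AE x in lborel. \<forall>k\<in>UNIV. weak_partial k G x = DG k x"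
    by (rule AE_finite_allI) (auto intro: weak_partial_AE C1c_H1[OF C] C1c_L2[OF C] C1c_weak_partial[OF C])
  then show ?thesis by eventually_elim (simp add: skew_dirac_def)
qed

text \<open>Closedness of the Dirac operator: each side of the weak identity is continuous in
  \<open>L2\<close>.\<close>

lemma weak_dirac_limit:
  assumes f: "\<And>n. f n \<in> L2" "F \<in> L2" "(\<lambda>n. L2_norm (\<lambda>x. f n x - F x)) \<longlonglongrightarrow> 0"
    and g: "\<And>n. g n \<in> L2" "G \<in> L2" "(\<lambda>n. L2_norm (\<lambda>x. g n x - G x)) \<longlonglongrightarrow> 0"
    and w: "\<And>n. weak_dirac (f n) (g n)"
  shows "weak_dirac F G"
  unfolding weak_dirac_def
proof (intro allI impI)
  fix \<eta> and c :: "complex^4" assume t: "test_function \<eta>"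
  note T = test_scaleR_C1c[OF t, of c]
  have "(\<lambda>n. \<Sum>k\<in>UNIV. ip (f n) (\<lambda>x. alpha_mat k *v (partial_deriv k \<eta> x *\<^sub>R c)))
      \<longlonglongrightarrow> (\<Sum>k\<in>UNIV. ip F (\<lambda>x. alpha_mat k *v (partial_deriv k \<eta> x *\<^sub>R c)))"
    by (intro tendsto_sum tendsto_ip_left f alpha_L2 C1c_L2(2)[OF T])
  moreover have "(\<lambda>n. ip (g n) (\<lambda>x. \<eta> x *\<^sub>R c)) \<longlonglongrightarrow> ip G (\<lambda>x. \<eta> x *\<^sub>R c)"
    by (intro tendsto_ip_left g C1c_L2(1)[OF T])
  ultimately show "(\<Sum>k\<in>UNIV. ip (\<lambda>x. alpha_mat k *v F x) (\<lambda>x. partial_deriv k \<eta> x *\<^sub>R c)) = ip G (\<lambda>x. \<eta> x *\<^sub>R c)"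
    using w t LIMSEQ_unique unfolding weak_dirac_def ip_alpha by auto
qed

subsection \<open>Polar coordinates\<close>

text \<open>Lebesgue measure is split into images of itself: \<open>rad\<close> carries the density
  \<open>4 * pi * r\<^sup>2\<close> implicitly, and \<open>sph\<close>, the image of the uniform
  measure on the unit ball, is the surface measure normalised to mass 1.\<close>

definition rad :: "real measure" where "rad = distr lborel borel (norm :: real^3 \<Rightarrow> real)"

definition sph :: "(real^3) measure" where
  "sph = distr (uniform_measure lborel (cball 0 1)) borel sgn"

lemma cball_finite: "emeasure lborel (cball (0::real^3) R) < \<infinity>"
  using emeasure_bounded_finite[OF bounded_cball] by simp

lemma cball_nonzero: "emeasure lborel (cball (0::real^3) 1) \<noteq> 0"
proof
  assume "emeasure lborel (cball (0::real^3) 1) = 0"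
  then have "measure lborel (cball (0::real^3) 1) = 0" by (simp add: measure_def)
  then show False using content_cball_pos[of 1 "0::real^3"] by simp
qed

lemma sets_sph [measurable_cong, simp]: "sets sph = sets borel" "space sph = UNIV"
  by (simp_all add: sph_def)

lemma sets_rad [measurable_cong, simp]: "sets rad = sets borel" "space rad = UNIV"
  by (simp_all add: rad_def)

lemma emeasure_sph:
  assumes B: "B \<in> sets borel"
  shows "emeasure sph B = emeasure lborel {x \<in> cball 0 1. sgn x \<in> B} / emeasure lborel (cball (0::real^3) 1)"
proof -
  have [measurable]: "B \<in> sets borel" by (rule B)
  have "emeasure sph B = emeasure (uniform_measure lborel (cball 0 1)) (sgn -` B)"
    unfolding sph_def by (subst emeasure_distr) (auto simp: B)
  also have "\<dots> = emeasure lborel (cball 0 1 \<inter> sgn -` B) / emeasure lborel (cball (0::real^3) 1)"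
    by (rule emeasure_uniform_measure) (auto intro: measurable_sets_borel[OF borel_measurable_sgn B])
  also have "cball 0 1 \<inter> sgn -` B = {x \<in> cball (0::real^3) 1. sgn x \<in> B}" by auto
  finally show ?thesis .
qed

lemma emeasure_sph_UNIV: "emeasure sph UNIV = 1"
proof -
  have "{x \<in> cball (0::real^3) 1. sgn x \<in> UNIV} = cball 0 1" by auto
  then show ?thesis
    using cball_finite[of 1] cball_nonzero by (simp only: emeasure_sph borel_open[OF open_UNIV]) (simp add: ennreal_divide_self)
qed

interpretation sph: finite_measure sph
  by (rule finite_measureI) (simp add: emeasure_sph_UNIV)

lemma emeasure_rad_atMost: "emeasure rad {..R} = emeasure lborel (cball (0::real^3) R)"
proof -
  have "emeasure rad {..R} = emeasure lborel (norm -` {..R} \<inter> space (lborel :: (real^3) measure))"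
    unfolding rad_def by (rule emeasure_distr) auto
  also have "norm -` {..R} \<inter> space (lborel :: (real^3) measure) = cball 0 R" by (auto simp: dist_norm)
  finally show ?thesis .
qed

interpretation rad: sigma_finite_measure rad
proof
  show "\<exists>A. countable A \<and> A \<subseteq> sets rad \<and> \<Union> A = space rad \<and> (\<forall>a\<in>A. emeasure rad a \<noteq> \<infinity>)"
  proof (intro exI conjI)
    show "countable (range (\<lambda>n. {..real n}))" by simp
    show "\<Union> (range (\<lambda>n. {..real n})) = space rad" using real_arch_simple by auto
    show "\<forall>a\<in>range (\<lambda>n. {..real n}). emeasure rad a \<noteq> \<infinity>"
      using cball_finite by (auto simp: emeasure_rad_atMost less_top)
  qed auto
qed

interpretation polar: pair_sigma_finite rad sph ..

text \<open>By scaling, a cone takes up the same fraction of every ball around the origin; this is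
  the independence of radius and direction.\<close>

lemma emeasure_sector:
  assumes B: "B \<in> sets borel"
  shows "emeasure lborel {x \<in> cball 0 R. sgn x \<in> B} = emeasure lborel (cball (0::real^3) R) * emeasure sph B"
proof -
  have [measurable]: "B \<in> sets borel" by (rule B)
  have scale: "emeasure lborel {x \<in> cball 0 R. sgn x \<in> B} = ennreal (R ^ 3) * emeasure lborel {x \<in> cball (0::real^3) 1. sgn x \<in> B}"
    if R: "R > 0" and B: "B \<in> sets borel" for B
  proof -
    have m: "{x \<in> cball (0::real^3) R. sgn x \<in> B} \<in> sets borel" for R using B by measurable
    have "(lborel :: (real^3) measure) = density (distr lborel borel (\<lambda>x. R *\<^sub>R x)) (\<lambda>_. R ^ 3)"
      using lborel_affine[of R "0::real^3"] R by simp
    then have "emeasure lborel {x \<in> cball (0::real^3) R. sgn x \<in> B}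
        = emeasure (density (distr lborel borel (\<lambda>x. R *\<^sub>R x)) (\<lambda>_. R ^ 3)) {x \<in> cball (0::real^3) R. sgn x \<in> B}"
      by (rule arg_cong)
    also have "\<dots> = ennreal (R ^ 3) * emeasure (distr lborel borel (\<lambda>x. R *\<^sub>R x)) {x \<in> cball (0::real^3) R. sgn x \<in> B}"
      by (rule emeasure_density_const) (use m in simp)
    also have "emeasure (distr lborel borel (\<lambda>x. R *\<^sub>R x)) {x \<in> cball (0::real^3) R. sgn x \<in> B}
        = emeasure lborel ((\<lambda>x. R *\<^sub>R x) -` {x \<in> cball (0::real^3) R. sgn x \<in> B} \<inter> space lborel)"
      by (rule emeasure_distr) (use m in auto)
    also have "(\<lambda>x. R *\<^sub>R x) -` {x \<in> cball (0::real^3) R. sgn x \<in> B} \<inter> space lborel = {x \<in> cball 0 1. sgn x \<in> B}"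
      using R by (auto simp: dist_norm sgn_scaleR)
    finally show ?thesis .
  qed
  show ?thesis
  proof (cases "R > 0")
    case True
    have c: "emeasure lborel (cball (0::real^3) R) = ennreal (R ^ 3) * emeasure lborel (cball (0::real^3) 1)"
    proof -
      have "{x \<in> cball (0::real^3) R. sgn x \<in> UNIV} = cball 0 R" for R by auto
      then show ?thesis using scale[OF True, of UNIV] by (simp only: borel_open[OF open_UNIV])
    qed
    have "emeasure lborel {x \<in> cball (0::real^3) 1. sgn x \<in> B} = emeasure lborel (cball (0::real^3) 1) * emeasure sph B"
      unfolding emeasure_sph[OF B] ennreal_times_divide
      by (subst mult.commute, rule mult_divide_eq_ennreal[symmetric]) (use cball_finite[of 1] cball_nonzero in auto)
    then show ?thesis using scale[OF True B] c by (simp add: mult.assoc)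
  next
    \<comment> \<open>For a nonpositive radius the ball has at most one point, and both sides
      vanish.\<close>
    case False
    have "cball (0::real^3) R \<subseteq> {0}"
    proof
      fix x :: "real^3" assume "x \<in> cball 0 R"
      then have "norm x \<le> 0" using False unfolding mem_cball_0 by linarith
      then show "x \<in> {0}" by simp
    qed
    moreover have z: "emeasure lborel A = 0" if "A \<subseteq> {0::real^3}" for A
      using that emeasure_lborel_singleton[of "0::real^3"] subset_singletonD by fastforce
    moreover from calculation have "{x \<in> cball (0::real^3) R. sgn x \<in> B} \<subseteq> {0}" by blast
    ultimately show ?thesis by (simp only: z mult_zero_left)
  qed
qed

text \<open>For a fixed set of directions, the two measures in the radius agree on all half lines
  \<open>{..R}\<close> by \<open>emeasure_sector\<close>, and these generate the Borel sets.\<close>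

lemma polar_measure: "rad \<Otimes>\<^sub>M sph = distr lborel (borel \<Otimes>\<^sub>M borel) (\<lambda>x. (norm x, sgn x))"
proof (rule pair_measure_eqI)
  show "sets (rad \<Otimes>\<^sub>M sph) = sets (distr lborel (borel \<Otimes>\<^sub>M borel) (\<lambda>x. (norm x, sgn x)))"
    by (simp cong: sets_pair_measure_cong)
  fix A B assume "A \<in> sets rad" "B \<in> sets sph"
  then have A: "A \<in> sets borel" and B [measurable]: "B \<in> sets borel" by simp_all
  define S where "S = {x::real^3. sgn x \<in> B}"
  have S [measurable]: "S \<in> sets borel" unfolding S_def by measurable
  have "distr (density lborel (indicator S)) borel norm = density rad (\<lambda>_. emeasure sph B)" (is "?M = ?N")
  proof (rule measure_eqI_generator_eq)
    show "Int_stable (range (\<lambda>a. {..a::real}))" by (auto simp: Int_stable_def)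
    show "range (\<lambda>a. {..a::real}) \<subseteq> Pow UNIV" by auto
    show "sets ?M = sigma_sets UNIV (range (\<lambda>a. {..a::real}))" "sets ?N = sigma_sets UNIV (range (\<lambda>a. {..a::real}))"
      by (simp_all add: borel_eq_atMost)
    have M: "emeasure ?M {..R} = emeasure lborel {x \<in> cball (0::real^3) R. sgn x \<in> B}" for R
    proof -
      have "emeasure ?M {..R} = emeasure (density lborel (indicator S)) (norm -` {..R} \<inter> space (lborel :: (real^3) measure))"
        by (subst emeasure_distr) auto
      also have "norm -` {..R} \<inter> space (lborel :: (real^3) measure) = cball 0 R" by (auto simp: dist_norm)
      also have "emeasure (density lborel (indicator S)) (cball (0::real^3) R) = (\<integral>\<^sup>+x. indicator S x * indicator (cball 0 R) x \<partial>lborel)"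
        by (rule emeasure_density) auto
      also have "\<dots> = (\<integral>\<^sup>+x. indicator {x \<in> cball (0::real^3) R. sgn x \<in> B} x \<partial>lborel)"
        by (rule nn_integral_cong) (auto simp: indicator_def S_def)
      also have "\<dots> = emeasure lborel {x \<in> cball (0::real^3) R. sgn x \<in> B}" by (rule nn_integral_indicator) measurable
      finally show ?thesis .
    qed
    show "emeasure ?M X = emeasure ?N X" if XR: "X \<in> range (\<lambda>a. {..a::real})" for X
    proof -
      obtain a where X: "X = {..a}" using XR by auto
      have "emeasure ?N {..a} = emeasure sph B * emeasure rad {..a}" by (rule emeasure_density_const) simp
      then show ?thesis by (simp only: X M emeasure_sector[OF B] emeasure_rad_atMost mult.commute)
    qed
    show "range (\<lambda>n::nat. {..real n}) \<subseteq> range (\<lambda>a. {..a::real})" by auto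
    show "(\<Union>n::nat. {..real n}) = UNIV" using real_arch_simple by auto
    show "emeasure ?M {..real n} \<noteq> \<infinity>" for n
    proof -
      have "emeasure lborel {x \<in> cball (0::real^3) (real n). sgn x \<in> B} \<le> emeasure lborel (cball (0::real^3) (real n))"
        by (rule emeasure_mono) auto
      then show ?thesis using cball_finite[of "real n"] by (auto simp: M top_unique)
    qed
  qed
  then have "emeasure ?M A = emeasure ?N A" by simp
  moreover have "emeasure ?N A = emeasure rad A * emeasure sph B"
    using A by (simp add: emeasure_density_const mult.commute)
  moreover have "emeasure ?M A = emeasure (distr lborel (borel \<Otimes>\<^sub>M borel) (\<lambda>x. (norm x, sgn x :: real^3))) (A \<times> B)"
  proof -
    have nA: "norm -` A \<in> sets (borel :: (real^3) measure)" by (rule measurable_sets_borel[OF _ A]) simp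
    have "emeasure ?M A = emeasure (density lborel (indicator S)) (norm -` A)"
      using A by (subst emeasure_distr) auto
    also have "\<dots> = (\<integral>\<^sup>+x. indicator S x * indicator (norm -` A) x \<partial>lborel)"
      by (rule emeasure_density) (use nA in auto)
    also have "\<dots> = (\<integral>\<^sup>+x. indicator (S \<inter> norm -` A) x \<partial>lborel)"
      by (rule nn_integral_cong) (auto simp: indicator_def)
    also have "\<dots> = emeasure lborel (S \<inter> norm -` A)" using nA by (intro nn_integral_indicator) auto
    also have "S \<inter> norm -` A = (\<lambda>x. (norm x, sgn x)) -` (A \<times> B) \<inter> space lborel" by (auto simp: S_def)
    also have "emeasure lborel \<dots> = emeasure (distr lborel (borel \<Otimes>\<^sub>M borel) (\<lambda>x. (norm x, sgn x))) (A \<times> B)"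
      by (rule emeasure_distr[symmetric]) (use A in auto)
    finally show ?thesis .
  qed
  ultimately show "emeasure rad A * emeasure sph B = emeasure (distr lborel (borel \<Otimes>\<^sub>M borel) (\<lambda>x. (norm x, sgn x))) (A \<times> B)"
    by simp
qed (rule rad.sigma_finite_measure_axioms sph.sigma_finite_measure_axioms)+

lemma norm_scaleR_sgn [simp]: "norm x *\<^sub>R sgn (x::real^3) = x"
  by (cases "x = 0") (simp_all add: sgn_div_norm)

lemma polar_nn:
  assumes [measurable]: "f \<in> borel_measurable borel"
  shows "(\<integral>\<^sup>+x. f x \<partial>lborel) = (\<integral>\<^sup>+r. \<integral>\<^sup>+w. f (r *\<^sub>R (w::real^3)) \<partial>sph \<partial>rad)"
proof -
  have "(\<integral>\<^sup>+r. \<integral>\<^sup>+w. f (r *\<^sub>R (w::real^3)) \<partial>sph \<partial>rad) = (\<integral>\<^sup>+p. f (fst p *\<^sub>R snd p) \<partial>(rad \<Otimes>\<^sub>M sph))"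
    using sph.nn_integral_fst[of "\<lambda>p. f (fst p *\<^sub>R snd p)" rad] by simp
  also have "\<dots> = (\<integral>\<^sup>+x. f (norm x *\<^sub>R sgn x) \<partial>lborel)"
    unfolding polar_measure by (subst nn_integral_distr) auto
  finally show ?thesis by simp
qed

lemma polar_integral:
  fixes f :: "real^3 \<Rightarrow> 'b::euclidean_space"
  assumes f: "integrable lborel f"
  shows "(\<integral>x. f x \<partial>lborel) = (\<integral>r. \<integral>w. f (r *\<^sub>R w) \<partial>sph \<partial>rad)"
proof -
  have [measurable]: "f \<in> borel_measurable borel" using f by auto
  have "integrable (rad \<Otimes>\<^sub>M sph) (\<lambda>p. f (fst p *\<^sub>R snd p))"
    unfolding polar_measure by (subst integrable_distr_eq) (auto simp: f)
  from polar.integral_fst'[OF this] have "(\<integral>r. \<integral>w. f (r *\<^sub>R w) \<partial>sph \<partial>rad) = (\<integral>p. f (fst p *\<^sub>R snd p) \<partial>(rad \<Otimes>\<^sub>M sph))"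
    by simp
  also have "\<dots> = (\<integral>x. f (norm x *\<^sub>R sgn x) \<partial>lborel)"
    unfolding polar_measure by (subst integral_distr) auto
  finally show ?thesis by simp
qed

lemma polar_AE:
  assumes "AE x in lborel. P (x::real^3)"
  shows "AE r in rad. AE w in sph. P (r *\<^sub>R w)"
proof -
  \<comment> \<open>\<open>P\<close> need not be measurable, so its failure set is first enclosed in
    a Borel null set.\<close>
  obtain N where N: "{x. \<not> P x} \<subseteq> N" "N \<in> sets borel" "emeasure lborel N = 0"
    using AE_E[OF assms] by auto
  have [measurable]: "N \<in> sets borel" by (rule N)
  have "AE x in lborel. x \<notin> N" using N by (intro AE_not_in) (auto simp: null_sets_def)
  then have "AE x in lborel. (\<lambda>p. fst p *\<^sub>R snd p \<notin> N) (norm x, sgn x)" by simp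
  then have "AE p in rad \<Otimes>\<^sub>M sph. fst p *\<^sub>R snd p \<notin> N"
    unfolding polar_measure by (subst AE_distr_iff) auto
  from polar.AE_pair[OF this] show ?thesis
    by eventually_elim (use N(1) in \<open>auto elim!: eventually_mono\<close>)
qed

text \<open>Here \<open>P\<close> has to be measurable: null slices make a measurable set null, by
  Fubini's theorem.\<close>

lemma polar_AE_converse:
  assumes [measurable]: "Measurable.pred borel P" and "AE r in rad. AE w in sph. P (r *\<^sub>R w)"
  shows "AE x in lborel. P (x::real^3)"
proof -
  have "AE p in rad \<Otimes>\<^sub>M sph. P (fst p *\<^sub>R snd p)"
  proof (rule polar.AE_pair_measure)
    have "Measurable.pred (rad \<Otimes>\<^sub>M sph) (\<lambda>p. P (fst p *\<^sub>R snd p))" by measurable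
    then show "{p \<in> space (rad \<Otimes>\<^sub>M sph). P (fst p *\<^sub>R snd p)} \<in> sets (rad \<Otimes>\<^sub>M sph)" by (simp add: pred_def)
  qed (use assms(2) in simp)
  then have "AE x in lborel. P (norm x *\<^sub>R sgn x)"
    unfolding polar_measure by (subst (asm) AE_distr_iff) auto
  then show ?thesis by simp
qed

lemma rad_AE: "AE r in rad. P r \<Longrightarrow> AE x in lborel. P (norm (x::real^3))"
  unfolding rad_def by (rule AE_distrD) auto

lemma rad_pos: "AE r in rad. r > 0"
  unfolding rad_def using AE_lborel_singleton[of "0::real^3"] by (subst AE_distr_iff) auto

lemma sph_norm: "AE w in sph. norm w = 1"
proof -
  have "AE x in lborel. x \<in> cball (0::real^3) 1 \<longrightarrow> norm (sgn x) = 1"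
    using AE_lborel_singleton[of "0::real^3"] by eventually_elim (simp add: norm_sgn)
  then have "AE x in uniform_measure lborel (cball (0::real^3) 1). norm (sgn x) = 1"
    by (intro AE_uniform_measureI) auto
  then show ?thesis unfolding sph_def by (subst AE_distr_iff) auto
qed

text \<open>Off a null set the variable has norm 1, which bounds the integrands.\<close>

lemma sph_integral_continuous:
  fixes G :: "real \<Rightarrow> real^3 \<Rightarrow> real"
  assumes m: "\<And>t. G t \<in> borel_measurable borel" and b: "\<And>t. AE w in sph. \<bar>G t w\<bar> \<le> B"
    and c: "\<And>w. continuous_on UNIV (\<lambda>t. G t w)"
  shows "continuous_on UNIV (\<lambda>t. \<integral>w. G t w \<partial>sph)"
proof (rule continuous_at_imp_continuous_on, rule ballI)
  fix t :: real
  have m': "G t \<in> borel_measurable sph" for t using m[of t] by (simp add: measurable_def)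
  show "isCont (\<lambda>t. \<integral>w. G t w \<partial>sph) t"
    unfolding isCont_def tendsto_at_iff_sequentially comp_def
  proof (intro allI impI)
    fix X assume X: "\<forall>i. X i \<in> UNIV - {t}" "X \<longlonglongrightarrow> t"
    show "(\<lambda>n. \<integral>w. G (X n) w \<partial>sph) \<longlonglongrightarrow> (\<integral>w. G t w \<partial>sph)"
    proof (rule integral_dominated_convergence[where w="\<lambda>_. B"])
      show "AE w in sph. (\<lambda>n. G (X n) w) \<longlonglongrightarrow> G t w"
        using continuous_on_tendsto_compose[OF c X(2)] by auto
      show "AE w in sph. norm (G (X n) w) \<le> B" for n using b[of "X n"] by simp
    qed (use m' in auto)
  qed
qed

text \<open>In the bound on the derivative the exceptional directions are the same for all
  \<open>t\<close>, since the mean value inequality for a fixed direction uses a whole segment of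
  values of \<open>t\<close>.\<close>

lemma sph_integral_deriv:
  fixes F F' :: "real \<Rightarrow> real^3 \<Rightarrow> real"
  assumes m: "\<And>t. F t \<in> borel_measurable borel" "\<And>t. F' t \<in> borel_measurable borel"
    and b: "AE w in sph. \<forall>t. \<bar>F' t w\<bar> \<le> B" "\<And>t. AE w in sph. \<bar>F t w\<bar> \<le> C"
    and d: "\<And>t w. ((\<lambda>t. F t w) has_real_derivative F' t w) (at t)"
  shows "((\<lambda>t. \<integral>w. F t w \<partial>sph) has_real_derivative (\<integral>w. F' t w \<partial>sph)) (at t)"
  unfolding DERIV_def tendsto_at_iff_sequentially comp_def
proof (intro allI impI)
  have m': "F t \<in> borel_measurable sph" "F' t \<in> borel_measurable sph" for t
    using m[of t] by (simp_all add: measurable_def)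
  have i: "integrable sph (F t)" for t
    by (rule sph.integrable_const_bound[of _ C]) (use b(2) m' in auto)
  fix X :: "nat \<Rightarrow> real" assume X: "\<forall>i. X i \<in> UNIV - {0}" "X \<longlonglongrightarrow> 0"
  have "(\<lambda>n. \<integral>w. (F (t + X n) w - F t w) / X n \<partial>sph) \<longlonglongrightarrow> (\<integral>w. F' t w \<partial>sph)"
  proof (rule integral_dominated_convergence[where w="\<lambda>_. B"])
    show "AE w in sph. (\<lambda>n. (F (t + X n) w - F t w) / X n) \<longlonglongrightarrow> F' t w"
    proof (rule AE_I2)
      fix w
      show "(\<lambda>n. (F (t + X n) w - F t w) / X n) \<longlonglongrightarrow> F' t w"
        using d[of w t] X unfolding DERIV_def tendsto_at_iff_sequentially comp_def by auto
    qed
    show "AE w in sph. norm ((F (t + X n) w - F t w) / X n) \<le> B" for n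
      using b(1)
    proof eventually_elim
      case (elim w)
      have "norm (F (t + X n) w - F t w) \<le> B * norm (t + X n - t)"
        by (rule field_differentiable_bound[of UNIV "\<lambda>t. F t w" "\<lambda>t. F' t w"]) (use d elim in auto)
      then show ?case using X(1) by (simp add: divide_le_eq)
    qed
  qed (use m' in auto)
  then show "(\<lambda>n. ((\<integral>w. F (t + X n) w \<partial>sph) - (\<integral>w. F t w \<partial>sph)) / X n) \<longlonglongrightarrow> (\<integral>w. F' t w \<partial>sph)"
    using i by simp
qed

subsection \<open>Orthonormal systems on the sphere\<close>

definition sp :: "(real^3 \<Rightarrow> complex^4) \<Rightarrow> (real^3 \<Rightarrow> complex^4) \<Rightarrow> real" where
  "sp u v = (\<integral>w. u w \<bullet> v w \<partial>sph)"

text \<open>The origin is exempted because an angular field has in general no limit there;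
  \<open>sph\<close> does not charge it.\<close>

definition sphb :: "(real^3 \<Rightarrow> complex^4) \<Rightarrow> bool" where
  "sphb u \<longleftrightarrow> u \<in> borel_measurable borel \<and> (\<exists>B. \<forall>x. x \<noteq> 0 \<longrightarrow> norm (u x) \<le> B)"

lemma sph_nonzero: "AE w in sph. w \<noteq> 0"
  using sph_norm by eventually_elim auto

lemma sphb_integrable:
  assumes u: "sphb u" and v: "sphb v"
  shows "integrable sph (\<lambda>w. u w \<bullet> v w)"
proof -
  obtain B C where B: "\<And>x. x \<noteq> 0 \<Longrightarrow> norm (u x) \<le> B" and C: "\<And>x. x \<noteq> 0 \<Longrightarrow> norm (v x) \<le> C"
    using u v unfolding sphb_def by blast
  have [measurable]: "u \<in> borel_measurable borel" "v \<in> borel_measurable borel" using u v by (auto simp: sphb_def)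
  show ?thesis
  proof (rule sph.integrable_const_bound[of _ "B * C"])
    show "AE w in sph. norm (u w \<bullet> v w) \<le> B * C"
      using sph_nonzero
    proof eventually_elim
      case (elim w)
      have "\<bar>u w \<bullet> v w\<bar> \<le> norm (u w) * norm (v w)" by (rule Cauchy_Schwarz_ineq2)
      also have "\<dots> \<le> B * C" by (intro mult_mono B C elim order_trans[OF norm_ge_zero B[OF elim]]) auto
      finally show ?case by simp
    qed
  qed measurable
qed

lemma sphb_sum:
  assumes "\<And>i. i \<in> I \<Longrightarrow> sphb (u i)" shows "sphb (\<lambda>x. \<Sum>i\<in>I. c i *\<^sub>R u i x)"
proof -
  obtain B where B: "\<And>i x. i \<in> I \<Longrightarrow> x \<noteq> 0 \<Longrightarrow> norm (u i x) \<le> B i" using assms unfolding sphb_def by metis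
  have "norm (\<Sum>i\<in>I. c i *\<^sub>R u i x) \<le> (\<Sum>i\<in>I. \<bar>c i\<bar> * B i)" if "x \<noteq> 0" for x
    by (intro sum_norm_le) (use B[OF _ that] in \<open>auto intro: mult_left_mono\<close>)
  moreover have "(\<lambda>x. \<Sum>i\<in>I. c i *\<^sub>R u i x) \<in> borel_measurable borel"
    using assms by (intro borel_measurable_sum borel_measurable_scaleR) (auto simp: sphb_def)
  ultimately show ?thesis unfolding sphb_def by blast
qed

lemma sp_sum_left: "(\<And>i. i \<in> I \<Longrightarrow> sphb (u i)) \<Longrightarrow> sphb v \<Longrightarrow> sp (\<lambda>x. \<Sum>i\<in>I. c i *\<^sub>R u i x) v = (\<Sum>i\<in>I. c i * sp (u i) v)"
  unfolding sp_def by (simp add: inner_sum_left sphb_integrable)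

lemma sp_commute: "sp u v = sp v u"
  by (simp add: sp_def inner_commute)

text \<open>The given fields may be dependent, so a remainder of norm 0 is dropped instead of
  normalised. Such a remainder vanishes only almost everywhere, which is why the last expansion is
  stated almost everywhere, while each \<open>g p\<close> is an exact combination.\<close>

lemma gram_schmidt:
  fixes f :: "'i::finite \<Rightarrow> real^3 \<Rightarrow> complex^4"
  assumes f: "\<And>i. sphb (f i)"
  shows "\<exists>m g. (\<forall>p<(m::nat). \<exists>c. g p = (\<lambda>x. \<Sum>i\<in>UNIV. c i *\<^sub>R f i x))
     \<and> (\<forall>p<m. \<forall>q<m. sp (g p) (g q) = (if p = q then 1 else 0))
     \<and> (\<forall>i\<in>I. \<exists>d. AE w in sph. f i w = (\<Sum>p<m. d p *\<^sub>R g p w))"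
proof -
  have "finite I" by simp
  then show ?thesis
  proof induction
    case empty
    show ?case by (rule exI[of _ 0]) simp
  next
    case (insert i I)
    from insert.IH obtain m g where G: "\<forall>p<(m::nat). \<exists>c. g p = (\<lambda>x. \<Sum>i\<in>UNIV. c i *\<^sub>R f i x)"
      "\<forall>p<m. \<forall>q<m. sp (g p) (g q) = (if p = q then 1 else 0)"
      "\<forall>i\<in>I. \<exists>d. AE w in sph. f i w = (\<Sum>p<m. d p *\<^sub>R g p w)"
      by (elim exE conjE) (rule that)
    note g = G(1)[rule_format] G(2)[rule_format] G(3)[rule_format]
    obtain c where c: "\<And>p. p < m \<Longrightarrow> g p = (\<lambda>x. \<Sum>i\<in>UNIV. c p i *\<^sub>R f i x)" using g(1) by metis
    have gb: "sphb (g p)" if "p < m" for p using c[OF that] sphb_sum[of UNIV f] f by simp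
    define s where "s p = sp (f i) (g p)" for p
    \<comment> \<open>The remainder is kept as an explicit combination of the original fields, so
      that homogeneity and derivatives pass to the new system at every point.\<close>
    define cr where "cr j = (if j = i then 1 else 0) - (\<Sum>p<m. s p * c p j)" for j
    define r where "r x = (\<Sum>j\<in>UNIV. cr j *\<^sub>R f j x)" for x
    have r: "r x = f i x - (\<Sum>p<m. s p *\<^sub>R g p x)" for x
    proof -
      have "(\<Sum>p<m. s p *\<^sub>R g p x) = (\<Sum>p<m. \<Sum>j\<in>UNIV. (s p * c p j) *\<^sub>R f j x)"
        by (rule sum.cong) (auto simp: c scaleR_sum_right)
      also have "\<dots> = (\<Sum>j\<in>UNIV. (\<Sum>p<m. s p * c p j) *\<^sub>R f j x)"
        by (subst sum.swap) (simp add: scaleR_sum_left)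
      finally have e: "(\<Sum>p<m. s p *\<^sub>R g p x) = (\<Sum>j\<in>UNIV. (\<Sum>p<m. s p * c p j) *\<^sub>R f j x)" .
      have "(\<Sum>j\<in>UNIV. (if j = i then 1 else 0) *\<^sub>R f j x) = (\<Sum>j\<in>UNIV. if j = i then f j x else 0)"
        by (rule sum.cong) auto
      then show ?thesis unfolding r_def cr_def e by (simp add: scaleR_diff_left sum_subtractf)
    qed
    have rb: "sphb r" unfolding r_def by (rule sphb_sum) (rule f)
    have rg: "sp r (g q) = 0" if "q < m" for q
    proof -
      have "sp r (g q) = sp (f i) (g q) - (\<Sum>p<m. s p * sp (g p) (g q))"
      proof -
        have "sp r (g q) = (\<integral>w. f i w \<bullet> g q w - (\<Sum>p<m. s p *\<^sub>R g p w) \<bullet> g q w \<partial>sph)"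
          unfolding sp_def by (simp add: r inner_diff_left)
        also have "\<dots> = sp (f i) (g q) - sp (\<lambda>x. \<Sum>p<m. s p *\<^sub>R g p x) (g q)"
          unfolding sp_def by (rule Bochner_Integration.integral_diff) (auto intro!: sphb_integrable f gb that sphb_sum)
        finally show ?thesis using sp_sum_left[of "{..<m}" g "g q" s] gb that by simp
      qed
      also have "(\<Sum>p<m. s p * sp (g p) (g q)) = (\<Sum>p<m. if p = q then s p else 0)"
        by (rule sum.cong) (use g(2) that in auto)
      finally show ?thesis using that by (simp add: s_def)
    qed
    show ?case
    proof (cases "sp r r = 0")
      case True
      have "AE w in sph. r w \<bullet> r w = 0"
        using integral_nonneg_eq_0_iff_AE[OF sphb_integrable[OF rb rb]] True by (simp add: sp_def)
      then have "AE w in sph. f i w = (\<Sum>p<m. s p *\<^sub>R g p w)"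
        by eventually_elim (simp add: r)
      then show ?thesis using g by (intro exI[of _ m] exI[of _ g]) auto
    next
      case False
      have rr: "sp r r > 0" using False unfolding sp_def by (simp add: order_less_le)
      define n where "n = sqrt (sp r r)"
      have n: "n > 0" "n * n = sp r r" using rr by (simp_all add: n_def)
      define g' where "g' = g(m := (\<lambda>x. inverse n *\<^sub>R r x))"
      have g'm: "g' m = (\<lambda>x. inverse n *\<^sub>R r x)" and g'p: "p < m \<Longrightarrow> g' p = g p" for p
        by (auto simp: g'_def)
      have sp1: "sp (g' m) v = inverse n * sp r v" for v unfolding g'm by (simp add: sp_def)
      have "\<exists>c. g' p = (\<lambda>x. \<Sum>i\<in>UNIV. c i *\<^sub>R f i x)" if "p < Suc m" for p
      proof (cases "p = m")
        case True
        then show ?thesis unfolding g'm r_def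
          by (intro exI[of _ "\<lambda>j. inverse n * cr j"]) (simp add: g'm r_def scaleR_sum_right)
      qed (use that g(1)[of p] g'p in auto)
      moreover have "sp (g' p) (g' q) = (if p = q then 1 else 0)" if "p < Suc m" "q < Suc m" for p q
      proof -
        have mm: "sp (g' m) (g' m) = 1"
        proof -
          have "sp (g' m) (g' m) = inverse n * (inverse n * (n * n))"
            unfolding n(2) using sp1[of "g' m"] sp1[of r] sp_commute[of r "g' m"] by simp
          also have "\<dots> = 1" using n(1) by (simp add: field_simps)
          finally show ?thesis .
        qed
        have pm: "sp (g' m) (g' q) = 0" if "q < m" for q using that by (simp add: sp1 g'p rg)
        show ?thesis using that mm pm[of q] pm[of p] g(2)[of p q] sp_commute[of "g' p" "g' q"]
          by (cases "p = m"; cases "q = m") (auto simp: g'p)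
      qed
      moreover have "\<exists>d. AE w in sph. f j w = (\<Sum>p<Suc m. d p *\<^sub>R g' p w)" if j: "j \<in> insert i I" for j
      proof (cases "j = i")
        case True
        have "f i w = (\<Sum>p<Suc m. (s(m := n)) p *\<^sub>R g' p w)" for w
        proof -
          have "(\<Sum>p<m. (s(m := n)) p *\<^sub>R g' p w) = (\<Sum>p<m. s p *\<^sub>R g p w)" by (rule sum.cong) (auto simp: g'p)
          then show ?thesis using n(1) by (simp add: g'm r)
        qed
        then show ?thesis unfolding True by (intro exI[of _ "s(m := n)"] AE_I2)
      next
        case False
        then obtain d where d: "AE w in sph. f j w = (\<Sum>p<m. d p *\<^sub>R g p w)" using j g(3) by auto
        have "(\<Sum>p<Suc m. (d(m := 0)) p *\<^sub>R g' p w) = (\<Sum>p<m. d p *\<^sub>R g p w)" for w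
          by (simp, rule sum.cong) (auto simp: g'p)
        then show ?thesis using d by (intro exI[of _ "d(m := 0)"]) simp
      qed
      ultimately show ?thesis by (intro exI[of _ "Suc m"] exI[of _ g']) blast
    qed
  qed
qed

subsection \<open>Dirac-invariant spaces of fields with prescribed angular dependence\<close>

lemma hom_sphb:
  assumes c: "continuous_on (- {0}) u" and h: "\<And>t x. t > 0 \<Longrightarrow> u (t *\<^sub>R x) = u x"
  shows "sphb u"
proof -
  have "compact (u ` sphere 0 1)"
    by (intro compact_continuous_image continuous_on_subset[OF c]) auto
  from compact_imp_bounded[OF this] obtain B where "\<forall>y\<in>u ` sphere 0 1. norm y \<le> B" unfolding bounded_iff by blast
  then have B: "norm (u x) \<le> B" if "norm x = 1" for x using that by simp
  have "norm (u x) \<le> B" if x: "x \<noteq> 0" for x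
  proof -
    have "u x = u (sgn x)" using h[of "inverse (norm x)" x] x by (simp add: sgn_div_norm)
    then show ?thesis using B[of "sgn x"] x by (simp add: norm_sgn)
  qed
  moreover have "u \<in> borel_measurable borel"
    by (rule borel_measurable_continuous_countable_exceptions[of "{0}"]) (auto intro: c)
  ultimately show ?thesis unfolding sphb_def by blast
qed

text \<open>For \<open>a(r) g\<close> the Dirac derivative has a part \<open>a'\<close> times the
  action of the unit radial matrix and a part \<open>a / r\<close> times \<open>r\<close> times the
  angular derivative. The two closure assumptions say exactly that both stay in the span, with
  constant coefficients.\<close>

locale sector =
  fixes m :: nat and g :: "nat \<Rightarrow> real^3 \<Rightarrow> complex^4" and dg :: "nat \<Rightarrow> 3 \<Rightarrow> real^3 \<Rightarrow> complex^4"
  assumes deriv: "\<And>p x. p < m \<Longrightarrow> x \<noteq> 0 \<Longrightarrow> (g p has_derivative (\<lambda>h. \<Sum>k\<in>UNIV. h$k *\<^sub>R dg p k x)) (at x)"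
    and dcont: "\<And>p k. p < m \<Longrightarrow> continuous_on (- {0}) (dg p k)"
    and hom: "\<And>p t x. p < m \<Longrightarrow> t > 0 \<Longrightarrow> g p (t *\<^sub>R x) = g p x"
    and ortho: "\<And>p q. p < m \<Longrightarrow> q < m \<Longrightarrow> sp (g p) (g q) = (if p = q then 1 else 0)"
    and closed_r: "\<And>p. p < m \<Longrightarrow> \<exists>c. AE x in lborel.
        (\<Sum>k\<in>UNIV. (x $ k / norm x) *\<^sub>R (alpha_mat k *v g p x)) = (\<Sum>q<m. c q *\<^sub>R g q x)"
    and closed_d: "\<And>p. p < m \<Longrightarrow> \<exists>c. AE x in lborel.
        norm x *\<^sub>R (\<Sum>k\<in>UNIV. alpha_mat k *v dg p k x) = (\<Sum>q<m. c q *\<^sub>R g q x)"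
begin

text \<open>The coefficients \<open>a\<close> are arbitrary functions of the radius; measurable
  versions arise only through \<open>coef\<close>.\<close>

definition form :: "(real^3 \<Rightarrow> complex^4) \<Rightarrow> bool" where
  "form \<rho> \<longleftrightarrow> (\<exists>a. AE x in lborel. \<rho> x = (\<Sum>p<m. a p (norm x) *\<^sub>R g p x))"

definition coef :: "nat \<Rightarrow> (real^3 \<Rightarrow> complex^4) \<Rightarrow> real \<Rightarrow> real" where
  "coef p \<rho> r = (\<integral>w. g p w \<bullet> \<rho> (r *\<^sub>R w) \<partial>sph)"

definition Q :: "(real^3 \<Rightarrow> complex^4) \<Rightarrow> real^3 \<Rightarrow> complex^4" where
  "Q \<rho> x = (\<Sum>p<m. coef p \<rho> (norm x) *\<^sub>R g p x)"

lemma g_cont: "p < m \<Longrightarrow> continuous_on (- {0}) (g p)"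
  by (intro continuous_at_imp_continuous_on) (auto dest: deriv has_derivative_continuous)

lemma g_sphb: "p < m \<Longrightarrow> sphb (g p)"
  by (rule hom_sphb) (auto intro: g_cont hom)

lemma g_measurable: "p < m \<Longrightarrow> g p \<in> borel_measurable borel"
  using g_sphb by (auto simp: sphb_def)

lemma g_bound: obtains B where "B \<ge> 0" "\<And>p x. p < m \<Longrightarrow> x \<noteq> 0 \<Longrightarrow> norm (g p x) \<le> B"
proof -
  have "\<forall>p. \<exists>B. p < m \<longrightarrow> (\<forall>x. x \<noteq> 0 \<longrightarrow> norm (g p x) \<le> B)" using g_sphb unfolding sphb_def by blast
  from choice[OF this] obtain B where B: "\<And>p x. p < m \<Longrightarrow> x \<noteq> 0 \<Longrightarrow> norm (g p x) \<le> B p" by blast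
  have "norm (g p x) \<le> (\<Sum>p<m. \<bar>B p\<bar>)" if p: "p < m" and x: "x \<noteq> 0" for p x
  proof -
    have "norm (g p x) \<le> \<bar>B p\<bar>" using B[OF p x] by simp
    also have "\<dots> \<le> (\<Sum>p<m. \<bar>B p\<bar>)" using p by (intro member_le_sum) auto
    finally show ?thesis .
  qed
  then show ?thesis using that[of "\<Sum>p<m. \<bar>B p\<bar>"] by (simp add: sum_nonneg)
qed

lemma coef_measurable: "p < m \<Longrightarrow> \<rho> \<in> borel_measurable borel \<Longrightarrow> coef p \<rho> \<in> borel_measurable borel"
proof -
  assume p: "p < m" and [measurable]: "\<rho> \<in> borel_measurable borel"
  have [measurable]: "g p \<in> borel_measurable borel" by (rule g_measurable[OF p])
  have "(\<lambda>r. \<integral>w. g p w \<bullet> \<rho> (r *\<^sub>R w) \<partial>sph) \<in> borel_measurable borel"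
    by (rule sph.borel_measurable_lebesgue_integral) measurable
  then show ?thesis by (simp add: coef_def[abs_def])
qed

text \<open>The Cauchy-Schwarz inequality on each sphere, which has mass 1, bounds the squared
  average by the average of the square; integrating over the radius restores the norm.\<close>

lemma coef_term_L2:
  assumes p: "p < m" and \<rho>: "\<rho> \<in> L2" and B: "B \<ge> 0" "\<And>x. x \<noteq> 0 \<Longrightarrow> norm (g p x) \<le> B"
  shows "(\<lambda>x. coef p \<rho> (norm x) *\<^sub>R g p x) \<in> L2"
proof -
  have [measurable]: "\<rho> \<in> borel_measurable borel" "g p \<in> borel_measurable borel"
    "coef p \<rho> \<in> borel_measurable borel"
    using \<rho> p g_measurable coef_measurable by auto
  have c: "ennreal ((coef p \<rho> r)\<^sup>2) \<le> ennreal (B\<^sup>2) * (\<integral>\<^sup>+w. ennreal ((norm (\<rho> (r *\<^sub>R w)))\<^sup>2) \<partial>sph)" for r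
  proof -
    have "ennreal \<bar>coef p \<rho> r\<bar> \<le> (\<integral>\<^sup>+w. ennreal B * ennreal (norm (\<rho> (r *\<^sub>R w))) \<partial>sph)"
    proof (cases "integrable sph (\<lambda>w. g p w \<bullet> \<rho> (r *\<^sub>R w))")
      case True
      have "ennreal \<bar>coef p \<rho> r\<bar> \<le> (\<integral>\<^sup>+w. ennreal \<bar>g p w \<bullet> \<rho> (r *\<^sub>R w)\<bar> \<partial>sph)"
        using integral_norm_bound_ennreal[OF True] by (simp add: coef_def)
      also have "\<dots> \<le> (\<integral>\<^sup>+w. ennreal B * ennreal (norm (\<rho> (r *\<^sub>R w))) \<partial>sph)"
      proof (rule nn_integral_mono_AE)
        show "AE w in sph. ennreal \<bar>g p w \<bullet> \<rho> (r *\<^sub>R w)\<bar> \<le> ennreal B * ennreal (norm (\<rho> (r *\<^sub>R w)))"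
          using sph_nonzero
        proof eventually_elim
          case (elim w)
          have "\<bar>g p w \<bullet> \<rho> (r *\<^sub>R w)\<bar> \<le> norm (g p w) * norm (\<rho> (r *\<^sub>R w))" by (rule Cauchy_Schwarz_ineq2)
          also have "\<dots> \<le> B * norm (\<rho> (r *\<^sub>R w))" by (intro mult_right_mono B elim) simp
          finally show ?case using B(1) by (simp add: ennreal_mult[symmetric] ennreal_leI)
        qed
      qed
      finally show ?thesis .
    \<comment> \<open>An average that does not exist has the default value 0, which satisfies the
      bound.\<close>
    qed (simp add: coef_def not_integrable_integral_eq)
    then have "(ennreal \<bar>coef p \<rho> r\<bar>)\<^sup>2 \<le> (\<integral>\<^sup>+w. ennreal B * ennreal (norm (\<rho> (r *\<^sub>R w))) \<partial>sph)\<^sup>2"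
      by (rule power_mono) simp
    also have "\<dots> \<le> (\<integral>\<^sup>+w. (ennreal B)\<^sup>2 \<partial>sph) * (\<integral>\<^sup>+w. (ennreal (norm (\<rho> (r *\<^sub>R w))))\<^sup>2 \<partial>sph)"
      by (rule Cauchy_Schwarz_nn_integral) measurable
    also have "(\<integral>\<^sup>+w. (ennreal B)\<^sup>2 \<partial>sph) = ennreal (B\<^sup>2)"
      using B(1) by (simp add: emeasure_sph_UNIV ennreal_power)
    finally show ?thesis by (simp add: ennreal_power)
  qed
  have "(\<integral>\<^sup>+x. ennreal ((norm (coef p \<rho> (norm x) *\<^sub>R g p x))\<^sup>2) \<partial>lborel)
      \<le> (\<integral>\<^sup>+x. ennreal (B\<^sup>2) * ennreal ((coef p \<rho> (norm (x::real^3)))\<^sup>2) \<partial>lborel)"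
  proof (rule nn_integral_mono_AE)
    show "AE x in lborel. ennreal ((norm (coef p \<rho> (norm x) *\<^sub>R g p x))\<^sup>2) \<le> ennreal (B\<^sup>2) * ennreal ((coef p \<rho> (norm x))\<^sup>2)"
      using AE_lborel_singleton[of "0::real^3"]
    proof eventually_elim
      case (elim x)
      have "(norm (g p x))\<^sup>2 \<le> B\<^sup>2" using B(2)[OF elim] by (intro power_mono) auto
      then have "(norm (coef p \<rho> (norm x) *\<^sub>R g p x))\<^sup>2 \<le> B\<^sup>2 * (coef p \<rho> (norm x))\<^sup>2"
        by (simp add: power_mult_distrib mult.commute mult_right_mono)
      then show ?case by (simp add: ennreal_mult[symmetric] ennreal_leI)
    qed
  qed
  also have "\<dots> = ennreal (B\<^sup>2) * (\<integral>\<^sup>+r. ennreal ((coef p \<rho> r)\<^sup>2) \<partial>rad)"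
  proof -
    have "(\<integral>\<^sup>+r. ennreal ((coef p \<rho> r)\<^sup>2) \<partial>rad) = (\<integral>\<^sup>+x. ennreal ((coef p \<rho> (norm (x::real^3)))\<^sup>2) \<partial>lborel)"
      unfolding rad_def by (rule nn_integral_distr) auto
    then show ?thesis by (simp add: nn_integral_cmult)
  qed
  also have "\<dots> \<le> ennreal (B\<^sup>2) * (\<integral>\<^sup>+r. ennreal (B\<^sup>2) * (\<integral>\<^sup>+w. ennreal ((norm (\<rho> (r *\<^sub>R w)))\<^sup>2) \<partial>sph) \<partial>rad)"
    by (intro mult_left_mono nn_integral_mono c) simp
  also have "\<dots> = ennreal (B\<^sup>2) * (ennreal (B\<^sup>2) * (\<integral>\<^sup>+x. ennreal ((norm (\<rho> x))\<^sup>2) \<partial>lborel))"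
    by (subst polar_nn) (measurable, simp add: nn_integral_cmult)
  also have "\<dots> = ennreal ((B\<^sup>2 * L2_norm \<rho>)\<^sup>2)"
    by (simp add: L2_norm_nn[OF \<rho>] ennreal_mult[symmetric] power_mult_distrib)
  finally have le: "(\<integral>\<^sup>+x. ennreal ((norm (coef p \<rho> (norm x) *\<^sub>R g p x))\<^sup>2) \<partial>lborel) \<le> ennreal ((B\<^sup>2 * L2_norm \<rho>)\<^sup>2)" .
  have "(\<lambda>x. coef p \<rho> (norm x) *\<^sub>R g p x) \<in> borel_measurable borel" by measurable
  from L2_if_nn[OF this le] show "(\<lambda>x. coef p \<rho> (norm x) *\<^sub>R g p x) \<in> L2" by simp
qed

lemma Q_L2: "\<rho> \<in> L2 \<Longrightarrow> Q \<rho> \<in> L2"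
proof -
  assume \<rho>: "\<rho> \<in> L2"
  obtain B where "B \<ge> 0" "\<And>p x. p < m \<Longrightarrow> x \<noteq> 0 \<Longrightarrow> norm (g p x) \<le> B" by (rule g_bound) blast
  then show ?thesis unfolding Q_def[abs_def] by (intro L2_sum coef_term_L2[OF _ \<rho>]) auto
qed

lemma Q_form: "form (Q \<rho>)"
  unfolding form_def Q_def by (rule exI[of _ "\<lambda>p. coef p \<rho>"]) simp

text \<open>The right-hand side is symmetric in the two fields, which makes \<open>Q\<close>
  symmetric.\<close>

lemma ip_coef_term:
  assumes p: "p < m" and \<rho>: "\<rho> \<in> L2" and \<eta>: "\<eta> \<in> L2"
  shows "ip (\<lambda>x. coef p \<rho> (norm x) *\<^sub>R g p x) \<eta> = (\<integral>r. coef p \<rho> r * coef p \<eta> r \<partial>rad)"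
proof -
  obtain B where B: "B \<ge> 0" "\<And>p x. p < m \<Longrightarrow> x \<noteq> 0 \<Longrightarrow> norm (g p x) \<le> B" by (rule g_bound) blast
  have [measurable]: "\<rho> \<in> borel_measurable borel" "\<eta> \<in> borel_measurable borel" "g p \<in> borel_measurable borel"
    "coef p \<rho> \<in> borel_measurable borel" "coef p \<eta> \<in> borel_measurable borel"
    using \<rho> \<eta> p g_measurable coef_measurable by auto
  have i: "integrable lborel (\<lambda>x. (coef p \<rho> (norm x) *\<^sub>R g p x) \<bullet> \<eta> x)"
    by (rule L2_integrable_inner[OF coef_term_L2[OF p \<rho> B(1) B(2)[OF p]] \<eta>])
  have "ip (\<lambda>x. coef p \<rho> (norm x) *\<^sub>R g p x) \<eta>
      = (\<integral>r. \<integral>w. (coef p \<rho> (norm (r *\<^sub>R w)) *\<^sub>R g p (r *\<^sub>R w)) \<bullet> \<eta> (r *\<^sub>R w) \<partial>sph \<partial>rad)"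
    unfolding ip_def by (rule polar_integral[OF i])
  also have "\<dots> = (\<integral>r. coef p \<rho> r * coef p \<eta> r \<partial>rad)"
  proof (rule integral_cong_AE)
    show "AE r in rad. (\<integral>w. (coef p \<rho> (norm (r *\<^sub>R w)) *\<^sub>R g p (r *\<^sub>R w)) \<bullet> \<eta> (r *\<^sub>R w) \<partial>sph) = coef p \<rho> r * coef p \<eta> r"
      using rad_pos
    proof eventually_elim
      case (elim r)
      have "(\<integral>w. (coef p \<rho> (norm (r *\<^sub>R w)) *\<^sub>R g p (r *\<^sub>R w)) \<bullet> \<eta> (r *\<^sub>R w) \<partial>sph)
          = (\<integral>w. coef p \<rho> r * (g p w \<bullet> \<eta> (r *\<^sub>R w)) \<partial>sph)"
      proof (rule integral_cong_AE)
        show "AE w in sph. (coef p \<rho> (norm (r *\<^sub>R w)) *\<^sub>R g p (r *\<^sub>R w)) \<bullet> \<eta> (r *\<^sub>R w) = coef p \<rho> r * (g p w \<bullet> \<eta> (r *\<^sub>R w))"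
          using sph_norm by eventually_elim (use elim hom[OF p elim] in simp)
      qed measurable
      then show ?case by (simp add: coef_def[of p \<eta>])
    qed
    show "(\<lambda>r. \<integral>w. (coef p \<rho> (norm (r *\<^sub>R w)) *\<^sub>R g p (r *\<^sub>R w)) \<bullet> \<eta> (r *\<^sub>R w) \<partial>sph) \<in> borel_measurable rad"
      by (rule sph.borel_measurable_lebesgue_integral) measurable
  qed measurable
  finally show ?thesis .
qed

lemma Q_sym:
  assumes "\<rho> \<in> L2" "\<eta> \<in> L2" shows "ip (Q \<rho>) \<eta> = ip \<rho> (Q \<eta>)"
proof -
  obtain B where B: "B \<ge> 0" "\<And>p x. p < m \<Longrightarrow> x \<noteq> 0 \<Longrightarrow> norm (g p x) \<le> B" by (rule g_bound) blast
  have "ip (Q \<rho>) \<eta> = (\<Sum>p<m. \<integral>r. coef p \<rho> r * coef p \<eta> r \<partial>rad)" if "\<rho> \<in> L2" "\<eta> \<in> L2" for \<rho> \<eta>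
    unfolding Q_def using that B coef_term_L2 by (subst ip_sum_left) (auto simp: ip_coef_term)
  from this[OF assms] this[OF assms(2,1)] show ?thesis
    by (simp add: ip_commute[of \<rho>] mult.commute)
qed

text \<open>On almost every sphere, orthonormality recovers the coefficient \<open>a p r\<close> as
  an average, whatever its dependence on \<open>r\<close>.\<close>

lemma Q_repro:
  assumes "form \<rho>" and \<rho>: "\<rho> \<in> L2" shows "AE x in lborel. Q \<rho> x = \<rho> x"
proof -
  have [measurable]: "\<rho> \<in> borel_measurable borel" using \<rho> by measurable
  obtain a where a: "AE x in lborel. \<rho> x = (\<Sum>p<m. a p (norm x) *\<^sub>R g p x)" using assms by (auto simp: form_def)
  have "AE r in rad. \<forall>p\<in>{..<m}. coef p \<rho> r = a p r"
    using polar_AE[OF a] rad_pos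
  proof eventually_elim
    case (elim r)
    show ?case
    proof
      fix p assume "p \<in> {..<m}"
      then have p: "p < m" by simp
      have gs: "sphb (\<lambda>w. \<Sum>q<m. a q r *\<^sub>R g q w)" by (rule sphb_sum) (simp add: g_sphb)
      have ae: "AE w in sph. \<rho> (r *\<^sub>R w) = (\<Sum>q<m. a q r *\<^sub>R g q w)"
        using elim(1) sph_norm
      proof eventually_elim
        case e: (elim w)
        have "(\<Sum>q<m. a q (norm (r *\<^sub>R w)) *\<^sub>R g q (r *\<^sub>R w)) = (\<Sum>q<m. a q r *\<^sub>R g q w)"
          using e(2) elim(2) hom by (intro sum.cong) auto
        then show ?case using e(1) by simp
      qed
      show "coef p \<rho> r = a p r"
      proof -
        have [measurable]: "g p \<in> borel_measurable borel" by (rule g_measurable[OF p])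
        have "(\<lambda>w. g p w \<bullet> \<rho> (r *\<^sub>R w)) \<in> borel_measurable sph" by measurable
        then have "coef p \<rho> r = sp (g p) (\<lambda>w. \<Sum>q<m. a q r *\<^sub>R g q w)"
          unfolding coef_def sp_def
          by (rule integral_cong_AE[OF _ borel_measurable_integrable[OF sphb_integrable[OF g_sphb[OF p] gs]]])
             (use ae in eventually_elim, simp)
        also have "\<dots> = (\<Sum>q<m. a q r * sp (g q) (g p))"
          using sp_sum_left[of "{..<m}" g "g p" "\<lambda>q. a q r"] g_sphb p by (simp add: sp_commute)
        also have "\<dots> = (\<Sum>q<m. if q = p then a q r else 0)" by (rule sum.cong) (use p ortho in auto)
        finally show ?thesis using p by simp
      qed
    qed
  qed
  from rad_AE[OF this] a show ?thesis
    by eventually_elim (auto simp: Q_def intro!: sum.cong)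
qed

lemma form_cong: "form \<rho> \<Longrightarrow> AE x in lborel. \<rho>' x = \<rho> x \<Longrightarrow> form \<rho>'"
proof -
  assume "form \<rho>" and e: "AE x in lborel. \<rho>' x = \<rho> x"
  then obtain a where "AE x in lborel. \<rho> x = (\<Sum>p<m. a p (norm x) *\<^sub>R g p x)" by (auto simp: form_def)
  with e have "AE x in lborel. \<rho>' x = (\<Sum>p<m. a p (norm x) *\<^sub>R g p x)" by eventually_elim simp
  then show "form \<rho>'" unfolding form_def by (rule exI[of _ a])
qed

text \<open>The averages of a test field are C1 in the radius and vanish near 0 and for large radii;
  the first makes up for the singularity of the angular fields at the origin. The product rule then
  separates the radial part, in \<open>closed_r\<close>, from the angular part, in
  \<open>closed_d\<close>.\<close>

lemma Q_C1c:
  assumes C: "C1c \<psi> D" and o: "off0 \<psi>"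
  obtains DQ where "C1c (Q \<psi>) DQ" "off0 (Q \<psi>)" "form (\<lambda>x. - (\<Sum>k\<in>UNIV. alpha_mat k *v DQ k x))"
proof -
  note C1 = C1c_C1[OF C]
  obtain R where R: "R > 0" "\<And>x. norm x > R \<Longrightarrow> \<psi> x = 0" "\<And>x k. norm x > R \<Longrightarrow> D k x = 0"
    using C1c_support[OF C] by metis
  obtain d0 where d0: "d0 > 0" "\<And>x. norm x < d0 \<Longrightarrow> \<psi> x = 0" using o by (auto simp: off0_def)
  have "\<exists>d>0. \<forall>x. norm x < d \<longrightarrow> D k x = 0" for k using off0_deriv[OF C1 o] by (auto simp: off0_def)
  then obtain dd where dd: "\<And>k. dd k > 0" "\<And>k x. norm x < dd k \<Longrightarrow> D k x = 0" by metis
  \<comment> \<open>One radius within which the field and its three partial derivatives all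
    vanish.\<close>
  define d where "d = min d0 (Min (range dd))"
  have d: "d > 0" "\<And>x. norm x < d \<Longrightarrow> \<psi> x = 0" "\<And>x k. norm x < d \<Longrightarrow> D k x = 0"
    using d0 dd by (auto simp: d_def)
  obtain B where B: "B \<ge> 0" "\<And>p x. p < m \<Longrightarrow> x \<noteq> 0 \<Longrightarrow> norm (g p x) \<le> B" by (rule g_bound) blast
  obtain E0 where E0: "\<And>x. norm (\<psi> x) \<le> E0" using compact_support_bounded[OF C1_continuous(1)[OF C1] R(2)] by metis
  have "\<exists>E. \<forall>x. norm (D k x) \<le> E" for k
    using compact_support_bounded[OF C1_continuous(2)[OF C1] R(3)] by metis
  then obtain E where E: "\<And>k x. norm (D k x) \<le> E k" by metis
  have m\<psi> [measurable]: "\<psi> \<in> borel_measurable borel" "D k \<in> borel_measurable borel" for k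
    using C1_measurable[OF C1] by auto
  have gm [measurable]: "p < m \<Longrightarrow> g p \<in> borel_measurable borel" for p by (rule g_measurable)
  define F where "F p r w = g p w \<bullet> \<psi> (r *\<^sub>R w)" for p r w
  define F' where "F' p r w = g p w \<bullet> (\<Sum>k\<in>UNIV. w $ k *\<^sub>R D k (r *\<^sub>R w))" for p r w
  define c' where "c' p r = (\<integral>w. F' p r w \<partial>sph)" for p r
  have Fm: "F p r \<in> borel_measurable borel" "F' p r \<in> borel_measurable borel" if "p < m" for p r
    unfolding F_def[abs_def] F'_def[abs_def] using gm[OF that] by measurable
  have Fd: "((\<lambda>t. F p t w) has_real_derivative F' p t w) (at t)" for p t w
  proof -
    have "((\<lambda>t. \<psi> (t *\<^sub>R w)) has_derivative (\<lambda>s. \<Sum>k\<in>UNIV. (s *\<^sub>R w) $ k *\<^sub>R D k (t *\<^sub>R w))) (at t)"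
      by (rule has_derivative_compose[OF _ C1_has_derivative[OF C1]]) (auto intro!: derivative_eq_intros)
    then have "((\<lambda>t. g p w \<bullet> \<psi> (t *\<^sub>R w)) has_derivative (\<lambda>s. g p w \<bullet> (\<Sum>k\<in>UNIV. (s *\<^sub>R w) $ k *\<^sub>R D k (t *\<^sub>R w)))) (at t)"
      by (rule has_derivative_inner_right)
    moreover have "(\<lambda>s. g p w \<bullet> (\<Sum>k\<in>UNIV. (s *\<^sub>R w) $ k *\<^sub>R D k (t *\<^sub>R w))) = (*) (F' p t w)"
      by (simp add: fun_eq_iff F'_def inner_sum_right sum_distrib_left mult_ac)
    ultimately show ?thesis unfolding F_def has_field_derivative_def by simp
  qed
  have b1: "AE w in sph. \<forall>t. \<bar>F' p t w\<bar> \<le> B * (\<Sum>k\<in>UNIV. E k)" if p: "p < m" for p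
    using sph_norm
  proof eventually_elim
    case (elim w)
    show ?case
    proof
      fix t
      have w0: "w \<noteq> 0" using elim by auto
      have "norm (\<Sum>k\<in>UNIV. w $ k *\<^sub>R D k (t *\<^sub>R w)) \<le> (\<Sum>k\<in>UNIV. E k)"
      proof (rule sum_norm_le)
        fix k
        have "\<bar>w $ k\<bar> * norm (D k (t *\<^sub>R w)) \<le> 1 * E k"
          using component_le_norm_cart[of w k] elim E by (intro mult_mono) auto
        then show "norm (w $ k *\<^sub>R D k (t *\<^sub>R w)) \<le> E k" by simp
      qed
      then have "norm (g p w) * norm (\<Sum>k\<in>UNIV. w $ k *\<^sub>R D k (t *\<^sub>R w)) \<le> B * (\<Sum>k\<in>UNIV. E k)"
        using B w0 p by (intro mult_mono) auto
      then show "\<bar>F' p t w\<bar> \<le> B * (\<Sum>k\<in>UNIV. E k)"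
        unfolding F'_def by (rule order_trans[OF Cauchy_Schwarz_ineq2])
    qed
  qed
  have b2: "AE w in sph. \<bar>F p t w\<bar> \<le> B * E0" if p: "p < m" for p t
    using sph_nonzero
  proof eventually_elim
    case (elim w)
    have "norm (g p w) * norm (\<psi> (t *\<^sub>R w)) \<le> B * E0"
      using B E0 elim p by (intro mult_mono) auto
    then show ?case unfolding F_def by (rule order_trans[OF Cauchy_Schwarz_ineq2])
  qed
  have cd: "(coef p \<psi> has_real_derivative c' p t) (at t)" if p: "p < m" for p t
    using sph_integral_deriv[OF Fm[OF p] b1[OF p] b2[OF p] Fd]
    unfolding coef_def[abs_def] c'_def by (simp add: F_def)
  have cc: "continuous_on UNIV (c' p)" if p: "p < m" for p
    unfolding c'_def[abs_def]
  proof (rule sph_integral_continuous[OF Fm(2)[OF p]])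
    show "AE w in sph. \<bar>F' p t w\<bar> \<le> B * (\<Sum>k\<in>UNIV. E k)" for t using b1[OF p] by eventually_elim auto
    show "continuous_on UNIV (\<lambda>t. F' p t w)" for w
      unfolding F'_def by (intro continuous_intros continuous_on_compose2[OF C1_continuous(2)[OF C1]]) auto
  qed
  have ce: "continuous_on UNIV (coef p \<psi>)" if p: "p < m" for p
    by (rule continuous_at_imp_continuous_on) (blast intro: DERIV_isCont cd[OF p])
  \<comment> \<open>The coefficients are functions on all of the real line, and a point
    \<open>r *\<^sub>R w\<close> with \<open>norm w = 1\<close> has norm
    \<open>\<bar>r\<bar>\<close>.\<close>
  have zero: "coef p \<psi> r = 0 \<and> c' p r = 0" if r: "\<bar>r\<bar> < d \<or> \<bar>r\<bar> > R" for p r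
  proof -
    have ae: "AE w in sph. F p r w = 0 \<and> F' p r w = 0"
      using sph_norm
    proof eventually_elim
      case (elim w)
      then have "norm (r *\<^sub>R w) < d \<or> norm (r *\<^sub>R w) > R" using r by simp
      then show ?case using d R unfolding F_def F'_def by (auto intro!: sum.neutral)
    qed
    have "(\<integral>w. F p r w \<partial>sph) = 0" by (rule integral_eq_zero_AE) (use ae in eventually_elim, simp)
    moreover have "(\<integral>w. F' p r w \<partial>sph) = 0" by (rule integral_eq_zero_AE) (use ae in eventually_elim, simp)
    ultimately show ?thesis by (simp add: coef_def c'_def F_def)
  qed
  define DQ where "DQ k x = (\<Sum>p<m. (c' p (norm x) * (x $ k / norm x)) *\<^sub>R g p x + coef p \<psi> (norm x) *\<^sub>R dg p k x)" for k and x :: "real^3"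
  have Q0: "Q \<psi> x = 0 \<and> DQ k x = 0" if "norm x < d \<or> norm x > R" for x k
    unfolding Q_def DQ_def using zero[of "norm x"] that by simp
  have der: "(Q \<psi> has_derivative (\<lambda>h. \<Sum>k\<in>UNIV. h $ k *\<^sub>R DQ k x)) (at x)" for x
  proof (cases "norm x < d")
    case True
    have "((\<lambda>x. 0) has_derivative (\<lambda>h. \<Sum>k\<in>UNIV. h $ k *\<^sub>R DQ k x)) (at x)" using Q0 True by simp
    then show ?thesis
      by (rule has_derivative_transform_within_open[of _ _ _ UNIV "{x. norm x < d}"])
         (use True Q0 in \<open>auto intro!: open_Collect_less continuous_intros\<close>)
  next
    case False
    then have x: "x \<noteq> 0" using d by auto
    have nd: "((\<lambda>x. coef p \<psi> (norm x)) has_derivative (\<lambda>h. c' p (norm x) * (h \<bullet> sgn x))) (at x)" if "p < m" for p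
      by (rule has_derivative_compose[OF has_derivative_norm[OF x] cd[OF that, unfolded has_field_derivative_def]])
    have "((\<lambda>x. \<Sum>p<m. coef p \<psi> (norm x) *\<^sub>R g p x) has_derivative
        (\<lambda>h. \<Sum>p<m. coef p \<psi> (norm x) *\<^sub>R (\<Sum>k\<in>UNIV. h $ k *\<^sub>R dg p k x) + (c' p (norm x) * (h \<bullet> sgn x)) *\<^sub>R g p x)) (at x)"
      by (intro has_derivative_sum has_derivative_scaleR nd deriv x) auto
    moreover have "(\<Sum>p<m. coef p \<psi> (norm x) *\<^sub>R (\<Sum>k\<in>UNIV. h $ k *\<^sub>R dg p k x) + (c' p (norm x) * (h \<bullet> sgn x)) *\<^sub>R g p x)
        = (\<Sum>k\<in>UNIV. h $ k *\<^sub>R DQ k x)" for h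
    proof -
      have "h \<bullet> sgn x = (\<Sum>k\<in>UNIV. h $ k * (x $ k / norm x))"
        by (simp add: inner_vec_def sgn_div_norm divide_inverse mult_ac)
      then have "(\<Sum>p<m. coef p \<psi> (norm x) *\<^sub>R (\<Sum>k\<in>UNIV. h $ k *\<^sub>R dg p k x) + (c' p (norm x) * (h \<bullet> sgn x)) *\<^sub>R g p x)
         = (\<Sum>p<m. \<Sum>k\<in>UNIV. h $ k *\<^sub>R ((c' p (norm x) * (x $ k / norm x)) *\<^sub>R g p x + coef p \<psi> (norm x) *\<^sub>R dg p k x))"
        by (intro sum.cong)
           (simp_all add: scaleR_sum_right scaleR_sum_left sum_distrib_left scaleR_add_right sum.distrib mult_ac)
      also have "\<dots> = (\<Sum>k\<in>UNIV. h $ k *\<^sub>R DQ k x)"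
        by (subst sum.swap) (simp add: DQ_def scaleR_sum_right)
      finally show ?thesis .
    qed
    ultimately show ?thesis unfolding Q_def[abs_def] by simp
  qed
  \<comment> \<open>Continuity is glued from two open sets: off the origin by the formula, on the
    ball of radius \<open>d\<close> because the derivative vanishes there.\<close>
  have cont: "continuous_on UNIV (DQ k)" for k
  proof -
    have "continuous_on (- {0}) (DQ k)" unfolding DQ_def[abs_def]
      by (intro continuous_intros continuous_on_compose2[OF cc] continuous_on_compose2[OF ce] g_cont dcont) auto
    moreover have "continuous_on (ball 0 d) (DQ k)"
      using continuous_on_cong[of "ball 0 d" "ball 0 d" "DQ k" "\<lambda>x. 0"] Q0 by (simp add: dist_norm)
    ultimately have "continuous_on (- {0} \<union> ball 0 d) (DQ k)"
      by (intro continuous_on_open_Un) auto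
    moreover have "- {0} \<union> ball 0 d = (UNIV :: (real^3) set)" using d by auto
    ultimately show ?thesis by simp
  qed
  have "C1c (Q \<psi>) DQ" unfolding C1c_def C1_def using der cont Q0 by blast
  moreover have "off0 (Q \<psi>)" unfolding off0_def using Q0 d(1) by blast
  moreover have "form (\<lambda>x. - (\<Sum>k\<in>UNIV. alpha_mat k *v DQ k x))"
  proof -
    obtain cr where cr: "\<And>p. p < m \<Longrightarrow> AE x in lborel. (\<Sum>k\<in>UNIV. (x $ k / norm x) *\<^sub>R (alpha_mat k *v g p x)) = (\<Sum>q<m. cr p q *\<^sub>R g q x)"
    proof -
      have "\<forall>p. \<exists>c. p < m \<longrightarrow> (AE x in lborel. (\<Sum>k\<in>UNIV. (x $ k / norm x) *\<^sub>R (alpha_mat k *v g p x)) = (\<Sum>q<m. c q *\<^sub>R g q x))"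
        using closed_r by auto
      from choice[OF this] show ?thesis using that by auto
    qed
    obtain cd where cd: "\<And>p. p < m \<Longrightarrow> AE x in lborel. norm x *\<^sub>R (\<Sum>k\<in>UNIV. alpha_mat k *v dg p k x) = (\<Sum>q<m. cd p q *\<^sub>R g q x)"
    proof -
      have "\<forall>p. \<exists>c. p < m \<longrightarrow> (AE x in lborel. norm x *\<^sub>R (\<Sum>k\<in>UNIV. alpha_mat k *v dg p k x) = (\<Sum>q<m. c q *\<^sub>R g q x))"
        using closed_d by auto
      from choice[OF this] show ?thesis using that by auto
    qed
    have r: "AE x in lborel. \<forall>p\<in>{..<m}. (\<Sum>k\<in>UNIV. (x $ k / norm x) *\<^sub>R (alpha_mat k *v g p x)) = (\<Sum>q<m. cr p q *\<^sub>R g q x)"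
      by (rule AE_finite_allI) (auto intro: cr)
    have a: "AE x in lborel. \<forall>p\<in>{..<m}. norm x *\<^sub>R (\<Sum>k\<in>UNIV. alpha_mat k *v dg p k x) = (\<Sum>q<m. cd p q *\<^sub>R g q x)"
      by (rule AE_finite_allI) (auto intro: cd)
    \<comment> \<open>The radial part contributes \<open>c' * cr\<close>; the angular part is
      \<open>closed_d\<close> divided by the radius, whence \<open>coef / r * cd\<close>.\<close>
    have "AE x in lborel. - (\<Sum>k\<in>UNIV. alpha_mat k *v DQ k x)
        = (\<Sum>q<m. (- (\<Sum>p<m. c' p (norm x) * cr p q + coef p \<psi> (norm x) / norm x * cd p q)) *\<^sub>R g q x)"
      using r a AE_lborel_singleton[of "0::real^3"]
    proof eventually_elim
      case (elim x)
      interpret al: bounded_linear "\<lambda>v. alpha_mat k *v v" for k by (rule alpha_linear)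
      have "(\<Sum>k\<in>UNIV. alpha_mat k *v DQ k x) = (\<Sum>p<m. c' p (norm x) *\<^sub>R (\<Sum>k\<in>UNIV. (x $ k / norm x) *\<^sub>R (alpha_mat k *v g p x))
          + coef p \<psi> (norm x) *\<^sub>R (\<Sum>k\<in>UNIV. alpha_mat k *v dg p k x))"
        unfolding DQ_def al.sum al.add al.scaleR
        by (subst sum.swap) (simp add: sum.distrib scaleR_sum_right)
      also have "\<dots> = (\<Sum>p<m. \<Sum>q<m. (c' p (norm x) * cr p q + coef p \<psi> (norm x) / norm x * cd p q) *\<^sub>R g q x)"
      proof (rule sum.cong[OF refl])
        fix p assume p: "p \<in> {..<m}"
        have "(\<Sum>k\<in>UNIV. alpha_mat k *v dg p k x) = (1 / norm x) *\<^sub>R (\<Sum>q<m. cd p q *\<^sub>R g q x)"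
          using elim(2)[rule_format, OF p, symmetric] elim(3) by simp
        then show "c' p (norm x) *\<^sub>R (\<Sum>k\<in>UNIV. (x $ k / norm x) *\<^sub>R (alpha_mat k *v g p x))
            + coef p \<psi> (norm x) *\<^sub>R (\<Sum>k\<in>UNIV. alpha_mat k *v dg p k x)
            = (\<Sum>q<m. (c' p (norm x) * cr p q + coef p \<psi> (norm x) / norm x * cd p q) *\<^sub>R g q x)"
          using elim(1)[rule_format, OF p] by (simp add: scaleR_sum_right scaleR_add_left sum.distrib)
      qed
      also have "\<dots> = (\<Sum>q<m. (\<Sum>p<m. c' p (norm x) * cr p q + coef p \<psi> (norm x) / norm x * cd p q) *\<^sub>R g q x)"
        by (subst sum.swap) (simp add: scaleR_sum_left)
      finally show ?case by (simp add: sum_negf)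
    qed
    then show ?thesis unfolding form_def by (rule exI[where x="\<lambda>q r. - (\<Sum>p<m. c' p r * cr p q + coef p \<psi> r / r * cd p q)"])
  qed
  ultimately show ?thesis by (rule that)
qed

lemma Q_test_dirac:
  assumes C: "C1c \<psi> D" and o: "off0 \<psi>"
  shows "Q \<psi> \<in> H1" "form (skew_dirac (Q \<psi>))"
proof -
  obtain DQ where DQ: "C1c (Q \<psi>) DQ" "form (\<lambda>x. - (\<Sum>k\<in>UNIV. alpha_mat k *v DQ k x))"
    by (rule Q_C1c[OF C o])
  show "Q \<psi> \<in> H1" by (rule C1c_H1[OF DQ(1)])
  show "form (skew_dirac (Q \<psi>))" by (rule form_cong[OF DQ(2) skew_dirac_C1c[OF DQ(1)]])
qed

lemma ip_Q_form:
  assumes "form \<rho>" "\<rho> \<in> L2" "\<eta> \<in> L2" shows "ip \<rho> (Q \<eta>) = ip \<rho> \<eta>"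
proof -
  have "ip \<rho> (Q \<eta>) = ip (Q \<rho>) \<eta>" using Q_sym assms by simp
  also have "\<dots> = ip \<rho> \<eta>"
    by (rule ip_cong_AE) (use assms Q_L2 L2_measurable Q_repro in auto)
  finally show ?thesis .
qed

text \<open>Tested with \<open>t\<close>: symmetry puts \<open>Q\<close> on \<open>t\<close>, and
  the Dirac derivative of \<open>Q t\<close> lies in the sector. So \<psi> may be replaced by
  \<open>Q \<psi>\<close> before the derivative is moved back.\<close>

lemma Q_dirac_commute:
  assumes C: "C1c \<psi> D" and o: "off0 \<psi>"
  shows "AE x in lborel. Q (skew_dirac \<psi>) x = skew_dirac (Q \<psi>) x"
proof -
  note H = C1c_H1[OF C] Q_test_dirac(1)[OF C o]
  note L = skew_dirac_L2[OF H(1)] skew_dirac_L2[OF H(2)] H1_L2[OF H(1)] H1_L2[OF H(2)]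
  have "AE x in lborel. Q (skew_dirac \<psi>) x - skew_dirac (Q \<psi>) x = 0"
  proof (rule fundamental_lemma)
    show "(\<lambda>x. Q (skew_dirac \<psi>) x - skew_dirac (Q \<psi>) x) \<in> L2" by (intro L2_diff Q_L2 L)
    fix t :: "real^3 \<Rightarrow> complex^4" and Dt assume t: "C1c t Dt" "off0 t"
    note Ht = C1c_H1[OF t(1)] Q_test_dirac(1)[OF t]
    note Lt = skew_dirac_L2[OF Ht(2)] H1_L2[OF Ht(1)] H1_L2[OF Ht(2)]
    have "ip (Q (skew_dirac \<psi>)) t = ip (skew_dirac \<psi>) (Q t)" by (rule Q_sym[OF L(1) Lt(2)])
    also have "\<dots> = - ip \<psi> (skew_dirac (Q t))" by (rule skew_dirac_skew[OF H(1) Ht(2)])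
    also have "ip \<psi> (skew_dirac (Q t)) = ip (Q \<psi>) (skew_dirac (Q t))"
      using ip_Q_form[OF Q_test_dirac(2)[OF t] Lt(1) L(3)] by (simp add: ip_commute)
    also have "- ip (Q \<psi>) (skew_dirac (Q t)) = ip (skew_dirac (Q \<psi>)) (Q t)"
      using skew_dirac_skew[OF H(2) Ht(2)] by simp
    also have "\<dots> = ip (skew_dirac (Q \<psi>)) t" by (rule ip_Q_form[OF Q_test_dirac(2)[OF C o] L(2) Lt(2)])
    finally show "ip (\<lambda>x. Q (skew_dirac \<psi>) x - skew_dirac (Q \<psi>) x) t = 0"
      by (simp add: ip_diff_left Q_L2 L Lt)
  qed
  then show ?thesis by eventually_elim simp
qed

text \<open>Against a field of the sector, a test field and its projection are indistinguishable
  even after differentiation. The invariance of the sector and the solution of the resolvent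
  equation both rest on this.\<close>

lemma ip_dirac_Q:
  assumes \<rho>: "form \<rho>" "\<rho> \<in> L2" and C: "C1c \<psi> D" "off0 \<psi>"
  shows "ip \<rho> (skew_dirac (Q \<psi>)) = ip \<rho> (skew_dirac \<psi>)"
proof -
  note L = skew_dirac_L2[OF C1c_H1[OF C(1)]] skew_dirac_L2[OF Q_test_dirac(1)[OF C]]
  have "ip (skew_dirac (Q \<psi>)) \<rho> = ip (Q (skew_dirac \<psi>)) \<rho>"
    by (rule ip_cong_AE[OF L2_measurable[OF L(2)] L2_measurable[OF Q_L2[OF L(1)]] L2_measurable[OF \<rho>(2)]])
       (use Q_dirac_commute[OF C] in eventually_elim, simp)
  then show ?thesis using ip_Q_form[OF \<rho> L(1)] by (simp add: ip_commute)
qed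

theorem dirac_invariant:
  assumes \<rho>: "form \<rho>" "\<rho> \<in> H1"
  shows "form (skew_dirac \<rho>)"
proof -
  note L = skew_dirac_L2[OF \<rho>(2)] H1_L2[OF \<rho>(2)]
  have "AE x in lborel. skew_dirac \<rho> x - Q (skew_dirac \<rho>) x = 0"
  proof (rule fundamental_lemma)
    show "(\<lambda>x. skew_dirac \<rho> x - Q (skew_dirac \<rho>) x) \<in> L2" by (intro L2_diff Q_L2 L)
    fix t :: "real^3 \<Rightarrow> complex^4" and Dt assume t: "C1c t Dt" "off0 t"
    note Ht = C1c_H1[OF t(1)] Q_test_dirac(1)[OF t]
    have "ip (skew_dirac \<rho>) t = - ip \<rho> (skew_dirac t)" by (rule skew_dirac_skew[OF \<rho>(2) Ht(1)])
    also have "\<dots> = ip (skew_dirac \<rho>) (Q t)"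
      using ip_dirac_Q[OF \<rho>(1) L(2) t] skew_dirac_skew[OF \<rho>(2) Ht(2)] by simp
    also have "\<dots> = ip (Q (skew_dirac \<rho>)) t" by (rule Q_sym[symmetric, OF L(1) H1_L2[OF Ht(1)]])
    finally show "ip (\<lambda>x. skew_dirac \<rho> x - Q (skew_dirac \<rho>) x) t = 0"
      by (simp add: ip_diff_left Q_L2 L H1_L2[OF Ht(1)])
  qed
  then have "AE x in lborel. skew_dirac \<rho> x = Q (skew_dirac \<rho>) x" by eventually_elim simp
  then show ?thesis by (rule form_cong[OF Q_form])
qed

text \<open>The weak identity \<open>ip F (Q t) = ip F t\<close>, valid for members of the sector,
  survives limits in \<open>L2\<close> and in turn forces \<open>F = Q F\<close> almost
  everywhere.\<close>

lemma form_limit: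
  assumes f: "\<And>n. f n \<in> L2" "F \<in> L2" "(\<lambda>n. L2_norm (\<lambda>x. f n x - F x)) \<longlonglongrightarrow> 0"
    and fo: "\<And>n. form (f n)"
  shows "form F"
proof -
  have D: "(\<lambda>x. F x - Q F x) \<in> L2" by (intro L2_diff Q_L2 f)
  have "ip F t = ip (Q F) t" if t: "t \<in> L2" for t
  proof -
    have "(\<lambda>n. ip (f n) (Q t)) \<longlonglongrightarrow> ip F (Q t)" by (rule tendsto_ip_left[OF f Q_L2[OF t]])
    moreover have "(\<lambda>n. ip (f n) t) \<longlonglongrightarrow> ip F t" by (rule tendsto_ip_left[OF f t])
    ultimately have "ip F (Q t) = ip F t" using ip_Q_form[OF fo f(1) t] LIMSEQ_unique by auto
    then show ?thesis using Q_sym[OF f(2) t] by simp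
  qed
  from this[OF D] have "ip (\<lambda>x. F x - Q F x) (\<lambda>x. F x - Q F x) = 0"
    by (simp only: ip_diff_left[OF f(2) Q_L2[OF f(2)] D])
  then have "L2_norm (\<lambda>x. F x - Q F x) = 0" by (simp add: L2_norm_eq)
  from L2_norm_zero_AE[OF D this] have "AE x in lborel. F x = Q F x" by eventually_elim simp
  then show ?thesis by (rule form_cong[OF Q_form])
qed

end

subsection \<open>Removing the origin\<close>

text \<open>Half the second difference of the squared positive part: a C1 transition from 0 to 1
  whose derivative is a hat function of height 1.\<close>

definition step :: "real \<Rightarrow> real" where
  "step t = (ppow (t - 1) - 2 * ppow (t - 2) + ppow (t - 3)) / 2"

definition step' :: "real \<Rightarrow> real" where
  "step' t = max 0 (t - 1) - 2 * max 0 (t - 2) + max 0 (t - 3)"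

lemma step_deriv: "(step has_vector_derivative step' t) (at t)"
proof -
  have p: "((\<lambda>t. ppow (t - a)) has_real_derivative 2 * max 0 (t - a)) (at t)" for a
    using DERIV_chain2[OF ppow_deriv[unfolded has_real_derivative_iff_has_vector_derivative[symmetric], of "t - a"]
      DERIV_diff[OF DERIV_ident DERIV_const]] by simp
  show ?thesis
    unfolding has_real_derivative_iff_has_vector_derivative[symmetric] step_def[abs_def] step'_def
    by (rule DERIV_cong[OF DERIV_cdivide[OF DERIV_add[OF DERIV_diff[OF p DERIV_cmult[OF p]] p]]]) simp
qed

lemma step_facts: "t \<le> 1 \<Longrightarrow> step t = 0" "t \<ge> 3 \<Longrightarrow> step t = 1" "\<bar>step t\<bar> \<le> 3"
  "\<bar>step' t\<bar> \<le> 1" "t \<ge> 3 \<Longrightarrow> step' t = 0"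
proof -
  show "t \<le> 1 \<Longrightarrow> step t = 0" by (simp add: step_def ppow_def)
  show 1: "step t = 1" if "t \<ge> 3" for t
    using that by (simp add: step_def ppow_def power2_eq_square algebra_simps)
  show "\<bar>step' t\<bar> \<le> 1" by (auto simp: step'_def max_def)
  show "t \<ge> 3 \<Longrightarrow> step' t = 0" by (auto simp: step'_def)
  show "\<bar>step t\<bar> \<le> 3"
  proof (cases "t \<ge> 3")
    case False
    have sq: "0 \<le> (max 0 (t - a))\<^sup>2 \<and> (max 0 (t - a))\<^sup>2 \<le> b\<^sup>2" if "0 \<le> b" "3 - a \<le> b" for a b
      using False that by (auto intro!: power_mono)
    \<comment> \<open>For \<open>t < 3\<close> these bounds give
      \<open>(4 + 2 * 1) / 2 = 3\<close>.\<close>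
    have "0 \<le> ppow (t - 1) \<and> ppow (t - 1) \<le> 4" "0 \<le> ppow (t - 2) \<and> ppow (t - 2) \<le> 1" "ppow (t - 3) = 0"
      using sq[of 2 1] sq[of 1 2] sq[of 0 3] unfolding ppow_def by auto
    then show ?thesis by (auto simp: step_def abs_le_iff)
  qed (simp add: 1)
qed

text \<open>The transition takes place between the radii \<open>1 / Suc j\<close> and
  \<open>sqrt 3 / Suc j\<close>; the square of the norm is smooth also at the origin.\<close>

definition cut :: "nat \<Rightarrow> real^3 \<Rightarrow> real" where
  "cut j x = step ((Suc j)\<^sup>2 * (norm x)\<^sup>2)"

definition dcut :: "nat \<Rightarrow> 3 \<Rightarrow> real^3 \<Rightarrow> real" where
  "dcut j k x = ((Suc j)\<^sup>2 * (2 * x $ k)) * step' ((Suc j)\<^sup>2 * (norm x)\<^sup>2)"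

lemma cut_C1: "C1 (cut j) (dcut j)"
proof -
  have "C1 (\<lambda>x::real^3. real ((Suc j)\<^sup>2) *\<^sub>R (norm x)\<^sup>2) (\<lambda>k x. real ((Suc j)\<^sup>2) *\<^sub>R (2 * x $ k))"
    by (rule C1_linear_image[OF bounded_linear_scaleR_right C1_norm2])
  from C1_compose[OF this step_deriv] show ?thesis
    unfolding cut_def[abs_def] dcut_def[abs_def] by (simp add: step'_def[abs_def] continuous_intros)
qed

lemma cut_off0: "off0 (cut j)"
proof -
  have "cut j x = 0" if "norm x < 1 / Suc j" for x
  proof -
    have "real (Suc j) * norm x \<le> 1" using that by (simp add: field_simps)
    then have "(real (Suc j) * norm x)\<^sup>2 \<le> 1" by (simp add: power_le_one)
    then show ?thesis unfolding cut_def by (intro step_facts) (simp add: power_mult_distrib)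
  qed
  then show ?thesis unfolding off0_def by (intro exI[of _ "1 / Suc j"]) auto
qed

lemma cut_lim: "x \<noteq> 0 \<Longrightarrow> (\<lambda>j. cut j x) \<longlonglongrightarrow> 1"
proof -
  assume x: "x \<noteq> 0"
  obtain N where N: "2 / norm x < real N" using reals_Archimedean2 by blast
  have "cut j x = 1" if "j \<ge> N" for j
  proof -
    have "2 / norm x \<le> real (Suc j)" using N that by simp
    then have "2 \<le> real (Suc j) * norm x" using x by (simp add: field_simps)
    then have "2\<^sup>2 \<le> (real (Suc j) * norm x)\<^sup>2" by (intro power_mono) auto
    then show ?thesis unfolding cut_def by (intro step_facts) (simp add: power_mult_distrib)
  qed
  then have "\<forall>\<^sub>F j in sequentially. cut j x = 1" by (rule eventually_sequentiallyI)
  then show ?thesis by (rule tendsto_eventually)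
qed

text \<open>The gradient has order \<open>j\<close> on a ball whose radius has order
  \<open>1 / j\<close>. Since \<open>sqrt 3 < 2\<close>, the radius \<open>2 / Suc j\<close> covers
  the transition, and the constant 4 is 2 from the derivative of the square times this 2.\<close>

lemma dcut_bound: "\<bar>dcut j k x\<bar> \<le> 4 * real (Suc j) * indicator (cball 0 (2 / Suc j)) x"
proof (cases "(real (Suc j))\<^sup>2 * (norm x)\<^sup>2 \<ge> 3")
  case True
  then show ?thesis by (simp add: dcut_def step_facts indicator_def)
next
  case False
  then have "(real (Suc j) * norm x)\<^sup>2 \<le> 2\<^sup>2" by (simp add: power_mult_distrib)
  then have l: "real (Suc j) * norm x \<le> 2" by (rule power2_le_imp_le) simp
  then have "x \<in> cball 0 (2 / Suc j)" by (simp add: field_simps)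
  moreover have "\<bar>dcut j k x\<bar> \<le> 4 * Suc j"
  proof -
    have "\<bar>dcut j k x\<bar> \<le> ((real (Suc j))\<^sup>2 * (2 * \<bar>x $ k\<bar>)) * 1"
      unfolding dcut_def abs_mult using step_facts(4) by (intro mult_mono) auto
    also have "\<dots> \<le> ((real (Suc j))\<^sup>2 * (2 * norm x)) * 1"
      using component_le_norm_cart[of x k] by (intro mult_right_mono mult_left_mono) auto
    also have "\<dots> = 2 * real (Suc j) * (real (Suc j) * norm x)" by (simp add: power2_eq_square)
    also have "\<dots> \<le> 2 * real (Suc j) * 2" by (intro mult_left_mono l) simp
    finally show ?thesis by simp
  qed
  ultimately show ?thesis by simp
qed

lemma indicator_cball_L2:
  defines "e \<equiv> axis (1::4) (1::complex)"
  shows "(\<lambda>x. indicator (cball 0 R) x *\<^sub>R e) \<in> L2"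
    "R \<ge> 0 \<Longrightarrow> L2_norm (\<lambda>x. indicator (cball 0 R) x *\<^sub>R e) = sqrt (unit_ball_vol 3 * R ^ 3)"
proof -
  show "(\<lambda>x. indicator (cball 0 R) x *\<^sub>R e) \<in> L2"
    by (rule L2_bounded_support[where C=1 and R=R]) (auto simp: indicator_def e_def)
  assume R: "R \<ge> 0"
  have "(\<integral>x. (norm (indicator (cball (0::real^3) R) x *\<^sub>R e))\<^sup>2 \<partial>lborel) = (\<integral>x. indicator (cball (0::real^3) R) x \<partial>lborel)"
    by (rule Bochner_Integration.integral_cong) (auto simp: indicator_def e_def)
  also have "\<dots> = measure lborel (cball (0::real^3) R)" by simp
  also have "\<dots> = unit_ball_vol 3 * R ^ 3" using content_cball[OF R, of "0::real^3"] by simp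
  finally show "L2_norm (\<lambda>x. indicator (cball 0 R) x *\<^sub>R e) = sqrt (unit_ball_vol 3 * R ^ 3)" by (simp add: L2_norm_def)
qed

text \<open>A point has zero capacity in dimension 3: the gradients of the cutoffs tend to 0 in \<open>L2\<close>.\<close>

lemma weak_dirac_punctured:
  assumes n: "n \<in> L2" and \<zeta>: "\<zeta> \<in> L2"
    and w: "\<And>\<psi> D. C1c \<psi> D \<Longrightarrow> off0 \<psi> \<Longrightarrow> ip n (\<lambda>x. \<Sum>k\<in>UNIV. alpha_mat k *v D k x) = ip \<zeta> \<psi>"
  shows "weak_dirac n \<zeta>"
  unfolding weak_dirac_def
proof (intro allI impI)
  fix \<eta> and c :: "complex^4" assume t: "test_function \<eta>"
  define \<psi> where "\<psi> x = \<eta> x *\<^sub>R c" for x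
  define D where "D k x = partial_deriv k \<eta> x *\<^sub>R c" for k x
  have T: "C1c \<psi> D" unfolding \<psi>_def[abs_def] D_def[abs_def] by (rule test_scaleR_C1c[OF t])
  note TL = C1c_L2[OF T]
  interpret al: bounded_linear "\<lambda>v. alpha_mat k *v v" for k by (rule alpha_linear)
  define G where "G x = (\<Sum>k\<in>UNIV. alpha_mat k *v D k x)" for x
  have GL: "G \<in> L2" unfolding G_def[abs_def] by (intro L2_sum alpha_L2 TL)
  \<comment> \<open>The commutator of the Dirac derivative with the cutoff: the only term that sees
    the singular region.\<close>
  define E where "E j x = (\<Sum>k\<in>UNIV. dcut j k x *\<^sub>R (alpha_mat k *v \<psi> x))" for j x
  have Cj: "C1c (\<lambda>x. cut j x *\<^sub>R \<psi> x) (\<lambda>k x. cut j x *\<^sub>R D k x + dcut j k x *\<^sub>R \<psi> x)" for j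
    by (rule C1c_mult[OF cut_C1 T])
  have oj: "off0 (\<lambda>x. cut j x *\<^sub>R \<psi> x)" for j using cut_off0[of j] by (auto simp: off0_def)
  have cm [measurable]: "cut j \<in> borel_measurable borel" "dcut j k \<in> borel_measurable borel" for j k
    using C1_measurable[OF cut_C1] by auto
  have cut_L2: "(\<lambda>x. cut j x *\<^sub>R f x) \<in> L2" if f: "f \<in> L2" for f j
  proof (rule L2_bound[OF _ f, of _ 3])
    show "(\<lambda>x. cut j x *\<^sub>R f x) \<in> borel_measurable borel" using f by measurable
    show "AE x in lborel. norm (cut j x *\<^sub>R f x) \<le> 3 * norm (f x)"
      using step_facts(3) by (intro AE_I2) (auto simp: cut_def intro!: mult_right_mono)
  qed
  have cut_ip: "(\<lambda>j. ip h (\<lambda>x. cut j x *\<^sub>R f x)) \<longlonglongrightarrow> ip h f" if h: "h \<in> L2" and f: "f \<in> L2" for h f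
    unfolding ip_def
  proof (rule integral_dominated_convergence[where w="\<lambda>x. 3 * (norm (h x) * norm (f x))"])
    have [measurable]: "h \<in> borel_measurable borel" "f \<in> borel_measurable borel" using h f by auto
    show "(\<lambda>x. h x \<bullet> f x) \<in> borel_measurable lborel" "(\<lambda>x. h x \<bullet> cut j x *\<^sub>R f x) \<in> borel_measurable lborel" for j
      by measurable
    show "integrable lborel (\<lambda>x. 3 * (norm (h x) * norm (f x)))" using L2_integrable_mult[OF h f] by simp
    show "AE x in lborel. (\<lambda>j. h x \<bullet> cut j x *\<^sub>R f x) \<longlonglongrightarrow> h x \<bullet> f x"
      using AE_lborel_singleton[of "0::real^3"]
    proof eventually_elim
      case (elim x)
      have "(\<lambda>j. h x \<bullet> cut j x *\<^sub>R f x) \<longlonglongrightarrow> h x \<bullet> 1 *\<^sub>R f x"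
        by (intro tendsto_intros cut_lim elim)
      then show ?case by simp
    qed
    show "AE x in lborel. norm (h x \<bullet> cut j x *\<^sub>R f x) \<le> 3 * (norm (h x) * norm (f x))" for j
      using step_facts(3) Cauchy_Schwarz_ineq2[of "h _" "f _"]
      by (intro AE_I2) (auto simp: cut_def abs_mult intro!: mult_mono)
  qed
  obtain R where R: "\<And>x. norm x > R \<Longrightarrow> \<psi> x = 0" using C1c_support[OF T] by metis
  obtain P where P: "P \<ge> 0" "\<And>x. norm (\<psi> x) \<le> P" using compact_support_bounded[OF C1_continuous(1)[OF C1c_C1[OF T]] R] by metis
  have "\<exists>K. \<forall>v. norm (alpha_mat k *v v) \<le> K * norm v" for k
    using al.bounded[of k] by (auto simp: mult.commute)
  then obtain K where K: "\<And>k v. norm (alpha_mat k *v v) \<le> K k * norm v" by metis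
  have K0: "K k \<ge> 0" for k
  proof -
    have "norm (alpha_mat k *v axis 1 1) \<le> K k" using K[of k "axis 1 1"] by simp
    then show ?thesis by (rule order_trans[OF norm_ge_zero])
  qed
  define M where "M = (\<Sum>k\<in>UNIV. 4 * (K k * P))"
  have M0: "M \<ge> 0" unfolding M_def using K0 P by (intro sum_nonneg mult_nonneg_nonneg) auto
  have Eb: "norm (E j x) \<le> norm ((Suc j * M) *\<^sub>R (indicator (cball 0 (2 / Suc j)) x *\<^sub>R axis (1::4) (1::complex)))" for j x
  proof -
    have "norm (E j x) \<le> (\<Sum>k\<in>UNIV. (4 * real (Suc j) * indicator (cball 0 (2 / Suc j)) x) * (K k * P))"
      unfolding E_def
    proof (rule sum_norm_le)
      fix k
      have "norm (alpha_mat k *v \<psi> x) \<le> K k * P"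
        by (rule order_trans[OF K]) (intro mult_left_mono P K0)
      then show "norm (dcut j k x *\<^sub>R (alpha_mat k *v \<psi> x)) \<le> (4 * real (Suc j) * indicator (cball 0 (2 / Suc j)) x) * (K k * P)"
        using dcut_bound[of j k x] by (simp only: norm_scaleR) (intro mult_mono, auto simp: P K0)
    qed
    also have "\<dots> = Suc j * M * indicator (cball 0 (2 / Suc j)) x"
      by (simp add: M_def sum_distrib_left sum_distrib_right mult_ac)
    finally show ?thesis using M0 by (simp add: abs_mult)
  qed
  have EL: "E j \<in> L2" for j
  proof (rule L2_bound[OF _ L2_scaleR[OF indicator_cball_L2(1)], of _ 1])
    have [measurable]: "(\<lambda>x. alpha_mat k *v \<psi> x) \<in> borel_measurable borel" for k using alpha_L2[OF TL(1)] by measurable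
    show "E j \<in> borel_measurable borel" unfolding E_def[abs_def] by measurable
  qed (use Eb in auto)
  have Elim: "(\<lambda>j. ip n (E j)) \<longlonglongrightarrow> 0"
  proof (rule Lim_null_comparison)
    have "\<bar>ip n (E j)\<bar> \<le> L2_norm n * \<bar>M\<bar> * sqrt (8 * unit_ball_vol 3) * sqrt (inverse (real (Suc j)))" for j
    proof -
      have "L2_norm (E j) \<le> \<bar>Suc j * M\<bar> * sqrt (unit_ball_vol 3 * (2 / Suc j) ^ 3)"
      proof -
        have "L2_norm (\<lambda>x. indicator (cball 0 (2 / Suc j)) x *\<^sub>R axis (1::4) (1::complex)) = sqrt (unit_ball_vol 3 * (2 / Suc j) ^ 3)"
          by (rule indicator_cball_L2(2)) simp
        then show ?thesis
          using L2_norm_mono_AE[OF EL L2_scaleR[OF indicator_cball_L2(1)] AE_I2[OF Eb], of j] by (simp only: L2_norm_scaleR)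
      qed
      \<comment> \<open>The square root of the volume has order \<open>j\<close> to the power -3/2,
        so against the factor \<open>j\<close> a decay of order \<open>1 / sqrt j\<close>
        remains.\<close>
      also have "sqrt (unit_ball_vol 3 * (2 / Suc j) ^ 3) = sqrt (8 * unit_ball_vol 3) * sqrt (inverse (real (Suc j))) * inverse (real (Suc j))"
      proof -
        have "unit_ball_vol 3 * (2 / Suc j) ^ 3 = (8 * unit_ball_vol 3) * inverse (real (Suc j)) * (inverse (real (Suc j)))\<^sup>2"
          by (simp add: field_simps power3_eq_cube power2_eq_square)
        then show ?thesis by (simp only: real_sqrt_mult) simp
      qed
      also have "\<bar>real (Suc j) * M\<bar> * (sqrt (8 * unit_ball_vol 3) * sqrt (inverse (real (Suc j))) * inverse (real (Suc j)))
          = \<bar>M\<bar> * sqrt (8 * unit_ball_vol 3) * sqrt (inverse (real (Suc j)))"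
        by (simp add: abs_mult del: of_nat_Suc)
      finally have "L2_norm (E j) \<le> \<bar>M\<bar> * sqrt (8 * unit_ball_vol 3) * sqrt (inverse (real (Suc j)))" .
      then have "L2_norm n * L2_norm (E j) \<le> L2_norm n * (\<bar>M\<bar> * sqrt (8 * unit_ball_vol 3) * sqrt (inverse (real (Suc j))))"
        by (intro mult_left_mono) auto
      then show ?thesis using ip_Cauchy_Schwarz[OF n EL, of j] by (simp add: mult.assoc)
    qed
    then show "\<forall>\<^sub>F j in sequentially. norm (ip n (E j)) \<le> L2_norm n * \<bar>M\<bar> * sqrt (8 * unit_ball_vol 3) * sqrt (inverse (real (Suc j)))"
      by simp
    have "(\<lambda>j. L2_norm n * \<bar>M\<bar> * sqrt (8 * unit_ball_vol 3) * sqrt (inverse (real (Suc j)))) \<longlonglongrightarrow>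
        L2_norm n * \<bar>M\<bar> * sqrt (8 * unit_ball_vol 3) * sqrt 0"
      by (intro tendsto_mult tendsto_const tendsto_real_sqrt LIMSEQ_inverse_real_of_nat)
    then show "(\<lambda>j. L2_norm n * \<bar>M\<bar> * sqrt (8 * unit_ball_vol 3) * sqrt (inverse (real (Suc j)))) \<longlonglongrightarrow> 0" by simp
  qed
  have "ip n (\<lambda>x. cut j x *\<^sub>R G x) + ip n (E j) = ip \<zeta> (\<lambda>x. cut j x *\<^sub>R \<psi> x)" for j
  proof -
    have "(\<Sum>k\<in>UNIV. alpha_mat k *v (cut j x *\<^sub>R D k x + dcut j k x *\<^sub>R \<psi> x)) = cut j x *\<^sub>R G x + E j x" for x
      by (simp add: al.add al.scaleR sum.distrib G_def E_def scaleR_sum_right)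
    then show ?thesis using w[OF Cj oj, of j] by (simp add: ip_add_right[OF cut_L2[OF GL] EL n])
  qed
  moreover have "(\<lambda>j. ip n (\<lambda>x. cut j x *\<^sub>R G x) + ip n (E j)) \<longlonglongrightarrow> ip n G + 0"
    by (intro tendsto_add cut_ip n GL Elim)
  ultimately have "ip n G = ip \<zeta> \<psi>" using LIMSEQ_unique[OF _ cut_ip[OF \<zeta> TL(1)]] by simp
  then show "(\<Sum>k\<in>UNIV. ip (\<lambda>x. alpha_mat k *v n x) (\<lambda>x. partial_deriv k \<eta> x *\<^sub>R c)) = ip \<zeta> (\<lambda>x. \<eta> x *\<^sub>R c)"
    unfolding G_def \<psi>_def[abs_def] ip_alpha by (simp add: ip_sum_right alpha_L2 TL n D_def[symmetric, abs_def])
qed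

section \<open>Linear operations on \<open>H1\<close> fields\<close>

lemma weak_dirac_add:
  assumes "f \<in> L2" "g \<in> L2" "f' \<in> L2" "g' \<in> L2" "weak_dirac f f'" "weak_dirac g g'"
  shows "weak_dirac (\<lambda>x. f x + g x) (\<lambda>x. f' x + g' x)"
  unfolding weak_dirac_def
proof (intro allI impI)
  fix \<eta> and c :: "complex^4" assume t: "test_function \<eta>"
  note T = test_scaleR_C1c[OF t, of c]
  show "(\<Sum>k\<in>UNIV. ip (\<lambda>x. alpha_mat k *v (f x + g x)) (\<lambda>x. partial_deriv k \<eta> x *\<^sub>R c))
      = ip (\<lambda>x. f' x + g' x) (\<lambda>x. \<eta> x *\<^sub>R c)"
    using assms t by (simp add: matrix_vector_right_distrib ip_add_left alpha_L2 C1c_L2[OF T] sum.distrib weak_dirac_def)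
qed

lemma weak_dirac_linear_image:
  assumes w: "weak_dirac f f'" and T: "\<And>k v. alpha_mat k *v T v = T (alpha_mat k *v v)"
    and S: "\<And>v w r. T v \<bullet> w = v \<bullet> S w" "\<And>v r. S (r *\<^sub>R v) = r *\<^sub>R S v"
  shows "weak_dirac (\<lambda>x. T (f x)) (\<lambda>x. T (f' x))"
  using w unfolding weak_dirac_def ip_def T S by simp

lemma H1_add:
  assumes "f \<in> H1" "g \<in> H1"
  shows "(\<lambda>x. f x + g x) \<in> H1" "AE x in lborel. skew_dirac (\<lambda>x. f x + g x) x = skew_dirac f x + skew_dirac g x"
proof -
  note L = H1_L2[OF assms(1)] H1_L2[OF assms(2)] skew_dirac_L2[OF assms(1)] skew_dirac_L2[OF assms(2)]
  note w = weak_dirac_add[OF L skew_dirac_weak[OF assms(1)] skew_dirac_weak[OF assms(2)]]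
  show "(\<lambda>x. f x + g x) \<in> H1" "AE x in lborel. skew_dirac (\<lambda>x. f x + g x) x = skew_dirac f x + skew_dirac g x"
    using weak_dirac_H1[OF L2_add[OF L(1,2)] L2_add[OF L(3,4)] w] by auto
qed

lemma H1_scaleR:
  assumes f: "f \<in> H1"
  shows "(\<lambda>x. c *\<^sub>R f x) \<in> H1" "AE x in lborel. skew_dirac (\<lambda>x. c *\<^sub>R f x) x = c *\<^sub>R skew_dirac f x"
proof -
  have "weak_dirac (\<lambda>x. c *\<^sub>R f x) (\<lambda>x. c *\<^sub>R skew_dirac f x)"
    by (rule weak_dirac_linear_image[OF skew_dirac_weak[OF f], where S="\<lambda>v. c *\<^sub>R v"])
       (simp_all add: linear_cmul[OF bounded_linear.linear[OF alpha_linear]])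
  from weak_dirac_H1[OF _ _ this]
  show "(\<lambda>x. c *\<^sub>R f x) \<in> H1" "AE x in lborel. skew_dirac (\<lambda>x. c *\<^sub>R f x) x = c *\<^sub>R skew_dirac f x"
    using f by (auto intro: L2_scaleR H1_L2 skew_dirac_L2)
qed

lemma H1_diff:
  assumes "f \<in> H1" "g \<in> H1"
  shows "(\<lambda>x. f x - g x) \<in> H1" "AE x in lborel. skew_dirac (\<lambda>x. f x - g x) x = skew_dirac f x - skew_dirac g x"
proof -
  show "(\<lambda>x. f x - g x) \<in> H1" using H1_add(1)[OF assms(1) H1_scaleR(1)[OF assms(2), of "-1"]] by simp
  show "AE x in lborel. skew_dirac (\<lambda>x. f x - g x) x = skew_dirac f x - skew_dirac g x"
    using H1_add(2)[OF assms(1) H1_scaleR(1)[OF assms(2), of "-1"]] H1_scaleR(2)[OF assms(2), of "-1"]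
    by eventually_elim simp
qed

subsection \<open>Solvability of the resolvent equation\<close>

text \<open>The zeroth-order part of the resolvent equation, as a bounded real-linear map
  \<open>B x\<close> at each point with adjoint \<open>Bt x\<close>. Its symmetric part is the
  scalar \<open>b\<close>, which will be \<open>- Re z\<close>; this is the only source of
  coercivity.\<close>

locale dissipative =
  fixes B Bt :: "real^3 \<Rightarrow> complex^4 \<Rightarrow> complex^4" and b K :: real
  assumes lin: "\<And>x. linear (B x)" "\<And>x. linear (Bt x)"
    and bounded: "AE x in lborel. \<forall>v. norm (B x v) \<le> K * norm v" "AE x in lborel. \<forall>v. norm (Bt x v) \<le> K * norm v"
    and meas: "\<And>f. f \<in> borel_measurable borel \<Longrightarrow> (\<lambda>x. B x (f x)) \<in> borel_measurable borel"
      "\<And>f. f \<in> borel_measurable borel \<Longrightarrow> (\<lambda>x. Bt x (f x)) \<in> borel_measurable borel"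
    and adj: "\<And>x v w. B x v \<bullet> w = v \<bullet> Bt x w"
    and diss: "\<And>x v. B x v \<bullet> v = b * (v \<bullet> v)" and b: "b \<noteq> 0"
begin

lemma B_L2: "f \<in> L2 \<Longrightarrow> (\<lambda>x. B x (f x)) \<in> L2" "f \<in> L2 \<Longrightarrow> (\<lambda>x. Bt x (f x)) \<in> L2"
  by (rule L2_bound[OF meas(1)[OF L2_measurable], of f f K]; use bounded(1) in \<open>auto elim: eventually_mono\<close>)
     (rule L2_bound[OF meas(2)[OF L2_measurable], of f f K]; use bounded(2) in \<open>auto elim: eventually_mono\<close>)

lemma ip_B: "ip (\<lambda>x. B x (f x)) g = ip f (\<lambda>x. Bt x (g x))"
  by (simp add: ip_def adj)

lemma ip_B_self: "ip (\<lambda>x. B x (f x)) f = b * (L2_norm f)\<^sup>2"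
  by (simp add: ip_def diss L2_norm_power2)

text \<open>Pairing with \<open>f\<close> removes the skew derivative and leaves \<open>b\<close>
  times the squared norm.\<close>

lemma lower_bound:
  assumes f: "f \<in> H1"
  shows "\<bar>b\<bar> * L2_norm f \<le> L2_norm (\<lambda>x. skew_dirac f x + B x (f x))"
proof (cases "L2_norm f = 0")
  case False
  note L = skew_dirac_L2[OF f] H1_L2[OF f] B_L2(1)[OF H1_L2[OF f]]
  have "ip (\<lambda>x. skew_dirac f x + B x (f x)) f = b * (L2_norm f)\<^sup>2"
    by (simp add: ip_add_left L skew_dirac_self[OF f] ip_B_self)
  then have "\<bar>b * (L2_norm f)\<^sup>2\<bar> \<le> L2_norm (\<lambda>x. skew_dirac f x + B x (f x)) * L2_norm f"
    using ip_Cauchy_Schwarz[OF L2_add[OF L(1,3)] L(2)] by simp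
  then have "(\<bar>b\<bar> * L2_norm f) * L2_norm f \<le> L2_norm (\<lambda>x. skew_dirac f x + B x (f x)) * L2_norm f"
    by (simp add: abs_mult power2_eq_square)
  moreover have "L2_norm f > 0" using False L2_norm_nonneg[of f] by linarith
  ultimately show ?thesis by simp
qed simp

end

locale dissipative_sector = sector + dissipative +
  assumes form_B: "\<And>f. form f \<Longrightarrow> form (\<lambda>x. B x (f x))" "\<And>f. form f \<Longrightarrow> form (\<lambda>x. Bt x (f x))"
begin

lemma form_add: "form f \<Longrightarrow> form h \<Longrightarrow> form (\<lambda>x. f x + h x)"
proof -
  assume "form f" "form h"
  then obtain u v where "AE x in lborel. f x = (\<Sum>p<m. u p (norm x) *\<^sub>R g p x)"
    "AE x in lborel. h x = (\<Sum>p<m. v p (norm x) *\<^sub>R g p x)" by (auto simp: form_def)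
  then have "AE x in lborel. f x + h x = (\<Sum>p<m. (u p (norm x) + v p (norm x)) *\<^sub>R g p x)"
    by eventually_elim (simp add: scaleR_add_left sum.distrib)
  then show ?thesis unfolding form_def by (rule exI[where x="\<lambda>p r. u p r + v p r"])
qed

lemma form_scaleR: "form f \<Longrightarrow> form (\<lambda>x. c *\<^sub>R f x)"
proof -
  assume "form f"
  then obtain u where "AE x in lborel. f x = (\<Sum>p<m. u p (norm x) *\<^sub>R g p x)" by (auto simp: form_def)
  then have "AE x in lborel. c *\<^sub>R f x = (\<Sum>p<m. (c * u p (norm x)) *\<^sub>R g p x)"
    by eventually_elim (simp add: scaleR_sum_right)
  then show ?thesis unfolding form_def by (rule exI[where x="\<lambda>p r. c * u p r"])
qed

lemma form_diff: "form f \<Longrightarrow> form h \<Longrightarrow> form (\<lambda>x. f x - h x)"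
  using form_add[of f "\<lambda>x. (-1) *\<^sub>R h x"] form_scaleR[of h "-1"] by simp

definition solves :: "(real^3 \<Rightarrow> complex^4) \<Rightarrow> (real^3 \<Rightarrow> complex^4) \<Rightarrow> bool" where
  "solves \<rho> t \<longleftrightarrow> \<rho> \<in> H1 \<and> form \<rho> \<and> (AE x in lborel. t x = skew_dirac \<rho> x + B x (\<rho> x))"

text \<open>By the lower bound, convergence of the right-hand sides makes the solutions Cauchy. The
  limit solves the equation weakly, and elliptic regularity puts it into \<open>H1\<close>.\<close>

lemma range_closed:
  assumes t: "\<And>n. t n \<in> L2" "w \<in> L2" "(\<lambda>n. L2_norm (\<lambda>x. t n x - w x)) \<longlonglongrightarrow> 0"
    and s: "\<And>n. solves (\<rho> n) (t n)"
  shows "\<exists>r. solves r w"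
proof -
  have H: "\<rho> n \<in> H1" "form (\<rho> n)" "AE x in lborel. t n x = skew_dirac (\<rho> n) x + B x (\<rho> n x)" for n
    using s[of n] by (auto simp: solves_def)
  note L = H1_L2[OF H(1)]
  have est: "\<bar>b\<bar> * L2_norm (\<lambda>x. \<rho> i x - \<rho> j x) \<le> L2_norm (\<lambda>x. t i x - t j x)" for i j
  proof -
    note d = H1_diff[OF H(1) H(1), of i j]
    have "L2_norm (\<lambda>x. skew_dirac (\<lambda>x. \<rho> i x - \<rho> j x) x + B x (\<rho> i x - \<rho> j x)) = L2_norm (\<lambda>x. t i x - t j x)"
    proof (rule L2_norm_cong_AE)
      show "(\<lambda>x. skew_dirac (\<lambda>x. \<rho> i x - \<rho> j x) x + B x (\<rho> i x - \<rho> j x)) \<in> borel_measurable borel"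
        by (intro L2_measurable L2_add skew_dirac_L2 d B_L2 L2_diff L)
      show "(\<lambda>x. t i x - t j x) \<in> borel_measurable borel" by (intro L2_measurable L2_diff t)
      show "AE x in lborel. skew_dirac (\<lambda>x. \<rho> i x - \<rho> j x) x + B x (\<rho> i x - \<rho> j x) = t i x - t j x"
        using d(2) H(3)[of i] H(3)[of j] by eventually_elim (simp add: linear_diff[OF lin(1)])
    qed
    then show ?thesis using lower_bound[OF d(1)] by simp
  qed
  have "\<exists>r\<in>L2. (\<lambda>n. L2_norm (\<lambda>x. \<rho> n x - r x)) \<longlonglongrightarrow> 0"
  proof (rule L2_complete[OF L])
    fix e :: real assume e: "e > 0"
    then obtain N where N: "\<And>n. n \<ge> N \<Longrightarrow> L2_norm (\<lambda>x. t n x - w x) < \<bar>b\<bar> * e / 2"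
      using LIMSEQ_D[OF t(3), of "\<bar>b\<bar> * e / 2"] b by auto
    show "\<exists>N. \<forall>i\<ge>N. \<forall>j\<ge>N. L2_norm (\<lambda>x. \<rho> i x - \<rho> j x) < e"
    proof (intro exI allI impI)
      fix i j assume ij: "i \<ge> N" "j \<ge> N"
      have "\<bar>b\<bar> * L2_norm (\<lambda>x. \<rho> i x - \<rho> j x) < \<bar>b\<bar> * e"
        using est[of i j] N[OF ij(1)] N[OF ij(2)] L2_norm_diff_triangle[OF t(1) t(2) t(1), of i j]
          L2_norm_minus_commute[of "t j" w] by linarith
      then show "L2_norm (\<lambda>x. \<rho> i x - \<rho> j x) < e" using b by simp
    qed
  qed
  then obtain r where r: "r \<in> L2" "(\<lambda>n. L2_norm (\<lambda>x. \<rho> n x - r x)) \<longlonglongrightarrow> 0" by blast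
  have fr: "form r" by (rule form_limit[OF L r H(2)])
  have S: "AE x in lborel. skew_dirac (\<rho> n) x = t n x - B x (\<rho> n x)" for n
    using H(3)[of n] by eventually_elim simp
  have D: "(\<lambda>x. w x - B x (r x)) \<in> L2" by (intro L2_diff t B_L2 r)
  have lim: "(\<lambda>n. L2_norm (\<lambda>x. skew_dirac (\<rho> n) x - (w x - B x (r x)))) \<longlonglongrightarrow> 0"
  proof (rule Lim_null_comparison)
    show "\<forall>\<^sub>F n in sequentially. norm (L2_norm (\<lambda>x. skew_dirac (\<rho> n) x - (w x - B x (r x))))
        \<le> L2_norm (\<lambda>x. t n x - w x) + \<bar>K\<bar> * L2_norm (\<lambda>x. \<rho> n x - r x)"
    proof (intro always_eventually allI)
      fix n
      have rr: "(\<lambda>x. r x - \<rho> n x) \<in> L2" by (intro L2_diff r L)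
      have "L2_norm (\<lambda>x. skew_dirac (\<rho> n) x - (w x - B x (r x))) = L2_norm (\<lambda>x. (t n x - w x) + B x (r x - \<rho> n x))"
      proof (rule L2_norm_cong_AE)
        show "(\<lambda>x. skew_dirac (\<rho> n) x - (w x - B x (r x))) \<in> borel_measurable borel"
          by (intro L2_measurable L2_diff skew_dirac_L2 H D)
        show "(\<lambda>x. (t n x - w x) + B x (r x - \<rho> n x)) \<in> borel_measurable borel"
          by (intro L2_measurable L2_add L2_diff t B_L2 L r)
        show "AE x in lborel. skew_dirac (\<rho> n) x - (w x - B x (r x)) = (t n x - w x) + B x (r x - \<rho> n x)"
          using S[of n] by eventually_elim (simp add: linear_diff[OF lin(1)])
      qed
      also have "\<dots> \<le> L2_norm (\<lambda>x. t n x - w x) + L2_norm (\<lambda>x. B x (r x - \<rho> n x))"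
        by (intro L2_norm_triangle L2_diff t B_L2 r L)
      also have "L2_norm (\<lambda>x. B x (r x - \<rho> n x)) \<le> L2_norm (\<lambda>x. K *\<^sub>R (r x - \<rho> n x))"
      proof (rule L2_norm_mono_AE[OF B_L2(1)[OF rr] L2_scaleR[OF rr]])
        show "AE x in lborel. norm (B x (r x - \<rho> n x)) \<le> norm (K *\<^sub>R (r x - \<rho> n x))"
          using bounded(1)
        proof eventually_elim
          case (elim x)
          show ?case using elim[rule_format, of "r x - \<rho> n x"]
            by (rule order_trans) (simp add: mult_right_mono)
        qed
      qed
      also have "\<dots> = \<bar>K\<bar> * L2_norm (\<lambda>x. \<rho> n x - r x)"
        by (simp only: L2_norm_scaleR L2_norm_minus_commute[of r])
      finally show "norm (L2_norm (\<lambda>x. skew_dirac (\<rho> n) x - (w x - B x (r x))))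
        \<le> L2_norm (\<lambda>x. t n x - w x) + \<bar>K\<bar> * L2_norm (\<lambda>x. \<rho> n x - r x)"
        by simp
    qed
    show "(\<lambda>n. L2_norm (\<lambda>x. t n x - w x) + \<bar>K\<bar> * L2_norm (\<lambda>x. \<rho> n x - r x)) \<longlonglongrightarrow> 0"
      using tendsto_add[OF t(3) tendsto_mult_right_zero[OF r(2), of "\<bar>K\<bar>"]] by simp
  qed
  have "weak_dirac r (\<lambda>x. w x - B x (r x))"
    by (rule weak_dirac_limit[OF L r _ D lim]) (intro skew_dirac_L2 skew_dirac_weak H)+
  from weak_dirac_H1[OF r(1) D this] have rH: "r \<in> H1" "AE x in lborel. skew_dirac r x = w x - B x (r x)" by auto
  from rH(2) have "AE x in lborel. w x = skew_dirac r x + B x (r x)" by eventually_elim simp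
  then show ?thesis using rH(1) fr unfolding solves_def by blast
qed

theorem solvable:
  assumes \<eta>: "\<eta> \<in> L2" "form \<eta>"
  shows "\<exists>\<rho>\<in>H1. form \<rho> \<and> (AE x in lborel. skew_dirac \<rho> x + B x (\<rho> x) = \<eta> x)"
proof -
  define T where "T = {t \<in> L2. \<exists>\<rho>. solves \<rho> t}"
  have "\<exists>t w. (\<forall>n. t n \<in> T) \<and> w \<in> L2 \<and> (\<lambda>n. L2_norm (\<lambda>x. t n x - w x)) \<longlonglongrightarrow> 0
           \<and> (\<forall>f\<in>T. ip (\<lambda>x. \<eta> x - w x) f = 0)"
  proof (rule L2_projection[OF _ _ _ _ \<eta>(1)])
    show "T \<subseteq> L2" by (auto simp: T_def)
    show add: "(\<lambda>x. s x + t x) \<in> T" if st: "s \<in> T" "t \<in> T" for s t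
    proof -
      obtain \<rho> \<sigma> where r: "solves \<rho> s" "solves \<sigma> t" "s \<in> L2" "t \<in> L2" using st unfolding T_def by blast
      then have H: "\<rho> \<in> H1" "\<sigma> \<in> H1" and ae: "AE x in lborel. s x = skew_dirac \<rho> x + B x (\<rho> x)"
        "AE x in lborel. t x = skew_dirac \<sigma> x + B x (\<sigma> x)" by (auto simp: solves_def)
      have "AE x in lborel. s x + t x = skew_dirac (\<lambda>x. \<rho> x + \<sigma> x) x + B x (\<rho> x + \<sigma> x)"
        using ae H1_add(2)[OF H] by eventually_elim (simp add: linear_add[OF lin(1)])
      then have "solves (\<lambda>x. \<rho> x + \<sigma> x) (\<lambda>x. s x + t x)"
        using r H1_add(1)[OF H] form_add by (auto simp: solves_def)
      then show ?thesis using L2_add[OF r(3,4)] unfolding T_def by blast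
    qed
    show scale: "(\<lambda>x. c *\<^sub>R t x) \<in> T" if t: "t \<in> T" for c t
    proof -
      obtain \<rho> where r: "solves \<rho> t" "t \<in> L2" using t unfolding T_def by blast
      then have H: "\<rho> \<in> H1" and ae: "AE x in lborel. t x = skew_dirac \<rho> x + B x (\<rho> x)" by (auto simp: solves_def)
      have "AE x in lborel. c *\<^sub>R t x = skew_dirac (\<lambda>x. c *\<^sub>R \<rho> x) x + B x (c *\<^sub>R \<rho> x)"
        using ae H1_scaleR(2)[OF H, of c] by eventually_elim (simp add: linear_cmul[OF lin(1)] scaleR_add_right)
      then have "solves (\<lambda>x. c *\<^sub>R \<rho> x) (\<lambda>x. c *\<^sub>R t x)"
        using r H1_scaleR(1)[OF H] form_scaleR by (auto simp: solves_def)
      then show ?thesis using L2_scaleR[OF r(2)] unfolding T_def by blast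
    qed
    have z: "C1c (\<lambda>x::real^3. 0::complex^4) (\<lambda>k x. 0)" by (simp add: C1c_def C1_const)
    have "AE x in lborel. 0 = skew_dirac (\<lambda>x. 0) x + B x 0"
      using skew_dirac_C1c[OF z] by eventually_elim (simp add: linear_0[OF lin(1)])
    moreover have "form (\<lambda>x. 0)" unfolding form_def by (rule exI[of _ "\<lambda>p r. 0"]) simp
    ultimately have "solves (\<lambda>x. 0) (\<lambda>x. 0)" using C1c_H1[OF z] by (simp add: solves_def)
    then show "(\<lambda>x. 0) \<in> T" unfolding T_def by auto
  qed
  then obtain t w where t: "\<And>n. t n \<in> T" "w \<in> L2" "(\<lambda>n. L2_norm (\<lambda>x. t n x - w x)) \<longlonglongrightarrow> 0"
    "\<And>f. f \<in> T \<Longrightarrow> ip (\<lambda>x. \<eta> x - w x) f = 0" by blast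
  have "\<exists>\<rho>. \<forall>n. solves (\<rho> n) (t n)" using t(1) unfolding T_def by (intro choice) auto
  then obtain \<rho> where \<rho>: "\<And>n. solves (\<rho> n) (t n)" by blast
  have tL: "t n \<in> L2" for n using t(1)[of n] by (simp add: T_def)
  obtain r where r: "solves r w" using range_closed[OF tL t(2,3) \<rho>] by blast
  then have rH: "r \<in> H1" "form r" "AE x in lborel. w x = skew_dirac r x + B x (r x)" by (auto simp: solves_def)
  have fw: "form w" by (rule form_cong[OF form_add[OF dirac_invariant[OF rH(2,1)] form_B(1)[OF rH(2)]] rH(3)])
  define n where "n x = \<eta> x - w x" for x
  have n: "n \<in> L2" "form n" unfolding n_def[abs_def] using \<eta> t(2) fw by (auto intro: L2_diff form_diff)
  note Btn = B_L2(2)[OF n(1)] form_B(2)[OF n(2)]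
  \<comment> \<open>\<open>n\<close> is orthogonal to the range, but only over the sector. Applying
    this to \<open>Q \<psi>\<close> and using that \<open>n\<close> and its image under
    \<open>Bt\<close> lie in the sector turns it into an identity for every test field
    \<psi>.\<close>
  have "weak_dirac n (\<lambda>x. Bt x (n x))"
  proof (rule weak_dirac_punctured[OF n(1) Btn(1)])
    fix \<psi> :: "real^3 \<Rightarrow> complex^4" and D assume C: "C1c \<psi> D" "off0 \<psi>"
    note QH = Q_test_dirac(1)[OF C]
    note L = skew_dirac_L2[OF QH] B_L2(1)[OF H1_L2[OF QH]] skew_dirac_L2[OF C1c_H1[OF C(1)]]
    have "solves (Q \<psi>) (\<lambda>x. skew_dirac (Q \<psi>) x + B x (Q \<psi> x))" using QH Q_form by (simp add: solves_def)
    then have "ip n (\<lambda>x. skew_dirac (Q \<psi>) x + B x (Q \<psi> x)) = 0"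
      unfolding n_def[abs_def] using L by (intro t(4)) (auto simp: T_def intro: L2_add)
    then have "ip n (skew_dirac (Q \<psi>)) + ip (\<lambda>x. Bt x (n x)) (Q \<psi>) = 0"
      by (simp add: ip_add_right L n ip_B ip_commute[of n "\<lambda>x. B x (Q \<psi> x)"] ip_commute[of "\<lambda>x. Bt x (n x)"])
    then have "ip n (skew_dirac \<psi>) + ip (\<lambda>x. Bt x (n x)) \<psi> = 0"
      by (simp add: ip_dirac_Q[OF n(2,1) C] ip_Q_form[OF Btn(2,1) C1c_L2(1)[OF C(1)]])
    moreover have "ip (skew_dirac \<psi>) n = ip (\<lambda>x. - (\<Sum>k\<in>UNIV. alpha_mat k *v D k x)) n"
      by (rule ip_cong_AE[OF L2_measurable[OF L(3)] L2_measurable L2_measurable[OF n(1)] skew_dirac_C1c[OF C(1)]])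
         (intro L2_minus L2_sum alpha_L2 C1c_L2(2)[OF C(1)])
    ultimately show "ip n (\<lambda>x. \<Sum>k\<in>UNIV. alpha_mat k *v D k x) = ip (\<lambda>x. Bt x (n x)) \<psi>"
      by (simp add: ip_commute[of n] ip_minus_left)
  qed
  from weak_dirac_H1[OF n(1) Btn(1) this]
  have nH: "n \<in> H1" "AE x in lborel. skew_dirac n x = Bt x (n x)" by auto
  \<comment> \<open>The energy identity for the adjoint equation: the derivative drops out, and
    \<open>b \<noteq> 0\<close> forces the norm of \<open>n\<close> to be 0.\<close>
  have "0 = ip (skew_dirac n) n" using skew_dirac_self[OF nH(1)] by simp
  also have "\<dots> = ip (\<lambda>x. Bt x (n x)) n"
    by (rule ip_cong_AE[OF L2_measurable[OF skew_dirac_L2[OF nH(1)]] L2_measurable[OF Btn(1)] L2_measurable[OF n(1)] nH(2)])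
  also have "\<dots> = b * (L2_norm n)\<^sup>2" using ip_B[of n n] ip_B_self[of n] by (simp add: ip_commute)
  finally have "L2_norm n = 0" using b by simp
  from L2_norm_zero_AE[OF n(1) this] rH(3) have "AE x in lborel. skew_dirac r x + B x (r x) = \<eta> x"
    by eventually_elim (simp add: n_def)
  then show ?thesis using rH by blast
qed

end

subsection \<open>Sectors generated by angular two-spinors\<close>

lemma pauli_linear: "bounded_linear (\<lambda>v. pauli k *v v)"
  by (rule linear_conv_bounded_linear[THEN iffD1], rule linearI)
     (rule matrix_vector_right_distrib, simp add: vec_eq_iff matrix_vector_mult_def sum_2 scaleR_add_right)

lemma sigma_r_mult: "sigma_r x *v a = (\<Sum>k\<in>UNIV. (x $ k / norm x) *\<^sub>R (pauli k *v a))"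
  by (simp add: vec_eq_iff forall_2 sigma_r_def matrix_vector_mult_def sum_2 sum_3 algebra_simps)

lemma sigma_r_linear: "bounded_linear (\<lambda>v. sigma_r x *v v)"
  by (rule linear_conv_bounded_linear[THEN iffD1], rule linearI)
     (rule matrix_vector_right_distrib, simp add: vec_eq_iff matrix_vector_mult_def sum_2 scaleR_add_right)

lemma mult_scale: "(A :: complex^'n^'m) *v (c *s v) = c *s (A *v v)"
  by (simp add: vec_eq_iff matrix_vector_mult_def sum_distrib_left mult_ac)

lemma scale_linear: "bounded_linear (\<lambda>v :: complex^'n. c *s v)"
  by (rule linear_conv_bounded_linear[THEN iffD1], rule linearI) (simp_all add: vec_eq_iff algebra_simps)

lemma spinor_linear: "bounded_linear (\<lambda>v. spinor v 0)" "bounded_linear (\<lambda>v. spinor 0 v)"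
  by (rule linear_conv_bounded_linear[THEN iffD1], rule linearI, simp_all add: spinor_add spinor_scaleR)+

text \<open>The anticommutation relations contracted with the unit radial vector.\<close>

lemma pauli_sigma_r: "pauli k *v (sigma_r x *v a) = (2 * (x $ k / norm x)) *\<^sub>R a - sigma_r x *v (pauli k *v a)"
proof -
  interpret p: bounded_linear "\<lambda>v. pauli j *v v" for j by (rule pauli_linear)
  have "pauli k *v (sigma_r x *v a) + sigma_r x *v (pauli k *v a)
      = (\<Sum>l\<in>UNIV. (x $ l / norm x) *\<^sub>R (pauli k *v (pauli l *v a) + pauli l *v (pauli k *v a)))"
    by (simp add: sigma_r_mult p.sum p.scaleR scaleR_add_right sum.distrib)
  also have "\<dots> = (\<Sum>l\<in>UNIV. if l = k then (2 * (x $ l / norm x)) *\<^sub>R a else 0)"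
    by (rule sum.cong) (auto simp: pauli_anticommute mult.commute)
  also have "\<dots> = (2 * (x $ k / norm x)) *\<^sub>R a" by simp
  finally show ?thesis by (rule eq_diff_eq[THEN iffD2])
qed

lemma sigma_r_square: "x \<noteq> 0 \<Longrightarrow> sigma_r x *v (sigma_r x *v a) = a"
proof -
  assume x: "x \<noteq> 0"
  interpret s: bounded_linear "\<lambda>v. sigma_r x *v v" by (rule sigma_r_linear)
  have "sigma_r x *v (sigma_r x *v a) = (\<Sum>k\<in>UNIV. (x $ k / norm x) *\<^sub>R (pauli k *v (sigma_r x *v a)))"
    by (rule sigma_r_mult)
  also have "\<dots> = (\<Sum>k\<in>UNIV. (2 * (x $ k / norm x)\<^sup>2) *\<^sub>R a) - sigma_r x *v (\<Sum>k\<in>UNIV. (x $ k / norm x) *\<^sub>R (pauli k *v a))"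
    by (simp add: pauli_sigma_r scaleR_diff_right sum_subtractf s.sum s.scaleR power2_eq_square mult_ac)
  also have "(\<Sum>k\<in>UNIV. (2 * (x $ k / norm x)\<^sup>2) *\<^sub>R a) = 2 *\<^sub>R a"
  proof -
    have "(\<Sum>k\<in>UNIV. (x $ k / norm x)\<^sup>2) = (\<Sum>k\<in>UNIV. x $ k * x $ k) / (norm x)\<^sup>2"
      by (simp add: power_divide power2_eq_square sum_divide_distrib)
    also have "(\<Sum>k\<in>UNIV. x $ k * x $ k) = (norm x)\<^sup>2" by (simp add: power2_norm_eq_inner inner_vec_def)
    finally have "(\<Sum>k\<in>UNIV. (x $ k / norm x)\<^sup>2) = 1" using x by simp
    then show ?thesis by (simp only: scaleR_sum_left[symmetric] sum_distrib_left[symmetric]) simp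
  qed
  finally have "sigma_r x *v (sigma_r x *v a) = 2 *\<^sub>R a - sigma_r x *v (sigma_r x *v a)"
    by (simp only: sigma_r_mult[symmetric])
  then have "2 *\<^sub>R (sigma_r x *v (sigma_r x *v a)) = 2 *\<^sub>R a" by (simp add: scaleR_2 algebra_simps)
  then show ?thesis by simp
qed

text \<open>The 2 is \<open>3 - 1\<close>: the divergence of the unit radial field is
  \<open>2 / r\<close>. Commuting the Pauli matrices past \<open>sigma_r\<close> flips the sign of
  the derivative term, and the correction is the radial derivative of \<open>v\<close>, which
  Euler's relation annihilates.\<close>

lemma dirac_sigma_r:
  assumes x: "x \<noteq> 0" and euler: "(\<Sum>k\<in>UNIV. x $ k *\<^sub>R dv k) = 0"
  shows "norm x *\<^sub>R (\<Sum>k\<in>UNIV. pauli k *v ((1 / norm x) *\<^sub>R (pauli k *v v) - (x $ k / (norm x)\<^sup>2) *\<^sub>R (sigma_r x *v v) + sigma_r x *v dv k))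
    = 2 *\<^sub>R v - norm x *\<^sub>R (sigma_r x *v (\<Sum>k\<in>UNIV. pauli k *v dv k))"
proof -
  interpret p: bounded_linear "\<lambda>v. pauli k *v v" for k by (rule pauli_linear)
  interpret s: bounded_linear "\<lambda>v. sigma_r x *v v" by (rule sigma_r_linear)
  have sq: "pauli k *v (pauli k *v v) = v" for k using pauli_anticommute[of k k v] by (simp flip: scaleR_2)
  have 1: "(\<Sum>k\<in>UNIV. pauli k *v ((1 / norm x) *\<^sub>R (pauli k *v v))) = (3 / norm x) *\<^sub>R v"
    by (simp add: p.scaleR sq sum_3 vec_eq_iff) (simp add: scaleR_conv_of_real)
  have 2: "(\<Sum>k\<in>UNIV. pauli k *v ((x $ k / (norm x)\<^sup>2) *\<^sub>R (sigma_r x *v v))) = (1 / norm x) *\<^sub>R v"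
  proof -
    have "(\<Sum>k\<in>UNIV. pauli k *v ((x $ k / (norm x)\<^sup>2) *\<^sub>R (sigma_r x *v v))) = (1 / norm x) *\<^sub>R (\<Sum>k\<in>UNIV. (x $ k / norm x) *\<^sub>R (pauli k *v (sigma_r x *v v)))"
      by (simp add: p.scaleR scaleR_sum_right power2_eq_square)
    then show ?thesis by (simp only: sigma_r_mult[symmetric] sigma_r_square[OF x])
  qed
  have 3: "(\<Sum>k\<in>UNIV. pauli k *v (sigma_r x *v dv k)) = - (sigma_r x *v (\<Sum>k\<in>UNIV. pauli k *v dv k))"
  proof -
    have "(\<Sum>k\<in>UNIV. (2 * (x $ k / norm x)) *\<^sub>R dv k) = (2 / norm x) *\<^sub>R (\<Sum>k\<in>UNIV. x $ k *\<^sub>R dv k)"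
      by (simp add: scaleR_sum_right)
    then show ?thesis using euler by (simp add: pauli_sigma_r sum_subtractf s.sum)
  qed
  have "(\<Sum>k\<in>UNIV. pauli k *v ((1 / norm x) *\<^sub>R (pauli k *v v) - (x $ k / (norm x)\<^sup>2) *\<^sub>R (sigma_r x *v v) + sigma_r x *v dv k))
     = (3 / norm x) *\<^sub>R v - (1 / norm x) *\<^sub>R v - sigma_r x *v (\<Sum>k\<in>UNIV. pauli k *v dv k)"
    unfolding p.add p.diff sum.distrib sum_subtractf 1 2 3 by simp
  then show ?thesis using x by (simp add: scaleR_diff_right scaleR_diff_left[symmetric])
qed

lemma sigma_r_has_derivative:
  assumes x: "x \<noteq> 0" and d: "(u has_derivative (\<lambda>h. \<Sum>k\<in>UNIV. h$k *\<^sub>R du k)) (at x)"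
  shows "((\<lambda>x. sigma_r x *v u x) has_derivative (\<lambda>h. \<Sum>k\<in>UNIV. h$k *\<^sub>R
    ((1 / norm x) *\<^sub>R (pauli k *v u x) - (x $ k / (norm x)\<^sup>2) *\<^sub>R (sigma_r x *v u x) + sigma_r x *v du k))) (at x)"
proof -
  interpret p: bounded_linear "\<lambda>v. pauli k *v v" for k by (rule pauli_linear)
  interpret s: bounded_linear "\<lambda>v. sigma_r x *v v" by (rule sigma_r_linear)
  have c: "((\<lambda>x. x $ l / norm x) has_derivative (\<lambda>h. h $ l / norm x - x $ l * (h \<bullet> x) / (norm x) ^ 3)) (at x)" for l
    using has_derivative_divide[OF bounded_linear.has_derivative[OF bounded_linear_vec_nth has_derivative_ident] has_derivative_norm[OF x], of l] x
    by (rule_tac has_derivative_eq_rhs) (auto simp: fun_eq_iff sgn_div_norm field_simps power3_eq_cube)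
  have "((\<lambda>x. \<Sum>l\<in>UNIV. (x $ l / norm x) *\<^sub>R (pauli l *v u x)) has_derivative
      (\<lambda>h. \<Sum>l\<in>UNIV. (x $ l / norm x) *\<^sub>R (pauli l *v (\<Sum>k\<in>UNIV. h$k *\<^sub>R du k))
        + (h $ l / norm x - x $ l * (h \<bullet> x) / (norm x) ^ 3) *\<^sub>R (pauli l *v u x))) (at x)"
    by (intro has_derivative_sum has_derivative_scaleR c p.has_derivative d)
  moreover have "(\<Sum>l\<in>UNIV. (x $ l / norm x) *\<^sub>R (pauli l *v (\<Sum>k\<in>UNIV. h$k *\<^sub>R du k))
        + (h $ l / norm x - x $ l * (h \<bullet> x) / (norm x) ^ 3) *\<^sub>R (pauli l *v u x))
      = (\<Sum>k\<in>UNIV. h$k *\<^sub>R ((1 / norm x) *\<^sub>R (pauli k *v u x) - (x $ k / (norm x)\<^sup>2) *\<^sub>R (sigma_r x *v u x) + sigma_r x *v du k))" for h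
  proof -
    have "(\<Sum>l\<in>UNIV. (x $ l / norm x) *\<^sub>R (pauli l *v (\<Sum>k\<in>UNIV. h$k *\<^sub>R du k))) = (\<Sum>k\<in>UNIV. h$k *\<^sub>R (sigma_r x *v du k))"
      by (simp only: sigma_r_mult[symmetric] s.sum s.scaleR)
    moreover have "(\<Sum>l\<in>UNIV. (x $ l * (h \<bullet> x) / (norm x) ^ 3) *\<^sub>R (pauli l *v u x)) = ((h \<bullet> x) / (norm x)\<^sup>2) *\<^sub>R (sigma_r x *v u x)"
      by (simp add: sigma_r_mult scaleR_sum_right power3_eq_cube power2_eq_square mult_ac)
    moreover have "(\<Sum>k\<in>UNIV. h$k *\<^sub>R (x $ k / (norm x)\<^sup>2) *\<^sub>R (sigma_r x *v u x)) = ((h \<bullet> x) / (norm x)\<^sup>2) *\<^sub>R (sigma_r x *v u x)"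
      by (simp add: inner_vec_def sum_divide_distrib scaleR_sum_left[symmetric])
    ultimately show ?thesis
      by (simp add: sum.distrib sum_subtractf scaleR_add_right scaleR_diff_right scaleR_diff_left)
  qed
  ultimately show ?thesis unfolding sigma_r_mult[abs_def, where x="_ :: real^3", symmetric] by (simp add: sigma_r_mult[symmetric])
qed

text \<open>The decisive assumption \<open>chi_key\<close> says that \<open>r\<close> times
  \<open>sigma_r\<close> times the Pauli derivative acts on the span of the spinors through a
  constant matrix. All else needed for a sector follows from this and the Clifford
  relations.\<close>

locale angular =
  fixes ch :: "'j::finite \<Rightarrow> real^3 \<Rightarrow> complex^2" and dch :: "'j \<Rightarrow> 3 \<Rightarrow> real^3 \<Rightarrow> complex^2"
    and M :: "'j \<Rightarrow> 'j \<Rightarrow> complex"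
  assumes chi_deriv: "\<And>j x. x \<noteq> 0 \<Longrightarrow> (ch j has_derivative (\<lambda>h. \<Sum>k\<in>UNIV. h$k *\<^sub>R dch j k x)) (at x)"
    and chi_dcont: "\<And>j k. continuous_on (- {0}) (dch j k)"
    and chi_hom: "\<And>j t x. t > 0 \<Longrightarrow> ch j (t *\<^sub>R x) = ch j x"
    and chi_key: "\<And>j x. x \<noteq> 0 \<Longrightarrow>
       norm x *\<^sub>R (sigma_r x *v (\<Sum>k\<in>UNIV. pauli k *v dch j k x)) = (\<Sum>i\<in>UNIV. M j i *s ch i x)"
begin

text \<open>The factor \<open>\<i>\<close> of the lower component in the theorem is absorbed into
  the complex coefficients \<open>z\<close>.\<close>

definition comb :: "('j \<Rightarrow> complex) \<Rightarrow> ('j \<Rightarrow> complex) \<Rightarrow> real^3 \<Rightarrow> complex^4" where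
  "comb y z x = spinor (\<Sum>j\<in>UNIV. y j *s ch j x) (sigma_r x *v (\<Sum>j\<in>UNIV. z j *s ch j x))"

definition Form :: "(real^3 \<Rightarrow> complex^4) \<Rightarrow> bool" where
  "Form \<rho> \<longleftrightarrow> (\<exists>a b. AE x in lborel. \<rho> x = comb (\<lambda>j. a j (norm x)) (\<lambda>j. b j (norm x)) x)"

text \<open>The real basis of the sector, indexed by the two-spinor, the lower or upper component, and a factor \<open>\<i>\<close>.\<close>

fun F :: "'j \<times> bool \<times> bool \<Rightarrow> real^3 \<Rightarrow> complex^4" where
  "F (j, False, im) x = spinor ((if im then \<i> else 1) *s ch j x) 0"
| "F (j, True, im) x = spinor 0 (sigma_r x *v ((if im then \<i> else 1) *s ch j x))"

fun dF :: "'j \<times> bool \<times> bool \<Rightarrow> 3 \<Rightarrow> real^3 \<Rightarrow> complex^4" where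
  "dF (j, False, im) k x = spinor ((if im then \<i> else 1) *s dch j k x) 0"
| "dF (j, True, im) k x = spinor 0 ((1 / norm x) *\<^sub>R (pauli k *v ((if im then \<i> else 1) *s ch j x))
     - (x $ k / (norm x)\<^sup>2) *\<^sub>R (sigma_r x *v ((if im then \<i> else 1) *s ch j x))
     + sigma_r x *v ((if im then \<i> else 1) *s dch j k x))"

fun rc :: "('j \<Rightarrow> complex) \<Rightarrow> ('j \<Rightarrow> complex) \<Rightarrow> 'j \<times> bool \<times> bool \<Rightarrow> real" where
  "rc y z (j, lo, im) = (let c = (if lo then z j else y j) in if im then Im c else Re c)"

lemma scale_Re_Im: "c *s v = Re c *\<^sub>R v + Im c *\<^sub>R (\<i> *s v)" for v :: "complex^'n"
  by (simp add: vec_eq_iff complex_eq_iff)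

lemma sum_index: "(\<Sum>p\<in>UNIV. G (p :: 'j \<times> bool \<times> bool)) = (\<Sum>j\<in>UNIV. G (j, False, False) + G (j, False, True) + G (j, True, False) + G (j, True, True))"
  for G :: "'j \<times> bool \<times> bool \<Rightarrow> 'c::comm_monoid_add"
proof -
  have "(\<Sum>p\<in>UNIV. G p) = (\<Sum>j\<in>UNIV. \<Sum>q\<in>UNIV. G (j, q))"
    by (simp add: sum.cartesian_product flip: UNIV_Times_UNIV)
  moreover have "(\<Sum>q\<in>UNIV. G (j, q)) = G (j, False, False) + G (j, False, True) + G (j, True, False) + G (j, True, True)" for j
  proof -
    have "(\<Sum>q\<in>UNIV. G (j, q)) = (\<Sum>a\<in>UNIV. \<Sum>b\<in>UNIV. G (j, a, b))"
      by (simp add: sum.cartesian_product flip: UNIV_Times_UNIV)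
    then show ?thesis by (simp add: UNIV_bool add_ac)
  qed
  ultimately show ?thesis by simp
qed

lemma comb_F: "comb y z x = (\<Sum>p\<in>UNIV. rc y z p *\<^sub>R F p x)"
proof -
  interpret s: bounded_linear "\<lambda>v. sigma_r x *v v" by (rule sigma_r_linear)
  have "(\<Sum>p\<in>UNIV. rc y z p *\<^sub>R F p x) = (\<Sum>j\<in>UNIV. spinor (y j *s ch j x) (sigma_r x *v (z j *s ch j x)))"
    unfolding sum_index
    by (rule sum.cong)
       (simp_all add: spinor_scaleR spinor_add scale_Re_Im[of "y _"] scale_Re_Im[of "z _"] s.add s.scaleR)
  then show ?thesis by (simp add: comb_def spinor_sum s.sum)
qed

lemma Form_F: "Form \<rho> \<longleftrightarrow> (\<exists>a. AE x in lborel. \<rho> x = (\<Sum>p\<in>UNIV. a p (norm x) *\<^sub>R F p x))"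
proof
  assume "Form \<rho>"
  then obtain a b where "AE x in lborel. \<rho> x = comb (\<lambda>j. a j (norm x)) (\<lambda>j. b j (norm x)) x" by (auto simp: Form_def)
  then show "\<exists>a. AE x in lborel. \<rho> x = (\<Sum>p\<in>UNIV. a p (norm x) *\<^sub>R F p x)"
    unfolding comb_F by (rule exI[where x="\<lambda>p r. rc (\<lambda>j. a j r) (\<lambda>j. b j r) p"])
next
  assume "\<exists>a. AE x in lborel. \<rho> x = (\<Sum>p\<in>UNIV. a p (norm x) *\<^sub>R F p x)"
  then obtain a where a: "AE x in lborel. \<rho> x = (\<Sum>p\<in>UNIV. a p (norm x) *\<^sub>R F p x)" by blast
  let ?y = "\<lambda>lo j r. Complex (a (j, lo, False) r) (a (j, lo, True) r)"
  have "rc (\<lambda>j. ?y False j r) (\<lambda>j. ?y True j r) p = a p r" for p r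
    by (cases p) (auto simp: Let_def)
  then show "Form \<rho>" unfolding Form_def comb_F
    using a by (intro exI[of _ "?y False"] exI[of _ "?y True"]) simp
qed

lemma chi_euler: "x \<noteq> 0 \<Longrightarrow> (\<Sum>k\<in>UNIV. x $ k *\<^sub>R dch j k x) = 0"
proof -
  assume x: "x \<noteq> 0"
  have "((\<lambda>t. ch j (t *\<^sub>R x)) has_derivative (\<lambda>s. \<Sum>k\<in>UNIV. (s *\<^sub>R x) $ k *\<^sub>R dch j k (1 *\<^sub>R x))) (at 1)"
    by (rule has_derivative_compose[of "\<lambda>t. t *\<^sub>R x", OF _ chi_deriv]) (use x in \<open>auto intro!: derivative_eq_intros\<close>)
  moreover have "((\<lambda>t. ch j (t *\<^sub>R x)) has_derivative (\<lambda>s. 0)) (at 1)"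
    by (rule has_derivative_transform_within_open[OF has_derivative_const, of "{0<..}" _ "ch j x"]) (auto simp: chi_hom)
  ultimately have "(\<lambda>s. \<Sum>k\<in>UNIV. (s *\<^sub>R x) $ k *\<^sub>R dch j k (1 *\<^sub>R x)) = (\<lambda>s. 0)"
    by (rule has_derivative_unique)
  from fun_cong[OF this, of 1] show ?thesis by simp
qed

lemma F_deriv: "x \<noteq> 0 \<Longrightarrow> (F p has_derivative (\<lambda>h. \<Sum>k\<in>UNIV. h$k *\<^sub>R dF p k x)) (at x)"
proof -
  assume x: "x \<noteq> 0"
  obtain j lo im where p: "p = (j, lo, im)" by (cases p)
  define c :: complex where "c = (if im then \<i> else 1)"
  interpret cc: bounded_linear "\<lambda>v :: complex^2. c *s v" by (rule scale_linear)
  have cd: "((\<lambda>x. c *s ch j x) has_derivative (\<lambda>h. \<Sum>k\<in>UNIV. h$k *\<^sub>R (c *s dch j k x))) (at x)"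
    using cc.has_derivative[OF chi_deriv[OF x, of j]] by (simp add: cc.sum cc.scaleR)
  show ?thesis
  proof (cases lo)
    case False
    interpret sp: bounded_linear "\<lambda>v. spinor v 0" by (rule spinor_linear)
    have "F p = (\<lambda>x. spinor (c *s ch j x) 0)" using False by (simp add: p c_def fun_eq_iff)
    then show ?thesis using sp.has_derivative[OF cd] False by (simp add: p c_def sp.sum sp.scaleR)
  next
    case True
    interpret sp: bounded_linear "\<lambda>v. spinor 0 v" by (rule spinor_linear)
    have "F p = (\<lambda>x. spinor 0 (sigma_r x *v (c *s ch j x)))" using True by (simp add: p c_def fun_eq_iff)
    then show ?thesis using sp.has_derivative[OF sigma_r_has_derivative[OF x cd]] True
      by (simp add: p c_def sp.sum sp.scaleR)
  qed
qed

lemma F_hom: "t > 0 \<Longrightarrow> F p (t *\<^sub>R x) = F p x"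
  by (cases "(p, x)" rule: F.cases) (simp_all add: chi_hom sigma_r_def)

lemma sigma_r_cont: "continuous_on (- {0}) v \<Longrightarrow> continuous_on (- {0}) (\<lambda>x. sigma_r x *v v x)"
  unfolding sigma_r_mult by (intro continuous_intros bounded_linear.continuous_on[OF pauli_linear]) auto

lemma dF_cont: "continuous_on (- {0}) (dF p k)"
proof -
  obtain j lo im where p: "p = (j, lo, im)" by (cases p)
  have chi_cont: "continuous_on (- {0}) (ch j)"
    by (intro continuous_at_imp_continuous_on) (auto dest: chi_deriv has_derivative_continuous)
  note cont = bounded_linear.continuous_on[OF scale_linear] bounded_linear.continuous_on[OF pauli_linear]
    bounded_linear.continuous_on[OF spinor_linear(1)] bounded_linear.continuous_on[OF spinor_linear(2)] sigma_r_cont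
    chi_cont chi_dcont
  show ?thesis
    by (cases lo) (auto simp: p[abs_def] intro!: cont continuous_intros)
qed

lemma F_closed_r: "x \<noteq> 0 \<Longrightarrow> (\<Sum>k\<in>UNIV. (x $ k / norm x) *\<^sub>R (alpha_mat k *v F (j, lo, im) x)) = F (j, \<not> lo, im) x"
  by (cases lo) (simp_all add: alpha_mult spinor_scaleR spinor_sum sigma_r_mult[symmetric] sigma_r_square matrix_vector_mult_0_right)

text \<open>An upper component is mapped to a lower one: \<open>chi_key\<close> applies after
  multiplication by \<open>sigma_r\<close>, whose square is 1. A lower component is mapped to an
  upper one by \<open>dirac_sigma_r\<close>, which produces the diagonal term
  \<open>2 * c\<close>.\<close>

lemma F_closed_d: "\<exists>y z. \<forall>x. x \<noteq> 0 \<longrightarrow> norm x *\<^sub>R (\<Sum>k\<in>UNIV. alpha_mat k *v dF p k x) = comb y z x"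
proof -
  obtain j lo im where p: "p = (j, lo, im)" by (cases p)
  define c :: complex where "c = (if im then \<i> else 1)"
  have key: "norm x *\<^sub>R (sigma_r x *v (\<Sum>k\<in>UNIV. pauli k *v (c *s dch j k x))) = (\<Sum>i\<in>UNIV. (c * M j i) *s ch i x)"
    if x: "x \<noteq> 0" for x
  proof -
    interpret cc: bounded_linear "\<lambda>v :: complex^2. c *s v" by (rule scale_linear)
    have "norm x *\<^sub>R (sigma_r x *v (\<Sum>k\<in>UNIV. pauli k *v (c *s dch j k x))) = c *s (norm x *\<^sub>R (sigma_r x *v (\<Sum>k\<in>UNIV. pauli k *v dch j k x)))"
      by (simp add: mult_scale cc.sum[symmetric] cc.scaleR)
    then show ?thesis using chi_key[OF x, of j] by (simp add: cc.sum)
  qed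
  show ?thesis
  proof (cases lo)
    case False
    have "norm x *\<^sub>R (\<Sum>k\<in>UNIV. alpha_mat k *v dF p k x) = comb (\<lambda>i. 0) (\<lambda>i. c * M j i) x" if x: "x \<noteq> 0" for x
    proof -
      interpret s: bounded_linear "\<lambda>v. sigma_r x *v v" by (rule sigma_r_linear)
      have "norm x *\<^sub>R (\<Sum>k\<in>UNIV. alpha_mat k *v dF p k x) = spinor 0 (norm x *\<^sub>R (\<Sum>k\<in>UNIV. pauli k *v (c *s dch j k x)))"
        using False by (simp add: p c_def alpha_mult spinor_sum spinor_scaleR)
      also have "norm x *\<^sub>R (\<Sum>k\<in>UNIV. pauli k *v (c *s dch j k x)) = sigma_r x *v (\<Sum>i\<in>UNIV. (c * M j i) *s ch i x)"
        unfolding key[OF x, symmetric] s.scaleR sigma_r_square[OF x] ..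
      finally show ?thesis by (simp add: comb_def)
    qed
    then show ?thesis by blast
  next
    case True
    have "norm x *\<^sub>R (\<Sum>k\<in>UNIV. alpha_mat k *v dF p k x) = comb (\<lambda>i. (if i = j then 2 * c else 0) - c * M j i) (\<lambda>i. 0) x" if x: "x \<noteq> 0" for x
    proof -
      interpret cc: bounded_linear "\<lambda>v :: complex^2. c *s v" by (rule scale_linear)
      have eu: "(\<Sum>k\<in>UNIV. x $ k *\<^sub>R (c *s dch j k x)) = 0"
        using arg_cong[OF chi_euler[OF x, of j], of "\<lambda>v. c *s v"] by (simp add: cc.sum cc.scaleR)
      have "norm x *\<^sub>R (\<Sum>k\<in>UNIV. alpha_mat k *v dF p k x)
          = spinor (norm x *\<^sub>R (\<Sum>k\<in>UNIV. pauli k *v ((1 / norm x) *\<^sub>R (pauli k *v (c *s ch j x))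
             - (x $ k / (norm x)\<^sup>2) *\<^sub>R (sigma_r x *v (c *s ch j x)) + sigma_r x *v (c *s dch j k x)))) 0"
        using True by (simp add: p c_def alpha_mult spinor_sum spinor_scaleR)
      also have "\<dots> = spinor (2 *\<^sub>R (c *s ch j x) - (\<Sum>i\<in>UNIV. (c * M j i) *s ch i x)) 0"
        unfolding dirac_sigma_r[OF x eu] key[OF x] ..
      also have "2 *\<^sub>R (c *s ch j x) = (\<Sum>i\<in>UNIV. (if i = j then 2 * c else 0) *s ch i x)"
      proof -
        have "(\<Sum>i\<in>UNIV. (if i = j then 2 * c else 0) *s ch i x) = (\<Sum>i\<in>UNIV. if i = j then (2 * c) *s ch i x else 0)"
          by (rule sum.cong) auto
        then show ?thesis by (simp add: vec_eq_iff) (simp add: scaleR_conv_of_real)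
      qed
      finally show ?thesis by (simp add: comb_def vec_eq_iff sum_subtractf left_diff_distrib)
    qed
    then show ?thesis by blast
  qed
qed

lemma F_sphb: "sphb (F p)"
proof (rule hom_sphb)
  show "continuous_on (- {0}) (F p)"
    by (intro continuous_at_imp_continuous_on) (auto dest: F_deriv has_derivative_continuous)
qed (rule F_hom)

text \<open>Orthonormalisation changes the real basis by constant coefficients only, so closure and
  the class of admissible fields carry over; going back to the original basis costs a null
  set.\<close>

lemma obtain_sector:
  obtains m g dg where "sector m g dg" "\<And>\<rho>. sector.form m g \<rho> \<longleftrightarrow> Form \<rho>"
proof -
  obtain m g where G: "\<forall>p<(m::nat). \<exists>c. g p = (\<lambda>x. \<Sum>i\<in>UNIV. c i *\<^sub>R F i x)"
      "\<forall>p<m. \<forall>q<m. sp (g p) (g q) = (if p = q then 1 else 0)"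
      "\<forall>i\<in>UNIV. \<exists>d. AE w in sph. F i w = (\<Sum>p<m. d p *\<^sub>R g p w)"
    using gram_schmidt[of F UNIV, OF F_sphb] by (elim exE conjE) (rule that)
  have "\<forall>p. \<exists>c. p < m \<longrightarrow> g p = (\<lambda>x. \<Sum>i\<in>UNIV. c i *\<^sub>R F i x)" using G(1) by blast
  from choice[OF this] obtain c where c: "\<And>p. p < m \<Longrightarrow> g p = (\<lambda>x. \<Sum>i\<in>UNIV. c p i *\<^sub>R F i x)" by blast
  from bchoice[OF G(3)] obtain d where d0: "\<And>i. AE w in sph. F i w = (\<Sum>p<m. d i p *\<^sub>R g p w)" by blast
  have ghom: "g p (t *\<^sub>R x) = g p x" if "p < m" "t > 0" for p t x
    by (simp add: c[OF that(1)] F_hom[OF that(2)])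
  have gm: "g p \<in> borel_measurable borel" if "p < m" for p
    using sphb_sum[of UNIV F "c p"] F_sphb unfolding c[OF that] by (auto simp: sphb_def)
  have d: "AE x in lborel. F i x = (\<Sum>p<m. d i p *\<^sub>R g p x)" for i
  \<comment> \<open>The expansion known on the unit sphere extends to all radii, since both sides
    are homogeneous of degree 0.\<close>
  proof (rule polar_AE_converse)
    have [measurable]: "F i \<in> borel_measurable borel" using F_sphb[of i] by (simp add: sphb_def)
    have [measurable]: "(\<lambda>x. \<Sum>p<m. d i p *\<^sub>R g p x) \<in> borel_measurable borel"
      by (intro borel_measurable_sum borel_measurable_scaleR) (auto intro: gm)
    show "Measurable.pred borel (\<lambda>x. F i x = (\<Sum>p<m. d i p *\<^sub>R g p x))" by measurable
    show "AE r in rad. AE w in sph. F i (r *\<^sub>R w) = (\<Sum>p<m. d i p *\<^sub>R g p (r *\<^sub>R w))"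
      using rad_pos
    proof eventually_elim
      case (elim r)
      then have "(\<Sum>p<m. d i p *\<^sub>R g p (r *\<^sub>R w)) = (\<Sum>p<m. d i p *\<^sub>R g p w)" for w by (intro sum.cong) (auto simp: ghom)
      then show ?case using d0[of i] elim by (simp add: F_hom)
    qed
  qed
  have dall: "AE x in lborel. \<forall>i\<in>UNIV. F i x = (\<Sum>p<m. d i p *\<^sub>R g p x)" by (rule AE_finite_allI) (auto intro: d)
  have conv1: "AE x in lborel. (\<Sum>i\<in>UNIV. a i x *\<^sub>R F i x) = (\<Sum>p<m. (\<Sum>i\<in>UNIV. a i x * d i p) *\<^sub>R g p x)" for a
    using dall
  proof eventually_elim
    case (elim x)
    then have "(\<Sum>i\<in>UNIV. a i x *\<^sub>R F i x) = (\<Sum>i\<in>UNIV. \<Sum>p<m. (a i x * d i p) *\<^sub>R g p x)"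
      by (simp only: elim[rule_format, OF UNIV_I] scaleR_sum_right scaleR_scaleR)
    also have "\<dots> = (\<Sum>p<m. (\<Sum>i\<in>UNIV. a i x * d i p) *\<^sub>R g p x)" by (subst sum.swap) (simp add: scaleR_sum_left)
    finally show ?case .
  qed
  define dg where "dg p k x = (\<Sum>i\<in>UNIV. c p i *\<^sub>R dF i k x)" for p k x
  have sec: "sector m g dg"
  proof
    show "(g p has_derivative (\<lambda>h. \<Sum>k\<in>UNIV. h$k *\<^sub>R dg p k x)) (at x)" if "p < m" "x \<noteq> 0" for p x
    proof -
      have "((\<lambda>x. \<Sum>i\<in>UNIV. c p i *\<^sub>R F i x) has_derivative (\<lambda>h. \<Sum>i\<in>UNIV. c p i *\<^sub>R (\<Sum>k\<in>UNIV. h$k *\<^sub>R dF i k x))) (at x)"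
        by (intro has_derivative_sum has_derivative_scaleR_right F_deriv that)
      moreover have "(\<Sum>i\<in>UNIV. c p i *\<^sub>R (\<Sum>k\<in>UNIV. h$k *\<^sub>R dF i k x)) = (\<Sum>k\<in>UNIV. h$k *\<^sub>R dg p k x)" for h :: "real^3"
        unfolding dg_def scaleR_sum_right by (subst sum.swap) (simp add: mult.commute)
      ultimately show ?thesis by (simp add: c[OF that(1)])
    qed
    show "continuous_on (- {0}) (dg p k)" for p k
      unfolding dg_def[abs_def] by (intro continuous_intros dF_cont)
    show "g p (t *\<^sub>R x) = g p x" if "p < m" "t > 0" for p t x by (rule ghom[OF that])
    show "sp (g p) (g q) = (if p = q then 1 else 0)" if "p < m" "q < m" for p q using G(2) that by blast
    interpret al: bounded_linear "\<lambda>v. alpha_mat k *v v" for k by (rule alpha_linear)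
    show "\<exists>e. AE x in lborel. (\<Sum>k\<in>UNIV. (x $ k / norm x) *\<^sub>R (alpha_mat k *v g p x)) = (\<Sum>q<m. e q *\<^sub>R g q x)" if p: "p < m" for p
    proof -
      let ?a = "\<lambda>i::'j \<times> bool \<times> bool. c p (fst i, \<not> fst (snd i), snd (snd i))"
      have "AE x in lborel. (\<Sum>k\<in>UNIV. (x $ k / norm x) *\<^sub>R (alpha_mat k *v g p x)) = (\<Sum>q<m. (\<Sum>i\<in>UNIV. ?a i * d i q) *\<^sub>R g q x)"
        using conv1[of "\<lambda>i x. ?a i"] AE_lborel_singleton[of "0::real^3"]
      proof eventually_elim
        case (elim x)
        have "(\<Sum>k\<in>UNIV. (x $ k / norm x) *\<^sub>R (alpha_mat k *v g p x))
            = (\<Sum>i\<in>UNIV. c p i *\<^sub>R (\<Sum>k\<in>UNIV. (x $ k / norm x) *\<^sub>R (alpha_mat k *v F i x)))"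
          unfolding c[OF p] al.sum al.scaleR scaleR_sum_right by (subst sum.swap) (simp add: mult.commute)
        also have "\<dots> = (\<Sum>i\<in>UNIV. ?a i *\<^sub>R F i x)"
          unfolding sum_index by (rule sum.cong) (simp_all only: F_closed_r[OF elim(2)] fst_conv snd_conv not_not simp_thms add_ac)
        finally show ?case using elim(1) by simp
      qed
      then show ?thesis by (rule exI[where x="\<lambda>q. \<Sum>i\<in>UNIV. ?a i * d i q"])
    qed
    show "\<exists>e. AE x in lborel. norm x *\<^sub>R (\<Sum>k\<in>UNIV. alpha_mat k *v dg p k x) = (\<Sum>q<m. e q *\<^sub>R g q x)" for p
    proof -
      have "\<forall>i. \<exists>y z. \<forall>x. x \<noteq> 0 \<longrightarrow> norm x *\<^sub>R (\<Sum>k\<in>UNIV. alpha_mat k *v dF i k x) = comb y z x" using F_closed_d by blast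
      from choice[OF this] obtain y where "\<forall>i. \<exists>z. \<forall>x. x \<noteq> 0 \<longrightarrow> norm x *\<^sub>R (\<Sum>k\<in>UNIV. alpha_mat k *v dF i k x) = comb (y i) z x" ..
      from choice[OF this] obtain z where yz: "\<And>i x. x \<noteq> 0 \<Longrightarrow> norm x *\<^sub>R (\<Sum>k\<in>UNIV. alpha_mat k *v dF i k x) = comb (y i) (z i) x" by blast
      let ?a = "\<lambda>l. \<Sum>i\<in>UNIV. c p i * rc (y i) (z i) l"
      have "AE x in lborel. norm x *\<^sub>R (\<Sum>k\<in>UNIV. alpha_mat k *v dg p k x) = (\<Sum>q<m. (\<Sum>l\<in>UNIV. ?a l * d l q) *\<^sub>R g q x)"
        using conv1[of "\<lambda>l x. ?a l"] AE_lborel_singleton[of "0::real^3"]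
      proof eventually_elim
        case (elim x)
        have "norm x *\<^sub>R (\<Sum>k\<in>UNIV. alpha_mat k *v dg p k x) = (\<Sum>i\<in>UNIV. c p i *\<^sub>R (norm x *\<^sub>R (\<Sum>k\<in>UNIV. alpha_mat k *v dF i k x)))"
          unfolding dg_def al.sum al.scaleR scaleR_sum_right by (subst sum.swap) (simp add: mult.commute)
        also have "\<dots> = (\<Sum>i\<in>UNIV. \<Sum>l\<in>UNIV. (c p i * rc (y i) (z i) l) *\<^sub>R F l x)"
          unfolding yz[OF elim(2)] comb_F by (simp only: scaleR_sum_right scaleR_scaleR)
        also have "\<dots> = (\<Sum>l\<in>UNIV. ?a l *\<^sub>R F l x)" by (subst sum.swap) (simp add: scaleR_sum_left)
        finally show ?case using elim(1) by simp
      qed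
      then show ?thesis by (rule exI[where x="\<lambda>q. \<Sum>l\<in>UNIV. ?a l * d l q"])
    qed
  qed
  interpret sector m g dg by (rule sec)
  have "form \<rho> \<longleftrightarrow> Form \<rho>" for \<rho>
  proof
    assume "form \<rho>"
    then obtain a where a: "AE x in lborel. \<rho> x = (\<Sum>p<m. a p (norm x) *\<^sub>R g p x)" by (auto simp: form_def)
    have "(\<Sum>p<m. a p r *\<^sub>R g p x) = (\<Sum>i\<in>UNIV. (\<Sum>p<m. a p r * c p i) *\<^sub>R F i x)" for r x
    proof -
      have "(\<Sum>p<m. a p r *\<^sub>R g p x) = (\<Sum>p<m. \<Sum>i\<in>UNIV. (a p r * c p i) *\<^sub>R F i x)"
        by (rule sum.cong) (auto simp: c scaleR_sum_right)
      also have "\<dots> = (\<Sum>i\<in>UNIV. (\<Sum>p<m. a p r * c p i) *\<^sub>R F i x)" by (subst sum.swap) (simp add: scaleR_sum_left)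
      finally show ?thesis .
    qed
    with a show "Form \<rho>" unfolding Form_F by (intro exI[of _ "\<lambda>i r. \<Sum>p<m. a p r * c p i"]) simp
  next
    assume "Form \<rho>"
    then obtain a where a: "AE x in lborel. \<rho> x = (\<Sum>i\<in>UNIV. a i (norm x) *\<^sub>R F i x)" by (auto simp: Form_F)
    from a conv1[of "\<lambda>i x. a i (norm x)"]
    have "AE x in lborel. \<rho> x = (\<Sum>p<m. (\<Sum>i\<in>UNIV. a i (norm x) * d i p) *\<^sub>R g p x)" by eventually_elim simp
    then show "form \<rho>" unfolding form_def by (rule exI[where x="\<lambda>p r. \<Sum>i\<in>UNIV. a i r * d i p"])
  qed
  with sec show ?thesis by (rule that)
qed

theorem Form_dirac: "Form \<rho> \<Longrightarrow> \<rho> \<in> H1 \<Longrightarrow> Form (skew_dirac \<rho>)"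
proof -
  obtain m g dg where s: "sector m g dg" "\<And>\<rho>. sector.form m g \<rho> \<longleftrightarrow> Form \<rho>" by (rule obtain_sector) blast
  show "Form \<rho> \<Longrightarrow> \<rho> \<in> H1 \<Longrightarrow> Form (skew_dirac \<rho>)" using sector.dirac_invariant[OF s(1)] s(2) by blast
qed

theorem Form_solvable:
  assumes B: "dissipative B Bt b K"
    and F: "\<And>f. Form f \<Longrightarrow> Form (\<lambda>x. B x (f x))" "\<And>f. Form f \<Longrightarrow> Form (\<lambda>x. Bt x (f x))"
    and \<eta>: "\<eta> \<in> L2" "Form \<eta>"
  shows "\<exists>\<rho>\<in>H1. Form \<rho> \<and> (AE x in lborel. skew_dirac \<rho> x + B x (\<rho> x) = \<eta> x)"
proof -
  obtain m g dg where s: "sector m g dg" "\<And>\<rho>. sector.form m g \<rho> \<longleftrightarrow> Form \<rho>" by (rule obtain_sector) blast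
  have "dissipative_sector m g dg B Bt b K"
    by (rule dissipative_sector.intro[OF s(1) B], rule dissipative_sector_axioms.intro) (use F s(2) in auto)
  from dissipative_sector.solvable[OF this \<eta>(1)] show ?thesis using \<eta>(2) s(2) by auto
qed

end

subsection \<open>Spherical harmonics in Cartesian coordinates\<close>

text \<open>
  With \<open>s = (x\<^sub>1 + \<i> e x\<^sub>2) / r\<close> and \<open>w = x\<^sub>3 / r\<close>, the harmonics with \<open>m \<ge> 0\<close> are multiples of
  \<open>s^m q(w)\<close> for \<open>e = 1\<close>, those with \<open>m \<le> 0\<close> of \<open>s^\<bar>m\<bar> q(w)\<close> for \<open>e = -1\<close>, where \<open>q\<close> is the
  \<open>\<bar>m\<bar>\<close>-th derivative of a Legendre polynomial.
\<close>

definition unitc :: "real \<Rightarrow> real^3 \<Rightarrow> complex" where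
  "unitc e x = (1 / norm x) *\<^sub>R Complex (x $ 1) (e * x $ 2)"

definition cart_harm :: "real \<Rightarrow> nat \<Rightarrow> real poly \<Rightarrow> real^3 \<Rightarrow> complex" where
  "cart_harm e a q x = unitc e x ^ a * of_real (poly q (x $ 3 / norm x))"

definition axc :: "real \<Rightarrow> 3 \<Rightarrow> complex" where
  "axc e k = (if k = 1 then 1 else if k = 2 then \<i> * of_real e else 0)"

text \<open>This is \<open>r\<close> times the gradient, so that the identities for it are
  polynomial in the direction. For \<open>a = 0\<close> the truncated exponent \<open>a - 1\<close>
  is harmless because of the factor \<open>of_nat a\<close>.\<close>

definition gharm :: "real \<Rightarrow> nat \<Rightarrow> real poly \<Rightarrow> 3 \<Rightarrow> real^3 \<Rightarrow> complex" where
  "gharm e a q k x =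
     of_nat a * unitc e x ^ (a - 1) * of_real (poly q (x $ 3 / norm x)) * (axc e k - unitc e x * of_real (x $ k / norm x))
     + unitc e x ^ a * of_real (poly (pderiv q) (x $ 3 / norm x)) * (of_real (if k = 3 then 1 else 0) - of_real (x $ 3 / norm x) * of_real (x $ k / norm x))"

definition dharm :: "real \<Rightarrow> nat \<Rightarrow> real poly \<Rightarrow> 3 \<Rightarrow> real^3 \<Rightarrow> complex" where
  "dharm e a q k x = (1 / norm x) *\<^sub>R gharm e a q k x"

lemma comp_has_derivative:
  fixes l :: 3
  assumes x: "x \<noteq> 0"
  shows "((\<lambda>x. x $ l / norm x) has_derivative
    (\<lambda>h. (1 / norm x) * (\<Sum>k\<in>UNIV. h $ k * ((if k = l then 1 else 0) - x $ l / norm x * (x $ k / norm x))))) (at x)"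
proof -
  have "((\<lambda>x. x $ l / norm x) has_derivative (\<lambda>h. h $ l / norm x - x $ l * (h \<bullet> x) / (norm x) ^ 3)) (at x)"
    using has_derivative_divide[OF bounded_linear.has_derivative[OF bounded_linear_vec_nth has_derivative_ident] has_derivative_norm[OF x], of l] x
    by (rule_tac has_derivative_eq_rhs) (auto simp: fun_eq_iff sgn_div_norm field_simps power3_eq_cube)
  then show ?thesis
  proof (rule has_derivative_eq_rhs, intro ext)
    fix h :: "real^3"
    have 1: "(\<Sum>k\<in>UNIV. h $ k * (if k = l then 1 else 0)) = h $ l" using vec_eq_sum_axis[of h l] by simp
    have 2: "(\<Sum>k\<in>UNIV. h $ k * (x $ l / norm x * (x $ k / norm x))) = x $ l / (norm x)\<^sup>2 * (h \<bullet> x)"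
      by (simp add: inner_vec_def sum_distrib_left power2_eq_square mult_ac)
    have e: "(\<Sum>k\<in>UNIV. h $ k * ((if k = l then 1 else 0) - x $ l / norm x * (x $ k / norm x))) = h $ l - x $ l / (norm x)\<^sup>2 * (h \<bullet> x)"
      by (simp only: right_diff_distrib sum_subtractf 1 2)
    show "h $ l / norm x - x $ l * (h \<bullet> x) / (norm x) ^ 3 =
        (1 / norm x) * (\<Sum>k\<in>UNIV. h $ k * ((if k = l then 1 else 0) - x $ l / norm x * (x $ k / norm x)))"
      unfolding e using x by (simp add: field_simps power2_eq_square power3_eq_cube)
  qed
qed

lemma unitc_alt: "unitc e x = of_real (x $ 1 / norm x) + \<i> * of_real e * of_real (x $ 2 / norm x)"
  by (simp add: unitc_def complex_eq_iff)

lemma unitc_has_derivative: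
  assumes x: "x \<noteq> 0"
  shows "(unitc e has_derivative (\<lambda>h. (1 / norm x) *\<^sub>R (\<Sum>k\<in>UNIV. h $ k *\<^sub>R (axc e k - unitc e x * of_real (x $ k / norm x))))) (at x)"
proof -
  have "((\<lambda>x. complex_of_real (x $ 1 / norm x) + \<i> * of_real e * of_real (x $ 2 / norm x)) has_derivative
     (\<lambda>h. of_real ((1 / norm x) * (\<Sum>k\<in>UNIV. h $ k * ((if k = 1 then 1 else 0) - x $ 1 / norm x * (x $ k / norm x))))
       + \<i> * of_real e * of_real ((1 / norm x) * (\<Sum>k\<in>UNIV. h $ k * ((if k = 2 then 1 else 0) - x $ 2 / norm x * (x $ k / norm x)))))) (at x)"
    by (intro has_derivative_add has_derivative_mult_right bounded_linear.has_derivative[OF bounded_linear_of_real] comp_has_derivative x)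
  then show ?thesis
    unfolding unitc_alt[abs_def]
    by (rule has_derivative_eq_rhs)
       (simp add: fun_eq_iff complex_eq_iff sum_3 axc_def algebra_simps add_divide_distrib diff_divide_distrib)
qed

lemma harm_has_derivative:
  assumes x: "x \<noteq> 0"
  shows "(cart_harm e a q has_derivative (\<lambda>h. \<Sum>k\<in>UNIV. h $ k *\<^sub>R dharm e a q k x)) (at x)"
proof -
  have p: "((\<lambda>x. complex_of_real (poly q (x $ 3 / norm x))) has_derivative
     (\<lambda>h. of_real (poly (pderiv q) (x $ 3 / norm x) * ((1 / norm x) * (\<Sum>k\<in>UNIV. h $ k * ((if k = 3 then 1 else 0) - x $ 3 / norm x * (x $ k / norm x))))))) (at x)"
    by (rule bounded_linear.has_derivative[OF bounded_linear_of_real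
        has_derivative_compose[OF comp_has_derivative[OF x] poly_DERIV[unfolded has_field_derivative_def]]])
  from has_derivative_mult[OF has_derivative_power[OF unitc_has_derivative[OF x], of e a] p]
  show ?thesis unfolding cart_harm_def[abs_def]
    by (rule has_derivative_eq_rhs)
       (simp add: fun_eq_iff sum_3 dharm_def gharm_def scaleR_conv_of_real algebra_simps add_divide_distrib diff_divide_distrib)
qed

lemma harm_hom: "t > 0 \<Longrightarrow> cart_harm e a q (t *\<^sub>R x) = cart_harm e a q x"
proof -
  assume "t > 0"
  then have "unitc e (t *\<^sub>R x) = unitc e x" by (simp add: unitc_def complex_eq_iff)
  then show ?thesis using \<open>t > 0\<close> by (simp add: cart_harm_def)
qed

lemma unitc_cont: "continuous_on (- {0}) (unitc e)"
  by (intro continuous_at_imp_continuous_on) (auto dest: unitc_has_derivative[of _ e] has_derivative_continuous)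

lemma dharm_cont: "continuous_on (- {0}) (dharm e a q k)"
  unfolding dharm_def[abs_def] gharm_def by (intro continuous_intros unitc_cont) auto

lemma sigma_r_nth:
  "(sigma_r x *v a) $ 1 = of_real (x $ 3 / norm x) * a $ 1 + unitc (-1) x * a $ 2"
  "(sigma_r x *v a) $ 2 = unitc 1 x * a $ 1 - of_real (x $ 3 / norm x) * a $ 2"
  unfolding sigma_r_mult unitc_alt
  by (simp_all add: sum_3 pauli_mult complex_eq_iff algebra_simps)

lemma unitc_sphere:
  assumes "x \<noteq> 0"
  shows "unitc 1 x * unitc (-1) x = 1 - of_real (x $ 3 / norm x) * of_real (x $ 3 / norm x)"
proof -
  have "(norm x)\<^sup>2 = (x $ 1)\<^sup>2 + (x $ 2)\<^sup>2 + (x $ 3)\<^sup>2"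
    unfolding power2_norm_eq_inner inner_vec_def by (simp add: sum_3 power2_eq_square)
  then have "((x $ 1)\<^sup>2 + (x $ 2)\<^sup>2) / (norm x)\<^sup>2 = ((norm x)\<^sup>2 - (x $ 3)\<^sup>2) / (norm x)\<^sup>2" by simp
  then have "(x $ 1 / norm x)\<^sup>2 + (x $ 2 / norm x)\<^sup>2 = 1 - (x $ 3 / norm x)\<^sup>2"
    using assms by (simp add: power_divide add_divide_distrib diff_divide_distrib)
  then show ?thesis unfolding unitc_alt by (simp add: complex_eq_iff power2_eq_square)
qed

lemma dharm_key:
  assumes x: "x \<noteq> 0"
  shows "norm x *\<^sub>R (sigma_r x *v (\<Sum>k\<in>UNIV. pauli k *v (dharm e a q k x *s v)))
    = sigma_r x *v (\<Sum>k\<in>UNIV. pauli k *v (gharm e a q k x *s v))"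
proof -
  interpret p: bounded_linear "\<lambda>v. pauli k *v v" for k by (rule pauli_linear)
  interpret s: bounded_linear "\<lambda>v. sigma_r x *v v" by (rule sigma_r_linear)
  have "dharm e a q k x *s v = (1 / norm x) *\<^sub>R (gharm e a q k x *s v)" for k
    by (simp add: dharm_def vec_eq_iff)
  then show ?thesis using x by (simp add: p.scaleR s.scaleR scaleR_sum_right[symmetric])
qed

lemma harm_pow: "of_nat a * unitc e x ^ (a - 1) * unitc e x = of_nat a * unitc e x ^ a"
  by (cases a) auto

text \<open>Everything reduces to \<open>s s\<^sup>* + w\<^sup>2 = 1\<close>.\<close>

lemma harm_spinors:
  assumes x: "x \<noteq> 0"
  defines "w \<equiv> complex_of_real (x $ 3 / norm x)"
  shows "norm x *\<^sub>R (sigma_r x *v (\<Sum>k\<in>UNIV. pauli k *v (dharm 1 a q k x *s e1)))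
      = (- of_nat a * cart_harm 1 a q x) *s e1 + cart_harm 1 (Suc a) (pderiv q) x *s e2" (is ?P1)
    and "norm x *\<^sub>R (sigma_r x *v (\<Sum>k\<in>UNIV. pauli k *v (dharm 1 (Suc b) q k x *s e2)))
      = (2 * of_nat (Suc b) * w * cart_harm 1 b q x - (1 - w * w) * cart_harm 1 b (pderiv q) x) *s e1 + (of_nat (Suc b) * cart_harm 1 (Suc b) q x) *s e2" (is ?P2)
    and "norm x *\<^sub>R (sigma_r x *v (\<Sum>k\<in>UNIV. pauli k *v (dharm (-1) (Suc b) q k x *s e1)))
      = (of_nat (Suc b) * cart_harm (-1) (Suc b) q x) *s e1 + ((1 - w * w) * cart_harm (-1) b (pderiv q) x - 2 * of_nat (Suc b) * w * cart_harm (-1) b q x) *s e2" (is ?P3)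
    and "norm x *\<^sub>R (sigma_r x *v (\<Sum>k\<in>UNIV. pauli k *v (dharm (-1) a q k x *s e2)))
      = (- cart_harm (-1) (Suc a) (pderiv q) x) *s e1 + (- of_nat a * cart_harm (-1) a q x) *s e2" (is ?P4)
proof -
  define X1 X2 S T q0 q1 where d: "X1 = complex_of_real (x $ 1 / norm x)" "X2 = complex_of_real (x $ 2 / norm x)"
    "S = unitc 1 x" "T = unitc (-1) x"
    "q0 = complex_of_real (poly q (x $ 3 / norm x))" "q1 = complex_of_real (poly (pderiv q) (x $ 3 / norm x))"
  have st: "S * T = 1 - w * w" unfolding d w_def by (rule unitc_sphere[OF x])
  have S: "S = X1 + \<i> * X2" and T: "T = X1 - \<i> * X2" by (simp_all add: d unitc_alt)
  have ii: "\<i> * \<i> = -1" by simp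
  have g: "gharm 1 a q 1 x = of_nat a * S ^ (a - 1) * q0 * (1 - S * X1) + S ^ a * q1 * (- w * X1)"
    "gharm 1 a q 2 x = of_nat a * S ^ (a - 1) * q0 * (\<i> - S * X2) + S ^ a * q1 * (- w * X2)"
    "gharm 1 a q 3 x = of_nat a * S ^ (a - 1) * q0 * (- S * w) + S ^ a * q1 * (1 - w * w)"
    "gharm (-1) a q 1 x = of_nat a * T ^ (a - 1) * q0 * (1 - T * X1) + T ^ a * q1 * (- w * X1)"
    "gharm (-1) a q 2 x = of_nat a * T ^ (a - 1) * q0 * (- \<i> - T * X2) + T ^ a * q1 * (- w * X2)"
    "gharm (-1) a q 3 x = of_nat a * T ^ (a - 1) * q0 * (- T * w) + T ^ a * q1 * (1 - w * w)" for a
    by (simp_all add: gharm_def axc_def d w_def)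
  have n: "(\<Sum>k\<in>UNIV. pauli k *v (c k *s e1)) $ 1 = c 3"
    "(\<Sum>k\<in>UNIV. pauli k *v (c k *s e1)) $ 2 = c 1 + \<i> * c 2"
    "(\<Sum>k\<in>UNIV. pauli k *v (c k *s e2)) $ 1 = c 1 - \<i> * c 2"
    "(\<Sum>k\<in>UNIV. pauli k *v (c k *s e2)) $ 2 = - c 3" for c
    by (simp_all add: sum_3 pauli_mult e1_def e2_def axis_def)
  have h: "cart_harm 1 a q x = S ^ a * q0" "cart_harm 1 a (pderiv q) x = S ^ a * q1"
    "cart_harm (-1) a q x = T ^ a * q0" "cart_harm (-1) a (pderiv q) x = T ^ a * q1" for a
    by (simp_all add: cart_harm_def d)
  have e: "e1 $ 1 = 1" "e1 $ 2 = 0" "e2 $ 1 = 0" "e2 $ 2 = 1" by (simp_all add: e1_def e2_def axis_def)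
  have sn: "(sigma_r x *v v) $ 1 = w * v $ 1 + T * v $ 2" "(sigma_r x *v v) $ 2 = S * v $ 1 - w * v $ 2" for v
    by (simp_all add: sigma_r_nth d w_def)
  have vs: "(u + v) $ i = u $ i + v $ i" "(c *s v) $ i = c * v $ i" for u v :: "complex^2" and c i by simp_all
  have pw: "of_nat a * S ^ (a - 1) * S = of_nat a * S ^ a" "of_nat a * T ^ (a - 1) * T = of_nat a * T ^ a"
    unfolding d by (rule harm_pow)+
  \<comment> \<open>The powers are abstracted so that the remaining identities are polynomial; the
    truncated exponent enters only through \<open>E'\<close>.\<close>
  define ES ET PS PT where E: "ES = of_nat a * S ^ (a - 1)" "ET = of_nat a * T ^ (a - 1)" "PS = S ^ a" "PT = T ^ a"
  have E': "ES * S = of_nat a * PS" "ET * T = of_nat a * PT" unfolding E by (rule pw)+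
  have A1: "w * (ES * q0 * (- S * w) + PS * q1 * (1 - w * w)) + T * (ES * q0 * (1 - S * X1) + PS * q1 * (- w * X1) + \<i> * (ES * q0 * (\<i> - S * X2) + PS * q1 * (- w * X2))) = - of_nat a * (PS * q0)"
    using st E' S T ii by algebra
  have A2: "S * (ES * q0 * (- S * w) + PS * q1 * (1 - w * w)) - w * (ES * q0 * (1 - S * X1) + PS * q1 * (- w * X1) + \<i> * (ES * q0 * (\<i> - S * X2) + PS * q1 * (- w * X2))) = S * PS * q1"
    using S ii by algebra
  show ?P1 unfolding dharm_key[OF x] vec_eq_iff forall_2 sn n vs e h g E[symmetric] power_Suc
    using A1 A2 by simp
  have A3: "w * (ET * q0 * (1 - T * X1) + PT * q1 * (- w * X1) - \<i> * (ET * q0 * (- \<i> - T * X2) + PT * q1 * (- w * X2))) + T * - (ET * q0 * (- T * w) + PT * q1 * (1 - w * w)) = - (T * PT * q1)"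
    using T ii by algebra
  have A4: "S * (ET * q0 * (1 - T * X1) + PT * q1 * (- w * X1) - \<i> * (ET * q0 * (- \<i> - T * X2) + PT * q1 * (- w * X2))) - w * - (ET * q0 * (- T * w) + PT * q1 * (1 - w * w)) = - of_nat a * (PT * q0)"
    using st E' S T ii by algebra
  show ?P4 unfolding dharm_key[OF x] vec_eq_iff forall_2 sn n vs e h g E[symmetric] power_Suc
    using A3 A4 by simp
  \<comment> \<open>These two cases lower the power of \<open>s\<close>, hence the exponent
    \<open>Suc b\<close> in the hypothesis and \<open>b\<close> in the result.\<close>
  define N B C where N: "N = complex_of_nat (Suc b)" "B = S ^ b" "C = T ^ b"
  have A5: "w * (N * B * q0 * (1 - S * X1) + S * B * q1 * (- w * X1) - \<i> * (N * B * q0 * (\<i> - S * X2) + S * B * q1 * (- w * X2))) + T * - (N * B * q0 * (- S * w) + S * B * q1 * (1 - w * w))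
      = 2 * N * w * (B * q0) - (1 - w * w) * (B * q1)"
    using st S T ii by algebra
  have A6: "S * (N * B * q0 * (1 - S * X1) + S * B * q1 * (- w * X1) - \<i> * (N * B * q0 * (\<i> - S * X2) + S * B * q1 * (- w * X2))) - w * - (N * B * q0 * (- S * w) + S * B * q1 * (1 - w * w))
      = N * (S * B * q0)"
    using st S T ii by algebra
  show ?P2 unfolding dharm_key[OF x] vec_eq_iff forall_2 sn n vs e h g diff_Suc_1 power_Suc N[symmetric]
    using A5 A6 by simp
  have A7: "w * (N * C * q0 * (- T * w) + T * C * q1 * (1 - w * w)) + T * (N * C * q0 * (1 - T * X1) + T * C * q1 * (- w * X1) + \<i> * (N * C * q0 * (- \<i> - T * X2) + T * C * q1 * (- w * X2)))
      = N * (T * C * q0)"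
    using st S T ii by algebra
  have A8: "S * (N * C * q0 * (- T * w) + T * C * q1 * (1 - w * w)) - w * (N * C * q0 * (1 - T * X1) + T * C * q1 * (- w * X1) + \<i> * (N * C * q0 * (- \<i> - T * X2) + T * C * q1 * (- w * X2)))
      = (1 - w * w) * (C * q1) - 2 * N * w * (C * q0)"
    using st S T ii by algebra
  show ?P3 unfolding dharm_key[OF x] vec_eq_iff forall_2 sn n vs e h g diff_Suc_1 power_Suc N[symmetric]
    using A7 A8 by simp
qed

subsection \<open>Legendre polynomials\<close>

definition legendre_poly :: "nat \<Rightarrow> real poly" where
  "legendre_poly l = smult (1 / (2 ^ l * fact l)) ((pderiv ^^ l) ([:-1, 0, 1:] ^ l))"

definition harm_poly :: "nat \<Rightarrow> nat \<Rightarrow> real poly" where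
  "harm_poly l m = smult (sqrt ((2 * real l + 1) / (4 * pi) * (fact (l - m) / fact (l + m)))) ((pderiv ^^ m) (legendre_poly l))"

text \<open>The power \<open>y\<close> satisfies \<open>(w * w - 1) * y' = 2 * l * w * y\<close>.
  Differentiating once gives the case \<open>n = 0\<close>, and each further derivative raises
  \<open>n\<close> by 1.\<close>

lemma legendre_higher_ode:
  fixes l :: nat
  defines "y \<equiv> [:-1, 0, 1 :: real:] ^ l"
  shows "[:-1, 0, 1:] * (pderiv ^^ (n + 2)) y + smult (2 * (real n + 1 - real l)) ([:0, 1:] * (pderiv ^^ (n + 1)) y)
     + smult ((real n + 1) * real n - 2 * real l * (real n + 1)) ((pderiv ^^ n) y) = 0"
proof (induction n)
  case 0
  have b: "[:-1, 0, 1:] * pderiv y = smult (2 * real l) ([:0, 1:] * y)"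
  proof (cases l)
    case (Suc k)
    have "poly ([:-1, 0, 1:] * pderiv y) w = poly (smult (2 * real l) ([:0, 1:] * y)) w" for w
      by (simp add: y_def Suc pderiv_power_Suc pderiv_pCons del: power_Suc) (simp add: algebra_simps)
    then show ?thesis by (intro poly_eq_poly_eq_iff[THEN iffD1]) (simp add: fun_eq_iff)
  qed (simp add: y_def)
  have "pderiv ([:-1, 0, 1:] * pderiv y) = pderiv (smult (2 * real l) ([:0, 1:] * y))" by (simp only: b)
  then have "poly (pderiv ([:-1, 0, 1:] * pderiv y)) w = poly (pderiv (smult (2 * real l) ([:0, 1:] * y))) w" for w by simp
  then have "poly ([:-1, 0, 1:] * pderiv (pderiv y) + [:0, 2:] * pderiv y) w = poly (smult (2 * real l) ([:0, 1:] * pderiv y + y)) w" for w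
    by (simp add: pderiv_mult pderiv_smult pderiv_pCons del: mult_pCons_left mult_pCons_right) (simp add: algebra_simps)
  then have "poly ([:-1, 0, 1:] * (pderiv ^^ (0 + 2)) y + smult (2 * (real 0 + 1 - real l)) ([:0, 1:] * (pderiv ^^ (0 + 1)) y)
     + smult ((real 0 + 1) * real 0 - 2 * real l * (real 0 + 1)) ((pderiv ^^ 0) y)) w = 0" for w
    by (simp add: numeral_2_eq_2 algebra_simps)
  then show ?case by (intro poly_eq_poly_eq_iff[THEN iffD1]) (simp add: fun_eq_iff)
next
  case (Suc n)
  have "pderiv ([:-1, 0, 1:] * (pderiv ^^ (n + 2)) y + smult (2 * (real n + 1 - real l)) ([:0, 1:] * (pderiv ^^ (n + 1)) y)
     + smult ((real n + 1) * real n - 2 * real l * (real n + 1)) ((pderiv ^^ n) y)) = 0" by (simp only: Suc pderiv_0)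
  then have "poly (pderiv ([:-1, 0, 1:] * (pderiv ^^ (n + 2)) y + smult (2 * (real n + 1 - real l)) ([:0, 1:] * (pderiv ^^ (n + 1)) y)
     + smult ((real n + 1) * real n - 2 * real l * (real n + 1)) ((pderiv ^^ n) y))) w = 0" for w by simp
  then have "poly ([:-1, 0, 1:] * (pderiv ^^ (Suc n + 2)) y + smult (2 * (real (Suc n) + 1 - real l)) ([:0, 1:] * (pderiv ^^ (Suc n + 1)) y)
     + smult ((real (Suc n) + 1) * real (Suc n) - 2 * real l * (real (Suc n) + 1)) ((pderiv ^^ (Suc n)) y)) w = 0" for w
    by (simp add: numeral_2_eq_2 pderiv_mult pderiv_smult pderiv_add pderiv_pCons del: mult_pCons_left mult_pCons_right) (simp add: algebra_simps)
  then show ?case by (intro poly_eq_poly_eq_iff[THEN iffD1]) (simp add: fun_eq_iff)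
qed

text \<open>Equal to \<open>(l - m) * (l + m + 1)\<close>, the eigenvalue in the equation for the
  \<open>m\<close>-th derivative of a Legendre polynomial; it vanishes for
  \<open>m = l\<close>.\<close>

definition kap :: "nat \<Rightarrow> nat \<Rightarrow> real" where
  "kap l m = real l * (real l + 1) - real m * (real m + 1)"

lemma harm_poly_ode:
  "(w * w - 1) * poly (pderiv (pderiv (harm_poly l m))) w + 2 * (real m + 1) * w * poly (pderiv (harm_poly l m)) w
    = kap l m * poly (harm_poly l m) w"
proof -
  define y where "y = [:-1, 0, 1 :: real:] ^ l"
  define c where "c = sqrt ((2 * real l + 1) / (4 * pi) * (fact (l - m) / fact (l + m))) * (1 / (2 ^ l * fact l))"
  have h: "harm_poly l m = smult c ((pderiv ^^ (m + l)) y)"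
    by (simp add: harm_poly_def legendre_poly_def higher_pderiv_smult c_def y_def funpow_add)
  have "poly ([:-1, 0, 1:] * (pderiv ^^ (m + l + 2)) y + smult (2 * (real (m + l) + 1 - real l)) ([:0, 1:] * (pderiv ^^ (m + l + 1)) y)
     + smult ((real (m + l) + 1) * real (m + l) - 2 * real l * (real (m + l) + 1)) ((pderiv ^^ (m + l)) y)) w = 0"
    unfolding y_def legendre_higher_ode by simp
  then have "(w * w - 1) * poly (pderiv (pderiv ((pderiv ^^ (m + l)) y))) w + 2 * (real m + 1) * w * poly (pderiv ((pderiv ^^ (m + l)) y)) w
    = kap l m * poly ((pderiv ^^ (m + l)) y) w"
    by (simp add: kap_def numeral_2_eq_2 algebra_simps)
  from arg_cong[OF this, of "\<lambda>t. c * t"] show ?thesis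
    unfolding h by (simp add: pderiv_smult algebra_simps)
qed

text \<open>In all, \<open>2 * l\<close> derivatives are taken of a polynomial of degree
  \<open>2 * l\<close>, which leaves a constant. Thus a single spinor suffices to generate
  \<open>Y_space l\<close>.\<close>

lemma harm_poly_top: "pderiv (harm_poly l l) = 0"
proof -
  have "degree ([:-1, 0, 1 :: real:] ^ l) = 2 * l" by (simp add: degree_power_eq)
  then have "degree (harm_poly l l) = 0"
    by (simp add: harm_poly_def legendre_poly_def higher_pderiv_smult degree_higher_pderiv)
  then show ?thesis by (simp add: pderiv_eq_0_iff)
qed

lemma higher_deriv_poly: "(deriv ^^ n) (poly (p :: real poly)) = poly ((pderiv ^^ n) p)"
proof (induction n)
  case (Suc n)
  have "deriv (poly q) = poly (pderiv q)" for q :: "real poly"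
    by (rule ext) (rule DERIV_imp_deriv[OF poly_DERIV])
  with Suc show ?case by simp
qed simp

lemma legendre_P_poly: "legendre_P l = poly (legendre_poly l)"
proof -
  have "(\<lambda>t :: real. (t\<^sup>2 - 1) ^ l) = poly ([:-1, 0, 1:] ^ l)"
    by (simp add: fun_eq_iff power2_eq_square algebra_simps)
  then have "(deriv ^^ l) (\<lambda>t :: real. (t\<^sup>2 - 1) ^ l) = poly ((pderiv ^^ l) ([:-1, 0, 1:] ^ l))"
    by (simp only: higher_deriv_poly)
  then show ?thesis by (simp add: fun_eq_iff legendre_P_def legendre_poly_def)
qed

lemma cnj_harm: "cnj (cart_harm e a q x) = cart_harm (- e) a q x"
proof -
  have "cnj (unitc e x) = unitc (- e) x" by (simp add: unitc_def complex_eq_iff)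
  then show ?thesis by (simp add: cart_harm_def)
qed

text \<open>The azimuthal phase times the sine of the polar angle is
  \<open>(x\<^sub>1 + \<i> x\<^sub>2) / r\<close>; on the axis this is 0 whatever value
  \<open>Arg\<close> has there.\<close>

lemma sph_harm_eq:
  assumes x: "x \<noteq> 0"
  shows "sph_harm l (int m) x = cart_harm 1 m (harm_poly l m) x"
    and "sph_harm l (- int m) x = cart_harm (-1) m (harm_poly l m) x"
proof -
  define w where "w = x $ 3 / norm x"
  have w: "\<bar>w\<bar> \<le> 1" using component_le_norm_cart[of x 3] x by (simp add: w_def)
  have r: "sqrt (1 - w\<^sup>2) = cmod (Complex (x $ 1) (x $ 2)) / norm x"
  proof -
    have "(norm x)\<^sup>2 = (x $ 1)\<^sup>2 + (x $ 2)\<^sup>2 + (x $ 3)\<^sup>2"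
      unfolding power2_norm_eq_inner inner_vec_def by (simp add: sum_3 power2_eq_square)
    then have n: "(norm x)\<^sup>2 - (x $ 3)\<^sup>2 = (x $ 1)\<^sup>2 + (x $ 2)\<^sup>2" by simp
    have "1 - w\<^sup>2 = ((norm x)\<^sup>2 - (x $ 3)\<^sup>2) / (norm x)\<^sup>2"
      using x by (simp add: w_def power_divide diff_divide_distrib)
    then have "1 - w\<^sup>2 = ((x $ 1)\<^sup>2 + (x $ 2)\<^sup>2) / (norm x)\<^sup>2" unfolding n .
    then show ?thesis by (simp add: real_sqrt_divide complex_norm)
  qed
  have u: "exp (\<i> * of_real (Arg (Complex (x $ 1) (x $ 2)))) * of_real (sqrt (1 - w\<^sup>2)) = unitc 1 x"
  proof -
    have "of_real (cmod (Complex (x $ 1) (x $ 2))) * exp (\<i> * of_real (Arg (Complex (x $ 1) (x $ 2)))) = Complex (x $ 1) (x $ 2)"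
      using rcis_cmod_Arg[of "Complex (x $ 1) (x $ 2)"] by (simp add: rcis_def cis_conv_exp)
    then show ?thesis unfolding r by (simp add: unitc_def scaleR_conv_of_real mult_ac divide_simps)
  qed
  have e: "exp (\<i> * of_nat m * of_real t) = exp (\<i> * of_real t) ^ m" for t
    by (simp add: exp_of_nat_mult[symmetric] mult_ac)
  have "sph_harm_angles l m (arccos w) (Arg (Complex (x $ 1) (x $ 2))) = cart_harm 1 m (harm_poly l m) x"
    unfolding sph_harm_angles_def assoc_legendre_P_def legendre_P_poly higher_deriv_poly harm_poly_def cart_harm_def
      cos_arccos_abs[OF w] e u[symmetric] w_def[symmetric]
    by (simp add: power_mult_distrib mult_ac)
  then show 1: "sph_harm l (int m) x = cart_harm 1 m (harm_poly l m) x"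
    by (simp add: sph_harm_def w_def)
  show "sph_harm l (- int m) x = cart_harm (-1) m (harm_poly l m) x"
  proof (cases m)
    case 0 with 1 show ?thesis by (simp add: cart_harm_def)
  next
    case Suc
    then have "sph_harm l (- int m) x = cnj (sph_harm l (int m) x)" by (simp add: sph_harm_def Let_def add.commute)
    then show ?thesis by (simp add: 1 cnj_harm)
  qed
qed

subsection \<open>The angular two-spinors\<close>

lemma harm_spinor_has_derivative:
  fixes v :: "complex^2"
  assumes x: "x \<noteq> 0"
  shows "((\<lambda>x. cart_harm e a q x *s v) has_derivative (\<lambda>h. \<Sum>k\<in>UNIV. h $ k *\<^sub>R (dharm e a q k x *s v))) (at x)"
proof -
  have "linear (\<lambda>c. c *s v)" by (rule linearI) (simp_all add: vec_eq_iff algebra_simps)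
  then interpret bounded_linear "\<lambda>c. c *s v" by (simp only: linear_conv_bounded_linear)
  from has_derivative[OF harm_has_derivative[OF x]] show ?thesis
    by (simp add: sum scaleR)
qed

lemma scale_const_cont: "continuous_on S c \<Longrightarrow> continuous_on S (\<lambda>x. c x *s v)" for v :: "complex^'n"
  unfolding vector_scalar_mult_def by (intro continuous_intros) auto

text \<open>The assumption keeps in the sector the \<open>\<real>\<close>-linear term of the linearization, a real part times \<open>\<beta>\<phi>\<close>.\<close>

locale angular_real = angular ch dch M for ch :: "'j::finite \<Rightarrow> real^3 \<Rightarrow> complex^2" and dch M +
  assumes chi_real: "\<And>c. \<exists>d. \<forall>x. x \<noteq> 0 \<longrightarrow> of_real (Re (\<Sum>j\<in>UNIV. c j * ch j x $ 1)) *s e1 = (\<Sum>j\<in>UNIV. d j *s ch j x)"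

text \<open>The second spinor of each family is the part of \<open>r \<sigma>\<^sub>r \<Sigma> h e\<^sub>1\<close> that is not a multiple of \<open>h e\<^sub>1\<close>.\<close>

fun hplus :: "nat \<Rightarrow> nat \<Rightarrow> bool \<Rightarrow> real^3 \<Rightarrow> complex^2" where
  "hplus l m False x = cart_harm 1 m (harm_poly l m) x *s e1"
| "hplus l m True x = cart_harm 1 (Suc m) (pderiv (harm_poly l m)) x *s e2"

fun dhplus :: "nat \<Rightarrow> nat \<Rightarrow> bool \<Rightarrow> 3 \<Rightarrow> real^3 \<Rightarrow> complex^2" where
  "dhplus l m False k x = dharm 1 m (harm_poly l m) k x *s e1"
| "dhplus l m True k x = dharm 1 (Suc m) (pderiv (harm_poly l m)) k x *s e2"

fun Mplus :: "nat \<Rightarrow> nat \<Rightarrow> bool \<Rightarrow> bool \<Rightarrow> complex" where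
  "Mplus l m False False = - of_nat m"
| "Mplus l m False True = 1"
| "Mplus l m True False = of_real (kap l m)"
| "Mplus l m True True = of_nat (Suc m)"

text \<open>With \<open>q\<close> the polynomial of the harmonic, this is \<open>(1 - w * w)\<close>
  to the power \<open>1 - m\<close> times the derivative of \<open>(1 - w * w) ^ m * q\<close>: the
  lowering operator in the azimuthal number.\<close>

definition lower_poly :: "nat \<Rightarrow> nat \<Rightarrow> real poly" where
  "lower_poly l m = [:1, 0, -1:] * pderiv (harm_poly l m) - smult (2 * real m) ([:0, 1:] * harm_poly l m)"

fun hminus :: "nat \<Rightarrow> nat \<Rightarrow> bool \<Rightarrow> real^3 \<Rightarrow> complex^2" where
  "hminus l m False x = cart_harm (-1) m (harm_poly l m) x *s e1"
| "hminus l m True x = cart_harm (-1) (m - 1) (lower_poly l m) x *s e2"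

fun dhminus :: "nat \<Rightarrow> nat \<Rightarrow> bool \<Rightarrow> 3 \<Rightarrow> real^3 \<Rightarrow> complex^2" where
  "dhminus l m False k x = dharm (-1) m (harm_poly l m) k x *s e1"
| "dhminus l m True k x = dharm (-1) (m - 1) (lower_poly l m) k x *s e2"

fun Mminus :: "nat \<Rightarrow> nat \<Rightarrow> bool \<Rightarrow> bool \<Rightarrow> complex" where
  "Mminus l m False False = of_nat m"
| "Mminus l m False True = 1"
| "Mminus l m True False = of_real (kap l m + 2 * real m)"
| "Mminus l m True True = - of_nat (m - 1)"

text \<open>Differentiating the second spinor brings in the second derivative of the Legendre
  factor, which the differential equation turns back into a multiple of the first spinor.\<close>

lemma hplus_key:
  assumes x: "x \<noteq> 0"
  shows "norm x *\<^sub>R (sigma_r x *v (\<Sum>k\<in>UNIV. pauli k *v dhplus l m j k x)) = (\<Sum>i\<in>UNIV. Mplus l m j i *s hplus l m i x)"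
proof (cases j)
  case False
  then show ?thesis by (simp add: UNIV_bool harm_spinors(1)[OF x] add.commute vec_eq_iff)
next
  case True
  define p w where "p = harm_poly l m" and "w = x $ 3 / norm x"
  have ode: "2 * (real m + 1) * w * poly (pderiv p) w - (1 - w * w) * poly (pderiv (pderiv p)) w = kap l m * poly p w"
    using harm_poly_ode[of w l m] by (simp add: p_def algebra_simps)
  have "2 * of_nat (Suc m) * of_real w * cart_harm 1 m (pderiv p) x - (1 - of_real w * of_real w) * cart_harm 1 m (pderiv (pderiv p)) x
      = unitc 1 x ^ m * of_real (2 * (real m + 1) * w * poly (pderiv p) w - (1 - w * w) * poly (pderiv (pderiv p)) w)"
    by (simp add: cart_harm_def w_def[symmetric] algebra_simps)
  also have "\<dots> = of_real (kap l m) * cart_harm 1 m p x"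
    unfolding ode by (simp add: cart_harm_def w_def[symmetric])
  finally show ?thesis using True
    by (simp add: UNIV_bool harm_spinors(2)[OF x] p_def w_def add.commute vec_eq_iff)
qed

text \<open>The condition \<open>m \<ge> 1\<close> keeps the exponent \<open>m - 1\<close> of the
  second spinor genuine. Its matrix entry \<open>kap l m + 2 * m\<close> comes from the derivative
  of \<open>lower_poly\<close> and the differential equation.\<close>

lemma hminus_key:
  assumes x: "x \<noteq> 0" and m: "m \<ge> 1"
  shows "norm x *\<^sub>R (sigma_r x *v (\<Sum>k\<in>UNIV. pauli k *v dhminus l m j k x)) = (\<Sum>i\<in>UNIV. Mminus l m j i *s hminus l m i x)"
proof -
  obtain b where b: "m = Suc b" using m by (cases m) auto
  define p w where "p = harm_poly l m" and "w = x $ 3 / norm x"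
  show ?thesis
  proof (cases j)
    case False
    have "(1 - of_real w * of_real w) * cart_harm (-1) b (pderiv p) x - 2 * of_nat (Suc b) * of_real w * cart_harm (-1) b p x
       = cart_harm (-1) b (lower_poly l m) x"
      by (simp add: cart_harm_def w_def[symmetric] lower_poly_def b p_def algebra_simps)
    with False show ?thesis
      by (simp add: UNIV_bool harm_spinors(3)[OF x] p_def w_def b add.commute vec_eq_iff)
  next
    case True
    have "poly (pderiv (lower_poly l m)) w = (1 - w * w) * poly (pderiv (pderiv p)) w - 2 * (real m + 1) * w * poly (pderiv p) w - 2 * real m * poly p w"
      unfolding lower_poly_def p_def[symmetric]
      by (simp add: pderiv_mult pderiv_smult pderiv_diff pderiv_pCons del: mult_pCons_left mult_pCons_right) (simp add: algebra_simps)
    also have "\<dots> = - ((kap l m + 2 * real m) * poly p w)"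
      using harm_poly_ode[of w l m] by (simp add: p_def algebra_simps)
    finally have "- cart_harm (-1) m (pderiv (lower_poly l m)) x = of_real (kap l m + 2 * real m) * cart_harm (-1) m p x"
      by (simp add: cart_harm_def w_def[symmetric])
    with True show ?thesis using b
      by (simp add: UNIV_bool harm_spinors(4)[OF x] p_def add.commute vec_eq_iff)
  qed
qed

lemma hplus_props:
  "x \<noteq> 0 \<Longrightarrow> (hplus l m j has_derivative (\<lambda>h. \<Sum>k\<in>UNIV. h$k *\<^sub>R dhplus l m j k x)) (at x)"
  "continuous_on (- {0}) (dhplus l m j k)" "t > 0 \<Longrightarrow> hplus l m j (t *\<^sub>R x) = hplus l m j x"
  by (cases j; simp add: harm_spinor_has_derivative scale_const_cont dharm_cont harm_hom hplus.simps[abs_def] dhplus.simps[abs_def])+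

lemma hminus_props:
  "x \<noteq> 0 \<Longrightarrow> (hminus l m j has_derivative (\<lambda>h. \<Sum>k\<in>UNIV. h$k *\<^sub>R dhminus l m j k x)) (at x)"
  "continuous_on (- {0}) (dhminus l m j k)" "t > 0 \<Longrightarrow> hminus l m j (t *\<^sub>R x) = hminus l m j x"
  by (cases j; simp add: harm_spinor_has_derivative scale_const_cont dharm_cont harm_hom hminus.simps[abs_def] dhminus.simps[abs_def])+

definition hpair :: "nat \<Rightarrow> nat \<Rightarrow> bool \<times> bool \<Rightarrow> real^3 \<Rightarrow> complex^2" where
  "hpair l m j = (if fst j then hminus l m (snd j) else hplus l m (snd j))"

definition dhpair :: "nat \<Rightarrow> nat \<Rightarrow> bool \<times> bool \<Rightarrow> 3 \<Rightarrow> real^3 \<Rightarrow> complex^2" where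
  "dhpair l m j = (if fst j then dhminus l m (snd j) else dhplus l m (snd j))"

definition Mpair :: "nat \<Rightarrow> nat \<Rightarrow> bool \<times> bool \<Rightarrow> bool \<times> bool \<Rightarrow> complex" where
  "Mpair l m j i = (if fst i \<noteq> fst j then 0 else if fst j then Mminus l m (snd j) (snd i) else Mplus l m (snd j) (snd i))"

lemma sum_bool_pair: "(\<Sum>p\<in>UNIV. G (p :: bool \<times> bool)) = (\<Sum>i\<in>UNIV. G (False, i)) + (\<Sum>i\<in>UNIV. G (True, i))"
  for G :: "bool \<times> bool \<Rightarrow> 'c::comm_monoid_add"
proof -
  have "(\<Sum>p\<in>UNIV. G p) = (\<Sum>a\<in>UNIV. \<Sum>b\<in>UNIV. G (a, b))"
    by (simp add: sum.cartesian_product flip: UNIV_Times_UNIV)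
  then show ?thesis by (simp add: UNIV_bool add_ac)
qed

lemma e1_e2_nth: "e1 $ 1 = 1" "e1 $ 2 = 0" "e2 $ 1 = 0" "e2 $ 2 = 1"
  by (simp_all add: e1_def e2_def axis_def)

text \<open>For \<open>m = 0\<close> the harmonic is real, so the real part only acts on its
  coefficient.\<close>

lemma angular_X0: "angular_real (hplus l 0) (dhplus l 0) (Mplus l 0)"
proof
  fix c :: "bool \<Rightarrow> complex"
  show "\<exists>d. \<forall>x. x \<noteq> 0 \<longrightarrow> of_real (Re (\<Sum>j\<in>UNIV. c j * hplus l 0 j x $ 1)) *s e1 = (\<Sum>j\<in>UNIV. d j *s hplus l 0 j x)"
    by (rule exI[where x="\<lambda>j. if j then 0 else of_real (Re (c j))"])
       (simp add: UNIV_bool vec_eq_iff forall_2 e1_e2_nth cart_harm_def)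
qed (simp_all add: hplus_props hplus_key)

text \<open>Taking real parts couples the coefficient of a harmonic with the conjugate of the
  coefficient of its complex conjugate, hence the pairing of the two signs of \<open>m\<close> in
  one family.\<close>

lemma angular_X: "m \<ge> 1 \<Longrightarrow> angular_real (hpair l m) (dhpair l m) (Mpair l m)"
proof
  fix c :: "bool \<times> bool \<Rightarrow> complex"
  have "complex_of_real (Re (a * cart_harm 1 m q x + b * cart_harm (-1) m q x)) = (a + cnj b) / 2 * cart_harm 1 m q x + (cnj a + b) / 2 * cart_harm (-1) m q x" for a b q x
    unfolding cnj_harm[of 1, simplified, symmetric] by (simp add: complex_eq_iff field_simps)
  then show "\<exists>d. \<forall>x. x \<noteq> 0 \<longrightarrow> of_real (Re (\<Sum>j\<in>UNIV. c j * hpair l m j x $ 1)) *s e1 = (\<Sum>j\<in>UNIV. d j *s hpair l m j x)"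
    by (intro exI[where x="\<lambda>j. if snd j then 0 else if fst j then (cnj (c (False, False)) + c (True, False)) / 2
          else (c (False, False) + cnj (c (True, False))) / 2"])
       (simp add: sum_bool_pair UNIV_bool hpair_def vec_eq_iff forall_2 e1_e2_nth)
next
  fix j :: "bool \<times> bool" and x :: "real^3"
  assume "m \<ge> 1" "x \<noteq> 0"
  then show "norm x *\<^sub>R (sigma_r x *v (\<Sum>k\<in>UNIV. pauli k *v dhpair l m j k x)) = (\<Sum>i\<in>UNIV. Mpair l m j i *s hpair l m i x)"
    by (cases j) (simp add: sum_bool_pair hpair_def dhpair_def Mpair_def hplus_key hminus_key)
qed (auto simp: hpair_def dhpair_def hplus_props hminus_props)

text \<open>The spinor points along \<open>e2\<close>, so the first components, whose real part is
  taken, vanish; and \<open>harm_poly_top\<close> removes the component along \<open>e1\<close> that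
  the Pauli derivative would create.\<close>

lemma angular_Y: "angular_real (\<lambda>_ :: unit. \<lambda>x. cart_harm (-1) l (harm_poly l l) x *s e2) (\<lambda>_ k x. dharm (-1) l (harm_poly l l) k x *s e2) (\<lambda>_ _. - of_nat l)"
proof
  fix j :: unit and x :: "real^3"
  assume x: "x \<noteq> 0"
  have "cart_harm (-1) (Suc l) 0 x = 0" by (simp add: cart_harm_def)
  then show "norm x *\<^sub>R (sigma_r x *v (\<Sum>k\<in>UNIV. pauli k *v (dharm (-1) l (harm_poly l l) k x *s e2)))
     = (\<Sum>i :: unit \<in>UNIV. - of_nat l *s (cart_harm (-1) l (harm_poly l l) x *s e2))"
    unfolding harm_spinors(4)[OF x] harm_poly_top by (simp add: vec_eq_iff)
qed (auto simp: harm_spinor_has_derivative scale_const_cont dharm_cont harm_hom e1_e2_nth intro!: exI[where x="\<lambda>_. 0"])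

lemma mult_minus: "(A :: complex^'n^'m) *v (- v) = - (A *v v)"
  by (simp add: vec_eq_iff matrix_vector_mult_def sum_negf)

section \<open>Operations preserving a sector, and the terms containing the wave profile\<close>

context angular
begin

lemma comb_linear:
  "comb y z x + comb y' z' x = comb (\<lambda>j. y j + y' j) (\<lambda>j. z j + z' j) x"
  "c *s comb y z x = comb (\<lambda>j. c * y j) (\<lambda>j. c * z j) x"
  "beta_mat *v comb y z x = comb y (\<lambda>j. - z j) x"
proof -
  interpret s: bounded_linear "\<lambda>v. sigma_r x *v v" by (rule sigma_r_linear)
  have n: "(\<Sum>j\<in>UNIV. - z j *s ch j x) = - (\<Sum>j\<in>UNIV. z j *s ch j x)"
    by (simp add: sum_negf[symmetric] vec_eq_iff)
  have c: "(\<Sum>j\<in>UNIV. (c * y j) *s ch j x) = c *s (\<Sum>j\<in>UNIV. y j *s ch j x)" for y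
    by (simp add: vec_eq_iff sum_distrib_left mult_ac)
  have a: "(\<Sum>j\<in>UNIV. (y j + y' j) *s ch j x) = (\<Sum>j\<in>UNIV. y j *s ch j x) + (\<Sum>j\<in>UNIV. y' j *s ch j x)" for y y'
    by (simp add: vec_eq_iff sum.distrib algebra_simps)
  show "comb y z x + comb y' z' x = comb (\<lambda>j. y j + y' j) (\<lambda>j. z j + z' j) x"
    unfolding comb_def spinor_add a s.add ..
  show "c *s comb y z x = comb (\<lambda>j. c * y j) (\<lambda>j. c * z j) x"
    by (simp add: comb_def spinor_scale c mult_scale)
  show "beta_mat *v comb y z x = comb y (\<lambda>j. - z j) x"
    unfolding comb_def beta_mult n mult_minus ..
qed

lemma Form_cong: "Form \<rho> \<Longrightarrow> AE x in lborel. \<rho>' x = \<rho> x \<Longrightarrow> Form \<rho>'"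
  unfolding Form_def by (elim exE) (intro exI, rule eventually_mono[OF eventually_conj], assumption, assumption, auto)

lemma Form_add:
  assumes "Form \<rho>" "Form \<rho>'" shows "Form (\<lambda>x. \<rho> x + \<rho>' x)"
proof -
  from assms obtain a b a' b' where
    "AE x in lborel. \<rho> x = comb (\<lambda>j. a j (norm x)) (\<lambda>j. b j (norm x)) x"
    "AE x in lborel. \<rho>' x = comb (\<lambda>j. a' j (norm x)) (\<lambda>j. b' j (norm x)) x" unfolding Form_def by blast
  then have "AE x in lborel. \<rho> x + \<rho>' x = comb (\<lambda>j. a j (norm x) + a' j (norm x)) (\<lambda>j. b j (norm x) + b' j (norm x)) x"
    by eventually_elim (simp add: comb_linear)
  then show ?thesis unfolding Form_def
    by (intro exI[where x="\<lambda>j r. a j r + a' j r"] exI[where x="\<lambda>j r. b j r + b' j r"])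
qed

lemma Form_radial:
  assumes "Form \<rho>" shows "Form (\<lambda>x. k (norm x) *s \<rho> x)"
proof -
  from assms obtain a b where
    "AE x in lborel. \<rho> x = comb (\<lambda>j. a j (norm x)) (\<lambda>j. b j (norm x)) x" unfolding Form_def by blast
  then have "AE x in lborel. k (norm x) *s \<rho> x = comb (\<lambda>j. k (norm x) * a j (norm x)) (\<lambda>j. k (norm x) * b j (norm x)) x"
    by eventually_elim (simp add: comb_linear)
  then show ?thesis unfolding Form_def
    by (intro exI[where x="\<lambda>j r. k r * a j r"] exI[where x="\<lambda>j r. k r * b j r"])
qed

lemmas Form_scale = Form_radial[where k="\<lambda>_. c" for c]

lemma Form_beta:
  assumes "Form \<rho>" shows "Form (\<lambda>x. beta_mat *v \<rho> x)"
proof -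
  from assms obtain a b where
    "AE x in lborel. \<rho> x = comb (\<lambda>j. a j (norm x)) (\<lambda>j. b j (norm x)) x" unfolding Form_def by blast
  then have "AE x in lborel. beta_mat *v \<rho> x = comb (\<lambda>j. a j (norm x)) (\<lambda>j. - b j (norm x)) x"
    by eventually_elim (simp add: comb_linear)
  then show ?thesis unfolding Form_def by (intro exI[where x=a] exI[where x="\<lambda>j r. - b j r"])
qed

end

lemma herm_spinor: "herm (spinor a b) (spinor c d) = herm a c + herm b d"
  by (simp add: herm_def sum_4 sum_2)

lemma herm_sigma_r: "x \<noteq> 0 \<Longrightarrow> herm (sigma_r x *v a) (sigma_r x *v b) = herm a b"
proof -
  assume x: "x \<noteq> 0"
  have "cnj (unitc e x) = unitc (- e) x" for e by (simp add: unitc_def complex_eq_iff)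
  then have "herm (sigma_r x *v a) v = herm a (sigma_r x *v v)" for v
    by (simp add: herm_def sum_2 sigma_r_nth algebra_simps)
  then show ?thesis by (simp add: sigma_r_square[OF x])
qed

text \<open>Since \<open>sigma_r\<close> preserves the hermitian product and both components of the
  profile stem from \<open>e1\<close>, only the first components of \<open>Y\<close> and
  \<open>Z\<close> enter.\<close>

lemma herm_wave_profile:
  assumes x: "x \<noteq> 0"
  shows "herm (wave_profile v u x) (beta_mat *v spinor Y (sigma_r x *v Z)) = of_real (v (norm x)) * Y $ 1 + \<i> * of_real (u (norm x)) * Z $ 1"
proof -
  have "wave_profile v u x = spinor (of_real (v (norm x)) *s e1) (sigma_r x *v ((\<i> * of_real (u (norm x))) *s e1))"
    by (simp add: wave_profile_def mult_scale)
  moreover have "- (sigma_r x *v Z) = sigma_r x *v (- Z)"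
    by (simp add: mult_minus)
  ultimately show ?thesis
    by (simp add: beta_mult herm_spinor herm_sigma_r[OF x]) (simp add: herm_def sum_2 e1_e2_nth)
qed

lemma wave_profile_beta:
  "beta_mat *v wave_profile v u x = spinor (of_real (v (norm x)) *s e1) (sigma_r x *v ((- \<i> * of_real (u (norm x))) *s e1))"
proof -
  have "- (c *s (sigma_r x *v v)) = sigma_r x *v ((- c) *s v)" for c v
  proof -
    have "(- c) *s v = - (c *s v)" by (simp add: vec_eq_iff)
    then show ?thesis by (simp add: mult_scale mult_minus)
  qed
  from this[of \<i> "of_real (u (norm x)) *s e1"] show ?thesis
    by (simp add: wave_profile_def beta_mult mult_scale)
qed

lemma wave_profile_charge:
  "x \<noteq> 0 \<Longrightarrow> herm (wave_profile v u x) (beta_mat *v wave_profile v u x) = of_real ((v (norm x))\<^sup>2 - (u (norm x))\<^sup>2)"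
proof -
  assume x: "x \<noteq> 0"
  have "wave_profile v u x = spinor (of_real (v (norm x)) *s e1) (sigma_r x *v ((\<i> * of_real (u (norm x))) *s e1))"
    by (simp add: wave_profile_def mult_scale)
  then have "herm (wave_profile v u x) (beta_mat *v wave_profile v u x) = herm (wave_profile v u x) (beta_mat *v spinor (of_real (v (norm x)) *s e1) (sigma_r x *v ((\<i> * of_real (u (norm x))) *s e1)))" by simp
  then show ?thesis unfolding herm_wave_profile[OF x] by (simp add: e1_e2_nth power2_eq_square complex_eq_iff)
qed

context angular_real
begin

text \<open>The real scalar multiplies a field whose components are radial multiples of
  \<open>e1\<close> and of \<open>sigma_r\<close> applied to \<open>e1\<close>;
  \<open>chi_real\<close> rewrites the scalar times \<open>e1\<close> in the spinors of the sector,
  with coefficients depending on the radius alone.\<close>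

lemma Form_nonlinear_term:
  assumes "Form \<rho>"
  shows "Form (\<lambda>x. (k (norm x) * Re (herm (wave_profile v u x) (beta_mat *v \<rho> x))) *\<^sub>R (beta_mat *v wave_profile v u x))"
proof -
  from assms obtain a b where ab:
    "AE x in lborel. \<rho> x = comb (\<lambda>j. a j (norm x)) (\<lambda>j. b j (norm x)) x" unfolding Form_def by blast
  from choice[of "\<lambda>c d. \<forall>x. x \<noteq> 0 \<longrightarrow> of_real (Re (\<Sum>j\<in>UNIV. c j * ch j x $ 1)) *s e1 = (\<Sum>j\<in>UNIV. d j *s ch j x)"] chi_real
  obtain D where D: "\<And>c x. x \<noteq> 0 \<Longrightarrow> of_real (Re (\<Sum>j\<in>UNIV. c j * ch j x $ 1)) *s e1 = (\<Sum>j\<in>UNIV. D c j *s ch j x)" by blast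
  define d where "d j r = of_real (k r) * D (\<lambda>j. of_real (v r) * a j r + \<i> * of_real (u r) * b j r) j" for j r
  have "AE x in lborel. (k (norm x) * Re (herm (wave_profile v u x) (beta_mat *v \<rho> x))) *\<^sub>R (beta_mat *v wave_profile v u x)
     = comb (\<lambda>j. of_real (v (norm x)) * d j (norm x)) (\<lambda>j. - \<i> * of_real (u (norm x)) * d j (norm x)) x"
    using ab AE_lborel_singleton[of "0 :: real^3"]
  proof eventually_elim
    case (elim x)
    define c where "c = (\<lambda>j. of_real (v (norm x)) * a j (norm x) + \<i> * of_real (u (norm x)) * b j (norm x))"
    define R where "R = Re (\<Sum>j\<in>UNIV. c j * ch j x $ 1)"
    have R: "Re (herm (wave_profile v u x) (beta_mat *v \<rho> x)) = R"
      unfolding elim(1) comb_def herm_wave_profile[OF elim(2)]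
      by (simp add: R_def c_def sum_distrib_left sum.distrib algebra_simps)
    have s: "(\<Sum>j\<in>UNIV. (t * d j (norm x)) *s ch j x) = t *s ((of_real (k (norm x)) * of_real R) *s e1)" for t
    proof -
      have "(\<Sum>j\<in>UNIV. (t * d j (norm x)) *s ch j x) = (t * of_real (k (norm x))) *s (\<Sum>j\<in>UNIV. D c j *s ch j x)"
        unfolding d_def c_def[symmetric] by (simp add: vec_eq_iff sum_distrib_left mult_ac)
      also have "\<dots> = (t * of_real (k (norm x))) *s (of_real R *s e1)"
        unfolding R_def D[OF elim(2), of c] ..
      finally show ?thesis by (simp add: vec_eq_iff mult_ac)
    qed
    have e: "(k (norm x) * R) *\<^sub>R (beta_mat *v wave_profile v u x) = (of_real (k (norm x)) * of_real R) *s (beta_mat *v wave_profile v u x)"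
      by (simp add: vec_eq_iff) (simp add: scaleR_conv_of_real)
    show ?case unfolding R e unfolding comb_def s wave_profile_beta spinor_scale mult_scale[symmetric] vector_smult_assoc
      by (simp only: mult_ac)
  qed
  then show ?thesis unfolding Form_def
    by (intro exI[where x="\<lambda>j r. of_real (v r) * d j r"] exI[where x="\<lambda>j r. - \<i> * of_real (u r) * d j r"])
qed

end

subsection \<open>The spaces of the theorem as sectors\<close>

lemma Sigma_op_harm:
  assumes x: "x \<noteq> 0" and eq: "\<And>x. x \<noteq> 0 \<Longrightarrow> h x = cart_harm e a q x"
  shows "Sigma_op (\<lambda>y. h y *s v) x = (\<Sum>k\<in>UNIV. pauli k *v (dharm e a q k x *s v))"
proof -
  have "((\<lambda>y. h y *s v) has_derivative (\<lambda>t. \<Sum>k\<in>UNIV. t $ k *\<^sub>R (dharm e a q k x *s v))) (at x)"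
    by (rule has_derivative_transform_within_open[OF harm_spinor_has_derivative[OF x], where s = "- {0}"])
       (use x eq in auto)
  from partial_deriv_eq[OF this] show ?thesis by (simp add: Sigma_op_def)
qed

lemma sigma_Sigma_harm:
  assumes x: "x \<noteq> 0"
  shows "norm x *\<^sub>R (sigma_r x *v Sigma_op (\<lambda>y. sph_harm l (int m) y *s e1) x)
      = (- of_nat m) *s hplus l m False x + hplus l m True x"
    and "m \<ge> 1 \<Longrightarrow> norm x *\<^sub>R (sigma_r x *v Sigma_op (\<lambda>y. sph_harm l (- int m) y *s e1) x)
      = of_nat m *s hminus l m False x + hminus l m True x"
proof -
  have s: "1 *s v = v" for v :: "complex^2" by (simp add: vec_eq_iff)
  show "norm x *\<^sub>R (sigma_r x *v Sigma_op (\<lambda>y. sph_harm l (int m) y *s e1) x)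
      = (- of_nat m) *s hplus l m False x + hplus l m True x"
    using hplus_key[OF x, of l m False] Sigma_op_harm[where h="sph_harm l (int m)" and v=e1, OF x sph_harm_eq(1)]
    by (simp add: UNIV_bool s add.commute)
  show "norm x *\<^sub>R (sigma_r x *v Sigma_op (\<lambda>y. sph_harm l (- int m) y *s e1) x)
      = of_nat m *s hminus l m False x + hminus l m True x" if "m \<ge> 1"
    using hminus_key[OF x that, of l False] Sigma_op_harm[where h="sph_harm l (- int m)" and v=e1, OF x sph_harm_eq(2)]
    by (simp add: UNIV_bool s add.commute)
qed

text \<open>The pair \<open>h e1\<close>, \<open>\<sigma>\<^sub>r \<Sigma> h e1\<close> differs from
  the two spinors of the sector by a triangular change with factor \<open>1 / r\<close>; \<nu> is
  the eigenvalue part, \<open>- m\<close> for one sign of \<open>m\<close> and \<open>m\<close> for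
  the other.\<close>

definition radial_coeff :: "complex \<Rightarrow> (real \<Rightarrow> complex) \<Rightarrow> (real \<Rightarrow> complex) \<Rightarrow> bool \<Rightarrow> real \<Rightarrow> complex" where
  "radial_coeff \<nu> A B j r = (if j then B r / of_real r else A r + \<nu> * (B r / of_real r))"

lemma AB_form_eq:
  assumes x: "x \<noteq> 0"
  shows "AB_form l (int m) A B x = (\<Sum>j\<in>UNIV. radial_coeff (- of_nat m) A B j (norm x) *s hplus l m j x)"
    and "m \<ge> 1 \<Longrightarrow> AB_form l (- int m) A B x = (\<Sum>j\<in>UNIV. radial_coeff (of_nat m) A B j (norm x) *s hminus l m j x)"
proof -
  have "norm x \<noteq> 0" using x by simp
  then have r: "b *s v = (b / of_real (norm x)) *s (norm x *\<^sub>R v)" for b and v :: "complex^2"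
    by (simp add: vec_eq_iff scaleR_conv_of_real[where 'a=complex] del: norm_eq_zero)
  show "AB_form l (int m) A B x = (\<Sum>j\<in>UNIV. radial_coeff (- of_nat m) A B j (norm x) *s hplus l m j x)"
    unfolding AB_form_def r[of _ "sigma_r x *v _"] sigma_Sigma_harm(1)[OF x] sph_harm_eq(1)[OF x]
    by (simp add: radial_coeff_def UNIV_bool vec_eq_iff algebra_simps)
  show "AB_form l (- int m) A B x = (\<Sum>j\<in>UNIV. radial_coeff (of_nat m) A B j (norm x) *s hminus l m j x)" if "m \<ge> 1"
    unfolding AB_form_def r[of _ "sigma_r x *v _"] sigma_Sigma_harm(2)[OF x that] sph_harm_eq(2)[OF x]
    by (simp add: radial_coeff_def UNIV_bool vec_eq_iff algebra_simps)
qed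

lemma radial_coeff_surj:
  "r \<noteq> 0 \<Longrightarrow> radial_coeff \<nu> (\<lambda>r. a False r - \<nu> * a True r) (\<lambda>r. of_real r * a True r) j r = a j r"
  by (cases j) (simp_all add: radial_coeff_def)

lemma X0_space_Form: "X0_space l = {\<rho> \<in> L2. angular.Form (hplus l 0) \<rho>}"
proof -
  interpret angular_real "hplus l 0" "dhplus l 0" "Mplus l 0" by (rule angular_X0)
  have X: "X_form l 0 A B P Q x = comb (\<lambda>j. radial_coeff 0 A B j (norm x)) (\<lambda>j. \<i> * radial_coeff 0 P Q j (norm x)) x" if "x \<noteq> 0" for x A B P Q
  proof -
    have ab: "AB_form l 0 A B x = (\<Sum>j\<in>UNIV. radial_coeff 0 A B j (norm x) *s hplus l 0 j x)" for A B
      using AB_form_eq(1)[OF that, of l 0] by simp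
    have i: "(\<Sum>j\<in>UNIV. (\<i> * radial_coeff 0 P Q j (norm x)) *s hplus l 0 j x) = \<i> *s (\<Sum>j\<in>UNIV. radial_coeff 0 P Q j (norm x) *s hplus l 0 j x)"
      by (simp add: vec_eq_iff sum_distrib_left mult_ac)
    show ?thesis unfolding comb_def i ab[symmetric] X_form_def mult_scale ..
  qed
  have "(\<exists>A B P Q. AE x in lborel. \<rho> x = X_form l 0 A B P Q x) \<longleftrightarrow> Form \<rho>" for \<rho>
  proof
    assume "\<exists>A B P Q. AE x in lborel. \<rho> x = X_form l 0 A B P Q x"
    then obtain A B P Q where "AE x in lborel. \<rho> x = X_form l 0 A B P Q x" by blast
    with AE_lborel_singleton[of "0 :: real^3"] have "AE x in lborel. \<rho> x = comb (\<lambda>j. radial_coeff 0 A B j (norm x)) (\<lambda>j. \<i> * radial_coeff 0 P Q j (norm x)) x"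
      by eventually_elim (simp add: X)
    then show "Form \<rho>" unfolding Form_def by (intro exI[where x="radial_coeff 0 A B"] exI[where x="\<lambda>j r. \<i> * radial_coeff 0 P Q j r"])
  next
    assume "Form \<rho>"
    then obtain a b where ab: "AE x in lborel. \<rho> x = comb (\<lambda>j. a j (norm x)) (\<lambda>j. b j (norm x)) x" unfolding Form_def by blast
    \<comment> \<open>Undoes the factor \<open>\<i>\<close> with which the lower component enters
      \<open>X_form\<close>.\<close>
    define c where "c j r = - \<i> * b j r" for j r
    from ab AE_lborel_singleton[of "0 :: real^3"]
    have "AE x in lborel. \<rho> x = X_form l 0 (\<lambda>r. a False r - 0 * a True r) (\<lambda>r. of_real r * a True r) (\<lambda>r. c False r - 0 * c True r) (\<lambda>r. of_real r * c True r) x"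
    proof eventually_elim
      case (elim x)
      then have "norm x \<noteq> 0" by simp
      from radial_coeff_surj[OF this] elim show ?case unfolding X[OF elim(2)] by (simp only:) (simp add: c_def)
    qed
    then show "\<exists>A B P Q. AE x in lborel. \<rho> x = X_form l 0 A B P Q x" by blast
  qed
  then show ?thesis by (simp add: X0_space_def)
qed

lemma X_space_Form:
  assumes m: "m \<ge> 1"
  shows "X_space l m = {\<rho> \<in> L2. angular.Form (hpair l m) \<rho>}"
proof -
  interpret angular_real "hpair l m" "dhpair l m" "Mpair l m" by (rule angular_X[OF m])
  define rc2 where "rc2 A B A' B' j r = (if fst j then radial_coeff (of_nat m) A' B' (snd j) r else radial_coeff (- of_nat m) A B (snd j) r)" for A B A' B' j r
  have X: "X_form l (int m) A B P Q x + X_form l (- int m) A' B' P' Q' x = comb (\<lambda>j. rc2 A B A' B' j (norm x)) (\<lambda>j. \<i> * rc2 P Q P' Q' j (norm x)) x" if x: "x \<noteq> 0" for x A B P Q A' B' P' Q'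
  proof -
    interpret s: bounded_linear "\<lambda>v. sigma_r x *v v" by (rule sigma_r_linear)
    have ab: "AB_form l (int m) A B x + AB_form l (- int m) A' B' x = (\<Sum>j\<in>UNIV. rc2 A B A' B' j (norm x) *s hpair l m j x)" for A B A' B'
      unfolding AB_form_eq(1)[OF x] AB_form_eq(2)[OF x m] sum_bool_pair by (simp add: rc2_def hpair_def)
    have i: "(\<Sum>j\<in>UNIV. (\<i> * rc2 P Q P' Q' j (norm x)) *s hpair l m j x) = \<i> *s (\<Sum>j\<in>UNIV. rc2 P Q P' Q' j (norm x) *s hpair l m j x)"
      by (simp add: vec_eq_iff sum_distrib_left mult_ac)
    show ?thesis
      unfolding comb_def i ab[symmetric]
      by (simp add: X_form_def spinor_add mult_scale s.add vec_eq_iff algebra_simps)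
  qed
  have "(\<exists>A B P Q A' B' P' Q'. AE x in lborel. \<rho> x = X_form l (int m) A B P Q x + X_form l (- int m) A' B' P' Q' x) \<longleftrightarrow> Form \<rho>" for \<rho>
  proof
    assume "\<exists>A B P Q A' B' P' Q'. AE x in lborel. \<rho> x = X_form l (int m) A B P Q x + X_form l (- int m) A' B' P' Q' x"
    then obtain A B P Q A' B' P' Q' where "AE x in lborel. \<rho> x = X_form l (int m) A B P Q x + X_form l (- int m) A' B' P' Q' x" by blast
    with AE_lborel_singleton[of "0 :: real^3"] have "AE x in lborel. \<rho> x = comb (\<lambda>j. rc2 A B A' B' j (norm x)) (\<lambda>j. \<i> * rc2 P Q P' Q' j (norm x)) x"
      by eventually_elim (simp add: X)
    then show "Form \<rho>" unfolding Form_def by (intro exI[where x="rc2 A B A' B'"] exI[where x="\<lambda>j r. \<i> * rc2 P Q P' Q' j r"])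
  next
    assume "Form \<rho>"
    then obtain a b where ab: "AE x in lborel. \<rho> x = comb (\<lambda>j. a j (norm x)) (\<lambda>j. b j (norm x)) x" unfolding Form_def by blast
    \<comment> \<open>The same removal of the factor \<open>\<i>\<close>, now for both signs of
      \<open>m\<close> together.\<close>
    define c where "c j r = - \<i> * b j r" for j r
    let ?A = "\<lambda>\<nu> p a r. a (p, False) r - \<nu> * a (p, True) r" and ?B = "\<lambda>p a r. of_real r * a (p, True) r"
    have rc2: "rc2 (?A (- of_nat m) False a) (?B False a) (?A (of_nat m) True a) (?B True a) j r = a j r" if "r \<noteq> 0" for a j r
      using radial_coeff_surj[OF that, of "- of_nat m" "\<lambda>i. a (False, i)" "snd j"] radial_coeff_surj[OF that, of "of_nat m" "\<lambda>i. a (True, i)" "snd j"]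
      by (cases j) (auto simp: rc2_def)
    from ab AE_lborel_singleton[of "0 :: real^3"]
    have "AE x in lborel. \<rho> x = X_form l (int m) (?A (- of_nat m) False a) (?B False a) (?A (- of_nat m) False c) (?B False c) x
       + X_form l (- int m) (?A (of_nat m) True a) (?B True a) (?A (of_nat m) True c) (?B True c) x"
    proof eventually_elim
      case (elim x)
      then have "norm x \<noteq> 0" by simp
      from rc2[OF this] elim show ?case unfolding X[OF elim(2)] by (simp only:) (simp add: c_def)
    qed
    then show "\<exists>A B P Q A' B' P' Q'. AE x in lborel. \<rho> x = X_form l (int m) A B P Q x + X_form l (- int m) A' B' P' Q' x" by blast
  qed
  then show ?thesis by (simp add: X_space_def)
qed

lemma Y_space_Form: "Y_space l = {\<rho> \<in> L2. angular.Form (\<lambda>_ :: unit. \<lambda>x. cart_harm (-1) l (harm_poly l l) x *s e2) \<rho>}"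
proof -
  interpret angular_real "\<lambda>_ :: unit. \<lambda>x. cart_harm (-1) l (harm_poly l l) x *s e2" "\<lambda>_ k x. dharm (-1) l (harm_poly l l) k x *s e2" "\<lambda>_ _. - of_nat l"
    by (rule angular_Y)
  have Y: "Y_form l R S x = comb (\<lambda>j. R (norm x)) (\<lambda>j. \<i> * S (norm x)) x" if "x \<noteq> 0" for x R S
    by (simp add: Y_form_def comb_def sph_harm_eq(2)[OF that] mult_scale vector_smult_assoc mult_ac)
  have "(\<exists>R S. AE x in lborel. \<rho> x = Y_form l R S x) \<longleftrightarrow> Form \<rho>" for \<rho>
  proof
    assume "\<exists>R S. AE x in lborel. \<rho> x = Y_form l R S x"
    then obtain R S where "AE x in lborel. \<rho> x = Y_form l R S x" by blast
    with AE_lborel_singleton[of "0 :: real^3"] have "AE x in lborel. \<rho> x = comb (\<lambda>j. R (norm x)) (\<lambda>j. \<i> * S (norm x)) x"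
      by eventually_elim (simp add: Y)
    then show "Form \<rho>" unfolding Form_def by (intro exI[where x="\<lambda>_. R"] exI[where x="\<lambda>j r. \<i> * S r"])
  next
    assume "Form \<rho>"
    then obtain a b where ab: "AE x in lborel. \<rho> x = comb (\<lambda>j. a j (norm x)) (\<lambda>j. b j (norm x)) x" unfolding Form_def by blast
    from ab AE_lborel_singleton[of "0 :: real^3"]
    have "AE x in lborel. \<rho> x = Y_form l (a ()) (\<lambda>r. - \<i> * b () r) x"
      by eventually_elim (simp add: Y)
    then show "\<exists>R S. AE x in lborel. \<rho> x = Y_form l R S x" by blast
  qed
  then show ?thesis by (simp add: Y_space_def)
qed

subsection \<open>The linearization\<close>

lemma dirac_op_eq: "dirac_op f x = \<i> *s skew_dirac f x"
  by (simp add: dirac_op_def skew_dirac_def vec_eq_iff)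

lemma Re_herm: "Re (herm a b) = a \<bullet> b"
  by (simp add: herm_def inner_vec_def inner_complex_def)

lemma scale_norm: "norm (c *s v) = cmod c * norm v" for v :: "complex^'n"
  by (simp add: norm_vec_def L2_set_def norm_mult power_mult_distrib sum_distrib_left[symmetric] real_sqrt_mult)

lemma scale_inner: "(c *s v) \<bullet> w = v \<bullet> (cnj c *s w)" for v w :: "complex^'n"
  by (simp add: inner_vec_def inner_complex_def algebra_simps)

lemma beta_linear: "bounded_linear (\<lambda>v. beta_mat *v v)"
  by (rule linear_conv_bounded_linear[THEN iffD1], rule linearI)
     (simp_all add: vec_eq_iff matrix_vector_mult_def scaleR_sum_right sum.distrib distrib_left)

lemma beta_sym: "(beta_mat *v v) \<bullet> w = v \<bullet> (beta_mat *v w)"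
  by (rule spinor_exhaust[of v], rule spinor_exhaust[of w]) (simp add: beta_mult spinor_inner)

lemma beta_norm: "norm (beta_mat *v v) = norm v"
  by (rule spinor_exhaust[of v]) (simp add: norm_eq_sqrt_inner beta_mult spinor_inner)

lemma imaginary_scale_inner: "Re c = 0 \<Longrightarrow> (c *s v) \<bullet> v = 0" "Re c = 0 \<Longrightarrow> (c *s (beta_mat *v v)) \<bullet> v = 0"
  for v :: "complex^4"
proof -
  assume c: "Re c = 0"
  then have n: "cnj c = - c" by (simp add: complex_eq_iff)
  have m: "(- c) *s v = - (c *s v)" for v :: "complex^4" by (simp add: vec_eq_iff)
  show "(c *s v) \<bullet> v = 0"
    using scale_inner[of c v v] unfolding n m by (simp add: inner_commute)
  have "(c *s (beta_mat *v v)) \<bullet> v = - ((beta_mat *v v) \<bullet> (c *s v))" unfolding scale_inner n m by simp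
  also have "\<dots> = - ((c *s (beta_mat *v v)) \<bullet> v)" unfolding beta_sym mult_scale by (simp add: inner_commute)
  finally show "(c *s (beta_mat *v v)) \<bullet> v = 0" by simp
qed

lemma continuous_bounded_AE:
  fixes h :: "real \<Rightarrow> real"
  assumes "continuous_on UNIV h" and "AE x in lborel. \<bar>\<tau> x\<bar> \<le> c"
  obtains K where "AE x in lborel. \<bar>h (\<tau> x)\<bar> \<le> K"
proof -
  have "bounded (h ` {-c..c})"
    by (rule compact_imp_bounded[OF compact_continuous_image]) (use assms(1) continuous_on_subset in auto)
  then obtain K where "\<And>t. \<bar>t\<bar> \<le> c \<Longrightarrow> \<bar>h t\<bar> \<le> K" unfolding bounded_iff by fastforce
  with assms(2) have "AE x in lborel. \<bar>h (\<tau> x)\<bar> \<le> K" by (auto elim: eventually_mono)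
  then show ?thesis by (rule that)
qed

context
  fixes g v u :: "real \<Rightarrow> real" and \<omega> :: real
  assumes g: "continuous_on UNIV g" "continuous_on UNIV (deriv g)" and wave: "solitary_wave g \<omega> v u"
begin

definition charge :: "real^3 \<Rightarrow> real" where
  "charge x = Re (herm (wave_profile v u x) (beta_mat *v wave_profile v u x))"

lemma profile_measurable: "wave_profile v u \<in> borel_measurable borel"
  using wave L2_measurable H1_L2 unfolding solitary_wave_def by blast

lemma charge_measurable: "charge \<in> borel_measurable borel"
  unfolding charge_def[abs_def] Re_herm
  by (intro borel_measurable_inner profile_measurable
      measurable_compose[OF profile_measurable borel_measurable_continuous_onI[OF linear_continuous_on[OF beta_linear]]])

lemma continuous_charge_measurable: "continuous_on UNIV h \<Longrightarrow> (\<lambda>x. h (charge x)) \<in> borel_measurable borel"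
  for h :: "real \<Rightarrow> real"
  by (rule measurable_compose[OF charge_measurable borel_measurable_continuous_onI])

lemma profile_bounded:
  obtains c where "c \<ge> 0" "AE x in lborel. norm (wave_profile v u x) \<le> c"
proof -
  have "bounded (v ` {0<..})" "bounded (u ` {0<..})" using wave by (auto simp: solitary_wave_def)
  then obtain a b where a: "\<And>r. r > 0 \<Longrightarrow> \<bar>v r\<bar> \<le> a" and b: "\<And>r. r > 0 \<Longrightarrow> \<bar>u r\<bar> \<le> b"
    unfolding bounded_iff by (auto simp: image_iff)
  have "norm (wave_profile v u x) \<le> a + b" if x: "x \<noteq> 0" for x
  proof -
    have e: "norm e1 = 1" by (simp add: e1_def)
    have s: "norm (sigma_r x *v w) = norm w" for w
      using herm_sigma_r[OF x, of w w] by (simp add: norm_eq_sqrt_inner flip: Re_herm)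
    have "norm (spinor y z) \<le> norm y + norm z" for y z
      using sqrt_sum_squares_le_sum[of "norm y" "norm z"]
      by (simp add: norm_eq_sqrt_inner[of "spinor y z"] spinor_inner power2_norm_eq_inner)
    from this[of "of_real (v (norm x)) *s e1" "\<i> *s (sigma_r x *v (of_real (u (norm x)) *s e1))"]
    show ?thesis using a[of "norm x"] b[of "norm x"] x
      by (simp add: wave_profile_def scale_norm s e)
  qed
  then have "AE x in lborel. norm (wave_profile v u x) \<le> a + b"
    using AE_lborel_singleton[of "0 :: real^3"] by (auto elim: eventually_mono)
  moreover have "a + b \<ge> 0" using a[of 1] b[of 1] by simp
  ultimately show ?thesis by (rule that[rotated])
qed

lemma continuous_charge_bounded:
  fixes h :: "real \<Rightarrow> real"
  assumes "continuous_on UNIV h"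
  obtains K where "AE x in lborel. \<bar>h (charge x)\<bar> \<le> K"
proof -
  obtain c where c: "c \<ge> 0" "AE x in lborel. norm (wave_profile v u x) \<le> c" by (rule profile_bounded)
  have "AE x in lborel. \<bar>charge x\<bar> \<le> c * c"
    using c(2)
  proof eventually_elim
    case (elim x)
    have "\<bar>charge x\<bar> \<le> norm (wave_profile v u x) * norm (wave_profile v u x)"
      unfolding charge_def Re_herm using Cauchy_Schwarz_ineq2[of "wave_profile v u x" "beta_mat *v wave_profile v u x"]
      by (simp add: beta_norm)
    also have "\<dots> \<le> c * c" by (intro mult_mono elim c) auto
    finally show ?case .
  qed
  from continuous_bounded_AE[OF assms this] that show ?thesis by blast
qed

text \<open>The profile is bounded, so \<open>g\<close> and its derivative are evaluated on a
  bounded range and all terms except the Dirac term are bounded in \<open>L2\<close>.\<close>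

lemma linearization_L2:
  assumes \<rho>: "\<rho> \<in> H1"
  shows "soler_linearization g \<omega> (wave_profile v u) \<rho> \<in> L2"
proof -
  note L = H1_L2[OF \<rho>]
  have bm: "(\<lambda>x. beta_mat *v f x) \<in> borel_measurable borel" if "f \<in> borel_measurable borel" for f
    by (rule measurable_compose[OF that borel_measurable_continuous_onI[OF linear_continuous_on[OF beta_linear]]])
  obtain c where c: "c \<ge> 0" "AE x in lborel. norm (wave_profile v u x) \<le> c" by (rule profile_bounded)
  obtain K where K: "AE x in lborel. \<bar>g (charge x)\<bar> \<le> K" by (rule continuous_charge_bounded[OF g(1)])
  obtain K' where K': "AE x in lborel. \<bar>deriv g (charge x)\<bar> \<le> K'" by (rule continuous_charge_bounded[OF g(2)])
  have 1: "(\<lambda>x. \<i> *s skew_dirac \<rho> x) \<in> L2" by (rule L2_linear_image[OF skew_dirac_L2[OF \<rho>] scale_linear])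
  have 2: "(\<lambda>x. g (charge x) *\<^sub>R (beta_mat *v \<rho> x)) \<in> L2"
    by (rule L2_bound[OF borel_measurable_scaleR[OF continuous_charge_measurable[OF g(1)] bm[OF L2_measurable[OF L]]] L, of K])
       (use K in \<open>auto elim!: eventually_mono simp: beta_norm intro: mult_right_mono\<close>)
  have "AE x in lborel. norm ((2 * deriv g (charge x) * (wave_profile v u x \<bullet> (beta_mat *v \<rho> x))) *\<^sub>R (beta_mat *v wave_profile v u x))
     \<le> (2 * K' * c * c) * norm (\<rho> x)"
    using c(2) K'
  proof eventually_elim
    case (elim x)
    have i: "\<bar>wave_profile v u x \<bullet> (beta_mat *v \<rho> x)\<bar> \<le> c * norm (\<rho> x)"
      using Cauchy_Schwarz_ineq2[of "wave_profile v u x" "beta_mat *v \<rho> x"] mult_right_mono[OF elim(1), of "norm (\<rho> x)"]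
      by (simp add: beta_norm)
    have "norm ((2 * deriv g (charge x) * (wave_profile v u x \<bullet> (beta_mat *v \<rho> x))) *\<^sub>R (beta_mat *v wave_profile v u x))
      = 2 * \<bar>deriv g (charge x)\<bar> * \<bar>wave_profile v u x \<bullet> (beta_mat *v \<rho> x)\<bar> * norm (wave_profile v u x)"
      by (simp add: beta_norm abs_mult)
    also have "\<dots> \<le> 2 * K' * (c * norm (\<rho> x)) * c"
      by (intro mult_mono elim i) (use c elim in auto)
    finally show ?case by (simp add: mult_ac)
  qed
  then have 3: "(\<lambda>x. (2 * deriv g (charge x) * (wave_profile v u x \<bullet> (beta_mat *v \<rho> x))) *\<^sub>R (beta_mat *v wave_profile v u x)) \<in> L2"
    by (intro L2_bound[OF _ L] borel_measurable_scaleR borel_measurable_times borel_measurable_inner borel_measurable_const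
        continuous_charge_measurable g(2) bm profile_measurable L2_measurable[OF L])
  have "soler_linearization g \<omega> (wave_profile v u) \<rho> = (\<lambda>x. \<i> *s skew_dirac \<rho> x + g (charge x) *\<^sub>R (beta_mat *v \<rho> x)
      + (2 * deriv g (charge x) * (wave_profile v u x \<bullet> (beta_mat *v \<rho> x))) *\<^sub>R (beta_mat *v wave_profile v u x) - \<omega> *\<^sub>R \<rho> x)"
    by (simp add: fun_eq_iff soler_linearization_def Let_def dirac_op_eq Re_herm charge_def)
  then show ?thesis using L2_diff[OF L2_add[OF L2_add[OF 1 2] 3] L2_scaleR[OF L, of \<omega>]] by simp
qed

lemma charge_radial: "x \<noteq> 0 \<Longrightarrow> charge x = (v (norm x))\<^sup>2 - (u (norm x))\<^sup>2"
  unfolding charge_def wave_profile_charge Re_complex_of_real ..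

text \<open>Off the origin the charge \<open>v\<^sup>2 - u\<^sup>2\<close> is a function of the
  radius, so the potential terms are radial multiples, apart from the real-linear one.\<close>

lemma linearization_Form:
  assumes "angular_real ch dch M" and F: "angular.Form ch \<rho>" and \<rho>: "\<rho> \<in> H1"
  shows "angular.Form ch (soler_linearization g \<omega> (wave_profile v u) \<rho>)"
proof -
  interpret angular_real ch dch M by fact
  define t where "t r = (v r)\<^sup>2 - (u r)\<^sup>2" for r
  note fs = Form_scale[OF Form_dirac[OF F \<rho>], of \<i>] Form_radial[OF Form_beta[OF F], of "\<lambda>r. of_real (g (t r))"]
     Form_nonlinear_term[OF F, of "\<lambda>r. 2 * deriv g (t r)" v u] Form_scale[OF F, of "- of_real \<omega>"]
  show ?thesis
  proof (rule Form_cong[OF Form_add[OF Form_add[OF Form_add[OF fs(1,2)] fs(3)] fs(4)]])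
    show "AE x in lborel. soler_linearization g \<omega> (wave_profile v u) \<rho> x = \<i> *s skew_dirac \<rho> x + of_real (g (t (norm x))) *s (beta_mat *v \<rho> x) +
      (2 * deriv g (t (norm x)) * Re (herm (wave_profile v u x) (beta_mat *v \<rho> x))) *\<^sub>R (beta_mat *v wave_profile v u x) + (- of_real \<omega>) *s \<rho> x"
      using AE_lborel_singleton[of "0 :: real^3"]
    proof eventually_elim
      case (elim x)
      have "r *\<^sub>R w = of_real r *s w" for r and w :: "complex^4" by (simp add: vec_eq_iff) (simp add: scaleR_conv_of_real)
      moreover have "- (c *s w) = (- c) *s w" for c and w :: "complex^4" by (simp add: vec_eq_iff)
      ultimately show ?case
        using charge_radial[OF elim]
        by (simp add: soler_linearization_def Let_def dirac_op_eq t_def charge_def diff_conv_add_uminus del: add_uminus_conv_diff)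
    qed
  qed
qed

lemma Y_space_resolvent:
  assumes z: "Re z \<noteq> 0"
  shows "z \<in> resolvent_set (Y_space l) (Y_space l \<inter> H1) (\<lambda>\<rho> x. (- \<i>) *s soler_linearization g \<omega> (wave_profile v u) \<rho> x)"
proof -
  let ?L = "soler_linearization g \<omega> (wave_profile v u)"
  interpret angular_real "\<lambda>_ :: unit. \<lambda>x. cart_harm (-1) l (harm_poly l l) x *s e2" "\<lambda>_ k x. dharm (-1) l (harm_poly l l) k x *s e2" "\<lambda>_ _. - of_nat l"
    by (rule angular_Y)
  \<comment> \<open>The factor \<open>- \<i>\<close> turns the Dirac operator into
    \<open>skew_dirac\<close>; \<open>B\<close> collects the potential, the frequency and
    \<open>z\<close>, and \<open>Bt\<close> is its adjoint for the real inner product.\<close>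
  define B where "B x w = (- \<i> * of_real (g (charge x))) *s (beta_mat *v w) + (\<i> * of_real \<omega> - z) *s w" for x w
  define Bt where "Bt x w = (\<i> * of_real (g (charge x))) *s (beta_mat *v w) + (- \<i> * of_real \<omega> - cnj z) *s w" for x w
  obtain K where K: "AE x in lborel. \<bar>g (charge x)\<bar> \<le> K" by (rule continuous_charge_bounded[OF g(1)])
  have bound: "norm (a *s (beta_mat *v w) + b *s w) \<le> (cmod a + cmod b) * norm w" for a b w
    using norm_triangle_ineq[of "a *s (beta_mat *v w)" "b *s w"] by (simp add: scale_norm beta_norm algebra_simps)
  have meas: "(\<lambda>x. (d * complex_of_real (g (charge x))) *s (beta_mat *v f x) + c *s f x) \<in> borel_measurable borel"
    if f: "f \<in> borel_measurable borel" for f :: "real^3 \<Rightarrow> complex^4" and d c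
  proof -
    have sc: "continuous_on UNIV (\<lambda>w :: complex^4. c *s w)" for c by (rule linear_continuous_on[OF scale_linear])
    have e: "(d * complex_of_real (g (charge x))) *s (beta_mat *v f x) = g (charge x) *\<^sub>R (d *s (beta_mat *v f x))" for x
      by (simp add: vec_eq_iff) (simp add: scaleR_conv_of_real mult_ac)
    have "(\<lambda>x. d *s (beta_mat *v f x)) \<in> borel_measurable borel" "(\<lambda>x. c *s f x) \<in> borel_measurable borel"
      by (rule measurable_compose[OF measurable_compose[OF f borel_measurable_continuous_onI[OF linear_continuous_on[OF beta_linear]]] borel_measurable_continuous_onI[OF sc]])
         (rule measurable_compose[OF f borel_measurable_continuous_onI[OF sc]])
    then show ?thesis unfolding e by (intro borel_measurable_add borel_measurable_scaleR continuous_charge_measurable g(1))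
  qed
  interpret d: dissipative B Bt "- Re z" "\<bar>K\<bar> + cmod (\<i> * of_real \<omega> - z)"
  proof (rule dissipative.intro)
    fix x
    have l: "linear (\<lambda>w. a *s (beta_mat *v w) + b *s w)" for a b
      by (rule linearI) (simp_all add: linear_add[OF bounded_linear.linear[OF beta_linear]] linear_cmul[OF bounded_linear.linear[OF beta_linear]] vec_eq_iff algebra_simps)
    show "linear (B x)" "linear (Bt x)" unfolding B_def[abs_def] Bt_def[abs_def] by (rule l)+
  next
    have "cmod (- \<i> * of_real \<omega> - cnj z) = cmod (\<i> * of_real \<omega> - z)"
      using complex_mod_cnj[of "\<i> * of_real \<omega> - z"] by simp
    note c = this
    show "AE x in lborel. \<forall>w. norm (B x w) \<le> (\<bar>K\<bar> + cmod (\<i> * of_real \<omega> - z)) * norm w"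
      using K
    proof eventually_elim
      case (elim x)
      have "(cmod (- \<i> * of_real (g (charge x))) + cmod (\<i> * of_real \<omega> - z)) * norm w \<le> (\<bar>K\<bar> + cmod (\<i> * of_real \<omega> - z)) * norm w" for w :: "complex^4"
        by (intro mult_right_mono add_right_mono) (use elim in \<open>auto simp: norm_mult\<close>)
      then show ?case unfolding B_def using bound order_trans by blast
    qed
    show "AE x in lborel. \<forall>w. norm (Bt x w) \<le> (\<bar>K\<bar> + cmod (\<i> * of_real \<omega> - z)) * norm w"
      using K
    proof eventually_elim
      case (elim x)
      have "(cmod (\<i> * of_real (g (charge x))) + cmod (- \<i> * of_real \<omega> - cnj z)) * norm w \<le> (\<bar>K\<bar> + cmod (\<i> * of_real \<omega> - z)) * norm w" for w :: "complex^4"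
        unfolding c by (intro mult_right_mono add_right_mono) (use elim in \<open>auto simp: norm_mult\<close>)
      then show ?case unfolding Bt_def using bound order_trans by blast
    qed
  next
    fix f :: "real^3 \<Rightarrow> complex^4" assume f: "f \<in> borel_measurable borel"
    show "(\<lambda>x. B x (f x)) \<in> borel_measurable borel" "(\<lambda>x. Bt x (f x)) \<in> borel_measurable borel"
      unfolding B_def Bt_def by (rule meas[OF f])+
  next
    fix x and v w :: "complex^4"
    show "B x v \<bullet> w = v \<bullet> Bt x w"
      unfolding B_def Bt_def inner_add_left inner_add_right scale_inner beta_sym mult_scale by simp
  next
    fix x and v :: "complex^4"
    \<comment> \<open>The imaginary part of \<open>z\<close> only shifts \<omega>. Imaginary
      multiples of the identity and of \<open>beta_mat\<close> are skew, so \<open>- Re z\<close> is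
      all that survives in the quadratic form.\<close>
    have "(\<i> * of_real \<omega> - z) *s v = (\<i> * of_real (\<omega> - Im z)) *s v - Re z *\<^sub>R v"
      by (simp add: vec_eq_iff complex_eq_iff algebra_simps)
    then show "B x v \<bullet> v = - Re z * (v \<bullet> v)"
      by (simp add: B_def inner_add_left inner_diff_left imaginary_scale_inner)
  qed (use z in simp)
  have FB: "Form (\<lambda>x. (d * complex_of_real (g (charge x))) *s (beta_mat *v f x) + c *s f x)" if f: "Form f" for f d c
  proof (rule Form_cong[OF Form_add[OF Form_radial[OF Form_beta[OF f], of "\<lambda>r. d * of_real (g ((v r)\<^sup>2 - (u r)\<^sup>2))"] Form_scale[OF f, of c]]])
    show "AE x in lborel. (d * complex_of_real (g (charge x))) *s (beta_mat *v f x) + c *s f x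
       = (d * of_real (g ((v (norm x))\<^sup>2 - (u (norm x))\<^sup>2))) *s (beta_mat *v f x) + c *s f x"
      using AE_lborel_singleton[of "0 :: real^3"] by eventually_elim (simp add: charge_radial)
  qed
  \<comment> \<open>On \<open>Y_space l\<close> the real-linear term vanishes pointwise, which
    leaves an equation of the type solved above.\<close>
  have S: "AE x in lborel. (- \<i>) *s ?L \<rho> x - z *s \<rho> x = skew_dirac \<rho> x + B x (\<rho> x)" if "\<rho> \<in> Y_space l" for \<rho>
  proof -
    obtain R T where "AE x in lborel. \<rho> x = Y_form l R T x" using \<open>\<rho> \<in> Y_space l\<close> unfolding Y_space_def by blast
    then show ?thesis
    proof eventually_elim
      case (elim x)
      have "herm (wave_profile v u x) (beta_mat *v \<rho> x) = 0" unfolding elim by (rule herm_wave_profile_Y_form)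
      then have "?L \<rho> x = \<i> *s skew_dirac \<rho> x + g (charge x) *\<^sub>R (beta_mat *v \<rho> x) - \<omega> *\<^sub>R \<rho> x"
        by (simp add: soler_linearization_def Let_def dirac_op_eq charge_def)
      then show ?case
        by (simp add: B_def vec_eq_iff) (simp add: scaleR_conv_of_real algebra_simps)
    qed
  qed
  have Y: "\<rho> \<in> Y_space l \<longleftrightarrow> \<rho> \<in> L2 \<and> Form \<rho>" for \<rho> by (simp add: Y_space_Form)
  have L2S: "(\<lambda>x. (- \<i>) *s ?L \<rho> x - z *s \<rho> x) \<in> L2" if "\<rho> \<in> H1" for \<rho>
    by (intro L2_diff L2_linear_image[OF _ scale_linear] linearization_L2 that H1_L2)
  have norm_S: "L2_norm (\<lambda>x. (- \<i>) *s ?L \<rho> x - z *s \<rho> x) = L2_norm (\<lambda>x. skew_dirac \<rho> x + B x (\<rho> x))" if "\<rho> \<in> Y_space l" "\<rho> \<in> H1" for \<rho>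
    by (rule L2_norm_cong_AE[OF L2_measurable[OF L2S[OF that(2)]] L2_measurable[OF L2_add[OF skew_dirac_L2[OF that(2)] d.B_L2(1)[OF H1_L2[OF that(2)]]]] S[OF that(1)]])
  show ?thesis
    unfolding resolvent_set_def Let_def
  proof (intro CollectI conjI ballI impI)
    fix \<rho> assume \<rho>: "\<rho> \<in> Y_space l \<inter> H1"
    have "Form (\<lambda>x. skew_dirac \<rho> x + B x (\<rho> x))"
      unfolding B_def by (intro Form_add[OF Form_dirac FB]) (use \<rho> Y in auto)
    from Form_cong[OF this S] have "Form (\<lambda>x. (- \<i>) *s ?L \<rho> x - z *s \<rho> x)" using \<rho> by simp
    then show "(\<lambda>x. (- \<i>) *s ?L \<rho> x - z *s \<rho> x) \<in> Y_space l" using Y L2S \<rho> by auto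
  next
    fix \<rho> \<rho>' assume \<rho>: "\<rho> \<in> Y_space l \<inter> H1" "\<rho>' \<in> Y_space l \<inter> H1"
      and eq: "AE x in lborel. (- \<i>) *s ?L \<rho> x - z *s \<rho> x = (- \<i>) *s ?L \<rho>' x - z *s \<rho>' x"
    have H: "\<rho> \<in> H1" "\<rho>' \<in> H1" and Ys: "\<rho> \<in> Y_space l" "\<rho>' \<in> Y_space l" using \<rho> by auto
    note D = H1_diff[OF H]
    have "AE x in lborel. skew_dirac (\<lambda>x. \<rho> x - \<rho>' x) x + B x (\<rho> x - \<rho>' x) = 0"
      using D(2) eq S[OF Ys(1)] S[OF Ys(2)]
    proof eventually_elim
      case (elim x)
      then have "skew_dirac \<rho> x + B x (\<rho> x) = skew_dirac \<rho>' x + B x (\<rho>' x)" by simp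
      then show ?case unfolding elim(1) linear_diff[OF d.lin(1)] by (simp add: algebra_simps)
    qed
    then have "L2_norm (\<lambda>x. skew_dirac (\<lambda>x. \<rho> x - \<rho>' x) x + B x (\<rho> x - \<rho>' x)) = L2_norm (\<lambda>x. 0)"
      by (intro L2_norm_cong_AE L2_measurable[OF L2_add[OF skew_dirac_L2[OF D(1)] d.B_L2(1)[OF H1_L2[OF D(1)]]]]) auto
    moreover have "L2_norm (\<lambda>x. 0) = 0" by (simp add: L2_norm_def)
    ultimately have "\<bar>- Re z\<bar> * L2_norm (\<lambda>x. \<rho> x - \<rho>' x) \<le> 0" using d.lower_bound[OF D(1)] by simp
    then have "L2_norm (\<lambda>x. \<rho> x - \<rho>' x) = 0"
      using z L2_norm_nonneg[of "\<lambda>x. \<rho> x - \<rho>' x"] by (auto simp: mult_le_0_iff)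
    from L2_norm_zero_AE[OF H1_L2[OF D(1)] this] show "AE x in lborel. \<rho> x = \<rho>' x" by simp
  next
    fix \<eta> assume "\<eta> \<in> Y_space l"
    then have \<eta>: "\<eta> \<in> L2" "Form \<eta>" using Y by auto
    have "Form (\<lambda>x. B x (f x))" "Form (\<lambda>x. Bt x (f x))" if "Form f" for f
      unfolding B_def Bt_def by (rule FB[OF that])+
    from Form_solvable[OF d.dissipative_axioms this \<eta>]
    obtain \<rho> where \<rho>: "\<rho> \<in> H1" "Form \<rho>" "AE x in lborel. skew_dirac \<rho> x + B x (\<rho> x) = \<eta> x" by blast
    then have Yr: "\<rho> \<in> Y_space l" using Y H1_L2 by blast
    have "AE x in lborel. (- \<i>) *s ?L \<rho> x - z *s \<rho> x = \<eta> x" using S[OF Yr] \<rho>(3) by eventually_elim simp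
    then show "\<exists>\<rho>\<in>Y_space l \<inter> H1. AE x in lborel. (- \<i>) *s ?L \<rho> x - z *s \<rho> x = \<eta> x" using Yr \<rho>(1) by blast
  next
    \<comment> \<open>The usual resolvent bound for a skew operator, by the inverse distance of
      \<open>z\<close> to the imaginary axis.\<close>
    have "L2_norm \<rho> \<le> 1 / \<bar>Re z\<bar> * L2_norm (\<lambda>x. (- \<i>) *s ?L \<rho> x - z *s \<rho> x)" if "\<rho> \<in> Y_space l \<inter> H1" for \<rho>
      using d.lower_bound[of \<rho>] norm_S[of \<rho>] that z by (simp add: field_simps)
    then show "\<exists>C. \<forall>\<rho>\<in>Y_space l \<inter> H1. L2_norm \<rho> \<le> C * L2_norm (\<lambda>x. (- \<i>) *s ?L \<rho> x - z *s \<rho> x)" by blast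
  qed
qed

end

theorem lemma3p1:
  fixes f g v u :: "real \<Rightarrow> real" and m0 \<omega> :: real
    and \<L> :: "(real^3 \<Rightarrow> complex^4) \<Rightarrow> real^3 \<Rightarrow> complex^4"
  assumes "m0 > 0"
    and "\<forall>\<tau>. f differentiable (at \<tau>)" and "continuous_on UNIV (deriv f)" and "f 0 = 0"
    and g: "g = (\<lambda>\<tau>. m0 - f \<tau>)"
    and "solitary_wave g \<omega> v u"
    and L: "\<L> = soler_linearization g \<omega> (wave_profile v u)"
  shows "(\<forall>l. \<forall>\<rho> \<in> X0_space l \<inter> H1. \<L> \<rho> \<in> X0_space l) \<and>
         (\<forall>l m. 1 \<le> m \<and> m \<le> l \<longrightarrow> (\<forall>\<rho> \<in> X_space l m \<inter> H1. \<L> \<rho> \<in> X_space l m)) \<and>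
         (\<forall>l. \<forall>\<rho> \<in> Y_space l \<inter> H1. \<L> \<rho> \<in> Y_space l) \<and>
         (\<forall>l. spectrum_on (Y_space l) (Y_space l \<inter> H1) (\<lambda>\<rho> x. (- \<i>) *s \<L> \<rho> x)
                \<subseteq> {z. Re z = 0})"
proof -
  have df: "f field_differentiable (at \<tau>)" for \<tau>
    using assms(2) by (simp add: field_differentiable_def real_differentiable_def)
  have "deriv g = (\<lambda>\<tau>. - deriv f \<tau>)"
    unfolding g by (rule ext, rule DERIV_imp_deriv)
      (auto intro!: derivative_eq_intros field_differentiable_derivI[OF df, unfolded has_field_derivative_def[symmetric]])
  then have g': "continuous_on UNIV (deriv g)" using assms(3) by (simp add: continuous_on_minus)
  have g0: "continuous_on UNIV g"
    unfolding g using assms(2)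
    by (intro continuous_intros) (auto intro!: continuous_at_imp_continuous_on differentiable_imp_continuous_within)
  note L2' = linearization_L2[OF g0 g' assms(6)] and F' = linearization_Form[OF g0 g' assms(6)]
  show ?thesis unfolding L
  proof (intro conjI allI impI ballI)
    fix l \<rho> assume "\<rho> \<in> X0_space l \<inter> H1"
    then show "soler_linearization g \<omega> (wave_profile v u) \<rho> \<in> X0_space l"
      using L2' F'[OF angular_X0] by (simp add: X0_space_Form)
  next
    fix l m \<rho> assume m: "1 \<le> m \<and> m \<le> l" and "\<rho> \<in> X_space l m \<inter> H1"
    then show "soler_linearization g \<omega> (wave_profile v u) \<rho> \<in> X_space l m"
      using L2' F'[OF angular_X] by (simp add: X_space_Form)
  next
    fix l \<rho> assume "\<rho> \<in> Y_space l \<inter> H1"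
    then show "soler_linearization g \<omega> (wave_profile v u) \<rho> \<in> Y_space l"
      using L2' F'[OF angular_Y] by (simp add: Y_space_Form)
  next
    fix l
    show "spectrum_on (Y_space l) (Y_space l \<inter> H1) (\<lambda>\<rho> x. (- \<i>) *s soler_linearization g \<omega> (wave_profile v u) \<rho> x) \<subseteq> {z. Re z = 0}"
      unfolding spectrum_on_def using Y_space_resolvent[OF g0 g' assms(6)] by blast
  qed
qed

end
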